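(* Let $\mathfrak{F}$ be a hereditary $K$-lattice saturated formation of finite groups containing all nilpotent groups, let $\sigma=\Sigma_s(\mathfrak{F})$, and let $G$ be a finite group. Then the following statements hold: (i) Every maximal chain of $G$ of length $2$ includes a proper $K$-$\mathfrak{F}$-subnormal subgroup of $G$ if and only if either $G\in\mathfrak{F}$, or $G\notin\mathfrak{F}$ and $G$ is a Schmidt group with abelian Sylow subgroups. (ii) If every maximal chain of $G$ of length $3$ includes a proper $K$-$\mathfrak{F}$-subnormal subgroup of $G$, then $G$ is $\sigma$-soluble.
   Context: All groups are finite. A class of groups is closed under isomorphism. $\Phi(G)$ is the Frattini subgroup of $G$. For subgroups $B\le A$, $B_A$ denotes the normal core of $B$ in $A$ (the largest normal subgroup of $A$ contained in $B$). For a class $\mathfrak{F}$ of groups containing the trivial group, $G^{\mathfrak{F}}$ is the intersection of all normal subgroups $N$ of $G$ with $G/N\in\mathfrak{F}$. The class $\mathfrak{F}$ is a formation if for every group $G$ every homomorphic image of $G/G^{\mathfrak{F}}$ belongs to $\mathfrak{F}$. A formation $\mathfrak{F}$ is saturated if $G\in\mathfrak{F}$ whenever $G^{\mathfrak{F}}\le\Phi(G)$; it is hereditary if $H\in\mathfrak{F}$ whenever $H\le G\in\mathfrak{F}$. A subgroup $A$ of $G$ is $K$-$\mathfrak{F}$-subnormal in $G$ if there is a chain of subgroups $A=A_0\le A_1\le\cdots\le A_n=G$ such that for each $i=1,\ldots,n$ either $A_{i-1}\trianglelefteq A_i$ or $A_i/(A_{i-1})_{A_i}\in\mathfrak{F}$.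 A formation $\mathfrak{F}$ is $K$-lattice if in every finite group $G$ the set of all $K$-$\mathfrak{F}$-subnormal subgroups of $G$ is a sublattice of the lattice of all subgroups of $G$ (i.e. closed under intersections $A\cap B$ and joins $\langle A,B\rangle$). A maximal chain of $G$ of length $n$ is a chain $M_n<M_{n-1}<\cdots<M_1<M_0=G$ where $M_i$ is a maximal subgroup of $M_{i-1}$ for all $i=1,\ldots,n$. It includes a proper $K$-$\mathfrak{F}$-subnormal subgroup if some $M_i$ with $i\ge 1$ is $K$-$\mathfrak{F}$-subnormal in $G$. A Schmidt group is a non-nilpotent group all of whose proper subgroups are nilpotent. Let $\mathbb{P}$ be the set of all primes and let $\sigma=\{\sigma_i\mid i\in I\}$ be a partition of $\mathbb{P}$. A group is $\sigma$-primary if it is a $\sigma_i$-group for some $i\in I$ (all prime divisors of its order lie in $\sigma_i$); $G$ is $\sigma$-soluble if every chief factor of $G$ is $\sigma$-primary. A class $\mathfrak{F}$ is $\sigma$-soluble if every group in $\mathfrak{F}$ is $\sigma$-soluble. $\Sigma_s(\mathfrak{F})$ is the partition of $\mathbb{P}$ corresponding to the equivalence relation on $\mathbb{P}$ that is the intersection of the equivalence relations defined by all partitions $\tau$ of $\mathbb{P}$ such that $\mathfrak{F}$ is $\tau$-soluble. (So $p,q$ lie in the same part of $\Sigma_s(\mathfrak{F})$ iff they lie in the same part of every partition $\tau$ for which $\mathfrak{F}$ is $\tau$-soluble; $\Sigma_s(\mathfrak{F})$ is the finest partition $\tau$ for which $\mathfrak{F}$ is $\tau$-soluble.) *)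

theory Defs
  imports
    "HOL-Algebra.Coset"
    "HOL-Algebra.Generated_Groups"
    "HOL-Algebra.Elementary_Groups"
    "HOL-Computational_Algebra.Primes"
    "HOL-Library.Disjoint_Sets"
begin

text \<open>
  All groups are finite. Subgroups of a group \<open>G\<close> are carrier sets; a subgroup \<open>H\<close> regarded as
  a group in its own right is \<open>G\<lparr>carrier := H\<rparr>\<close>.
\<close>


section \<open>Subgroups\<close>

definition maximal_subgroup :: "'a set \<Rightarrow> ('a, 'b) monoid_scheme \<Rightarrow> bool" where
  "maximal_subgroup M G \<longleftrightarrow>
     subgroup M G \<and> M \<noteq> carrier G \<and>
     (\<forall>H. subgroup H G \<and> M \<subseteq> H \<longrightarrow> H = M \<or> H = carrier G)"

text \<open>The intersection with the carrier makes \<open>\<Phi>(G) = G\<close> when \<open>G\<close> has no maximal subgroup,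
  that is, when \<open>G\<close> is trivial.\<close>

definition frattini :: "('a, 'b) monoid_scheme \<Rightarrow> 'a set" where
  "frattini G = carrier G \<inter> \<Inter>{M. maximal_subgroup M G}"

definition normal_core :: "('a, 'b) monoid_scheme \<Rightarrow> 'a set \<Rightarrow> 'a set" where
  "normal_core A B = (GREATEST N. N \<lhd> A \<and> N \<subseteq> B)"

lemma normal_core_greatest:
  assumes "group A" and "subgroup B A"
  shows "normal_core A B \<lhd> A" and "normal_core A B \<subseteq> B"
    and "\<And>N. N \<lhd> A \<Longrightarrow> N \<subseteq> B \<Longrightarrow> N \<subseteq> normal_core A B"
proof -
  interpret A: group A by fact
  interpret B: subgroup B A by fact
  define C where "C = {x \<in> carrier A. \<forall>g\<in>carrier A. g \<otimes>\<^bsub>A\<^esub> x \<otimes>\<^bsub>A\<^esub> inv\<^bsub>A\<^esub> g \<in> B}"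
  have C_B: "C \<subseteq> B"
  proof
    fix x assume "x \<in> C"
    then have "x \<in> carrier A" "\<one>\<^bsub>A\<^esub> \<otimes>\<^bsub>A\<^esub> x \<otimes>\<^bsub>A\<^esub> inv\<^bsub>A\<^esub> \<one>\<^bsub>A\<^esub> \<in> B"
      unfolding C_def by blast+
    then show "x \<in> B" by simp
  qed
  have "subgroup C A"
  proof
    show "C \<subseteq> carrier A" "\<one>\<^bsub>A\<^esub> \<in> C" by (auto simp: C_def)
  next
    fix x y assume xy: "x \<in> C" "y \<in> C"
    have "g \<otimes>\<^bsub>A\<^esub> (x \<otimes>\<^bsub>A\<^esub> y) \<otimes>\<^bsub>A\<^esub> inv\<^bsub>A\<^esub> g \<in> B" if g: "g \<in> carrier A" for g
    proof -
      have c: "x \<in> carrier A" "y \<in> carrier A" using xy by (auto simp: C_def)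
      have "(g \<otimes>\<^bsub>A\<^esub> x \<otimes>\<^bsub>A\<^esub> inv\<^bsub>A\<^esub> g) \<otimes>\<^bsub>A\<^esub> (g \<otimes>\<^bsub>A\<^esub> y \<otimes>\<^bsub>A\<^esub> inv\<^bsub>A\<^esub> g) \<in> B"
        using xy g by (auto simp: C_def intro: B.m_closed)
      also have "(g \<otimes>\<^bsub>A\<^esub> x \<otimes>\<^bsub>A\<^esub> inv\<^bsub>A\<^esub> g) \<otimes>\<^bsub>A\<^esub> (g \<otimes>\<^bsub>A\<^esub> y \<otimes>\<^bsub>A\<^esub> inv\<^bsub>A\<^esub> g) =
          g \<otimes>\<^bsub>A\<^esub> (x \<otimes>\<^bsub>A\<^esub> y) \<otimes>\<^bsub>A\<^esub> inv\<^bsub>A\<^esub> g"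
        using g c by (simp add: A.m_assoc A.inv_solve_left')
      finally show ?thesis .
    qed
    then show "x \<otimes>\<^bsub>A\<^esub> y \<in> C" using xy by (auto simp: C_def)
  next
    fix x assume x: "x \<in> C"
    have "g \<otimes>\<^bsub>A\<^esub> inv\<^bsub>A\<^esub> x \<otimes>\<^bsub>A\<^esub> inv\<^bsub>A\<^esub> g \<in> B" if g: "g \<in> carrier A" for g
    proof -
      have c: "x \<in> carrier A" using x by (auto simp: C_def)
      have "inv\<^bsub>A\<^esub> (g \<otimes>\<^bsub>A\<^esub> x \<otimes>\<^bsub>A\<^esub> inv\<^bsub>A\<^esub> g) \<in> B"
        using x g by (auto simp: C_def)
      then show ?thesis using g c by (simp add: A.inv_mult_group A.m_assoc)
    qed
    then show "inv\<^bsub>A\<^esub> x \<in> C" using x by (auto simp: C_def)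
  qed
  then have C_normal: "C \<lhd> A"
  proof (rule A.normal_invI)
    fix h x assume "h \<in> carrier A" and x: "x \<in> C"
    have "g \<otimes>\<^bsub>A\<^esub> (h \<otimes>\<^bsub>A\<^esub> x \<otimes>\<^bsub>A\<^esub> inv\<^bsub>A\<^esub> h) \<otimes>\<^bsub>A\<^esub> inv\<^bsub>A\<^esub> g \<in> B" if g: "g \<in> carrier A" for g
    proof -
      have c: "x \<in> carrier A" using x by (auto simp: C_def)
      have "(g \<otimes>\<^bsub>A\<^esub> h) \<otimes>\<^bsub>A\<^esub> x \<otimes>\<^bsub>A\<^esub> inv\<^bsub>A\<^esub> (g \<otimes>\<^bsub>A\<^esub> h) \<in> B"
        using x g \<open>h \<in> carrier A\<close> by (auto simp: C_def)
      then show ?thesis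
        using g c \<open>h \<in> carrier A\<close> by (simp add: A.inv_mult_group A.m_assoc)
    qed
    then show "h \<otimes>\<^bsub>A\<^esub> x \<otimes>\<^bsub>A\<^esub> inv\<^bsub>A\<^esub> h \<in> C"
      using x \<open>h \<in> carrier A\<close> by (auto simp: C_def)
  qed
  have C_max: "N \<subseteq> C" if "N \<lhd> A" "N \<subseteq> B" for N
  proof
    fix x assume "x \<in> N"
    then show "x \<in> C"
      using that normal.inv_op_closed2[OF that(1)] subgroup.subset[OF normal_imp_subgroup[OF that(1)]]
      by (auto simp: C_def)
  qed
  have "normal_core A B = C"
    unfolding normal_core_def using C_normal C_B C_max by (intro Greatest_equality) auto
  then show "normal_core A B \<lhd> A" "normal_core A B \<subseteq> B"
    "\<And>N. N \<lhd> A \<Longrightarrow> N \<subseteq> B \<Longrightarrow> N \<subseteq> normal_core A B"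
    using C_normal C_B C_max by auto
qed

definition sylow_subgroup :: "nat \<Rightarrow> 'a set \<Rightarrow> ('a, 'b) monoid_scheme \<Rightarrow> bool" where
  "sylow_subgroup p P G \<longleftrightarrow>
     Factorial_Ring.prime p \<and> subgroup P G \<and> card P = p ^ multiplicity p (order G)"

definition abelian_sylow_subgroups :: "('a, 'b) monoid_scheme \<Rightarrow> bool" where
  "abelian_sylow_subgroups G \<longleftrightarrow>
     (\<forall>p P. sylow_subgroup p P G \<longrightarrow> comm_group (G\<lparr>carrier := P\<rparr>))"


section \<open>Nilpotent groups and Schmidt groups\<close>

primrec lower_central_series :: "('a, 'b) monoid_scheme \<Rightarrow> nat \<Rightarrow> 'a set" where
  "lower_central_series G 0 = carrier G"
| "lower_central_series G (Suc n) =
     generate G (\<Union>x\<in>lower_central_series G n. \<Union>y\<in>carrier G.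
       {x \<otimes>\<^bsub>G\<^esub> y \<otimes>\<^bsub>G\<^esub> inv\<^bsub>G\<^esub> x \<otimes>\<^bsub>G\<^esub> inv\<^bsub>G\<^esub> y})"

definition nilpotent_group :: "('a, 'b) monoid_scheme \<Rightarrow> bool" where
  "nilpotent_group G \<longleftrightarrow> group G \<and> (\<exists>n. lower_central_series G n = {\<one>\<^bsub>G\<^esub>})"

definition schmidt_group :: "('a, 'b) monoid_scheme \<Rightarrow> bool" where
  "schmidt_group G \<longleftrightarrow>
     group G \<and> finite (carrier G) \<and> \<not> nilpotent_group G \<and>
     (\<forall>H. subgroup H G \<and> H \<noteq> carrier G \<longrightarrow> nilpotent_group (G\<lparr>carrier := H\<rparr>))"


section \<open>Classes of finite groups and formations\<close>

text \<open>
  Every finite group is isomorphic to a group whose elements are natural numbers, so an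
  isomorphism-closed class of finite groups is determined by its members of type
  \<open>nat monoid\<close> and is represented by the set of these. Membership of a group over another type
  (such as a quotient) is membership up to isomorphism. Quantifying over all
  finite \<open>G :: nat monoid\<close> below amounts to quantifying over all finite groups.
\<close>

definition group_class :: "nat monoid set \<Rightarrow> bool" where
  "group_class F \<longleftrightarrow>
     (\<forall>G\<in>F. group G \<and> finite (carrier G)) \<and>
     (\<forall>G\<in>F. \<forall>H :: nat monoid. group H \<and> G \<cong> H \<longrightarrow> H \<in> F)"

definition in_class :: "('a, 'b) monoid_scheme \<Rightarrow> nat monoid set \<Rightarrow> bool" where
  "in_class G F \<longleftrightarrow> group G \<and> (\<exists>H\<in>F. G \<cong> H)"

definition residual :: "('a, 'b) monoid_scheme \<Rightarrow> nat monoid set \<Rightarrow> 'a set" where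
  "residual G F = \<Inter>{N. N \<lhd> G \<and> in_class (G Mod N) F}"

definition formation :: "nat monoid set \<Rightarrow> bool" where
  "formation F \<longleftrightarrow>
     group_class F \<and>
     (\<forall>E :: nat monoid. trivial_group E \<longrightarrow> E \<in> F) \<and>
     (\<forall>(G :: nat monoid) (H :: nat monoid).
        group G \<and> finite (carrier G) \<and> group H \<and> epi (G Mod residual G F) H \<noteq> {} \<longrightarrow> H \<in> F)"

definition saturated :: "nat monoid set \<Rightarrow> bool" where
  "saturated F \<longleftrightarrow>
     (\<forall>G :: nat monoid.
        group G \<and> finite (carrier G) \<and> residual G F \<subseteq> frattini G \<longrightarrow> G \<in> F)"

definition hereditary :: "nat monoid set \<Rightarrow> bool" where
  "hereditary F \<longleftrightarrow> (\<forall>G\<in>F. \<forall>H. subgroup H G \<longrightarrow> G\<lparr>carrier := H\<rparr> \<in> F)"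

definition contains_all_nilpotent :: "nat monoid set \<Rightarrow> bool" where
  "contains_all_nilpotent F \<longleftrightarrow>
     (\<forall>G :: nat monoid. finite (carrier G) \<and> nilpotent_group G \<longrightarrow> G \<in> F)"


section \<open>\<open>K\<close>-\<open>F\<close>-subnormal subgroups and maximal chains\<close>

definition K_subnormal :: "nat monoid set \<Rightarrow> 'a set \<Rightarrow> ('a, 'b) monoid_scheme \<Rightarrow> bool" where
  "K_subnormal F A G \<longleftrightarrow>
     (\<exists>(n :: nat) C. C 0 = A \<and> C n = carrier G \<and>
        (\<forall>i\<le>n. subgroup (C i) G) \<and>
        (\<forall>i<n. C i \<subseteq> C (Suc i) \<and>
           (C i \<lhd> G\<lparr>carrier := C (Suc i)\<rparr> \<or>
            in_class (G\<lparr>carrier := C (Suc i)\<rparr> Mod normal_core (G\<lparr>carrier := C (Suc i)\<rparr>) (C i)) F)))"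

definition K_lattice :: "nat monoid set \<Rightarrow> bool" where
  "K_lattice F \<longleftrightarrow>
     (\<forall>(G :: nat monoid) A B.
        group G \<and> finite (carrier G) \<and> K_subnormal F A G \<and> K_subnormal F B G \<longrightarrow>
        K_subnormal F (A \<inter> B) G \<and> K_subnormal F (generate G (A \<union> B)) G)"

definition maximal_chain :: "('a, 'b) monoid_scheme \<Rightarrow> nat \<Rightarrow> (nat \<Rightarrow> 'a set) \<Rightarrow> bool" where
  "maximal_chain G n M \<longleftrightarrow>
     M 0 = carrier G \<and> (\<forall>i<n. maximal_subgroup (M (Suc i)) (G\<lparr>carrier := M i\<rparr>))"

definition every_maximal_chain_includes_K_subnormal ::
    "nat monoid set \<Rightarrow> nat \<Rightarrow> ('a, 'b) monoid_scheme \<Rightarrow> bool" where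
  "every_maximal_chain_includes_K_subnormal F n G \<longleftrightarrow>
     (\<forall>M. maximal_chain G n M \<longrightarrow> (\<exists>i. 1 \<le> i \<and> i \<le> n \<and> K_subnormal F (M i) G))"


section \<open>\<open>\<sigma>\<close>-soluble groups\<close>

definition sigma_primary :: "nat set set \<Rightarrow> ('a, 'b) monoid_scheme \<Rightarrow> bool" where
  "sigma_primary \<sigma> G \<longleftrightarrow> (\<exists>S\<in>\<sigma>. prime_factors (order G) \<subseteq> S)"

definition chief_factor :: "('a, 'b) monoid_scheme \<Rightarrow> 'a set \<Rightarrow> 'a set \<Rightarrow> bool" where
  "chief_factor G H K \<longleftrightarrow>
     H \<lhd> G \<and> K \<lhd> G \<and> K \<subset> H \<and> (\<forall>N. N \<lhd> G \<and> K \<subseteq> N \<and> N \<subseteq> H \<longrightarrow> N = K \<or> N = H)"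

definition sigma_soluble :: "nat set set \<Rightarrow> ('a, 'b) monoid_scheme \<Rightarrow> bool" where
  "sigma_soluble \<sigma> G \<longleftrightarrow>
     (\<forall>H K. chief_factor G H K \<longrightarrow> sigma_primary \<sigma> (G\<lparr>carrier := H\<rparr> Mod K))"

definition sigma_soluble_class :: "nat set set \<Rightarrow> nat monoid set \<Rightarrow> bool" where
  "sigma_soluble_class \<sigma> F \<longleftrightarrow> (\<forall>G\<in>F. sigma_soluble \<sigma> G)"

abbreviation primes :: "nat set" where
  "primes \<equiv> {p. Factorial_Ring.prime p}"

text \<open>The family intersected below is never empty: it contains the relation given by the
  one-part partition \<open>{primes}\<close>.\<close>

definition Sigma_s :: "nat monoid set \<Rightarrow> nat set set" where
  "Sigma_s F =
     primes // \<Inter>{{(p, q). \<exists>S\<in>\<tau>. p \<in> S \<and> q \<in> S} | \<tau>.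
                  partition_on primes \<tau> \<and> sigma_soluble_class \<tau> F}"

end

theory Submission
  imports
    Defs
    "HOL-Algebra.Sylow"
    "HOL-Algebra.Group_Action"
    "HOL-Algebra.Multiplicative_Group"
    "HOL-Number_Theory.Pocklington"
begin

text \<open>Statement (i), from left to right. If every maximal subgroup of \<open>G\<close> is \<open>K\<close>-\<open>F\<close>-subnormal, then the
  quotient of \<open>G\<close> by the core of each of them belongs to \<open>F\<close>, so the residual lies in the Frattini subgroup and
  saturation puts \<open>G\<close> into \<open>F\<close> (\<open>in_class_if_maximal_K_subnormal\<close>). Otherwise some maximal subgroup \<open>M\<close>
  is not \<open>K\<close>-\<open>F\<close>-subnormal, whereas all maximal subgroups of \<open>M\<close> are. Two different ones would generate \<open>M\<close>,
  and the lattice property would make \<open>M\<close> subnormal; so \<open>M\<close> has only one maximal subgroup and is cyclic,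
  generated by some \<open>m\<close> of order \<open>p\<^sup>n\<close> (\<open>non_K_subnormal_cyclic\<close>). An abelian maximal subgroup that is not normal
  meets its other conjugates in the centre of \<open>G\<close>. Hence no two of its elements are fused in \<open>G\<close>, the transfer into
  it has a kernel that complements it, and maximality cuts a normal \<open>q\<close>-subgroup \<open>Q\<close> with
  \<open>G = QM\<close> out of this kernel (\<open>abelian_maximal_p_subgroup\<close>). As \<open>M\<close> is maximal, \<open>Q\<close> is minimal normal, thus
  abelian.

  It remains to see that \<open>m\<^sup>p\<close> is central. If not, some power of \<open>m\<^sup>p\<close> acts on \<open>Q\<close> with order
  \<open>p\<close> and without nontrivial fixed points. A wreath product of \<open>G\<close> with a cyclic group then exhibits \<open>\<langle>m\<rangle>\<close> as a pullback
  of the join of two subgroups, each of which is an intersection of pullbacks of the \<open>K\<close>-\<open>F\<close>-subnormal subgroup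
  \<open>\<langle>m\<^sup>p\<rangle>\<close>; the lattice property in the wreath product yields the contradiction that \<open>M\<close> is
  \<open>K\<close>-\<open>F\<close>-subnormal (\<open>cyclic_complement_K_subnormal\<close>). So \<open>G\<close> is a minimal nonabelian group
  (\<open>maximal_chains_2_structure\<close>), in particular a Schmidt group with abelian Sylow subgroups.

  From right to left: in a group of \<open>F\<close> all subgroups are \<open>K\<close>-\<open>F\<close>-subnormal. In a Schmidt group with abelian
  Sylow subgroups all proper subgroups are abelian, and the only maximal subgroup of a maximal subgroup that is not
  normal is the centre of the whole group (\<open>minimal_nonabelian_second_maximal_central\<close>).

  Statement (ii). The \<open>\<sigma>\<close>-soluble \<open>K\<close>-\<open>F\<close>-subnormal subgroups lie in the \<open>\<sigma>\<close>-soluble radical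
  (\<open>K_subnormal_ssol_in_radical\<close>), and the hypothesis passes to quotients; so it is enough to show that a group
  with trivial radical is trivial (\<open>maximal_chains_3_trivial\<close>). Otherwise let \<open>N\<close> be a minimal normal subgroup, \<open>P\<close> a
  Sylow subgroup of \<open>N\<close> for the smallest prime, and \<open>M\<close> a maximal subgroup containing the normaliser of \<open>P\<close>. Then
  \<open>N\<close> is not contained in \<open>M\<close>, so \<open>M\<close> is not \<open>K\<close>-\<open>F\<close>-subnormal. The chains of length two of
  \<open>M\<close> satisfy the hypothesis of (i), hence \<open>M\<close> is \<open>\<sigma>\<close>-soluble, and the \<open>K\<close>-\<open>F\<close>-subnormal subgroups
  of \<open>G\<close> below \<open>M\<close> are trivial. Therefore the proper subgroups of \<open>M\<close> are trivial or of prime order. Either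
  \<open>P = M\<close>, which is then abelian, and \<open>abelian_maximal_p_subgroup\<close> gives a nontrivial normal \<open>q\<close>-subgroup of
  \<open>G\<close>, which the trivial radical excludes; or \<open>P\<close> has prime order and Burnside's theorem gives a normal complement of \<open>P\<close> in \<open>N\<close>
  (\<open>smallest_prime_complement\<close>), contrary to the minimality of \<open>N\<close>.\<close>

section \<open>Conjugation, normality and maximal subgroups\<close>

lemma (in group) mult_inv_cancel:
  assumes "x \<in> carrier G" "y \<in> carrier G"
  shows "inv x \<otimes> (x \<otimes> y) = y" "x \<otimes> (inv x \<otimes> y) = y"
  using assms by (simp_all add: m_assoc[symmetric])

lemmas (in group) word_simps = m_assoc inv_mult_group mult_inv_cancel

text \<open>Conjugation acts from the left, \<open>conjg G (g \<otimes> h) = conjg G g \<circ> conjg G h\<close>.\<close>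

definition conjg :: "('a, 'b) monoid_scheme \<Rightarrow> 'a \<Rightarrow> 'a \<Rightarrow> 'a" where
  "conjg G g x = g \<otimes>\<^bsub>G\<^esub> x \<otimes>\<^bsub>G\<^esub> inv\<^bsub>G\<^esub> g"

lemma (in group) conjg_closed [simp]:
  "g \<in> carrier G \<Longrightarrow> x \<in> carrier G \<Longrightarrow> conjg G g x \<in> carrier G"
  by (simp add: conjg_def)

lemma (in group) conjg_mult:
  "g \<in> carrier G \<Longrightarrow> x \<in> carrier G \<Longrightarrow> y \<in> carrier G \<Longrightarrow>
    conjg G g (x \<otimes> y) = conjg G g x \<otimes> conjg G g y"
  by (simp add: conjg_def word_simps)

lemma (in group) conjg_inv:
  "g \<in> carrier G \<Longrightarrow> x \<in> carrier G \<Longrightarrow> conjg G g (inv x) = inv (conjg G g x)"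
  by (simp add: conjg_def word_simps)

lemma (in group) conjg_conjg:
  "g \<in> carrier G \<Longrightarrow> h \<in> carrier G \<Longrightarrow> x \<in> carrier G \<Longrightarrow>
    conjg G g (conjg G h x) = conjg G (g \<otimes> h) x"
  by (simp add: conjg_def word_simps)

lemma (in group) conjg_one [simp]:
  "x \<in> carrier G \<Longrightarrow> conjg G \<one> x = x"  "g \<in> carrier G \<Longrightarrow> conjg G g \<one> = \<one>"
  by (simp_all add: conjg_def)

lemma (in group) conjg_inv_conjg [simp]:
  assumes "g \<in> carrier G" "x \<in> carrier G"
  shows "conjg G (inv g) (conjg G g x) = x" "conjg G g (conjg G (inv g) x) = x"
  using assms by (simp_all add: conjg_conjg)

lemma (in group) conjg_fixed_iff:
  "g \<in> carrier G \<Longrightarrow> x \<in> carrier G \<Longrightarrow> conjg G g x = x \<longleftrightarrow> g \<otimes> x = x \<otimes> g"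
  unfolding conjg_def by (metis inv_solve_right m_closed)

lemma (in group) conjg_pow:
  "g \<in> carrier G \<Longrightarrow> x \<in> carrier G \<Longrightarrow> conjg G g (x [^] (n::nat)) = conjg G g x [^] n"
  by (induction n) (simp_all add: conjg_mult)

lemma (in group) inj_conjg: "g \<in> carrier G \<Longrightarrow> inj_on (conjg G g) (carrier G)"
  by (metis conjg_inv_conjg(1) inj_onI)

lemma (in group) subgroup_conjg:
  assumes "subgroup H G" "g \<in> carrier G"
  shows "subgroup (conjg G g ` H) G"
proof (rule subgroupI)
  interpret H: subgroup H G by fact
  show "conjg G g ` H \<subseteq> carrier G" using assms by auto
  show "conjg G g ` H \<noteq> {}" using H.one_closed by blast
  show "inv a \<in> conjg G g ` H" if "a \<in> conjg G g ` H" for a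
    using that assms by (auto simp: conjg_inv[symmetric])
  show "a \<otimes> b \<in> conjg G g ` H" if "a \<in> conjg G g ` H" "b \<in> conjg G g ` H" for a b
    using that assms by (auto simp: conjg_mult[symmetric])
qed

lemma (in group) card_conjg:
  "H \<subseteq> carrier G \<Longrightarrow> g \<in> carrier G \<Longrightarrow> card (conjg G g ` H) = card H"
  by (meson card_image inj_conjg inj_on_subset)

lemma (in group) normal_iff:
  "N \<lhd> G \<longleftrightarrow> subgroup N G \<and> (\<forall>g\<in>carrier G. \<forall>x\<in>N. conjg G g x \<in> N)"
  unfolding normal_inv_iff conjg_def by auto

lemma carrier_update [simp]: "G\<lparr>carrier := H, carrier := K\<rparr> = G\<lparr>carrier := K\<rparr>"
  by simp

lemma (in group) subgroup_in:
  assumes "subgroup H G"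
  shows "subgroup K (G\<lparr>carrier := H\<rparr>) \<longleftrightarrow> subgroup K G \<and> K \<subseteq> H"
  using assms incl_subgroup[OF assms, of K] subgroup_incl[of K H] subgroup.subset[of K "G\<lparr>carrier := H\<rparr>"]
  by auto

lemma (in group) conjg_in:
  assumes "subgroup H G" "g \<in> H"
  shows "conjg (G\<lparr>carrier := H\<rparr>) g x = conjg G g x"
  using assms m_inv_consistent[OF assms] by (simp add: conjg_def)

lemma (in group) normal_in:
  assumes "subgroup H G"
  shows "N \<lhd> G\<lparr>carrier := H\<rparr> \<longleftrightarrow> subgroup N G \<and> N \<subseteq> H \<and> (\<forall>g\<in>H. \<forall>x\<in>N. conjg G g x \<in> N)"
  using group.normal_iff[OF subgroup_imp_group[OF assms], of N] subgroup_in[OF assms, of N]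
    conjg_in[OF assms] by auto

lemma (in group) normal_in_subgroup:
  assumes "N \<lhd> G" "subgroup H G" "N \<subseteq> H"
  shows "N \<lhd> G\<lparr>carrier := H\<rparr>"
  using assms by (auto simp: normal_in normal_iff subgroup.mem_carrier)

lemma (in group) pow_in_subgroup: "subgroup H G \<Longrightarrow> x \<in> H \<Longrightarrow> x [^] (n::nat) \<in> H"
  by (induction n) (auto intro: subgroup.m_closed subgroup.one_closed)

lemma (in group) order_sub: "order (G\<lparr>carrier := H\<rparr>) = card H"
  by (simp add: order_def)

lemma (in group) card_sub_dvd:
  assumes "subgroup H G" "subgroup K G" "H \<subseteq> K" "finite (carrier G)"
  shows "card H dvd card K"
  using group.lagrange[OF subgroup_imp_group[OF assms(2)], of H] assms
  by (metis dvd_triv_right order_sub subgroup_in)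

lemma (in group) card_pos: "subgroup H G \<Longrightarrow> finite (carrier G) \<Longrightarrow> 0 < card H"
  by (simp add: subgroup.finite_imp_card_positive)

lemma (in group) fin_sub: "subgroup H G \<Longrightarrow> finite (carrier G) \<Longrightarrow> finite H"
  by (meson finite_subset subgroup.subset)

lemma (in group) subgroup_Int: "subgroup H G \<Longrightarrow> subgroup K G \<Longrightarrow> subgroup (H \<inter> K) G"
  by (rule subgroups_Inter_pair)

lemma (in group) subgroup_normal_mult:
  assumes "N \<lhd> G" "subgroup H G"
  shows "subgroup (N <#> H) G" "N \<subseteq> N <#> H" "H \<subseteq> N <#> H"
proof -
  interpret N: normal N G by fact
  interpret H: subgroup H G by fact
  show "subgroup (N <#> H) G"
  proof (rule subgroupI)
    show "N <#> H \<subseteq> carrier G" unfolding set_mult_def by auto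
    show "N <#> H \<noteq> {}" unfolding set_mult_def using N.one_closed H.one_closed by blast
  next
    fix a assume "a \<in> N <#> H"
    then obtain n h where nh: "n \<in> N" "h \<in> H" "a = n \<otimes> h" unfolding set_mult_def by blast
    have "conjg G (inv h) (inv n) \<in> N" using nh assms by (simp add: normal_iff)
    moreover have "inv a = conjg G (inv h) (inv n) \<otimes> inv h"
      using nh by (simp add: conjg_def word_simps)
    ultimately show "inv a \<in> N <#> H" unfolding set_mult_def using nh by blast
  next
    fix a b assume "a \<in> N <#> H" "b \<in> N <#> H"
    then obtain n h n' h' where nh: "n \<in> N" "h \<in> H" "a = n \<otimes> h" "n' \<in> N" "h' \<in> H" "b = n' \<otimes> h'"
      unfolding set_mult_def by blast
    have "conjg G h n' \<in> N" using nh assms by (simp add: normal_iff)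
    then have "n \<otimes> conjg G h n' \<in> N" "h \<otimes> h' \<in> H" using nh by auto
    moreover have "a \<otimes> b = (n \<otimes> conjg G h n') \<otimes> (h \<otimes> h')"
      using nh by (simp add: conjg_def word_simps)
    ultimately show "a \<otimes> b \<in> N <#> H" unfolding set_mult_def by blast
  qed
  have "x \<in> N <#> H" if "x \<in> N" for x
  proof -
    have "x = x \<otimes> \<one>" using N.mem_carrier[OF that] by simp
    then show ?thesis unfolding set_mult_def using that H.one_closed by blast
  qed
  then show "N \<subseteq> N <#> H" by blast
  have "x \<in> N <#> H" if "x \<in> H" for x
  proof -
    have "x = \<one> \<otimes> x" using H.mem_carrier[OF that] by simp
    then show ?thesis unfolding set_mult_def using that N.one_closed by blast
  qed
  then show "H \<subseteq> N <#> H" by blast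
qed

lemma (in group) ex_maximal_above:
  assumes fin: "finite (carrier G)" and "subgroup H G" "H \<noteq> carrier G"
  shows "\<exists>M. maximal_subgroup M G \<and> H \<subseteq> M"
  using assms(2,3)
proof (induction "order G - card H" arbitrary: H rule: less_induct)
  case less
  show ?case
  proof (cases "maximal_subgroup H G")
    case False
    then obtain K where K: "subgroup K G" "H \<subseteq> K" "K \<noteq> H" "K \<noteq> carrier G"
      using less.prems unfolding maximal_subgroup_def by blast
    have "card H < card K" using K fin_sub[OF K(1) fin] by (intro psubset_card_mono) auto
    moreover have "card K \<le> order G"
      unfolding order_def using K fin by (meson card_mono subgroup.subset)
    ultimately show ?thesis using less.hyps[of K] K by fastforce
  qed auto
qed


section \<open>Groups of prime power order acting on finite sets\<close>

text \<open>The orbits that are not fixed points have a length divisible by \<open>p\<close>.\<close>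

lemma p_group_fixed_points:
  fixes P (structure)
  assumes "group P" "finite (carrier P)" "order P = p ^ n" "Factorial_Ring.prime (p::nat)" "finite E"
    and closed: "\<And>g x. g \<in> carrier P \<Longrightarrow> x \<in> E \<Longrightarrow> act g x \<in> E"
    and one: "\<And>x. x \<in> E \<Longrightarrow> act \<one> x = x"
    and mult: "\<And>g h x. g \<in> carrier P \<Longrightarrow> h \<in> carrier P \<Longrightarrow> x \<in> E \<Longrightarrow> act (g \<otimes> h) x = act g (act h x)"
  shows "card E mod p = card {x\<in>E. \<forall>g\<in>carrier P. act g x = x} mod p"
proof -
  interpret group P by fact
  have one_P: "\<one> \<in> carrier P" by simp
  define \<phi> where "\<phi> g = restrict (act g) E" for g
  have bij: "\<phi> g \<in> Bij E" if g: "g \<in> carrier P" for g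
  proof -
    have "act (inv g) (act g x) = x" "act g (act (inv g) x) = x" if "x \<in> E" for x
      using mult[of "inv g" g x] mult[of g "inv g" x] one that g by simp_all
    then have "bij_betw (act g) E E"
      using closed g by (intro bij_betwI[where g = "act (inv g)"]) auto
    then show ?thesis by (simp add: Bij_def \<phi>_def bij_betw_cong[of E "restrict (act g) E" "act g"])
  qed
  have "\<phi> \<in> hom P (BijGroup E)"
    by (intro homI) (auto simp: BijGroup_def bij, auto simp: \<phi>_def compose_def mult closed fun_eq_iff)
  then interpret A: group_action P E \<phi>
    unfolding group_action_def group_hom_def group_hom_axioms_def by (auto simp: group_BijGroup)
  define Fix where "Fix = {x\<in>E. \<forall>g\<in>carrier P. act g x = x}"
  define Os where "Os = orbits P E \<phi>"
  have orb: "orbit P \<phi> x = (\<lambda>g. act g x) ` carrier P" if "x \<in> E" for x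
    using that unfolding orbit_def \<phi>_def by auto
  have finOs: "finite Os" and finO: "\<And>B. B \<in> Os \<Longrightarrow> finite B"
    unfolding Os_def orbits_def using \<open>finite E\<close> orb \<open>finite (carrier P)\<close> by auto
  have sing: "x \<in> Fix \<longleftrightarrow> orbit P \<phi> x = {x}" if "x \<in> E" for x
  proof
    assume "x \<in> Fix"
    then have "(\<lambda>g. act g x) ` carrier P = (\<lambda>g. x) ` carrier P"
      by (intro image_cong) (auto simp: Fix_def)
    then show "orbit P \<phi> x = {x}" using one_P unfolding orb[OF that] by blast
  next
    assume "orbit P \<phi> x = {x}"
    then show "x \<in> Fix" using that unfolding orb[OF that] Fix_def by blast
  qed
  have "card E = (\<Sum>B\<in>Os. \<Sum>x\<in>B. 1)"
    using A.disjoint_sum[OF \<open>finite E\<close>, of "\<lambda>_. 1::nat"] unfolding Os_def by simp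
  also have "\<dots> = (\<Sum>B\<in>Os. card B)" by simp
  also have "\<dots> = (\<Sum>B\<in>Os \<inter> {B. card B = 1}. card B) + (\<Sum>B\<in>Os \<inter> - {B. card B = 1}. card B)"
    using finOs by (subst sum.union_disjoint[symmetric]) (auto intro!: sum.cong)
  also have "(\<Sum>B\<in>Os \<inter> {B. card B = 1}. card B) = card (Os \<inter> {B. card B = 1})"
    by simp
  also have "Os \<inter> {B. card B = 1} = (\<lambda>x. {x}) ` Fix"
  proof (intro Set.set_eqI iffI)
    fix B assume "B \<in> Os \<inter> {B. card B = 1}"
    then obtain x where x: "x \<in> E" "B = orbit P \<phi> x" "card B = 1" unfolding Os_def orbits_def by auto
    then obtain y where "B = {y}" by (meson card_1_singletonE)
    moreover have "x \<in> B" using A.orbit_refl x by simp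
    ultimately show "B \<in> (\<lambda>x. {x}) ` Fix" using x sing[of x] by auto
  next
    fix B assume "B \<in> (\<lambda>x. {x}) ` Fix"
    then obtain x where "x \<in> Fix" "B = {x}" by blast
    moreover have "x \<in> E" using \<open>x \<in> Fix\<close> by (simp add: Fix_def)
    ultimately show "B \<in> Os \<inter> {B. card B = 1}" using sing[of x] unfolding Os_def orbits_def by force
  qed
  also have "card ((\<lambda>x. {x}) ` Fix) = card Fix" by (simp add: card_image)
  finally have eq: "card E = card Fix + (\<Sum>B\<in>Os \<inter> - {B. card B = 1}. card B)" .
  have "p dvd card B" if "B \<in> Os \<inter> - {B. card B = 1}" for B
  proof -
    obtain x where x: "x \<in> E" "B = orbit P \<phi> x" using \<open>B \<in> _\<close> unfolding Os_def orbits_def by auto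
    have "card B dvd p ^ n"
      using A.orbit_stabilizer_theorem[OF x(1)] x(2) assms(3) by (metis dvd_triv_left)
    then obtain i where "card B = p ^ i" using assms(4) by (meson divides_primepow_nat)
    then show ?thesis using that by (cases i) auto
  qed
  then have "p dvd (\<Sum>B\<in>Os \<inter> - {B. card B = 1}. card B)" by (intro dvd_sum) auto
  then show ?thesis unfolding eq Fix_def[symmetric] by (auto elim!: dvdE)
qed

text \<open>Right cosets are permuted by right multiplication; the inverse turns this into a left action.\<close>

lemma (in group) p_subgroup_fixed_cosets:
  assumes fin: "finite (carrier G)" and P: "subgroup P G" "card P = p ^ n" "Factorial_Ring.prime p"
    and S: "subgroup S G"
  shows "card (rcosets S) mod p = card {C \<in> rcosets S. \<forall>h\<in>P. C #> inv h = C} mod p"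
proof -
  interpret P: subgroup P G by fact
  interpret S: subgroup S G by fact
  have sub: "C \<subseteq> carrier G" if "C \<in> rcosets S" for C
    using that rcosets_part_G[OF S] by blast
  have finE: "finite (rcosets S)" using fin by (auto simp: RCOSETS_def)
  have "card (rcosets S) mod p
      = card {C \<in> rcosets S. \<forall>h\<in>carrier (G\<lparr>carrier := P\<rparr>). C #> inv h = C} mod p"
  proof (rule p_group_fixed_points[where n = n])
    show "group (G\<lparr>carrier := P\<rparr>)" using P by (simp add: subgroup_imp_group)
    show "finite (carrier (G\<lparr>carrier := P\<rparr>))" using fin_sub[OF P(1) fin] by simp
    show "order (G\<lparr>carrier := P\<rparr>) = p ^ n" using P by (simp add: order_def)
    show "C #> inv g \<in> rcosets S" if "g \<in> carrier (G\<lparr>carrier := P\<rparr>)" "C \<in> rcosets S" for g C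
      using that unfolding RCOSETS_def by (auto simp: coset_mult_assoc S.subset)
    show "C #> inv \<one>\<^bsub>G\<lparr>carrier := P\<rparr>\<^esub> = C" if "C \<in> rcosets S" for C
      using sub[OF that] by simp
    show "C #> inv (g \<otimes>\<^bsub>G\<lparr>carrier := P\<rparr>\<^esub> h) = C #> inv h #> inv g"
      if "g \<in> carrier (G\<lparr>carrier := P\<rparr>)" "h \<in> carrier (G\<lparr>carrier := P\<rparr>)" "C \<in> rcosets S" for g h C
      using sub[OF that(3)] that by (simp add: coset_mult_assoc inv_mult_group)
  qed (use P finE in auto)
  then show ?thesis by simp
qed

text \<open>The stabiliser of the coset of \<open>g\<close> is the conjugate of \<open>S\<close> by \<open>inv g\<close>.\<close>

lemma (in group) fixed_coset_conjg:
  assumes S: "subgroup S G" and g: "g \<in> carrier G" and h: "h \<in> carrier G" "S #> g #> inv h = S #> g"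
  shows "conjg G g h \<in> S"
proof -
  have sub: "S \<subseteq> carrier G" using subgroup.subset[OF S] .
  have "S #> (g \<otimes> h) = S #> g #> h" using sub g h(1) by (simp add: coset_mult_assoc)
  also have "\<dots> = S #> g #> inv h #> h" by (simp only: h(2))
  also have "\<dots> = S #> g" using sub g h(1) by (simp add: coset_mult_assoc m_assoc)
  finally have "g \<otimes> h \<in> S #> g" using rcos_self[of "g \<otimes> h" S] g h(1) S by auto
  then obtain s where s: "s \<in> S" "g \<otimes> h = s \<otimes> g" by (auto simp: r_coset_def)
  then have "conjg G g h = s" using g h(1) sub by (auto simp: conjg_def word_simps)
  then show ?thesis using s by simp
qed

text \<open>If the number of cosets is prime to \<open>p\<close>, one of them is fixed.\<close>

lemma (in group) sylow_contains_conjugate: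
  assumes fin: "finite (carrier G)" and P: "subgroup P G" "card P = p ^ n" "Factorial_Ring.prime p"
    and S: "subgroup S G" "\<not> p dvd card (rcosets S)"
  shows "\<exists>g\<in>carrier G. conjg G g ` P \<subseteq> S"
proof -
  have "card (rcosets S) mod p \<noteq> 0" using S(2) by (simp add: dvd_eq_mod_eq_0)
  then have "{C \<in> rcosets S. \<forall>h\<in>P. C #> inv h = C} \<noteq> {}"
    using p_subgroup_fixed_cosets[OF fin P S(1)] by (metis card.empty mod_0)
  then obtain g where g: "g \<in> carrier G" "\<And>h. h \<in> P \<Longrightarrow> S #> g #> inv h = S #> g"
    by (auto simp: RCOSETS_def)
  then have "conjg G g h \<in> S" if "h \<in> P" for h
    using fixed_coset_conjg[OF S(1) g(1) subgroup.mem_carrier[OF P(1) that]] that by blast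
  then show ?thesis using g(1) by blast
qed

text \<open>The equality is required, instead of an inclusion, so that this is a subgroup in infinite groups as well.\<close>

definition normz :: "('a, 'b) monoid_scheme \<Rightarrow> 'a set \<Rightarrow> 'a set" where
  "normz G H = {g \<in> carrier G. conjg G g ` H = H}"

lemma (in group) normz_subgroup:
  assumes "subgroup H G"
  shows "subgroup (normz G H) G" "H \<subseteq> normz G H"
proof -
  interpret H: subgroup H G by fact
  show "subgroup (normz G H) G"
  proof (rule subgroupI)
    have "conjg G \<one> ` H = H" by (simp add: image_def)
    then show "normz G H \<noteq> {}" unfolding normz_def by blast
    show "inv a \<in> normz G H" if "a \<in> normz G H" for a
    proof -
      have "conjg G (inv a) ` (conjg G a ` H) = H"
      proof -
        have "(\<lambda>x. conjg G (inv a) (conjg G a x)) ` H = (\<lambda>x. x) ` H"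
          using that by (intro image_cong) (auto simp: normz_def)
        then show ?thesis by (simp add: image_image)
      qed
      then show ?thesis using that by (simp add: normz_def)
    qed
    show "a \<otimes> b \<in> normz G H" if "a \<in> normz G H" "b \<in> normz G H" for a b
    proof -
      have "conjg G (a \<otimes> b) ` H = conjg G a ` (conjg G b ` H)"
        using that unfolding image_image
        by (intro image_cong) (auto simp: normz_def conjg_conjg)
      then show ?thesis using that by (simp add: normz_def)
    qed
  qed (auto simp: normz_def)
  have sub: "conjg G h ` H \<subseteq> H" if "h \<in> H" for h using that by (auto simp: conjg_def)
  have "H \<subseteq> conjg G h ` H" if "h \<in> H" for h
  proof
    fix x assume "x \<in> H"
    then have "x = conjg G h (conjg G (inv h) x)" "conjg G (inv h) x \<in> H"
      using that sub[of "inv h"] by auto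
    then show "x \<in> conjg G h ` H" by blast
  qed
  then have "conjg G h ` H = H" if "h \<in> H" for h
    using sub[OF that] that by (intro equalityI)
  then show "H \<subseteq> normz G H" unfolding normz_def using H.subset by blast
qed

lemma (in group) normzI:
  assumes "finite H" "H \<subseteq> carrier G" "g \<in> carrier G" "conjg G g ` H \<subseteq> H"
  shows "g \<in> normz G H"
proof -
  have "conjg G g ` H = H"
    by (rule card_subset_eq[OF assms(1,4) card_conjg[OF assms(2,3)]])
  then show ?thesis using assms(3) unfolding normz_def by blast
qed

lemma (in group) normal_iff_normz:
  assumes "subgroup H G"
  shows "H \<lhd> G \<longleftrightarrow> normz G H = carrier G"
proof
  assume H: "H \<lhd> G"
  have "g \<in> normz G H" if g: "g \<in> carrier G" for g
  proof -
    have "conjg G g ` H \<subseteq> H" using H g by (auto simp: normal_iff)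
    moreover have "H \<subseteq> conjg G g ` H"
    proof
      fix x assume x: "x \<in> H"
      then have "x = conjg G g (conjg G (inv g) x)" "conjg G (inv g) x \<in> H"
        using H g subgroup.mem_carrier[OF assms x] by (auto simp: normal_iff)
      then show "x \<in> conjg G g ` H" by blast
    qed
    ultimately show ?thesis using g by (auto simp: normz_def)
  qed
  then show "normz G H = carrier G" by (auto simp: normz_def)
next
  assume "normz G H = carrier G"
  then show "H \<lhd> G" unfolding normal_iff normz_def using assms by blast
qed

text \<open>The conjugate of \<open>Q\<close> by \<open>g\<close> is again a Sylow subgroup of \<open>N\<close>, so an element of \<open>N\<close> moves it back
  to \<open>Q\<close>.\<close>

lemma (in group) frattini_argument:
  assumes fin: "finite (carrier G)" and N: "N \<lhd> G" and Q: "subgroup Q G" "Q \<subseteq> N"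
    and "card Q = p ^ a" "Factorial_Ring.prime p" "card N = card Q * m" "\<not> p dvd m"
    and g: "g \<in> carrier G"
  shows "\<exists>n\<in>N. \<exists>h\<in>normz G Q. g = n \<otimes> h"
proof -
  interpret N: normal N G by fact
  interpret Ng: group "G\<lparr>carrier := N\<rparr>" using N.subgroup_axioms by (rule subgroup_imp_group)
  have finN: "finite N" using fin fin_sub N.subgroup_axioms by blast
  have QN: "subgroup Q (G\<lparr>carrier := N\<rparr>)" using Q N.subgroup_axioms by (simp add: subgroup_in)
  have sub: "conjg G g ` Q \<subseteq> N" using N Q g by (auto simp: normal_iff)
  have "card (rcosets\<^bsub>G\<lparr>carrier := N\<rparr>\<^esub> Q) * card Q = card N"
    using Ng.lagrange[OF QN] by (simp add: order_def)
  moreover have "card Q > 0" using card_pos Q fin by blast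
  ultimately have "card (rcosets\<^bsub>G\<lparr>carrier := N\<rparr>\<^esub> Q) = m" using assms(7) by (metis mult.commute nat_mult_eq_cancel1)
  then have "\<exists>n\<in>N. conjg (G\<lparr>carrier := N\<rparr>) n ` (conjg G g ` Q) \<subseteq> Q"
    using Ng.sylow_contains_conjugate[of "conjg G g ` Q" p a Q] assms finN QN sub
      subgroup_conjg[OF Q(1) g] card_conjg[OF subgroup.subset[OF Q(1)] g]
    by (simp add: subgroup_in N.subgroup_axioms)
  then obtain n where n: "n \<in> N" "conjg G n ` (conjg G g ` Q) \<subseteq> Q"
    using conjg_in[OF N.subgroup_axioms] by (metis (no_types, lifting) image_cong)
  have "conjg G (n \<otimes> g) ` Q = conjg G n ` (conjg G g ` Q)"
    using n g subgroup.mem_carrier[OF Q(1)] by (auto simp: image_image conjg_conjg intro!: image_cong)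
  then have "n \<otimes> g \<in> normz G Q"
    using n g fin_sub[OF Q(1) fin] subgroup.subset[OF Q(1)] by (intro normzI) auto
  moreover have "g = inv n \<otimes> (n \<otimes> g)" using n g by (simp add: mult_inv_cancel)
  ultimately show ?thesis using n by blast
qed

definition centre :: "('a, 'b) monoid_scheme \<Rightarrow> 'a set" where
  "centre G = {z \<in> carrier G. \<forall>g\<in>carrier G. conjg G g z = z}"

lemma (in group) centre_normal: "centre G \<lhd> G"
proof -
  have "subgroup (centre G) G"
  proof (rule subgroupI)
    have "\<one> \<in> centre G" by (simp add: centre_def)
    then show "centre G \<noteq> {}" by blast
  qed (auto simp: centre_def conjg_mult conjg_inv)
  then show ?thesis unfolding normal_iff by (auto simp: centre_def)
qed

lemma (in group) centre_commute: "z \<in> centre G \<Longrightarrow> g \<in> carrier G \<Longrightarrow> g \<otimes> z = z \<otimes> g"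
  unfolding centre_def by (auto simp: conjg_fixed_iff)

lemma (in group) centre_iff: "z \<in> centre G \<longleftrightarrow> z \<in> carrier G \<and> (\<forall>g\<in>carrier G. g \<otimes> z = z \<otimes> g)"
  unfolding centre_def by (auto simp: conjg_fixed_iff)

text \<open>The centre is the set of fixed points of the conjugation action.\<close>

lemma (in group) p_group_centre_nontrivial:
  assumes fin: "finite (carrier G)" and "order G = p ^ n" "Factorial_Ring.prime p" "carrier G \<noteq> {\<one>}"
  shows "centre G \<noteq> {\<one>}"
proof
  assume c: "centre G = {\<one>}"
  have "card (carrier G) mod p = card {x\<in>carrier G. \<forall>g\<in>carrier G. conjg G g x = x} mod p"
    using assms by (intro p_group_fixed_points[where n = n]) (auto simp: conjg_conjg)
  also have "\<dots> = 1" using c prime_gt_1_nat[OF assms(3)] by (simp add: centre_def)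
  finally have "\<not> p dvd order G" by (simp add: order_def dvd_eq_mod_eq_0)
  then have "order G = 1" using assms(2) by (cases n) auto
  then show False using assms(4) order_one_triv_iff by blast
qed

section \<open>Transfer into an abelian subgroup\<close>

lemma (in group_hom) order_eq_card_kernel_mult_card_image:
  "order G = card (kernel G H h) * card (h ` carrier G)"
proof -
  have im: "(\<lambda>X. the_elem (h ` X)) ` carrier (G Mod kernel G H h) = h ` carrier G"
  proof -
    have "the_elem (h ` (kernel G H h #> g)) = h g" if g: "g \<in> carrier G" for g
    proof -
      have "h ` (kernel G H h #> g) = {h g}"
      proof -
        have "\<one> \<in> kernel G H h" by (simp add: kernel_def)
        moreover have "h x = h g" if "x \<in> kernel G H h #> g" for x
          using that g by (auto simp: kernel_def r_coset_def)
        moreover have "g \<in> kernel G H h #> g"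
          using G.rcos_self[OF g subgroup_kernel] .
        ultimately show ?thesis by blast
      qed
      then show ?thesis by simp
    qed
    then show ?thesis unfolding carrier_FactGroup image_image by (rule image_cong[OF refl])
  qed
  have "card (rcosets (kernel G H h)) = card (h ` carrier G)"
    using card_image[OF FactGroup_inj_on] im by (simp add: FactGroup_def)
  then show ?thesis using G.lagrange[OF subgroup_kernel] by (simp add: mult.commute)
qed

text \<open>With a representative \<open>r(C)\<close> of each right coset \<open>C\<close>, the element \<open>r(C) g\<close> lies in the coset \<open>C g\<close>, so it
  differs from \<open>r(C g)\<close> by a factor in \<open>P\<close>. The transfer is the product of these factors; for abelian \<open>P\<close>
  their order does not matter.\<close>

definition coset_rep :: "'a set \<Rightarrow> 'a" where
  "coset_rep C = (SOME x. x \<in> C)"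

definition transfer_factor :: "('a, 'b) monoid_scheme \<Rightarrow> 'a \<Rightarrow> 'a set \<Rightarrow> 'a" where
  "transfer_factor G g C = coset_rep C \<otimes>\<^bsub>G\<^esub> g \<otimes>\<^bsub>G\<^esub> inv\<^bsub>G\<^esub> (coset_rep (C #>\<^bsub>G\<^esub> g))"

definition transfer :: "('a, 'b) monoid_scheme \<Rightarrow> 'a set \<Rightarrow> 'a \<Rightarrow> 'a" where
  "transfer G P g = finprod (G\<lparr>carrier := P\<rparr>) (transfer_factor G g) (rcosets\<^bsub>G\<^esub> P)"

locale abelian_subgroup_transfer = group G + P: subgroup P G for G (structure) and P +
  assumes fin: "finite (carrier G)"
    and comm: "\<And>x y. x \<in> P \<Longrightarrow> y \<in> P \<Longrightarrow> x \<otimes> y = y \<otimes> x"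
begin

sublocale PG: comm_group "G\<lparr>carrier := P\<rparr>"
  using P.subgroup_is_group[OF is_group] comm by (intro group.group_comm_groupI) auto

lemma coset_sub: "C \<in> rcosets P \<Longrightarrow> C \<subseteq> carrier G"
  using rcosets_part_G[OF P.subgroup_axioms] by blast

lemma coset_step: "C \<in> rcosets P \<Longrightarrow> g \<in> carrier G \<Longrightarrow> C #> g \<in> rcosets P"
  unfolding RCOSETS_def by (auto simp: coset_mult_assoc P.subset)

lemma coset_rep_in: "C \<in> rcosets P \<Longrightarrow> coset_rep C \<in> C"
  unfolding coset_rep_def using P.rcosets_non_empty[of C] by (simp add: some_in_eq)

lemma coset_rep_carrier: "C \<in> rcosets P \<Longrightarrow> coset_rep C \<in> carrier G"
  using coset_rep_in coset_sub by blast

lemma coset_eq: "C \<in> rcosets P \<Longrightarrow> x \<in> C \<Longrightarrow> C = P #> x"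
  unfolding RCOSETS_def using repr_independence[OF _ _ P.subgroup_axioms] by auto

lemma same_coset_quotient:
  assumes "C \<in> rcosets P" "x \<in> C" "y \<in> C"
  shows "x \<otimes> inv y \<in> P"
proof -
  have y: "y \<in> carrier G" using assms coset_sub by blast
  have "x \<in> P #> y" using coset_eq[OF assms(1,3)] assms(2) by simp
  then obtain s where "s \<in> P" "x = s \<otimes> y" by (auto simp: r_coset_def)
  then show ?thesis using y by (simp add: word_simps)
qed

lemma transfer_factor_in: 
  assumes C: "C \<in> rcosets P" and g: "g \<in> carrier G"
  shows "transfer_factor G g C \<in> P"
proof -
  have "coset_rep C \<otimes> g \<in> C #> g" using coset_rep_in[OF C] by (auto simp: r_coset_def)
  then show ?thesis unfolding transfer_factor_def
    using same_coset_quotient[OF coset_step[OF C g]] coset_rep_in[OF coset_step[OF C g]] by blast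
qed

lemma finite_cosets: "finite (rcosets P)"
  using fin by (auto simp: RCOSETS_def)

lemma transfer_closed: "g \<in> carrier G \<Longrightarrow> transfer G P g \<in> P"
  unfolding transfer_def using PG.finprod_closed[of "transfer_factor G g" "rcosets P"]
    transfer_factor_in by auto

text \<open>The factors satisfy a cocycle identity, and \<open>C \<mapsto> C g\<close> permutes the cosets.\<close>

lemma transfer_hom: "transfer G P \<in> hom G (G\<lparr>carrier := P\<rparr>)"
proof (rule homI)
  fix g h assume g: "g \<in> carrier G" and h: "h \<in> carrier G"
  have step: "transfer_factor G (g \<otimes> h) C = transfer_factor G g C \<otimes> transfer_factor G h (C #> g)"
    if C: "C \<in> rcosets P" for C
  proof -
    have "C #> (g \<otimes> h) = C #> g #> h" using coset_mult_assoc[OF coset_sub[OF C] g h] by simp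
    then show ?thesis using g h coset_rep_carrier[OF C] coset_rep_carrier[OF coset_step[OF C g]]
      coset_rep_carrier[OF coset_step[OF coset_step[OF C g] h]]
      by (simp add: transfer_factor_def word_simps)
  qed
  have inj: "inj_on (\<lambda>C. C #> g) (rcosets P)"
  proof (rule inj_onI)
    fix C D assume CD: "C \<in> rcosets P" "D \<in> rcosets P" "C #> g = D #> g"
    have "C = (C #> g) #> inv g" "D = (D #> g) #> inv g"
      using coset_sub[OF CD(1)] coset_sub[OF CD(2)] g by (simp_all add: coset_mult_assoc)
    then show "C = D" using CD(3) by simp
  qed
  have surj: "(\<lambda>C. C #> g) ` (rcosets P) = rcosets P"
    using coset_step[OF _ g] by (intro endo_inj_surj[OF finite_cosets _ inj]) auto
  have "transfer G P (g \<otimes> h) =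
      finprod (G\<lparr>carrier := P\<rparr>) (\<lambda>C. transfer_factor G g C \<otimes>\<^bsub>G\<lparr>carrier := P\<rparr>\<^esub> transfer_factor G h (C #> g)) (rcosets P)"
    unfolding transfer_def using transfer_factor_in coset_step g h
    by (intro PG.finprod_cong') (auto simp: step)
  also have "\<dots> = transfer G P g \<otimes> finprod (G\<lparr>carrier := P\<rparr>) (\<lambda>C. transfer_factor G h (C #> g)) (rcosets P)"
    unfolding transfer_def using transfer_factor_in coset_step g h by (subst PG.finprod_multf) auto
  also have "finprod (G\<lparr>carrier := P\<rparr>) (\<lambda>C. transfer_factor G h (C #> g)) (rcosets P) = transfer G P h"
    unfolding transfer_def using PG.finprod_reindex[OF _ inj, of "transfer_factor G h"] transfer_factor_in h
    by (simp add: surj)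
  finally show "transfer G P (g \<otimes> h) = transfer G P g \<otimes>\<^bsub>G\<lparr>carrier := P\<rparr>\<^esub> transfer G P h" by simp
qed (simp add: transfer_closed)

text \<open>Along a cycle of \<open>x\<close> on the cosets the product of the factors telescopes to a conjugate of a
  power of \<open>x\<close>; without fusion this conjugate is that power itself. Splitting off one cycle at a time
  requires the claim for all sets of cosets that \<open>x\<close> permutes.\<close>

lemma transfer_partial:
  assumes x: "x \<in> P" and nofuse: "\<And>t y. t \<in> carrier G \<Longrightarrow> y \<in> P \<Longrightarrow> conjg G t y \<in> P \<Longrightarrow> conjg G t y = y"
    and E: "E \<subseteq> rcosets P" "\<And>C. C \<in> E \<Longrightarrow> C #> x \<in> E"
  shows "finprod (G\<lparr>carrier := P\<rparr>) (transfer_factor G x) E = x [^] card E"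
  using E
proof (induction "card E" arbitrary: E rule: less_induct)
  case less
  have xc: "x \<in> carrier G" using x by simp
  have finE: "finite E" using less.prems finite_cosets finite_subset by blast
  have tf: "transfer_factor G x \<in> E' \<rightarrow> P" if "E' \<subseteq> rcosets P" for E'
    using transfer_factor_in xc that by blast
  show ?case
  proof (cases "E = {}")
    case False
    then obtain C where C: "C \<in> E" by blast
    have CP: "C \<in> rcosets P" using C less.prems by blast
    define f where "f i = C #> x [^] i" for i :: nat
    have f0: "f 0 = C" using coset_sub[OF CP] by (simp add: f_def)
    have fSuc: "f i #> x = f (Suc i)" for i
      using coset_sub[OF CP] xc by (simp add: f_def coset_mult_assoc)
    have fE: "f i \<in> E" for i by (induction i) (use f0 C fSuc less.prems(2) in \<open>auto simp flip: fSuc\<close>)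
    have fadd: "f i #> x [^] j = f (i + j)" for i j
      using coset_sub[OF CP] xc by (simp add: f_def coset_mult_assoc nat_pow_mult)
    have ex: "\<exists>l>0. f l = C"
      using pow_order_eq_1[OF xc] fin order_gt_0_iff_finite f0 unfolding f_def by (metis nat_pow_0)
    (* the length of the cycle of x through C *)
    define l where "l = (LEAST l. l > 0 \<and> f l = C)"
    have l: "l > 0" "f l = C" using LeastI_ex[OF ex] unfolding l_def by auto
    have lmin: "\<not> (0 < k \<and> f k = C)" if "k < l" for k using not_less_Least that unfolding l_def by blast
    have cancel: "f (j - i) = C" if "f i = f j" "i \<le> j" for i j
    proof -
      have "f i #> inv (x [^] i) = C" using coset_sub[OF CP] xc by (simp add: f_def coset_mult_assoc)
      moreover have "f j #> inv (x [^] i) = f (j - i)"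
      proof -
        have "f j = f (j - i) #> x [^] i" using that fadd by simp
        moreover have "f (j - i) \<subseteq> carrier G" using fE less.prems(1) coset_sub by blast
        ultimately show ?thesis using xc by (simp add: coset_mult_assoc)
      qed
      ultimately show ?thesis using that by simp
    qed
    have inj: "inj_on f {..<l}"
    proof (rule linorder_inj_onI)
      fix i j assume ij: "i < j" "i \<in> {..<l}" "j \<in> {..<l}"
      show "f i \<noteq> f j"
      proof
        assume "f i = f j"
        then have "f (j - i) = C" using cancel ij by simp
        moreover have "j - i < l" "0 < j - i" using ij by (simp_all add: less_imp_diff_less)
        ultimately show False using lmin by blast
      qed
    qed (use nat_le_linear in auto)
    define B where "B = f ` {..<l}"
    have BE: "B \<subseteq> E" using fE by (auto simp: B_def)
    have cardB: "card B = l" using inj by (simp add: B_def card_image)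
    have finB: "finite B" by (simp add: B_def)
    have outside: "D #> x \<in> E - B" if D: "D \<in> E - B" for D
    proof -
      have DE: "D \<in> rcosets P" using D less.prems(1) by blast
      have "D #> x \<notin> B"
      proof
        assume "D #> x \<in> B"
        then obtain i where i: "i < l" "D #> x = f i" by (auto simp: B_def)
        have "\<exists>k<l. f i = f (Suc k)"
        proof (cases i)
          case 0
          then have "f i = f (Suc (l - 1))" "l - 1 < l" using l f0 by simp_all
          then show ?thesis by blast
        next
          case (Suc n)
          then show ?thesis using i(1) by (intro exI[of _ n]) simp
        qed
        then obtain k where k: "k < l" "D #> x = f k #> x" using i fSuc by auto
        have "D = D #> x #> inv x" "f k = f k #> x #> inv x"
          using coset_sub[OF DE] fE[of k] less.prems(1) coset_sub[of "f k"] xc by (auto simp: coset_mult_assoc)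
        then have "D = f k" using k by simp
        then show False using D k by (auto simp: B_def)
      qed
      then show ?thesis using D less.prems(2) by blast
    qed
    have part: "j \<le> l \<Longrightarrow> finprod (G\<lparr>carrier := P\<rparr>) (\<lambda>i. transfer_factor G x (f i)) {..<j}
        = coset_rep C \<otimes> x [^] j \<otimes> inv (coset_rep (f j))" for j
    proof (induction j)
      case 0
      then show ?case using f0 coset_rep_carrier[OF CP] by simp
    next
      case (Suc j)
      have r: "coset_rep (f k) \<in> carrier G" for k using fE less.prems(1) coset_rep_carrier by blast
      have rC: "coset_rep C \<in> carrier G" using coset_rep_carrier[OF CP] .
      have t: "transfer_factor G x (f k) \<in> P" for k using transfer_factor_in xc fE less.prems(1) by blast
      have pc: "coset_rep C \<otimes> x [^] j \<otimes> inv (coset_rep (f j)) \<in> P"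
        using same_coset_quotient[of "f j" "coset_rep C \<otimes> x [^] j"] coset_rep_in[OF CP] coset_rep_in[of "f j"]
          fE[of j] less.prems(1) by (auto simp: f_def r_coset_def)
      have "finprod (G\<lparr>carrier := P\<rparr>) (\<lambda>i. transfer_factor G x (f i)) {..<Suc j}
          = transfer_factor G x (f j) \<otimes> (coset_rep C \<otimes> x [^] j \<otimes> inv (coset_rep (f j)))"
        using Suc t by (simp add: lessThan_Suc)
      also have "\<dots> = (coset_rep C \<otimes> x [^] j \<otimes> inv (coset_rep (f j))) \<otimes> transfer_factor G x (f j)"
        using comm t pc by blast
      also have "\<dots> = coset_rep C \<otimes> x [^] Suc j \<otimes> inv (coset_rep (f (Suc j)))"
        using r rC xc by (simp add: transfer_factor_def fSuc word_simps)
      finally show ?case .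
    qed
    have "finprod (G\<lparr>carrier := P\<rparr>) (transfer_factor G x) B = conjg G (coset_rep C) (x [^] l)"
      using PG.finprod_reindex[OF _ inj, of "transfer_factor G x"] part[of l] l tf[of B] BE less.prems(1)
      by (auto simp: B_def conjg_def)
    moreover have "finprod (G\<lparr>carrier := P\<rparr>) (transfer_factor G x) B \<in> P"
      using PG.finprod_closed[of "transfer_factor G x" B] tf[of B] BE less.prems(1) by auto
    ultimately have B: "finprod (G\<lparr>carrier := P\<rparr>) (transfer_factor G x) B = x [^] l"
      using nofuse[of "coset_rep C" "x [^] l"] coset_rep_carrier[OF CP] x pow_in_subgroup[OF P.subgroup_axioms x]
      by simp
    have "card (E - B) < card E"
      using finE C f0 l BE by (intro psubset_card_mono) (auto simp: B_def)
    then have EB: "finprod (G\<lparr>carrier := P\<rparr>) (transfer_factor G x) (E - B) = x [^] card (E - B)"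
      using less.hyps[of "E - B"] less.prems outside by blast
    have cE: "card E = l + card (E - B)"
      using card_Diff_subset[OF finB BE] card_mono[OF finE BE] cardB by simp
    have "transfer_factor G x \<in> B \<rightarrow> P" "transfer_factor G x \<in> E - B \<rightarrow> P"
      by (rule tf; use BE less.prems(1) in blast)+
    then have "finprod (G\<lparr>carrier := P\<rparr>) (transfer_factor G x) (B \<union> (E - B))
        = finprod (G\<lparr>carrier := P\<rparr>) (transfer_factor G x) B \<otimes>\<^bsub>G\<lparr>carrier := P\<rparr>\<^esub> finprod (G\<lparr>carrier := P\<rparr>) (transfer_factor G x) (E - B)"
      by (intro PG.finprod_Un_disjoint) (simp_all add: finB finE)
    moreover have "B \<union> (E - B) = E" using BE by blast
    ultimately have "finprod (G\<lparr>carrier := P\<rparr>) (transfer_factor G x) E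
        = finprod (G\<lparr>carrier := P\<rparr>) (transfer_factor G x) B \<otimes>\<^bsub>G\<lparr>carrier := P\<rparr>\<^esub> finprod (G\<lparr>carrier := P\<rparr>) (transfer_factor G x) (E - B)"
      by simp
    also have "\<dots> = x [^] l \<otimes> x [^] card (E - B)" using B EB by simp
    also have "\<dots> = x [^] card E" using xc by (simp add: cE nat_pow_mult)
    finally show ?thesis .
  qed simp
qed

lemma transfer_eq_power:
  assumes "x \<in> P" "\<And>t y. t \<in> carrier G \<Longrightarrow> y \<in> P \<Longrightarrow> conjg G t y \<in> P \<Longrightarrow> conjg G t y = y"
  shows "transfer G P x = x [^] card (rcosets P)"
  unfolding transfer_def using coset_step assms(1) by (intro transfer_partial assms) auto

end


lemma coprime_pow_eq_one:
  assumes "group G" "x \<in> carrier G" "x [^]\<^bsub>G\<^esub> (m::nat) = \<one>\<^bsub>G\<^esub>" "x [^]\<^bsub>G\<^esub> (n::nat) = \<one>\<^bsub>G\<^esub>" "coprime m n"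
  shows "x = \<one>\<^bsub>G\<^esub>"
proof -
  interpret group G by fact
  have "ord x dvd m" "ord x dvd n" using assms pow_eq_id by auto
  then have "ord x = 1" using assms(5) by (metis coprime_common_divisor_nat nat_dvd_1_iff_1 coprime_def)
  then show ?thesis using ord_eq_1 assms(2) by blast
qed

lemma (in group) pow_card_eq_one:
  assumes "subgroup H G" "finite (carrier G)" "x \<in> H"
  shows "x [^] card H = \<one>"
  using group.pow_order_eq_1[OF subgroup_imp_group[OF assms(1)], of x] assms
  by (simp add: order_sub nat_pow_consistent[symmetric])

lemma (in group) coprime_subgroups_Int:
  assumes "finite (carrier G)" "subgroup H G" "subgroup K G" "coprime (card H) (card K)"
  shows "H \<inter> K = {\<one>}"
proof -
  have "x = \<one>" if "x \<in> H" "x \<in> K" for x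
    by (rule coprime_pow_eq_one[OF is_group subgroup.mem_carrier[OF assms(2) that(1)]
        pow_card_eq_one[OF assms(2,1) that(1)] pow_card_eq_one[OF assms(3,1) that(2)] assms(4)])
  then show ?thesis using subgroup.one_closed[OF assms(2)] subgroup.one_closed[OF assms(3)] by blast
qed

text \<open>On \<open>P\<close> the transfer is the power map for the index of \<open>P\<close>, which is injective as the index is prime to
  the order; the kernel of the transfer is therefore a complement of \<open>P\<close>.\<close>

theorem (in group) burnside_transfer_complement:
  assumes fin: "finite (carrier G)" and P: "subgroup P G"
    and comm: "\<And>x y. x \<in> P \<Longrightarrow> y \<in> P \<Longrightarrow> x \<otimes> y = y \<otimes> x"
    and nofuse: "\<And>t y. t \<in> carrier G \<Longrightarrow> y \<in> P \<Longrightarrow> conjg G t y \<in> P \<Longrightarrow> conjg G t y = y"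
    and cop: "coprime (card P) (card (rcosets P))"
  shows "\<exists>V\<in>hom G (G\<lparr>carrier := P\<rparr>). V ` P = P \<and> kernel G (G\<lparr>carrier := P\<rparr>) V \<inter> P = {\<one>}
           \<and> card (kernel G (G\<lparr>carrier := P\<rparr>) V) = card (rcosets P)"
proof -
  interpret T: abelian_subgroup_transfer G P
    using fin P comm unfolding abelian_subgroup_transfer_def abelian_subgroup_transfer_axioms_def by auto
  define V where "V = transfer G P"
  interpret V: group_hom G "G\<lparr>carrier := P\<rparr>" V
    unfolding group_hom_def group_hom_axioms_def using T.transfer_hom T.PG.group_axioms by (simp add: V_def)
  have Vx: "V x = x [^] card (rcosets P)" if "x \<in> P" for x
    using T.transfer_eq_power[OF that nofuse] by (simp add: V_def)
  have one: "x = \<one>" if "x \<in> P" "V x = \<one>" for x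
    using coprime_pow_eq_one[OF is_group _ pow_card_eq_one[OF P fin that(1)] _ cop] Vx[OF that(1)] that(2)
      T.P.mem_carrier[OF that(1)] by simp
  have K: "kernel G (G\<lparr>carrier := P\<rparr>) V \<inter> P = {\<one>}"
    using one V.hom_one subgroup.one_closed[OF P] by (auto simp: kernel_def)
  have "inj_on V P"
  proof (rule inj_onI)
    fix x y assume xy: "x \<in> P" "y \<in> P" "V x = V y"
    have c: "x \<in> carrier G" "y \<in> carrier G" using xy P subgroup.mem_carrier by auto
    have Vm: "V (a \<otimes> b) = V a \<otimes> V b" if "a \<in> carrier G" "b \<in> carrier G" for a b
      using V.hom_mult that by simp
    have "V (x \<otimes> inv y) = V x \<otimes> V (inv y)" using c by (intro Vm) auto
    also have "\<dots> = V y \<otimes> V (inv y)" using xy by simp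
    also have "\<dots> = V (y \<otimes> inv y)" using c by (intro Vm[symmetric]) auto
    also have "\<dots> = \<one>" using c V.hom_one by simp
    finally have "V (x \<otimes> inv y) = \<one>" .
    moreover have "x \<otimes> inv y \<in> P" using xy P by (simp add: subgroup.m_closed subgroup.m_inv_closed)
    ultimately have "x \<otimes> inv y = \<one>" using one by blast
    then have "x = \<one> \<otimes> y" using c inv_solve_right'[of "\<one>" x y] by simp
    then show "x = y" using c by simp
  qed
  moreover have VP: "V ` P \<subseteq> P" using V.hom_closed T.P.subset by auto
  ultimately have "V ` P = P" using fin_sub[OF P fin] by (simp add: endo_inj_surj)
  moreover have "V ` carrier G = P"
  proof
    show "V ` carrier G \<subseteq> P" using V.hom_closed by auto
    show "P \<subseteq> V ` carrier G" using image_mono[OF T.P.subset, of V] \<open>V ` P = P\<close> by simp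
  qed
  then have "order G = card (kernel G (G\<lparr>carrier := P\<rparr>) V) * card P"
    using V.order_eq_card_kernel_mult_card_image by simp
  then have "card (kernel G (G\<lparr>carrier := P\<rparr>) V) = card (rcosets P)"
    using lagrange[OF P] card_pos[OF P fin] by simp
  ultimately show ?thesis using K T.transfer_hom unfolding V_def by blast
qed

section \<open>Abelian maximal subgroups\<close>

lemma (in group) maximal_not_normal_normz:
  assumes "maximal_subgroup M G" "\<not> M \<lhd> G"
  shows "normz G M = M"
  using assms normz_subgroup[of M] normal_iff_normz[of M] unfolding maximal_subgroup_def by blast

lemma (in group) centralizer_subgroup:
  assumes "X \<subseteq> carrier G"
  shows "subgroup {g \<in> carrier G. \<forall>x\<in>X. g \<otimes> x = x \<otimes> g} G"
proof (rule subgroupI)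
  have "\<one> \<in> {g \<in> carrier G. \<forall>x\<in>X. g \<otimes> x = x \<otimes> g}" using assms by auto
  then show "{g \<in> carrier G. \<forall>x\<in>X. g \<otimes> x = x \<otimes> g} \<noteq> {}" by blast
  show "inv a \<in> {g \<in> carrier G. \<forall>x\<in>X. g \<otimes> x = x \<otimes> g}" if "a \<in> {g \<in> carrier G. \<forall>x\<in>X. g \<otimes> x = x \<otimes> g}" for a
  proof -
    have "inv a \<otimes> x = x \<otimes> inv a" if x: "x \<in> X" for x
    proof -
      have c: "a \<in> carrier G" "x \<in> carrier G" "a \<otimes> x = x \<otimes> a" using that \<open>a \<in> _\<close> assms by auto
      have "inv a \<otimes> x = inv a \<otimes> (x \<otimes> a) \<otimes> inv a" using c(1,2) by (simp add: word_simps)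
      also have "\<dots> = inv a \<otimes> (a \<otimes> x) \<otimes> inv a" by (simp only: c(3))
      also have "\<dots> = x \<otimes> inv a" using c(1,2) by (simp add: word_simps)
      finally show ?thesis .
    qed
    then show ?thesis using that by auto
  qed
  show "a \<otimes> b \<in> {g \<in> carrier G. \<forall>x\<in>X. g \<otimes> x = x \<otimes> g}"
    if "a \<in> {g \<in> carrier G. \<forall>x\<in>X. g \<otimes> x = x \<otimes> g}" "b \<in> {g \<in> carrier G. \<forall>x\<in>X. g \<otimes> x = x \<otimes> g}" for a b
  proof -
    have "a \<otimes> b \<otimes> x = x \<otimes> (a \<otimes> b)" if x: "x \<in> X" for x
    proof -
      have c: "a \<in> carrier G" "b \<in> carrier G" "x \<in> carrier G" "a \<otimes> x = x \<otimes> a" "b \<otimes> x = x \<otimes> b"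
        using that \<open>a \<in> _\<close> \<open>b \<in> _\<close> assms by auto
      have "a \<otimes> b \<otimes> x = a \<otimes> (x \<otimes> b)" using c by (simp add: m_assoc)
      also have "\<dots> = a \<otimes> x \<otimes> b" using c(1-3) by (simp add: m_assoc)
      also have "\<dots> = x \<otimes> a \<otimes> b" by (simp only: c(4))
      finally show ?thesis using c(1-3) by (simp add: m_assoc)
    qed
    then show ?thesis using that by auto
  qed
qed auto

text \<open>The image \<open>y\<close> of \<open>x\<close> commutes with both the abelian groups \<open>M\<close> and \<open>M\<^sup>t\<close>, and these generate \<open>G\<close>
  because \<open>M\<close> is maximal and equal to its normaliser.\<close>

lemma (in group) conjg_abelian_maximal_central:
  assumes fin: "finite (carrier G)" and M: "maximal_subgroup M G" "\<not> M \<lhd> G"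
    and comm: "\<And>x y. x \<in> M \<Longrightarrow> y \<in> M \<Longrightarrow> x \<otimes> y = y \<otimes> x"
    and t: "t \<in> carrier G" "t \<notin> M" and x: "x \<in> M" "conjg G t x \<in> M"
  shows "x \<in> centre G"
proof -
  have MG: "subgroup M G" using M(1) by (simp add: maximal_subgroup_def)
  interpret M: subgroup M G by fact
  define y where "y = conjg G t x"
  have y: "y \<in> carrier G" "y \<in> M" using x t by (auto simp: y_def)
  define C where "C = {g \<in> carrier G. \<forall>z\<in>{y}. g \<otimes> z = z \<otimes> g}"
  have C: "subgroup C G" unfolding C_def by (rule centralizer_subgroup) (use y in auto)
  have "M \<subseteq> C" using comm y by (auto simp: C_def)
  moreover have "conjg G t ` M \<subseteq> C"
  proof -
    have "conjg G t z \<otimes> y = y \<otimes> conjg G t z" if "z \<in> M" for z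
      unfolding y_def using comm[OF that x(1)] that x t by (simp add: conjg_mult[symmetric])
    then show ?thesis using t by (auto simp: C_def)
  qed
  moreover have "conjg G t ` M \<noteq> M" using t maximal_not_normal_normz[OF M] by (auto simp: normz_def)
  then have "\<not> conjg G t ` M \<subseteq> M"
    using card_conjg[OF M.subset t(1)] fin_sub[OF MG fin] card_subset_eq by blast
  ultimately have "C = carrier G" using M(1) C unfolding maximal_subgroup_def by blast
  then have "y \<in> centre G" using y unfolding centre_iff C_def by auto
  moreover have "x = conjg G (inv t) y" using t x by (simp add: y_def)
  ultimately show ?thesis using t by (simp add: centre_def)
qed

lemma (in group) abelian_maximal_no_fusion:
  assumes "finite (carrier G)" "maximal_subgroup M G" "\<not> M \<lhd> G"
    and comm: "\<And>x y. x \<in> M \<Longrightarrow> y \<in> M \<Longrightarrow> x \<otimes> y = y \<otimes> x"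
    and t: "t \<in> carrier G" and x: "x \<in> M" "conjg G t x \<in> M"
  shows "conjg G t x = x"
proof (cases "t \<in> M")
  case True
  have "x \<in> carrier G" using x(1) assms(2) subgroup.mem_carrier unfolding maximal_subgroup_def by metis
  then show ?thesis using comm[OF True x(1)] t conjg_fixed_iff by blast
next
  case False
  then show ?thesis using conjg_abelian_maximal_central[OF assms(1-4) t False x] t by (simp add: centre_def)
qed

text \<open>The coset \<open>M\<close> is the only fixed point of the \<open>p\<close>-group \<open>X\<close> on the cosets of \<open>M\<close>: for another one a
  conjugation by some \<open>g\<close> outside of \<open>M\<close> would send \<open>X\<close> into \<open>M\<close>.\<close>

lemma (in group) abelian_maximal_index:
  assumes fin: "finite (carrier G)" and M: "maximal_subgroup M G" "\<not> M \<lhd> G"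
    and comm: "\<And>x y. x \<in> M \<Longrightarrow> y \<in> M \<Longrightarrow> x \<otimes> y = y \<otimes> x"
    and X: "subgroup X G" "X \<subseteq> M" "\<not> X \<subseteq> centre G" "card X = p ^ n" "Factorial_Ring.prime p"
  shows "\<not> p dvd card (rcosets M)"
proof -
  have MG: "subgroup M G" using M(1) by (simp add: maximal_subgroup_def)
  interpret M: subgroup M G by fact
  interpret X: subgroup X G by fact
  define Fx where "Fx = {C \<in> rcosets M. \<forall>h\<in>X. C #> inv h = C}"
  have "card (rcosets M) mod p = card Fx mod p"
    unfolding Fx_def by (rule p_subgroup_fixed_cosets[OF fin X(1,4,5) MG])
  moreover have "Fx = {M}"
  proof (intro Set.set_eqI iffI)
    fix C assume "C \<in> {M}"
    moreover have "M #> inv h = M" if "h \<in> X" for h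
      using that X(2) by (meson M.m_inv_closed M.rcos_const is_group subsetD)
    ultimately show "C \<in> Fx" using M.subgroup_in_rcosets[OF is_group] by (auto simp: Fx_def)
  next
    fix C assume C: "C \<in> Fx"
    then obtain g where g: "g \<in> carrier G" "C = M #> g" by (auto simp: Fx_def RCOSETS_def)
    obtain h where h: "h \<in> X" "h \<notin> centre G" using X(3) by blast
    have "M #> g #> inv h = M #> g" using C h(1) g(2) by (simp add: Fx_def)
    then have "conjg G g h \<in> M" using fixed_coset_conjg[OF MG g(1)] h(1) by simp
    then have "g \<in> M"
      using conjg_abelian_maximal_central[OF fin M comm g(1), of h] h X(2) by blast
    then show "C \<in> {M}" using g M.rcos_const[OF is_group] by simp
  qed
  ultimately have "card (rcosets M) mod p = 1" using prime_gt_1_nat[OF X(5)] by simp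
  then show ?thesis by (metis dvd_imp_mod_0 zero_neq_one)
qed

text \<open>The transfer \<open>V\<close> into \<open>M\<close> has a kernel \<open>K\<close> that complements \<open>M\<close>. By the Frattini argument the
  normaliser \<open>L\<close> of a Sylow subgroup of \<open>K\<close> covers \<open>G/K\<close>, so its index is prime to \<open>p\<close> and it contains a
  conjugate of \<open>M\<close>. Thus \<open>M\<close> normalises a Sylow subgroup of \<open>K\<close>, and this subgroup is normal in \<open>G\<close>
  because \<open>M\<close> is maximal.\<close>

theorem (in group) abelian_maximal_p_subgroup:
  assumes fin: "finite (carrier G)" and M: "maximal_subgroup M G" "\<not> M \<lhd> G"
    and comm: "\<And>x y. x \<in> M \<Longrightarrow> y \<in> M \<Longrightarrow> x \<otimes> y = y \<otimes> x"
    and p: "card M = p ^ n" "Factorial_Ring.prime p"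
  shows "\<exists>q b Q. Factorial_Ring.prime q \<and> q \<noteq> p \<and> Q \<lhd> G \<and> card Q = q ^ b \<and> Q \<noteq> {\<one>} \<and> Q \<inter> M = {\<one>}
           \<and> Q <#> M = carrier G"
proof -
  have MG: "subgroup M G" using M(1) by (simp add: maximal_subgroup_def)
  interpret M: subgroup M G by fact
  have "\<not> M \<subseteq> centre G"
  proof
    assume "M \<subseteq> centre G"
    then have "M \<lhd> G" unfolding normal_iff using MG by (auto simp: centre_def subset_iff)
    then show False using M by simp
  qed
  then have ndvd: "\<not> p dvd card (rcosets M)"
    using abelian_maximal_index[OF fin M comm MG] p by blast
  define m where "m = card (rcosets M)"
  have cop: "coprime (card M) m"
    using ndvd p by (simp add: m_def prime_imp_coprime)
  obtain V where V: "V \<in> hom G (G\<lparr>carrier := M\<rparr>)" "V ` M = M"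
      "kernel G (G\<lparr>carrier := M\<rparr>) V \<inter> M = {\<one>}" "card (kernel G (G\<lparr>carrier := M\<rparr>) V) = m"
    using burnside_transfer_complement[OF fin MG comm abelian_maximal_no_fusion[OF fin M comm]] cop
    unfolding m_def by blast
  interpret V: group_hom G "G\<lparr>carrier := M\<rparr>" V
    unfolding group_hom_def group_hom_axioms_def using V(1) subgroup_imp_group[OF MG] by simp
  define K where "K = kernel G (G\<lparr>carrier := M\<rparr>) V"
  have K: "K \<lhd> G" "subgroup K G" unfolding K_def using V.normal_kernel V.subgroup_kernel by auto
  have mG: "m * card M = order G" using lagrange[OF MG] by (simp add: m_def)
  have "m \<noteq> 1"
  proof
    assume "m = 1"
    then have "card M = card (carrier G)" using mG by (simp add: order_def)
    then have "M = carrier G" using fin M.subset by (simp add: card_subset_eq)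
    then show False using M(1) by (simp add: maximal_subgroup_def)
  qed
  then obtain q where q: "Factorial_Ring.prime q" "q dvd m" using prime_factor_nat by blast
  have qp: "q \<noteq> p" using q ndvd by (auto simp: m_def)
  have m0: "m \<noteq> 0" using mG fin order_gt_0_iff_finite by (metis less_numeral_extra(3) mult_0)
  define b where "b = multiplicity q m"
  obtain m' where m': "m = q ^ b * m'" "\<not> q dvd m'"
    using multiplicity_decompose'[of m q] m0 prime_gt_1_nat[OF q(1)] by (auto simp: b_def)
  have b: "b \<noteq> 0" using m' q(2) by (cases b) auto
  interpret Kg: group "G\<lparr>carrier := K\<rparr>" using K by (simp add: subgroup_imp_group)
  obtain Q0 where Q0: "subgroup Q0 G" "Q0 \<subseteq> K" "card Q0 = q ^ b"
    using Sylow.sylow_thm[OF q(1) Kg.is_group, of b m'] V(4) m'(1) fin_sub[OF K(2) fin] subgroup_in[OF K(2)]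
    unfolding K_def[symmetric] by (auto simp: order_def)
  define L where "L = normz G Q0"
  have L: "subgroup L G" "Q0 \<subseteq> L" unfolding L_def using normz_subgroup[OF Q0(1)] by auto
  have GKL: "\<exists>k\<in>K. \<exists>l\<in>L. g = k \<otimes> l" if "g \<in> carrier G" for g
    unfolding L_def using frattini_argument[OF fin K(1) Q0(1,2,3) q(1) _ m'(2) that] V(4) Q0(3) m'(1)
    unfolding K_def[symmetric] by simp
  have VL: "V ` L = M"
  proof -
    have "V ` carrier G \<subseteq> V ` L"
    proof
      fix y assume "y \<in> V ` carrier G"
      then obtain g where g: "g \<in> carrier G" "y = V g" by blast
      obtain k l where kl: "k \<in> K" "l \<in> L" "g = k \<otimes> l" using GKL[OF g(1)] by blast
      have c: "k \<in> carrier G" "l \<in> carrier G" using kl(1,2) K(2) L(1) by (auto simp: subgroup.mem_carrier)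
      have "V g = V k \<otimes> V l" using kl c V.hom_mult by simp
      also have "\<dots> = V l" using kl(1) V.hom_closed[OF c(2)] by (simp add: K_def kernel_def)
      finally show "y \<in> V ` L" using g kl by blast
    qed
    moreover have "M \<subseteq> V ` carrier G" using V(2) M.subset by blast
    moreover have "V ` L \<subseteq> M" using V.hom_closed subgroup.subset[OF L(1)] by auto
    ultimately show ?thesis by (meson subset_antisym subset_trans)
  qed
  interpret VL: group_hom "G\<lparr>carrier := L\<rparr>" "G\<lparr>carrier := M\<rparr>" V
    unfolding group_hom_def group_hom_axioms_def using subgroup_imp_group[OF MG] subgroup_imp_group[OF L(1)]
      V(1) L(1) by (auto simp: hom_def subgroup.mem_carrier)
  have "card L = card (kernel (G\<lparr>carrier := L\<rparr>) (G\<lparr>carrier := M\<rparr>) V) * card M"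
    using VL.order_eq_card_kernel_mult_card_image VL by (simp add: order_sub)
  then obtain l where l: "card L = l * card M" by blast
  have "card (rcosets L) * l = m"
  proof -
    have "card (rcosets L) * l * card M = m * card M" using lagrange[OF L(1)] mG l by simp
    then show ?thesis using card_pos[OF MG fin] by simp
  qed
  then have "\<not> p dvd card (rcosets L)" using ndvd unfolding m_def[symmetric] by (metis dvd_mult2)
  then obtain g where g: "g \<in> carrier G" "conjg G g ` M \<subseteq> L"
    using sylow_contains_conjugate[OF fin MG p L(1)] by blast
  define Q where "Q = conjg G (inv g) ` Q0"
  have Q: "subgroup Q G" "card Q = q ^ b"
    unfolding Q_def using Q0 g subgroup_conjg card_conjg[of Q0 "inv g"] by (auto simp: subgroup.subset)
  have "M \<subseteq> normz G Q"
  proof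
    fix h assume h: "h \<in> M"
    have "conjg G g h \<in> L" using g h by blast
    then have e: "conjg G (conjg G g h) ` Q0 = Q0" by (simp add: L_def normz_def)
    have "conjg G h ` Q \<subseteq> Q"
    proof
      fix y assume "y \<in> conjg G h ` Q"
      then obtain z where z: "z \<in> Q0" "y = conjg G h (conjg G (inv g) z)" unfolding Q_def by blast
      have zc: "z \<in> carrier G" using subgroup.mem_carrier[OF Q0(1) z(1)] .
      have "y = conjg G (inv g) (conjg G (conjg G g h) z)"
        using z zc h g by (simp add: conjg_def word_simps)
      then show "y \<in> Q" using e z by (auto simp: Q_def)
    qed
    then show "h \<in> normz G Q"
      using h Q(1) fin_sub[OF Q(1) fin] by (intro normzI) (auto simp: subgroup.subset)
  qed
  have QM: "Q \<inter> M = {\<one>}"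
    using coprime_subgroups_Int[OF fin Q(1) MG] Q(2) p qp q(1) by (simp add: primes_coprime)
  have Q1: "Q \<noteq> {\<one>}"
  proof
    assume "Q = {\<one>}"
    then have "q ^ b = 1" using Q(2) by simp
    then show False using b q(1) prime_gt_1_nat[OF q(1)] by simp
  qed
  then have notsub: "\<not> Q \<subseteq> M" using QM by blast
  then have "normz G Q = carrier G"
    using M(1) \<open>M \<subseteq> normz G Q\<close> normz_subgroup[OF Q(1)] unfolding maximal_subgroup_def by blast
  then have Qn: "Q \<lhd> G" using normal_iff_normz[OF Q(1)] by simp
  have "Q <#> M = carrier G"
    using M(1) subgroup_normal_mult[OF Qn MG] notsub unfolding maximal_subgroup_def by blast
  then show ?thesis using q qp Qn Q Q1 QM by blast
qed

lemma (in group) pow_eq_pow_iff_cong: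
  assumes x: "x \<in> carrier G"
  shows "x [^] (i::nat) = x [^] (j::nat) \<longleftrightarrow> [i = j] (mod ord x)"
proof -
  have le: "x [^] (i::nat) = x [^] (j::nat) \<longleftrightarrow> [i = j] (mod ord x)" if "i \<le> j" for i j
  proof -
    have "x [^] j = x [^] i \<otimes> x [^] (j - i)" using x that by (simp add: nat_pow_mult)
    then have "x [^] i = x [^] j \<longleftrightarrow> x [^] (j - i) = \<one>" using x by (metis l_cancel_one' nat_pow_closed)
    also have "\<dots> \<longleftrightarrow> ord x dvd j - i" using pow_eq_id[OF x] .
    also have "\<dots> \<longleftrightarrow> [j = i] (mod ord x)" using cong_altdef_nat[OF that] by simp
    finally show ?thesis by (simp add: cong_sym_eq)
  qed
  show ?thesis using le[of i j] le[of j i] by (cases "i \<le> j") (auto simp: cong_sym_eq)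
qed

text \<open>An element normalising the subgroup \<open>P\<close> of order \<open>p\<close> raises its elements to the \<open>a\<close>-th power for some \<open>a\<close>,
  whose order modulo \<open>p\<close> divides both the group order and \<open>p - 1\<close>. So \<open>a\<close> is \<open>1\<close> modulo \<open>p\<close>, and
  there is no fusion in \<open>P\<close>. The coprimality holds when \<open>p\<close> is the smallest prime divisor of the group
  order.\<close>

theorem (in group) smallest_prime_complement:
  assumes fin: "finite (carrier G)" and P: "subgroup P G" "card P = p" "Factorial_Ring.prime p"
    and ndvd: "\<not> p dvd card (rcosets P)" and cop: "coprime (order G) (p - 1)"
  shows "\<exists>K. K \<lhd> G \<and> card K * p = order G \<and> coprime (card K) p"
proof -
  interpret P: subgroup P G by fact
  have gen: "P = {x [^] k | k. k \<in> (UNIV::nat set)}" "x \<in> carrier G" "ord x = p" if x: "x \<in> P" "x \<noteq> \<one>" for x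
  proof -
    show xc: "x \<in> carrier G" using x by simp
    have "x [^] p = \<one>" using pow_card_eq_one[OF P(1) fin x(1)] P(2) by simp
    then have "ord x dvd p" using pow_eq_id[OF xc] by simp
    moreover have "ord x \<noteq> 1" using ord_eq_1[OF xc] x by simp
    ultimately show o: "ord x = p" using P(3) prime_nat_iff by blast
    have g: "generate G {x} = {x [^] k | k. k \<in> (UNIV::nat set)}"
      using generate_pow_on_finite_carrier[OF fin xc] by simp
    have "generate G {x} \<subseteq> P" using x by (simp add: generate_subgroup_incl P(1))
    moreover have "card (generate G {x}) = card P" using generate_pow_card[OF xc] o P(2) by simp
    ultimately have "generate G {x} = P" using fin_sub[OF P(1) fin] by (simp add: card_subset_eq)
    then show "P = {x [^] k | k. k \<in> (UNIV::nat set)}" using g by simp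
  qed
  have comm: "x \<otimes> y = y \<otimes> x" if xy: "x \<in> P" "y \<in> P" for x y
  proof (cases "x = \<one>")
    case False
    then obtain k :: nat where "y = x [^] k" using gen(1)[OF xy(1) False] xy(2) by blast
    then show ?thesis using xy(1) nat_pow_Suc2[of x k] by simp
  qed (use that in simp)
  have nofuse: "conjg G t y = y" if t: "t \<in> carrier G" and y: "y \<in> P" "conjg G t y \<in> P" for t y
  proof (cases "y = \<one>")
    case False
    note g = gen[OF y(1) False]
    obtain a :: nat where a: "conjg G t y = y [^] a" using g(1) y(2) by auto
    have it: "conjg G (t [^] i) y = y [^] (a ^ i)" for i :: nat
    proof (induction i)
      case (Suc i)
      have "conjg G (t [^] Suc i) y = conjg G t (conjg G (t [^] i) y)"
        using t g(2) nat_pow_Suc2[of t i] by (simp add: conjg_conjg)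
      also have "\<dots> = (conjg G t y) [^] (a ^ i)" using Suc t g(2) by (simp add: conjg_pow)
      also have "\<dots> = y [^] (a ^ Suc i)" using a g(2) by (simp add: nat_pow_pow)
      finally show ?case .
    qed (use g(2) in simp)
    have "y [^] (a ^ order G) = y [^] (1::nat)"
      using it[of "order G"] pow_order_eq_1[OF t] g(2) by simp
    then have A: "[a ^ order G = 1] (mod p)" using g pow_eq_pow_iff_cong by metis
    have pa: "coprime p a"
    proof (rule ccontr)
      assume "\<not> coprime p a"
      then have "p dvd a" using P(3) prime_imp_coprime by blast
      then have "y [^] a = \<one>" using g pow_eq_id by simp
      then have "y = \<one>" using a t g(2) conjg_inv_conjg(1)[OF t g(2)] by simp
      then show False using False by simp
    qed
    have "\<not> p dvd a" using pa P(3) by (metis coprime_absorb_left not_prime_unit)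
    then have B: "[a ^ (p - 1) = 1] (mod p)" using fermat_theorem[OF P(3)] by simp
    have "[a = 1] (mod p)"
    proof -
      have "Pocklington.ord p a dvd order G" "Pocklington.ord p a dvd p - 1"
        using A B ord_divides by blast+
      then have "Pocklington.ord p a = 1" using cop by (metis coprime_common_divisor_nat coprime_def nat_dvd_1_iff_1)
      then show ?thesis using ord_works[of a p] by simp
    qed
    then have "y [^] a = y [^] (1::nat)" using g pow_eq_pow_iff_cong by metis
    then show ?thesis using a g(2) by simp
  qed (use t in simp)
  have "coprime (card P) (card (rcosets P))" using P(2,3) ndvd by (simp add: prime_imp_coprime)
  then obtain V where V: "V \<in> hom G (G\<lparr>carrier := P\<rparr>)" "card (kernel G (G\<lparr>carrier := P\<rparr>) V) = card (rcosets P)"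
    using burnside_transfer_complement[OF fin P(1) comm nofuse] by blast
  interpret V: group_hom G "G\<lparr>carrier := P\<rparr>" V
    unfolding group_hom_def group_hom_axioms_def using V(1) subgroup_imp_group[OF P(1)] by simp
  have "card (rcosets P) * p = order G" using lagrange[OF P(1)] P(2) by simp
  moreover have "coprime (card (rcosets P)) p" using P(3) ndvd by (simp add: prime_imp_coprime coprime_commute)
  ultimately show ?thesis using V V.normal_kernel by metis
qed

section \<open>Classes of finite groups\<close>

text \<open>Classes of groups contain only groups on the natural numbers; every finite group is moved there.\<close>

lemma ex_nat_copy:
  fixes G (structure)
  assumes "group G" "finite (carrier G)"
  shows "\<exists>(K :: nat monoid) h. group K \<and> finite (carrier K) \<and> h \<in> iso G K"
proof -
  interpret group G by fact
  obtain f where f: "bij_betw f (carrier G) {0..<card (carrier G)}"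
    using ex_bij_betw_finite_nat[OF assms(2)] by blast
  define g where "g = inv_into (carrier G) f"
  have gf: "g (f x) = x" if "x \<in> carrier G" for x
    using f that by (simp add: g_def bij_betw_def)
  define H :: "nat monoid" where
    "H = \<lparr>carrier = f ` carrier G, monoid.mult = \<lambda>a b. f (g a \<otimes> g b), one = f \<one>\<rparr>"
  have hom: "f \<in> hom G H" by (rule homI) (auto simp: H_def gf)
  have "H = H\<lparr>carrier := f ` carrier G, one := f \<one>\<rparr>" by (simp add: H_def)
  then have "group H" using hom_imp_img_group[OF hom] by simp
  moreover have "f \<in> iso G H" using hom f by (auto simp: iso_def H_def bij_betw_def)
  ultimately show ?thesis using assms(2) by (auto simp: H_def)
qed

lemma group_homI: "group G \<Longrightarrow> group H \<Longrightarrow> h \<in> hom G H \<Longrightarrow> group_hom G H h"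
  by (simp add: group_hom_def group_hom_axioms_def)

lemma hom_restrict_sub: "h \<in> hom G H \<Longrightarrow> A \<subseteq> carrier G \<Longrightarrow> h \<in> hom (G\<lparr>carrier := A\<rparr>) H"
  by (auto simp: hom_def)

lemma hom_corestrict: "h \<in> hom G H \<Longrightarrow> h ` carrier G \<subseteq> A \<Longrightarrow> h \<in> hom G (H\<lparr>carrier := A\<rparr>)"
  by (auto simp: hom_def)

lemma hom_comp: "g \<in> hom G H \<Longrightarrow> h \<in> hom H K \<Longrightarrow> (\<lambda>x. h (g x)) \<in> hom G K"
  by (auto simp: hom_def Pi_iff)

lemma (in group) canonical_hom:
  assumes "N \<lhd> G"
  shows "(\<lambda>x. N #> x) \<in> hom G (G Mod N)" "(\<lambda>x. N #> x) ` carrier G = carrier (G Mod N)"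
    "kernel G (G Mod N) (\<lambda>x. N #> x) = N" "group (G Mod N)"
proof -
  interpret N: normal N G by fact
  show "(\<lambda>x. N #> x) \<in> hom G (G Mod N)" by (rule N.r_coset_hom_Mod)
  show "(\<lambda>x. N #> x) ` carrier G = carrier (G Mod N)" by (simp add: carrier_FactGroup)
  show "group (G Mod N)" by (rule N.factorgroup_is_group)
  have "N #> x = N \<longleftrightarrow> x \<in> N" if "x \<in> carrier G" for x
    using coset_join1[OF _ that N.subgroup_axioms] N.rcos_const[OF is_group] by blast
  then have "x \<in> kernel G (G Mod N) (\<lambda>x. N #> x) \<longleftrightarrow> x \<in> carrier G \<and> x \<in> N" for x
    unfolding kernel_def one_FactGroup mem_Collect_eq by metis
  then show "kernel G (G Mod N) (\<lambda>x. N #> x) = N"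
    using N.mem_carrier by (intro Set.set_eqI) metis
qed

text \<open>The homomorphism theorem in the form: \<open>\<chi>\<close> factors through the image of \<open>\<psi>\<close>.\<close>

lemma epi_factor:
  assumes "group A" "group K" "\<psi> \<in> hom A K" "\<chi> \<in> hom A B" "\<chi> ` carrier A = carrier B" "group B"
    and ker: "kernel A K \<psi> \<subseteq> kernel A B \<chi>"
  shows "\<exists>f\<in>hom (K\<lparr>carrier := \<psi> ` carrier A\<rparr>) B. f ` (\<psi> ` carrier A) = carrier B"
proof -
  interpret A: group A by fact
  interpret psi: group_hom A K \<psi> using assms(1-3) by (rule group_homI)
  interpret chi: group_hom A B \<chi> using assms(1,6,4) by (rule group_homI)
  have wd: "\<chi> x = \<chi> y" if xy: "x \<in> carrier A" "y \<in> carrier A" "\<psi> x = \<psi> y" for x y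
  proof -
    have "x \<otimes>\<^bsub>A\<^esub> inv\<^bsub>A\<^esub> y \<in> kernel A K \<psi>" using xy by (simp add: kernel_def)
    then have "x \<otimes>\<^bsub>A\<^esub> inv\<^bsub>A\<^esub> y \<in> kernel A B \<chi>" using ker by blast
    then have "\<chi> (x \<otimes>\<^bsub>A\<^esub> inv\<^bsub>A\<^esub> y) = \<one>\<^bsub>B\<^esub>" unfolding kernel_def by blast
    then have e: "\<chi> x \<otimes>\<^bsub>B\<^esub> inv\<^bsub>B\<^esub> \<chi> y = \<one>\<^bsub>B\<^esub>" using xy(1,2) by simp
    have c: "\<chi> x \<in> carrier B" "\<chi> y \<in> carrier B" using xy by auto
    have "\<chi> x = \<one>\<^bsub>B\<^esub> \<otimes>\<^bsub>B\<^esub> \<chi> y"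
      using chi.H.inv_solve_right'[of "\<one>\<^bsub>B\<^esub>" "\<chi> x" "\<chi> y"] c e by simp
    then show ?thesis using c by simp
  qed
  define f where "f y = \<chi> (SOME x. x \<in> carrier A \<and> \<psi> x = y)" for y
  have f: "f (\<psi> x) = \<chi> x" if "x \<in> carrier A" for x
  proof -
    have "(SOME z. z \<in> carrier A \<and> \<psi> z = \<psi> x) \<in> carrier A \<and> \<psi> (SOME z. z \<in> carrier A \<and> \<psi> z = \<psi> x) = \<psi> x"
      by (rule someI[of _ x]) (simp add: that)
    then show ?thesis using wd that unfolding f_def by blast
  qed
  have "f \<in> hom (K\<lparr>carrier := \<psi> ` carrier A\<rparr>) B"
  proof (rule homI)
    fix x y assume "x \<in> carrier (K\<lparr>carrier := \<psi> ` carrier A\<rparr>)" "y \<in> carrier (K\<lparr>carrier := \<psi> ` carrier A\<rparr>)"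
    then obtain a b where ab: "a \<in> carrier A" "b \<in> carrier A" "x = \<psi> a" "y = \<psi> b" by auto
    have "f (\<psi> (a \<otimes>\<^bsub>A\<^esub> b)) = \<chi> a \<otimes>\<^bsub>B\<^esub> \<chi> b" using f[of "a \<otimes>\<^bsub>A\<^esub> b"] ab by simp
    then show "f (x \<otimes>\<^bsub>K\<lparr>carrier := \<psi> ` carrier A\<rparr>\<^esub> y) = f x \<otimes>\<^bsub>B\<^esub> f y"
      using ab f by simp
  qed (auto simp: f)
  moreover have "f ` (\<psi> ` carrier A) = carrier B"
    using f assms(5) by (simp add: image_image cong: image_cong)
  ultimately show ?thesis by blast
qed

locale hereditary_formation =
  fixes F :: "nat monoid set"
  assumes formation: "formation F" and hereditary: "hereditary F"
begin

lemma class_F: "group_class F"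
  using formation unfolding formation_def by (elim conjE)

lemma mem_group: "K \<in> F \<Longrightarrow> group K" and mem_finite: "K \<in> F \<Longrightarrow> finite (carrier K)"
  using class_F unfolding group_class_def by blast+

lemma in_class_finite: "in_class G F \<Longrightarrow> finite (carrier G)"
  unfolding in_class_def using mem_finite iso_finite by blast

lemma in_class_mem: "K \<in> F \<Longrightarrow> in_class K F"
  unfolding in_class_def using mem_group iso_set_refl[of K] is_isoI by blast

lemma in_class_trivial: "group G \<Longrightarrow> carrier G = {\<one>\<^bsub>G\<^esub>} \<Longrightarrow> in_class G F"
proof -
  assume G: "group G" "carrier G = {\<one>\<^bsub>G\<^esub>}"
  then obtain K :: "nat monoid" and h where K: "group K" "h \<in> iso G K"
    using ex_nat_copy[OF G(1)] by auto
  then have "carrier K = {h \<one>\<^bsub>G\<^esub>}" using G unfolding iso_def bij_betw_def by auto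
  then have "trivial_group K" using group.trivial_group[OF K(1)] by blast
  then have "K \<in> F" using formation unfolding formation_def by blast
  then show "in_class G F" unfolding in_class_def using G K is_isoI by blast
qed

lemma in_class_embed:
  assumes "group A" "in_class B F" "h \<in> hom A B" "inj_on h (carrier A)"
  shows "in_class A F"
proof -
  obtain K t where K: "K \<in> F" "t \<in> iso B K" "group B"
    using assms(2) unfolding in_class_def is_iso_def by blast
  define f where "f x = t (h x)" for x
  have f: "f \<in> hom A K" unfolding f_def using assms(3) K(2) by (auto simp: iso_def intro: hom_comp)
  have inj: "inj_on f (carrier A)"
    unfolding f_def using assms(3,4) K(2)
    by (auto simp: inj_on_def iso_def bij_betw_def hom_def Pi_iff)
  interpret f: group_hom A K f using assms(1) mem_group[OF K(1)] f by (rule group_homI)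
  have "K\<lparr>carrier := f ` carrier A\<rparr> \<in> F"
    using hereditary K(1) f.img_is_subgroup unfolding hereditary_def by blast
  moreover have "f \<in> iso A (K\<lparr>carrier := f ` carrier A\<rparr>)"
    using hom_corestrict[OF f, of "f ` carrier A"] inj by (auto simp: iso_def bij_betw_def)
  ultimately show ?thesis unfolding in_class_def using assms(1) is_isoI by blast
qed

lemma in_class_subgroup:
  assumes "in_class G F" "subgroup H G"
  shows "in_class (G\<lparr>carrier := H\<rparr>) F"
proof (rule in_class_embed[OF _ assms(1)])
  show "group (G\<lparr>carrier := H\<rparr>)" using assms by (simp add: in_class_def group.subgroup_imp_group)
  show "id \<in> hom (G\<lparr>carrier := H\<rparr>) G" using subgroup.subset[OF assms(2)] by (auto simp: hom_def)
qed simp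

text \<open>The definition of a formation speaks of images of \<open>K\<close> modulo its residual, which is trivial for a
  member \<open>K\<close>.\<close>

lemma mem_epi:
  fixes H :: "nat monoid"
  assumes "K \<in> F" "h \<in> hom K H" "h ` carrier K = carrier H" "group H"
  shows "H \<in> F"
proof -
  interpret K: group K using assms(1) by (rule mem_group)
  have iso: "the_elem \<in> iso (K Mod {\<one>\<^bsub>K\<^esub>}) K" by (rule K.trivial_factor_iso)
  then have "K Mod {\<one>\<^bsub>K\<^esub>} \<cong> K" by (rule is_isoI)
  then have "in_class (K Mod {\<one>\<^bsub>K\<^esub>}) F"
    unfolding in_class_def using assms(1) K.canonical_hom(4)[OF K.one_is_normal] by blast
  then have "residual K F \<subseteq> {\<one>\<^bsub>K\<^esub>}" unfolding residual_def using K.one_is_normal by blast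
  moreover have "\<one>\<^bsub>K\<^esub> \<in> residual K F"
    unfolding residual_def by (auto dest!: normal_imp_subgroup intro: subgroup.one_closed)
  ultimately have r: "residual K F = {\<one>\<^bsub>K\<^esub>}" by blast
  have "(\<lambda>x. h (the_elem x)) \<in> hom (K Mod {\<one>\<^bsub>K\<^esub>}) H"
    using iso assms(2) by (auto simp: iso_def intro: hom_comp)
  moreover have "(\<lambda>x. h (the_elem x)) ` carrier (K Mod {\<one>\<^bsub>K\<^esub>}) = carrier H"
  proof -
    have "the_elem ` carrier (K Mod {\<one>\<^bsub>K\<^esub>}) = carrier K" using iso by (simp add: iso_def bij_betw_def)
    then show ?thesis using assms(3) by (metis image_image)
  qed
  ultimately have "epi (K Mod residual K F) H \<noteq> {}" unfolding r epi_def by blast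
  then show ?thesis using formation assms(4) mem_group[OF assms(1)] mem_finite[OF assms(1)]
    unfolding formation_def by blast
qed

lemma in_class_epi:
  assumes "in_class A F" "h \<in> hom A B" "h ` carrier A = carrier B" "group B"
  shows "in_class B F"
proof -
  have "finite (carrier B)" using in_class_finite[OF assms(1)] assms(3) by (metis finite_imageI)
  then obtain H :: "nat monoid" and g where H: "group H" "g \<in> iso B H" using ex_nat_copy assms(4) by blast
  obtain K t where K: "K \<in> F" "t \<in> iso A K" "group A"
    using assms(1) unfolding in_class_def is_iso_def by blast
  define s where "s = inv_into (carrier A) t"
  have s: "s \<in> iso K A" using K(2) group.iso_set_sym[OF K(3)] by (simp add: s_def)
  have "(\<lambda>x. g (h (s x))) \<in> hom K H"
    by (rule hom_comp[OF hom_comp[OF iso_imp_homomorphism[OF s] assms(2)] iso_imp_homomorphism[OF H(2)]])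
  moreover have "(\<lambda>x. g (h (s x))) ` carrier K = carrier H"
  proof -
    have "s ` carrier K = carrier A" "g ` carrier B = carrier H" using s H(2) by (auto simp: iso_def bij_betw_def)
    then show ?thesis using assms(3) by (metis image_image)
  qed
  ultimately have "H \<in> F" using mem_epi[OF K(1)] H(1) by blast
  then show ?thesis unfolding in_class_def using assms(4) H is_isoI by blast
qed

text \<open>A section of \<open>K\<close>: the image of \<open>\<psi>\<close> is a subgroup of \<open>K\<close>, and \<open>B\<close> is a homomorphic image of it.\<close>

lemma in_class_factor:
  assumes "in_class K F" "group A" "\<psi> \<in> hom A K" "\<chi> \<in> hom A B" "\<chi> ` carrier A = carrier B" "group B"
    and "kernel A K \<psi> \<subseteq> kernel A B \<chi>"
  shows "in_class B F"
proof -
  have K: "group K" using assms(1) by (simp add: in_class_def)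
  interpret psi: group_hom A K \<psi> using assms K by (simp add: group_homI)
  obtain f where "f \<in> hom (K\<lparr>carrier := \<psi> ` carrier A\<rparr>) B" "f ` (\<psi> ` carrier A) = carrier B"
    using epi_factor[OF assms(2) K assms(3-7)] by blast
  then show ?thesis
    using in_class_epi[OF in_class_subgroup[OF assms(1) psi.img_is_subgroup]] assms(6) by simp
qed

lemma in_class_kernel_quotient:
  assumes "in_class K F" "group A" "\<psi> \<in> hom A K" "N \<lhd> A" "kernel A K \<psi> \<subseteq> N"
  shows "in_class (A Mod N) F"
  using in_class_factor[OF assms(1-3) group.canonical_hom(1,2)[OF assms(2,4)]]
    group.canonical_hom(3,4)[OF assms(2,4)] assms(5) by simp

section \<open>\<open>K\<close>-\<open>F\<close>-subnormal subgroups\<close>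

text \<open>The condition that \<open>B\<close> modulo the core of \<open>A\<close> belongs to \<open>F\<close> is phrased with a homomorphism into a
  member of \<open>F\<close>, since homomorphisms can be composed and restricted, whereas cores change in a complicated way.
  A chain of subgroups becomes an element of a reflexive transitive closure, which gives access to induction
  along the chain.\<close>

definition embeds_above :: "('a, 'b) monoid_scheme \<Rightarrow> 'a set \<Rightarrow> bool" where
  "embeds_above B A \<longleftrightarrow> (\<exists>K\<in>F. \<exists>\<phi>\<in>hom B K. kernel B K \<phi> \<subseteq> A)"

definition Kstep :: "('a, 'b) monoid_scheme \<Rightarrow> 'a set \<Rightarrow> 'a set \<Rightarrow> bool" where
  "Kstep G A B \<longleftrightarrow> subgroup A (G\<lparr>carrier := B\<rparr>) \<and>
     (A \<lhd> G\<lparr>carrier := B\<rparr> \<or> embeds_above (G\<lparr>carrier := B\<rparr>) A)"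

lemma embeds_aboveI:
  assumes "in_class L F" "\<phi> \<in> hom B L" "kernel B L \<phi> \<subseteq> A"
  shows "embeds_above B A"
proof -
  obtain K t where K: "K \<in> F" "t \<in> iso L K" "group L"
    using assms(1) unfolding in_class_def is_iso_def by blast
  interpret t: group_hom L K t using K mem_group[OF K(1)] by (simp add: group_homI iso_def)
  have "(\<lambda>x. t (\<phi> x)) \<in> hom B K" using hom_comp[OF assms(2) t.homh] .
  moreover have "kernel B K (\<lambda>x. t (\<phi> x)) \<subseteq> kernel B L \<phi>"
  proof
    fix x assume x: "x \<in> kernel B K (\<lambda>x. t (\<phi> x))"
    then have "t (\<phi> x) = t \<one>\<^bsub>L\<^esub>" "\<phi> x \<in> carrier L"
      using assms(2) t.hom_one by (auto simp: kernel_def hom_def)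
    then have "\<phi> x = \<one>\<^bsub>L\<^esub>" using K(2) t.G.one_closed unfolding iso_def bij_betw_def inj_on_def by blast
    then show "x \<in> kernel B L \<phi>" using x by (simp add: kernel_def)
  qed
  ultimately show ?thesis unfolding embeds_above_def using K(1) assms(3) by blast
qed

lemma embeds_above_iff_core:
  assumes "group B" "subgroup A B"
  shows "embeds_above B A \<longleftrightarrow> in_class (B Mod normal_core B A) F"
proof
  note core = normal_core_greatest[OF assms]
  assume "embeds_above B A"
  then obtain K \<phi> where K: "K \<in> F" "\<phi> \<in> hom B K" "kernel B K \<phi> \<subseteq> A" unfolding embeds_above_def by blast
  interpret phi: group_hom B K \<phi> using assms(1) mem_group[OF K(1)] K(2) by (rule group_homI)
  show "in_class (B Mod normal_core B A) F"
    using in_class_kernel_quotient[OF in_class_mem[OF K(1)] assms(1) K(2) core(1) core(3)[OF phi.normal_kernel K(3)]] .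
next
  note core = normal_core_greatest[OF assms]
  assume "in_class (B Mod normal_core B A) F"
  then show "embeds_above B A"
    using embeds_aboveI group.canonical_hom(1,3)[OF assms(1) core(1)] core(2) by metis
qed

lemma Kstep_rtranclp_subgroup:
  assumes "group G" "(Kstep G)\<^sup>*\<^sup>* A (carrier G)"
  shows "subgroup A G"
  using assms(2)
proof (induction rule: converse_rtranclp_induct)
  case base
  show ?case using assms(1) by (rule group.subgroup_self)
next
  case (step A B)
  then show ?case using group.incl_subgroup[OF assms(1), of B A] unfolding Kstep_def by blast
qed

lemma K_subnormal_iff:
  assumes G: "group G"
  shows "K_subnormal F A G \<longleftrightarrow> (Kstep G)\<^sup>*\<^sup>* A (carrier G)"
proof
  interpret group G by fact
  assume "K_subnormal F A G"
  then obtain n C where C: "C 0 = A" "C n = carrier G" "\<And>i. i \<le> n \<Longrightarrow> subgroup (C i) G"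
      "\<And>i. i < n \<Longrightarrow> C i \<subseteq> C (Suc i)"
      "\<And>i. i < n \<Longrightarrow> C i \<lhd> G\<lparr>carrier := C (Suc i)\<rparr> \<or>
        in_class (G\<lparr>carrier := C (Suc i)\<rparr> Mod normal_core (G\<lparr>carrier := C (Suc i)\<rparr>) (C i)) F"
    unfolding K_subnormal_def by blast
  have step: "Kstep G (C i) (C (Suc i))" if "i < n" for i
  proof -
    have s: "subgroup (C i) (G\<lparr>carrier := C (Suc i)\<rparr>)"
      using C(3)[of i] C(3)[of "Suc i"] C(4)[OF that] that by (simp add: subgroup_in)
    moreover have "group (G\<lparr>carrier := C (Suc i)\<rparr>)" using C(3)[of "Suc i"] that subgroup_imp_group by simp
    ultimately show ?thesis unfolding Kstep_def using embeds_above_iff_core C(5)[OF that] by blast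
  qed
  have "i \<le> n \<Longrightarrow> (Kstep G)\<^sup>*\<^sup>* (C 0) (C i)" for i
  proof (induction i)
    case (Suc i)
    then show ?case using step[of i] by (simp add: rtranclp.rtrancl_into_rtrancl)
  qed simp
  from this[of n] show "(Kstep G)\<^sup>*\<^sup>* A (carrier G)" using C(1,2) by simp
next
  interpret group G by fact
  assume "(Kstep G)\<^sup>*\<^sup>* A (carrier G)"
  then show "K_subnormal F A G"
  proof (induction rule: converse_rtranclp_induct)
    case base
    show ?case unfolding K_subnormal_def by (intro exI[of _ 0] exI[of _ "\<lambda>_. carrier G"]) (simp add: subgroup_self)
  next
    case (step A B)
    obtain n C where C: "C 0 = B" "C n = carrier G" "\<And>i. i \<le> n \<Longrightarrow> subgroup (C i) G"
      "\<And>i. i < n \<Longrightarrow> C i \<subseteq> C (Suc i)"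
      "\<And>i. i < n \<Longrightarrow> C i \<lhd> G\<lparr>carrier := C (Suc i)\<rparr> \<or>
        in_class (G\<lparr>carrier := C (Suc i)\<rparr> Mod normal_core (G\<lparr>carrier := C (Suc i)\<rparr>) (C i)) F"
      using step.IH unfolding K_subnormal_def by blast
    have B: "subgroup B G" using Kstep_rtranclp_subgroup[OF G step.hyps(2)] .
    have A: "subgroup A G" "A \<subseteq> B" using step.hyps(1) B unfolding Kstep_def by (auto simp: subgroup_in)
    have link: "A \<lhd> G\<lparr>carrier := B\<rparr> \<or> in_class (G\<lparr>carrier := B\<rparr> Mod normal_core (G\<lparr>carrier := B\<rparr>) A) F"
      using step.hyps(1) embeds_above_iff_core[OF subgroup_imp_group[OF B]] unfolding Kstep_def by blast
    define D where "D i = (case i of 0 \<Rightarrow> A | Suc j \<Rightarrow> C j)" for i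
    have "D 0 = A" "D (Suc n) = carrier G" using C by (simp_all add: D_def)
    moreover have "subgroup (D i) G" if "i \<le> Suc n" for i using that A C(3) by (cases i) (auto simp: D_def)
    moreover have "D i \<subseteq> D (Suc i) \<and> (D i \<lhd> G\<lparr>carrier := D (Suc i)\<rparr> \<or>
        in_class (G\<lparr>carrier := D (Suc i)\<rparr> Mod normal_core (G\<lparr>carrier := D (Suc i)\<rparr>) (D i)) F)"
      if "i < Suc n" for i
      using that A C(1) C(4,5) link by (cases i) (auto simp: D_def)
    ultimately show ?case unfolding K_subnormal_def by blast
  qed
qed

lemma K_subnormal_subgroup: "group G \<Longrightarrow> K_subnormal F A G \<Longrightarrow> subgroup A G"
  using Kstep_rtranclp_subgroup K_subnormal_iff by blast

lemma K_subnormal_trans: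
  assumes G: "group G" and B: "K_subnormal F B G" and A: "K_subnormal F A (G\<lparr>carrier := B\<rparr>)"
  shows "K_subnormal F A G"
proof -
  have s: "subgroup B G" using K_subnormal_subgroup[OF G B] .
  have "Kstep (G\<lparr>carrier := B\<rparr>) = Kstep G" unfolding Kstep_def by (simp add: fun_eq_iff)
  then show ?thesis
    using A B unfolding K_subnormal_iff[OF G] K_subnormal_iff[OF group.subgroup_imp_group[OF G s]] by simp
qed

lemma K_subnormal_link:
  assumes G: "group G" and "subgroup A G" "A \<lhd> G \<or> embeds_above G A"
  shows "K_subnormal F A G"
proof -
  have "Kstep G A (carrier G)" using assms unfolding Kstep_def by simp
  then show ?thesis unfolding K_subnormal_iff[OF G] by blast
qed

lemma K_subnormal_self: "group G \<Longrightarrow> K_subnormal F (carrier G) G"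
  using K_subnormal_link group.subgroup_self group.normal_self by blast

text \<open>Preimages under arbitrary homomorphisms cover restriction to a subgroup, lifting from a
  quotient, and transport along isomorphisms.\<close>

lemma K_subnormal_preimage:
  assumes G: "group G" and H: "group H" and h: "h \<in> hom G H" and A: "K_subnormal F A H"
  shows "K_subnormal F {x \<in> carrier G. h x \<in> A} G"
proof -
  interpret h: group_hom G H h using assms by (simp add: group_homI)
  define pre where "pre X = {x \<in> carrier G. h x \<in> X}" for X
  have pre_sub: "subgroup (pre X) G" if X: "subgroup X H" for X
  proof -
    interpret X: subgroup X H by fact
    show ?thesis
    proof (rule h.G.subgroupI)
      have "\<one>\<^bsub>G\<^esub> \<in> pre X" using X.one_closed by (simp add: pre_def)
      then show "pre X \<noteq> {}" by blast
    qed (auto simp: pre_def)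
  qed
  have "(Kstep H)\<^sup>*\<^sup>* A (carrier H)" using A K_subnormal_iff[OF H] by simp
  then have "(Kstep G)\<^sup>*\<^sup>* (pre A) (carrier G)"
  proof (induction rule: converse_rtranclp_induct)
    case base
    have "pre (carrier H) = carrier G" by (auto simp: pre_def)
    then show ?case by simp
  next
    case (step A B)
    have B: "subgroup B H" using Kstep_rtranclp_subgroup[OF H step.hyps(2)] .
    have A: "subgroup A H" "A \<subseteq> B" using step.hyps(1) B unfolding Kstep_def by (auto simp: h.H.subgroup_in)
    have preAB: "subgroup (pre A) (G\<lparr>carrier := pre B\<rparr>)"
      using pre_sub A B by (auto simp: h.G.subgroup_in pre_def)
    have "Kstep G (pre A) (pre B)"
      using step.hyps(1) unfolding Kstep_def
    proof (elim conjE disjE)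
      assume "A \<lhd> H\<lparr>carrier := B\<rparr>"
      then have "conjg H b a \<in> A" if "b \<in> B" "a \<in> A" for a b using that h.H.normal_in[OF B] by blast
      moreover have "h (conjg G b a) = conjg H (h b) (h a)" if "b \<in> carrier G" "a \<in> carrier G" for a b
        using that by (simp add: conjg_def)
      ultimately have "pre A \<lhd> G\<lparr>carrier := pre B\<rparr>"
        using pre_sub A B by (auto simp: h.G.normal_in pre_def)
      then show "subgroup (pre A) (G\<lparr>carrier := pre B\<rparr>) \<and>
        (pre A \<lhd> G\<lparr>carrier := pre B\<rparr> \<or> embeds_above (G\<lparr>carrier := pre B\<rparr>) (pre A))" using preAB by blast
    next
      assume "embeds_above (H\<lparr>carrier := B\<rparr>) A"
      then obtain K \<phi> where K: "K \<in> F" "\<phi> \<in> hom (H\<lparr>carrier := B\<rparr>) K" "kernel (H\<lparr>carrier := B\<rparr>) K \<phi> \<subseteq> A"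
        unfolding embeds_above_def by blast
      have "h \<in> hom (G\<lparr>carrier := pre B\<rparr>) (H\<lparr>carrier := B\<rparr>)"
        using h by (auto simp: hom_def pre_def)
      then have "(\<lambda>x. \<phi> (h x)) \<in> hom (G\<lparr>carrier := pre B\<rparr>) K" using K(2) by (rule hom_comp)
      moreover have "kernel (G\<lparr>carrier := pre B\<rparr>) K (\<lambda>x. \<phi> (h x)) \<subseteq> pre A"
        using K(3) by (auto simp: kernel_def pre_def)
      ultimately have "embeds_above (G\<lparr>carrier := pre B\<rparr>) (pre A)" unfolding embeds_above_def using K(1) by blast
      then show "subgroup (pre A) (G\<lparr>carrier := pre B\<rparr>) \<and>
        (pre A \<lhd> G\<lparr>carrier := pre B\<rparr> \<or> embeds_above (G\<lparr>carrier := pre B\<rparr>) (pre A))" using preAB by blast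
    qed
    then show ?case using step.IH by (rule converse_rtranclp_into_rtranclp)
  qed
  then show ?thesis unfolding K_subnormal_iff[OF G] pre_def .
qed

lemma K_subnormal_in_subgroup:
  assumes "group G" "K_subnormal F A G" "subgroup H G"
  shows "K_subnormal F (A \<inter> H) (G\<lparr>carrier := H\<rparr>)"
proof -
  have "id \<in> hom (G\<lparr>carrier := H\<rparr>) G" using subgroup.subset[OF assms(3)] by (auto simp: hom_def)
  then have "K_subnormal F {x \<in> carrier (G\<lparr>carrier := H\<rparr>). id x \<in> A} (G\<lparr>carrier := H\<rparr>)"
    using assms group.subgroup_imp_group[OF assms(1,3)] by (intro K_subnormal_preimage[of _ G])
  then show ?thesis by (simp add: Int_def conj_commute)
qed

lemma K_subnormal_Int:
  assumes "group G" "K_subnormal F A G" "K_subnormal F B G"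
  shows "K_subnormal F (A \<inter> B) G"
  using K_subnormal_trans[OF assms(1,3)] K_subnormal_in_subgroup[OF assms(1,2)]
    K_subnormal_subgroup[OF assms(1,3)] by blast

text \<open>The carrier takes part in the intersection because the family of subgroups may be empty.\<close>

lemma K_subnormal_INT:
  assumes "group G" "finite I" "\<And>i. i \<in> I \<Longrightarrow> K_subnormal F (A i) G"
  shows "K_subnormal F (carrier G \<inter> (\<Inter>i\<in>I. A i)) G"
  using assms(2,3)
proof (induction I rule: finite_induct)
  case empty
  then show ?case using K_subnormal_self[OF assms(1)] by simp
next
  case (insert i I)
  then have "K_subnormal F (A i \<inter> (carrier G \<inter> (\<Inter>i\<in>I. A i))) G"
    using K_subnormal_Int[OF assms(1)] by simp
  moreover have "A i \<inter> (carrier G \<inter> (\<Inter>i\<in>I. A i)) = carrier G \<inter> (\<Inter>j\<in>insert i I. A j)" by auto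
  ultimately show ?case by simp
qed

text \<open>If \<open>N \<le> A\<close> is the kernel of a homomorphism from \<open>B\<close> to a member of \<open>F\<close>, then \<open>h B\<close> modulo \<open>h N\<close> is an image of \<open>B/N\<close> and
  so belongs to \<open>F\<close>.\<close>

lemma K_subnormal_image:
  assumes G: "group G" and H: "group H" and h: "h \<in> hom G H" "h ` carrier G = carrier H"
    and A: "K_subnormal F A G"
  shows "K_subnormal F (h ` A) H"
proof -
  interpret h: group_hom G H h using assms by (simp add: group_homI)
  have im_sub: "subgroup (h ` X) H" if X: "subgroup X G" for X
    using h.subgroup_img_is_subgroup[OF X] .
  have "(Kstep G)\<^sup>*\<^sup>* A (carrier G)" using A K_subnormal_iff[OF G] by simp
  then have "(Kstep H)\<^sup>*\<^sup>* (h ` A) (carrier H)"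
  proof (induction rule: converse_rtranclp_induct)
    case base
    show ?case using h(2) by simp
  next
    case (step A B)
    have B: "subgroup B G" using Kstep_rtranclp_subgroup[OF G step.hyps(2)] .
    have A: "subgroup A G" "A \<subseteq> B" using step.hyps(1) B unfolding Kstep_def by (auto simp: h.G.subgroup_in)
    have BG: "B \<subseteq> carrier G" using subgroup.subset[OF B] .
    have imAB: "subgroup (h ` A) (H\<lparr>carrier := h ` B\<rparr>)"
      using im_sub A B by (auto simp: h.H.subgroup_in)
    have hc: "conjg H (h b) (h a) = h (conjg G b a)" if "b \<in> B" "a \<in> B" for a b
      using that BG by (simp add: conjg_def subset_iff)
    have nrm: "h ` N \<lhd> H\<lparr>carrier := h ` B\<rparr>" if N: "N \<lhd> G\<lparr>carrier := B\<rparr>" for N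
    proof -
      have "subgroup N G" "N \<subseteq> B" "\<And>b a. b \<in> B \<Longrightarrow> a \<in> N \<Longrightarrow> conjg G b a \<in> N"
        using N h.G.normal_in[OF B] by auto
      then show ?thesis unfolding h.H.normal_in[OF im_sub[OF B]] using im_sub hc by (auto simp: subset_iff)
    qed
    have "Kstep H (h ` A) (h ` B)"
      using step.hyps(1) unfolding Kstep_def
    proof (elim conjE disjE)
      assume "A \<lhd> G\<lparr>carrier := B\<rparr>"
      then show "subgroup (h ` A) (H\<lparr>carrier := h ` B\<rparr>) \<and>
        (h ` A \<lhd> H\<lparr>carrier := h ` B\<rparr> \<or> embeds_above (H\<lparr>carrier := h ` B\<rparr>) (h ` A))" using imAB nrm by blast
    next
      assume "embeds_above (G\<lparr>carrier := B\<rparr>) A"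
      then obtain K \<phi> where K: "K \<in> F" "\<phi> \<in> hom (G\<lparr>carrier := B\<rparr>) K" "kernel (G\<lparr>carrier := B\<rparr>) K \<phi> \<subseteq> A"
        unfolding embeds_above_def by blast
      define N where "N = kernel (G\<lparr>carrier := B\<rparr>) K \<phi>"
      have gB: "group (G\<lparr>carrier := B\<rparr>)" and ghB: "group (H\<lparr>carrier := h ` B\<rparr>)"
        using h.G.subgroup_imp_group[OF B] h.H.subgroup_imp_group[OF im_sub[OF B]] by auto
      interpret phi: group_hom "G\<lparr>carrier := B\<rparr>" K \<phi> using gB mem_group[OF K(1)] K(2) by (rule group_homI)
      have N: "h ` N \<lhd> H\<lparr>carrier := h ` B\<rparr>" unfolding N_def by (rule nrm[OF phi.normal_kernel])
      let ?c = "\<lambda>x. (h ` N) #>\<^bsub>H\<lparr>carrier := h ` B\<rparr>\<^esub> x" and ?Q = "H\<lparr>carrier := h ` B\<rparr> Mod h ` N"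
      note can = group.canonical_hom[OF ghB N]
      have hB: "h \<in> hom (G\<lparr>carrier := B\<rparr>) (H\<lparr>carrier := h ` B\<rparr>)"
        using h(1) BG by (auto simp: hom_def subset_iff)
      have chi: "(\<lambda>x. ?c (h x)) \<in> hom (G\<lparr>carrier := B\<rparr>) ?Q" using hom_comp[OF hB can(1)] .
      have surj: "(\<lambda>x. ?c (h x)) ` carrier (G\<lparr>carrier := B\<rparr>) = carrier ?Q"
      proof -
        have "(\<lambda>x. ?c (h x)) ` B = ?c ` (h ` B)" by (simp only: image_image)
        then show ?thesis using can(2) by simp
      qed
      have ker: "N \<subseteq> kernel (G\<lparr>carrier := B\<rparr>) ?Q (\<lambda>x. ?c (h x))"
      proof
        fix x assume x: "x \<in> N"
        then have "x \<in> B" by (auto simp: N_def kernel_def)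
        have "h x \<in> kernel (H\<lparr>carrier := h ` B\<rparr>) ?Q ?c" using x can(3) by simp
        then have "?c (h x) = \<one>\<^bsub>?Q\<^esub>" unfolding kernel_def by blast
        then show "x \<in> kernel (G\<lparr>carrier := B\<rparr>) ?Q (\<lambda>x. ?c (h x))" using \<open>x \<in> B\<close> by (simp add: kernel_def)
      qed
      have "in_class ?Q F"
        using in_class_factor[OF in_class_mem[OF K(1)] gB K(2) chi surj can(4)] ker by (simp add: N_def)
      then have "embeds_above (H\<lparr>carrier := h ` B\<rparr>) (h ` A)"
        using embeds_aboveI[OF _ can(1)] can(3) K(3) by (simp add: N_def image_mono)
      then show "subgroup (h ` A) (H\<lparr>carrier := h ` B\<rparr>) \<and>
        (h ` A \<lhd> H\<lparr>carrier := h ` B\<rparr> \<or> embeds_above (H\<lparr>carrier := h ` B\<rparr>) (h ` A))" using imAB by blast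
    qed
    then show ?case using step.IH by (rule converse_rtranclp_into_rtranclp)
  qed
  then show ?thesis unfolding K_subnormal_iff[OF H] .
qed

end

section \<open>Nilpotent groups\<close>

lemma (in group_hom) preimage_subgroup:
  assumes "subgroup X H"
  shows "subgroup {x \<in> carrier G. h x \<in> X} G"
proof -
  interpret X: subgroup X H by fact
  show ?thesis
  proof (rule G.subgroupI)
    have "\<one> \<in> {x \<in> carrier G. h x \<in> X}" using X.one_closed by simp
    then show "{x \<in> carrier G. h x \<in> X} \<noteq> {}" by blast
  qed auto
qed

lemma (in group_hom) hom_conjg:
  "g \<in> carrier G \<Longrightarrow> x \<in> carrier G \<Longrightarrow> h (conjg G g x) = conjg H (h g) (h x)"
  by (simp add: conjg_def)

lemma (in group_hom) preimage_normal:
  assumes "X \<lhd> H"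
  shows "{x \<in> carrier G. h x \<in> X} \<lhd> G"
  using assms preimage_subgroup[of X] unfolding G.normal_iff H.normal_iff by (simp add: hom_conjg)

lemma (in group_hom) preimage_maximal:
  assumes surj: "h ` carrier G = carrier H" and M: "maximal_subgroup M H"
  shows "maximal_subgroup {x \<in> carrier G. h x \<in> M} G"
proof -
  define P where "P = {x \<in> carrier G. h x \<in> M}"
  have MH: "subgroup M H" "M \<noteq> carrier H" using M by (auto simp: maximal_subgroup_def)
  have "P \<noteq> carrier G"
  proof
    assume "P = carrier G"
    then have "h ` carrier G \<subseteq> M" by (auto simp: P_def)
    then show False using surj MH subgroup.subset[OF MH(1)] by simp
  qed
  moreover have "X = P \<or> X = carrier G" if X: "subgroup X G" "P \<subseteq> X" for X
  proof -
    have ker: "kernel G H h \<subseteq> X" using X(2) subgroup.one_closed[OF MH(1)] by (auto simp: P_def kernel_def)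
    have "M \<subseteq> h ` X"
    proof
      fix y assume y: "y \<in> M"
      then obtain x where "x \<in> carrier G" "h x = y" using surj subgroup.mem_carrier[OF MH(1) y] by (metis imageE)
      then show "y \<in> h ` X" using y X(2) by (auto simp: P_def)
    qed
    then have "h ` X = M \<or> h ` X = carrier H"
      using M subgroup_img_is_subgroup[OF X(1)] unfolding maximal_subgroup_def by blast
    then show ?thesis
    proof
      assume "h ` X = M"
      then have "X \<subseteq> P" using subgroup.subset[OF X(1)] by (auto simp: P_def)
      then show ?thesis using X(2) by blast
    next
      assume hX: "h ` X = carrier H"
      have "g \<in> X" if g: "g \<in> carrier G" for g
      proof -
        obtain x where x: "x \<in> X" "h x = h g" using hX g by (metis hom_closed imageE)
        have xc: "x \<in> carrier G" using subgroup.mem_carrier[OF X(1) x(1)] .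
        have "g \<otimes> inv x \<in> kernel G H h" using x(2) g xc by (simp add: kernel_def)
        then have "g \<otimes> inv x \<otimes> x \<in> X" using ker x(1) subgroup.m_closed[OF X(1)] by blast
        then show ?thesis using g xc by (simp add: G.m_assoc)
      qed
      then show ?thesis using subgroup.subset[OF X(1)] by blast
    qed
  qed
  ultimately show ?thesis using preimage_subgroup[OF MH(1)] unfolding maximal_subgroup_def P_def by blast
qed

lemma (in group) one_in_lower_central: "\<one> \<in> lower_central_series G n"
  by (cases n) (auto intro: generate.one)

lemma (in group) lower_central_subset: "lower_central_series G n \<subseteq> carrier G"
proof (induction n)
  case (Suc n)
  then show ?case by (auto intro!: generate_incl)
qed simp

lemma (in group) lower_central_Suc_subset:
  assumes "subgroup N G" "lower_central_series G n \<subseteq> A"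
    and "\<And>x y. x \<in> A \<Longrightarrow> y \<in> carrier G \<Longrightarrow> x \<otimes> y \<otimes> inv x \<otimes> inv y \<in> N"
  shows "lower_central_series G (Suc n) \<subseteq> N"
  unfolding lower_central_series.simps using assms by (intro generate_subgroup_incl) auto

lemma (in group) comm_group_nilpotent:
  assumes "\<And>x y. x \<in> carrier G \<Longrightarrow> y \<in> carrier G \<Longrightarrow> x \<otimes> y = y \<otimes> x"
  shows "nilpotent_group G"
proof -
  have c: "x \<otimes> y \<otimes> inv x \<otimes> inv y \<in> {\<one>}" if xy: "x \<in> carrier G" "y \<in> carrier G" for x y
  proof -
    have "x \<otimes> y \<otimes> inv x \<otimes> inv y = y \<otimes> x \<otimes> inv x \<otimes> inv y" using assms[OF xy] by simp
    then show ?thesis using xy by (simp add: word_simps)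
  qed
  have "lower_central_series G (Suc 0) \<subseteq> {\<one>}"
    by (rule lower_central_Suc_subset[OF triv_subgroup _ c]) auto
  then have "lower_central_series G (Suc 0) = {\<one>}" using one_in_lower_central[of "Suc 0"] by blast
  then show ?thesis unfolding nilpotent_group_def using is_group by blast
qed

text \<open>By downward induction on the order, the lower central series reaches every normal subgroup \<open>N\<close>: it
  reaches the preimage of the centre of \<open>G/N\<close>, which is larger than \<open>N\<close>, and the next term lies in \<open>N\<close>.\<close>

lemma (in group) p_group_nilpotent:
  assumes fin: "finite (carrier G)" and p: "order G = p ^ k" "Factorial_Ring.prime p"
  shows "nilpotent_group G"
proof -
  have "\<exists>n. lower_central_series G n \<subseteq> N" if "N \<lhd> G" for N
    using that
  proof (induction "order G - card N" arbitrary: N rule: less_induct)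
    case less
    show ?case
    proof (cases "N = carrier G")
      case True
      have "lower_central_series G 0 \<subseteq> N" using True by simp
      then show ?thesis by blast
    next
      case False
      interpret N: normal N G by fact
      define Q where "Q = G Mod N"
      note can = canonical_hom[OF less.prems, folded Q_def]
      interpret can: group_hom G Q "\<lambda>x. N #> x" using is_group can(4,1) by (rule group_homI)
      have finQ: "finite (carrier Q)" using can(2) fin by (metis finite_imageI)
      have "order G = card N * order Q"
        using can.order_eq_card_kernel_mult_card_image can(2,3) by (simp add: order_def)
      then have "order Q dvd p ^ k" using p(1) by (metis dvd_triv_right)
      then obtain j where j: "order Q = p ^ j" using p(2) by (meson divides_primepow_nat)
      have "carrier Q \<noteq> {\<one>\<^bsub>Q\<^esub>}"
      proof
        assume Q1: "carrier Q = {\<one>\<^bsub>Q\<^esub>}"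
        have "x \<in> N" if "x \<in> carrier G" for x
        proof -
          have "N #> x = \<one>\<^bsub>Q\<^esub>" using Q1 can.hom_closed[OF that] by blast
          then have "x \<in> kernel G Q (\<lambda>x. N #> x)" using that by (simp add: kernel_def)
          then show ?thesis using can(3) by simp
        qed
        then show False using False N.subset by blast
      qed
      then have "centre Q \<noteq> {\<one>\<^bsub>Q\<^esub>}"
        using group.p_group_centre_nontrivial[OF can(4) finQ j p(2)] by blast
      moreover have "\<one>\<^bsub>Q\<^esub> \<in> centre Q"
        using group.centre_normal[OF can(4)] normal_imp_subgroup subgroup.one_closed by blast
      ultimately obtain z where z: "z \<in> centre Q" "z \<noteq> \<one>\<^bsub>Q\<^esub>" by blast
      then have "z \<in> carrier Q" by (simp add: centre_def)
      then obtain x where x: "x \<in> carrier G" "N #> x = z" using can(2) by (metis imageE)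
      define N' where "N' = {x \<in> carrier G. N #> x \<in> centre Q}"
      have N': "N' \<lhd> G" unfolding N'_def by (rule can.preimage_normal[OF group.centre_normal[OF can(4)]])
      have "N \<subseteq> N'"
      proof
        fix y assume y: "y \<in> N"
        then have "y \<in> kernel G Q (\<lambda>x. N #> x)" using can(3) by simp
        then have "y \<in> carrier G" "N #> y = \<one>\<^bsub>Q\<^esub>" by (auto simp: kernel_def)
        then show "y \<in> N'" using \<open>\<one>\<^bsub>Q\<^esub> \<in> centre Q\<close> by (simp add: N'_def)
      qed
      moreover have "x \<in> N'" using x z by (simp add: N'_def)
      moreover have "x \<notin> N"
      proof
        assume "x \<in> N"
        then have "x \<in> kernel G Q (\<lambda>x. N #> x)" using can(3) by simp
        then show False using x z by (simp add: kernel_def)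
      qed
      ultimately have "N \<subset> N'" by blast
      moreover have sub: "N' \<subseteq> carrier G" by (auto simp: N'_def)
      ultimately have "card N < card N'" "card N' \<le> order G"
        using fin by (auto intro!: psubset_card_mono card_mono simp: order_def dest: finite_subset)
      then have "order G - card N' < order G - card N" by linarith
      then obtain n where n: "lower_central_series G n \<subseteq> N'" using less.hyps[OF _ N'] by blast
      have "a \<otimes> b \<otimes> inv a \<otimes> inv b \<in> N" if ab: "a \<in> N'" "b \<in> carrier G" for a b
      proof -
        have ac: "a \<in> carrier G" "N #> a \<in> centre Q" using ab by (auto simp: N'_def)
        have "conjg Q (N #> b) (N #> a) = N #> a"
          using ac(2) can.hom_closed[OF ab(2)] by (simp add: centre_def)
        then have e: "N #> (conjg G b a) = N #> a" using can.hom_conjg[OF ab(2) ac(1)] by simp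
        have "N #> (a \<otimes> inv (conjg G b a)) = (N #> a) \<otimes>\<^bsub>Q\<^esub> inv\<^bsub>Q\<^esub> (N #> a)"
          using can.hom_mult[of a "inv (conjg G b a)"] can.hom_inv[of "conjg G b a"] ac ab(2) e by simp
        also have "\<dots> = \<one>\<^bsub>Q\<^esub>" using can.hom_closed[OF ac(1)] by simp
        finally have "a \<otimes> inv (conjg G b a) \<in> kernel G Q (\<lambda>x. N #> x)" using ac ab(2) by (simp add: kernel_def)
        moreover have "a \<otimes> inv (conjg G b a) = a \<otimes> b \<otimes> inv a \<otimes> inv b"
          using ac ab(2) by (simp add: conjg_def word_simps)
        ultimately show ?thesis using can(3) by simp
      qed
      then have "lower_central_series G (Suc n) \<subseteq> N"
        using lower_central_Suc_subset[OF N.subgroup_axioms n] by blast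
      then show ?thesis by blast
    qed
  qed
  from this[OF one_is_normal] obtain n where "lower_central_series G n \<subseteq> {\<one>}" by blast
  then have "lower_central_series G n = {\<one>}" using one_in_lower_central by blast
  then show ?thesis unfolding nilpotent_group_def using is_group by blast
qed

text \<open>The last term of the lower central series not contained in \<open>M\<close> normalises \<open>M\<close>.\<close>

lemma (in group) nilpotent_maximal_normal:
  assumes "nilpotent_group G" and M: "maximal_subgroup M G"
  shows "M \<lhd> G"
proof (rule ccontr)
  assume nM: "\<not> M \<lhd> G"
  have MG: "subgroup M G" "M \<noteq> carrier G" using M by (auto simp: maximal_subgroup_def)
  interpret M: subgroup M G by fact
  obtain n where n: "lower_central_series G n = {\<one>}" using assms(1) unfolding nilpotent_group_def by blast
  then have ex: "\<exists>i. lower_central_series G i \<subseteq> M" using M.one_closed by (intro exI[of _ n]) simp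
  define i where "i = (LEAST i. lower_central_series G i \<subseteq> M)"
  have i: "lower_central_series G i \<subseteq> M" unfolding i_def by (rule LeastI_ex[OF ex])
  have "i \<noteq> 0"
  proof
    assume "i = 0"
    then show False using i MG(2) M.subset by simp
  qed
  then obtain j where j: "i = Suc j" by (cases i) auto
  have "\<not> lower_central_series G j \<subseteq> M" using not_less_Least[of j "\<lambda>i. lower_central_series G i \<subseteq> M"] j
    unfolding i_def by simp
  then obtain x where x: "x \<in> lower_central_series G j" "x \<notin> M" by blast
  have xc: "x \<in> carrier G" using x lower_central_subset by blast
  have comm: "a \<otimes> y \<otimes> inv a \<otimes> inv y \<in> M" if "a \<in> lower_central_series G j" "y \<in> carrier G" for a y
    using that i unfolding j lower_central_series.simps by (auto intro: generate.incl)
  have cM: "conjg G a y \<in> M" if "a \<in> lower_central_series G j" "y \<in> M" for a y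
  proof -
    have ac: "a \<in> carrier G" using that(1) lower_central_subset by blast
    have "(a \<otimes> y \<otimes> inv a \<otimes> inv y) \<otimes> y \<in> M" using comm[OF that(1)] that(2) by auto
    then show ?thesis using ac that(2) by (simp add: conjg_def word_simps)
  qed
  have invc: "inv x \<otimes> y \<otimes> x \<otimes> inv y \<in> M" if "y \<in> M" for y
  proof -
    have "x \<otimes> conjg G (inv x) y \<otimes> inv x \<otimes> inv (conjg G (inv x) y) \<in> M"
      using comm[OF x(1)] xc that by simp
    have e: "x \<otimes> conjg G (inv x) y \<otimes> inv x \<otimes> inv (conjg G (inv x) y) = y \<otimes> inv (conjg G (inv x) y)"
      using xc that by (simp add: conjg_def word_simps)
    have "inv (y \<otimes> inv (conjg G (inv x) y)) \<in> M"
      using e \<open>x \<otimes> conjg G (inv x) y \<otimes> inv x \<otimes> inv (conjg G (inv x) y) \<in> M\<close> by simp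
    moreover have "inv (y \<otimes> inv (conjg G (inv x) y)) = inv x \<otimes> y \<otimes> x \<otimes> inv y"
      using xc that by (simp add: conjg_def word_simps)
    ultimately show ?thesis by simp
  qed
  have "conjg G x ` M = M"
  proof
    show "conjg G x ` M \<subseteq> M" using cM[OF x(1)] by blast
    show "M \<subseteq> conjg G x ` M"
    proof
      fix y assume y: "y \<in> M"
      have "inv x \<otimes> y \<otimes> x \<otimes> inv y \<otimes> y \<in> M" using invc[OF y] y by auto
      then have "conjg G (inv x) y \<in> M" using xc y by (simp add: conjg_def word_simps)
      moreover have "y = conjg G x (conjg G (inv x) y)" using xc y by simp
      ultimately show "y \<in> conjg G x ` M" by blast
    qed
  qed
  then have "x \<in> normz G M" using xc by (simp add: normz_def)
  then show False using maximal_not_normal_normz[OF M nM] x(2) by simp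
qed

section \<open>Saturated \<open>K\<close>-lattice formations\<close>

locale lattice_formation = hereditary_formation F for F :: "nat monoid set" +
  assumes saturated: "saturated F" and K_lattice: "K_lattice F" and nilpotent: "contains_all_nilpotent F"
begin

text \<open>The hypothesis on nilpotent groups concerns groups on the natural numbers and is carried over to other
  types by an isomorphism.\<close>

lemma abelian_in_class:
  assumes "group G" "finite (carrier G)"
    "\<And>x y. x \<in> carrier G \<Longrightarrow> y \<in> carrier G \<Longrightarrow> x \<otimes>\<^bsub>G\<^esub> y = y \<otimes>\<^bsub>G\<^esub> x"
  shows "in_class G F"
proof -
  obtain K :: "nat monoid" and h where K: "group K" "finite (carrier K)" "h \<in> iso G K"
    using ex_nat_copy assms(1,2) by blast
  have "comm_group G" by (rule group.group_comm_groupI[OF assms(1,3)])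
  then have "comm_group K" using comm_group.iso_imp_comm_group[of G K] K(1,3) is_isoI group.axioms(1) by blast
  then have "nilpotent_group K"
    using group.comm_group_nilpotent[OF K(1)] comm_groupE(4)[of K] by blast
  then have "K \<in> F" using nilpotent K(2) unfolding contains_all_nilpotent_def by blast
  then show ?thesis unfolding in_class_def using assms(1) K(3) is_isoI by blast
qed

lemma p_group_in_class:
  assumes "group G" "finite (carrier G)" "order G = p ^ n" "Factorial_Ring.prime p"
  shows "in_class G F"
proof -
  obtain K :: "nat monoid" and h where K: "group K" "finite (carrier K)" "h \<in> iso G K"
    using ex_nat_copy assms(1,2) by blast
  have "order K = p ^ n" using assms(3) iso_same_card[OF is_isoI[OF K(3)]] by (simp add: order_def)
  then have "nilpotent_group K" using group.p_group_nilpotent[OF K(1,2)] assms(4) by blast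
  then have "K \<in> F" using nilpotent K(2) unfolding contains_all_nilpotent_def by blast
  then show ?thesis unfolding in_class_def using assms(1) K(3) is_isoI by blast
qed

lemma K_subnormal_join:
  assumes G: "group G" "finite (carrier G)" and "K_subnormal F A G" "K_subnormal F B G"
  shows "K_subnormal F (generate G (A \<union> B)) G"
proof -
  obtain K :: "nat monoid" and h where K: "group K" "finite (carrier K)" "h \<in> iso G K"
    using ex_nat_copy G by blast
  have hom: "h \<in> hom G K" and surj: "h ` carrier G = carrier K" and inj: "inj_on h (carrier G)"
    using K(3) by (auto simp: iso_def bij_betw_def)
  interpret h: group_hom G K h using G(1) K(1) hom by (rule group_homI)
  have AB: "A \<subseteq> carrier G" "B \<subseteq> carrier G"
    using K_subnormal_subgroup[OF G(1)] assms(3,4) subgroup.subset by blast+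
  have "K_subnormal F (generate K (h ` A \<union> h ` B)) K"
    using K_lattice K(1,2) K_subnormal_image[OF G(1) K(1) hom surj] assms(3,4) unfolding K_lattice_def by blast
  moreover have "generate K (h ` A \<union> h ` B) = h ` generate G (A \<union> B)"
    using h.generate_img[of "A \<union> B"] AB by (simp add: image_Un)
  ultimately have "K_subnormal F {x \<in> carrier G. h x \<in> h ` generate G (A \<union> B)} G"
    using K_subnormal_preimage[OF G(1) K(1) hom] by simp
  moreover have "generate G (A \<union> B) \<subseteq> carrier G" using AB h.G.generate_incl by simp
  then have "{x \<in> carrier G. h x \<in> h ` generate G (A \<union> B)} = generate G (A \<union> B)"
    using inj by (auto simp: inj_on_def subset_iff)
  ultimately show ?thesis by simp
qed

text \<open>The last proper subgroup of the chain.\<close>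

lemma K_subnormal_top_link:
  assumes G: "group G" and A: "K_subnormal F A G" "A \<noteq> carrier G"
  shows "\<exists>B. subgroup B G \<and> A \<subseteq> B \<and> B \<noteq> carrier G \<and> (B \<lhd> G \<or> embeds_above G B)"
proof -
  have "(Kstep G)\<^sup>*\<^sup>* A (carrier G)" using A(1) K_subnormal_iff[OF G] by simp
  then show ?thesis using A(2)
  proof (induction rule: converse_rtranclp_induct)
    case base
    then show ?case by simp
  next
    case (step A B)
    have B: "subgroup B G" using Kstep_rtranclp_subgroup[OF G step.hyps(2)] .
    have A: "subgroup A G" "A \<subseteq> B" using step.hyps(1) B unfolding Kstep_def by (auto simp: group.subgroup_in[OF G])
    show ?case
    proof (cases "B = carrier G")
      case True
      then have "A \<lhd> G \<or> embeds_above G A" using step.hyps(1) unfolding Kstep_def by simp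
      then show ?thesis using A step.prems by blast
    next
      case False
      then show ?thesis using step.IH A by blast
    qed
  qed
qed

text \<open>The quotient by \<open>M\<close> is abelian: the centraliser of the image of an element outside \<open>M\<close> has a preimage that
  properly contains \<open>M\<close>, hence is \<open>G\<close>.\<close>

lemma maximal_normal_embeds_above:
  assumes G: "group G" "finite (carrier G)" and M: "maximal_subgroup M G" "M \<lhd> G"
  shows "embeds_above G M"
proof -
  interpret group G by fact
  note can = canonical_hom[OF M(2)]
  interpret can: group_hom G "G Mod M" "\<lambda>x. M #>\<^bsub>G\<^esub> x" using G(1) can(4,1) by (rule group_homI)
  have MG: "subgroup M G" using M(1) by (simp add: maximal_subgroup_def)
  have one: "M #>\<^bsub>G\<^esub> m = \<one>\<^bsub>G Mod M\<^esub>" if "m \<in> M" for m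
  proof -
    have "m \<in> kernel G (G Mod M) (\<lambda>x. M #>\<^bsub>G\<^esub> x)" using that can(3) by simp
    then show ?thesis by (simp add: kernel_def)
  qed
  have comm: "(M #>\<^bsub>G\<^esub> x) \<otimes>\<^bsub>G Mod M\<^esub> (M #>\<^bsub>G\<^esub> y) = (M #>\<^bsub>G\<^esub> y) \<otimes>\<^bsub>G Mod M\<^esub> (M #>\<^bsub>G\<^esub> x)"
    if xy: "x \<in> carrier G" "y \<in> carrier G" for x y
  proof (cases "x \<in> M")
    case True
    then show ?thesis using one[OF True] can.hom_closed[OF xy(2)] can.H.l_one can.H.r_one by metis
  next
    case False
    define Z where "Z = {g \<in> carrier (G Mod M). \<forall>z\<in>{M #>\<^bsub>G\<^esub> x}. g \<otimes>\<^bsub>G Mod M\<^esub> z = z \<otimes>\<^bsub>G Mod M\<^esub> g}"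
    define C where "C = {g \<in> carrier G. M #>\<^bsub>G\<^esub> g \<in> Z}"
    have "subgroup Z (G Mod M)" unfolding Z_def using can.hom_closed[OF xy(1)] by (intro can.H.centralizer_subgroup) blast
    then have "subgroup C G" unfolding C_def by (rule can.preimage_subgroup)
    moreover have "M \<subseteq> C"
    proof
      fix m assume m: "m \<in> M"
      have mc: "m \<in> carrier G" using m subgroup.mem_carrier[OF MG] by blast
      have "M #>\<^bsub>G\<^esub> m \<in> Z" unfolding Z_def mem_Collect_eq one[OF m]
      proof (intro conjI ballI)
        fix z assume "z \<in> {M #>\<^bsub>G\<^esub> x}"
        then have "z \<in> carrier (G Mod M)" using can.hom_closed[OF xy(1)] by (simp only: singleton_iff)
        then show "\<one>\<^bsub>G Mod M\<^esub> \<otimes>\<^bsub>G Mod M\<^esub> z = z \<otimes>\<^bsub>G Mod M\<^esub> \<one>\<^bsub>G Mod M\<^esub>"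
          using can.H.l_one can.H.r_one by metis
      qed (rule can.H.one_closed)
      then show "m \<in> C" using mc by (simp only: C_def mem_Collect_eq)
    qed
    moreover have "x \<in> C" using xy(1) can.hom_closed[OF xy(1)] unfolding C_def Z_def by blast
    ultimately have "C = carrier G" using M(1) False unfolding maximal_subgroup_def by blast
    then have "y \<in> C" using xy by simp
    then show ?thesis unfolding C_def Z_def mem_Collect_eq by simp
  qed
  have "in_class (G Mod M) F"
  proof (rule abelian_in_class[OF can(4)])
    show "finite (carrier (G Mod M))" using can(2) G(2) by (metis finite_imageI)
    fix a b assume "a \<in> carrier (G Mod M)" "b \<in> carrier (G Mod M)"
    then obtain x y where "x \<in> carrier G" "y \<in> carrier G" "a = M #>\<^bsub>G\<^esub> x" "b = M #>\<^bsub>G\<^esub> y"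
      unfolding can(2)[symmetric] by blast
    then show "a \<otimes>\<^bsub>G Mod M\<^esub> b = b \<otimes>\<^bsub>G Mod M\<^esub> a" using comm by blast
  qed
  then show ?thesis using embeds_aboveI[OF _ can(1)] can(3) by simp
qed

lemma K_subnormal_maximal_embeds_above:
  assumes G: "group G" "finite (carrier G)" and M: "maximal_subgroup M G" "K_subnormal F M G"
  shows "embeds_above G M"
proof -
  have "M \<noteq> carrier G" using M(1) by (simp add: maximal_subgroup_def)
  then obtain B where "subgroup B G" "M \<subseteq> B" "B \<noteq> carrier G" "B \<lhd> G \<or> embeds_above G B"
    using K_subnormal_top_link[OF G(1) M(2)] by blast
  then have "M \<lhd> G \<or> embeds_above G M" using M(1) unfolding maximal_subgroup_def by blast
  then show ?thesis using maximal_normal_embeds_above[OF G M(1)] by blast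
qed

text \<open>Each maximal subgroup contains the kernel of a homomorphism into a member of \<open>F\<close>, hence the residual;
  so the residual lies in the Frattini subgroup.\<close>

lemma in_class_if_maximal_K_subnormal:
  assumes G: "group G" "finite (carrier G)"
    and all: "\<And>M. maximal_subgroup M G \<Longrightarrow> K_subnormal F M G"
  shows "in_class G F"
proof -
  obtain E :: "nat monoid" and h where E: "group E" "finite (carrier E)" "h \<in> iso G E"
    using ex_nat_copy G by blast
  interpret E: group E by fact
  have hom: "h \<in> hom G E" and surj: "h ` carrier G = carrier E" and inj: "inj_on h (carrier G)"
    using E(3) by (auto simp: iso_def bij_betw_def)
  interpret h: group_hom G E h using G(1) E(1) hom by (rule group_homI)
  have res: "residual E F \<subseteq> M" if M: "maximal_subgroup M E" for M
  proof -
    define M' where "M' = {x \<in> carrier G. h x \<in> M}"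
    have M': "maximal_subgroup M' G" unfolding M'_def by (rule h.preimage_maximal[OF surj M])
    have MM': "h ` M' = M"
    proof -
      have "M \<subseteq> h ` carrier G" using M subgroup.subset[of M E] surj by (simp add: maximal_subgroup_def)
      then show ?thesis by (auto simp: M'_def)
    qed
    have "K_subnormal F M E" using K_subnormal_image[OF G(1) E(1) hom surj all[OF M']] MM' by simp
    then obtain K \<phi> where K: "K \<in> F" "\<phi> \<in> hom E K" "kernel E K \<phi> \<subseteq> M"
      using K_subnormal_maximal_embeds_above[OF E(1,2) M] unfolding embeds_above_def by blast
    interpret phi: group_hom E K \<phi> using E(1) mem_group[OF K(1)] K(2) by (rule group_homI)
    have "in_class (E Mod kernel E K \<phi>) F"
      using in_class_kernel_quotient[OF in_class_mem[OF K(1)] E(1) K(2) phi.normal_kernel] by simp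
    then have "residual E F \<subseteq> kernel E K \<phi>" using phi.normal_kernel unfolding residual_def by blast
    then show ?thesis using K(3) by blast
  qed
  have "in_class (E Mod carrier E) F"
  proof (rule in_class_trivial)
    show "group (E Mod carrier E)" by (rule E.canonical_hom(4)[OF E.normal_self])
    have "carrier E #>\<^bsub>E\<^esub> x = carrier E" if "x \<in> carrier E" for x
      using E.coset_join2[OF that E.subgroup_self that] .
    then show "carrier (E Mod carrier E) = {\<one>\<^bsub>E Mod carrier E\<^esub>}"
      using E.one_closed unfolding carrier_FactGroup by (auto simp: image_iff)
  qed
  then have "residual E F \<subseteq> carrier E" unfolding residual_def using E.normal_self by blast
  then have "residual E F \<subseteq> frattini E" unfolding frattini_def using res by blast
  then have "E \<in> F" using saturated E unfolding saturated_def by blast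
  then show ?thesis unfolding in_class_def using G(1) is_isoI[OF E(3)] by blast
qed

end

section \<open>Wreath products with a cyclic group\<close>

text \<open>\<open>G\<^sup>p\<close> extended by the cyclic group of order \<open>N\<close>, which permutes the \<open>p\<close> coordinates cyclically
  (so \<open>p\<close> has to divide \<open>N\<close>).\<close>

definition cyclic_wreath :: "('a, 'b) monoid_scheme \<Rightarrow> nat \<Rightarrow> nat \<Rightarrow> ((nat \<Rightarrow> 'a) \<times> nat) monoid" where
  "cyclic_wreath G p N = \<lparr>carrier = ({..<p} \<rightarrow>\<^sub>E carrier G) \<times> {..<N},
     monoid.mult = (\<lambda>x y. (\<lambda>i\<in>{..<p}. fst x i \<otimes>\<^bsub>G\<^esub> fst y ((i + snd x) mod p), (snd x + snd y) mod N)),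
     one = (\<lambda>i\<in>{..<p}. \<one>\<^bsub>G\<^esub>, 0)\<rparr>"

lemma cyclic_wreath_simps [simp]:
  "carrier (cyclic_wreath G p N) = ({..<p} \<rightarrow>\<^sub>E carrier G) \<times> {..<N}"
  "(f, a) \<otimes>\<^bsub>cyclic_wreath G p N\<^esub> (g, b) = (\<lambda>i\<in>{..<p}. f i \<otimes>\<^bsub>G\<^esub> g ((i + a) mod p), (a + b) mod N)"
  "\<one>\<^bsub>cyclic_wreath G p N\<^esub> = (\<lambda>i\<in>{..<p}. \<one>\<^bsub>G\<^esub>, 0)"
  by (simp_all add: cyclic_wreath_def)

lemma mod_add_mod_dvd:
  assumes "p dvd (N::nat)"
  shows "(i + a mod N) mod p = (i + a) mod p"
  using assms by (metis mod_add_right_eq mod_mod_cancel)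

lemma (in group) cyclic_wreath_group:
  assumes p: "p > 0" "p dvd N" "N > 0"
  shows "group (cyclic_wreath G p N)"
proof (rule groupI)
  let ?W = "cyclic_wreath G p N"
  have in_p: "x mod p \<in> {..<p}" for x using p by simp
  show "x \<otimes>\<^bsub>?W\<^esub> y \<in> carrier ?W" if "x \<in> carrier ?W" "y \<in> carrier ?W" for x y
  proof -
    obtain f a g b where e: "x = (f, a)" "y = (g, b)" by (meson surj_pair)
    have "f i \<in> carrier G" "g i \<in> carrier G" if "i < p" for i
      using \<open>x \<in> _\<close> \<open>y \<in> _\<close> that unfolding e by (auto dest: PiE_mem)
    then show ?thesis unfolding e using p by simp
  qed
  show "\<one>\<^bsub>?W\<^esub> \<in> carrier ?W" using p by auto
  show "x \<otimes>\<^bsub>?W\<^esub> y \<otimes>\<^bsub>?W\<^esub> z = x \<otimes>\<^bsub>?W\<^esub> (y \<otimes>\<^bsub>?W\<^esub> z)"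
    if xyz: "x \<in> carrier ?W" "y \<in> carrier ?W" "z \<in> carrier ?W" for x y z
  proof -
    obtain f a g b h c where e: "x = (f, a)" "y = (g, b)" "z = (h, c)" by (meson surj_pair)
    have m: "f i \<in> carrier G" "g i \<in> carrier G" "h i \<in> carrier G" if "i < p" for i
      using xyz that unfolding e by (auto dest: PiE_mem)
    have "f i \<otimes> g ((i + a) mod p) \<otimes> h ((i + (a + b) mod N) mod p)
        = f i \<otimes> (g ((i + a) mod p) \<otimes> h (((i + a) mod p + b) mod p))" if "i < p" for i
      using m[OF that] m[of "(i + a) mod p"] m[of "(i + a + b) mod p"] p
      by (simp add: mod_add_mod_dvd m_assoc mod_add_left_eq add.assoc)
    then show ?thesis unfolding e using p by (auto simp: fun_eq_iff mod_add_left_eq mod_add_right_eq add.assoc)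
  qed
  show "\<one>\<^bsub>?W\<^esub> \<otimes>\<^bsub>?W\<^esub> x = x" if "x \<in> carrier ?W" for x
  proof -
    obtain f a where x: "x = (f, a)" by (meson surj_pair)
    have f: "f \<in> {..<p} \<rightarrow>\<^sub>E carrier G" "a < N" using that by (auto simp: x)
    have "(\<lambda>i\<in>{..<p}. (\<lambda>i\<in>{..<p}. \<one>) i \<otimes> f ((i + 0) mod p)) = f"
    proof (rule ext)
      fix i show "(\<lambda>i\<in>{..<p}. (\<lambda>i\<in>{..<p}. \<one>) i \<otimes> f ((i + 0) mod p)) i = f i"
        using PiE_mem[OF f(1), of i] PiE_arb[OF f(1), of i] by (cases "i < p") auto
    qed
    then show ?thesis using f(2) by (simp add: x)
  qed
  show "\<exists>y\<in>carrier ?W. y \<otimes>\<^bsub>?W\<^esub> x = \<one>\<^bsub>?W\<^esub>" if "x \<in> carrier ?W" for x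
  proof -
    obtain f a where x: "x = (f, a)" by (meson surj_pair)
    have f: "f \<in> {..<p} \<rightarrow>\<^sub>E carrier G" "a < N" using that by (auto simp: x)
    define b where "b = (N - a) mod N"
    have b: "b < N" using p by (simp add: b_def)
    define y where "y = (\<lambda>i\<in>{..<p}. inv (f ((i + b) mod p)), b)"
    have m: "f (i mod p) \<in> carrier G" for i using PiE_mem[OF f(1)] p by simp
    have "y \<in> carrier ?W" using b m by (auto simp: y_def)
    moreover have "y \<otimes>\<^bsub>?W\<^esub> x = \<one>\<^bsub>?W\<^esub>"
      unfolding x y_def using m f(2) by (auto simp: b_def mod_add_left_eq fun_eq_iff)
    ultimately show ?thesis by blast
  qed
qed

lemma (in group) cyclic_wreath_finite:
  "finite (carrier G) \<Longrightarrow> finite (carrier (cyclic_wreath G p N))"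
  by (auto intro!: finite_PiE)

lemma (in group) cyclic_wreath_order:
  "order (cyclic_wreath G p N) = order G ^ p * N"
  by (simp add: order_def card_PiE card_cartesian_product)

section \<open>Cyclic groups acting on an abelian group of coprime order\<close>

text \<open>The part of discrete Fourier analysis that is needed below: an element \<open>c\<close> of order \<open>p\<close> acting without
  fixed points on an abelian group takes the place of a primitive \<open>p\<close>-th root of unity.\<close>

lemma (in comm_monoid) finprod_swap:
  assumes "finite A" "finite B" "\<And>i j. i \<in> A \<Longrightarrow> j \<in> B \<Longrightarrow> f i j \<in> carrier G"
  shows "finprod G (\<lambda>i. finprod G (f i) B) A = finprod G (\<lambda>j. finprod G (\<lambda>i. f i j) A) B"
  using assms(1,3)
proof (induction A rule: finite_induct)
  case empty
  then show ?case by (simp add: finprod_one_eqI)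
next
  case (insert a A)
  have c: "f a \<in> B \<rightarrow> carrier G" "(\<lambda>j. finprod G (\<lambda>i. f i j) A) \<in> B \<rightarrow> carrier G"
      "(\<lambda>i. finprod G (f i) B) \<in> A \<rightarrow> carrier G" using insert.prems by auto
  have "finprod G (\<lambda>i. finprod G (f i) B) (insert a A)
      = finprod G (f a) B \<otimes> finprod G (\<lambda>j. finprod G (\<lambda>i. f i j) A) B"
    using insert c by simp
  also have "\<dots> = finprod G (\<lambda>j. f a j \<otimes> finprod G (\<lambda>i. f i j) A) B"
    using c by (subst finprod_multf) auto
  also have "\<dots> = finprod G (\<lambda>j. finprod G (\<lambda>i. f i j) (insert a A)) B"
    using insert c by (intro finprod_cong') auto
  finally show ?case .
qed

lemma finprod_hom:
  assumes "comm_monoid G" "comm_monoid H" "h \<in> hom G H" "h \<one>\<^bsub>G\<^esub> = \<one>\<^bsub>H\<^esub>" "finite A" "f \<in> A \<rightarrow> carrier G"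
  shows "h (finprod G f A) = finprod H (\<lambda>i. h (f i)) A"
  using assms(5,6)
proof (induction A rule: finite_induct)
  case empty
  then show ?case using comm_monoid.finprod_empty assms(1,2,4) by metis
next
  case (insert a A)
  have c: "f a \<in> carrier G" "f \<in> A \<rightarrow> carrier G" "finprod G f A \<in> carrier G"
    using insert.prems comm_monoid.finprod_closed[OF assms(1)] by auto
  have "(\<lambda>i. h (f i)) \<in> A \<rightarrow> carrier H" "h (f a) \<in> carrier H" using assms(3) c by (auto simp: hom_def)
  then show ?case
    using insert c assms(3) comm_monoid.finprod_insert[OF assms(1), of A a f]
      comm_monoid.finprod_insert[OF assms(2), of A a "\<lambda>i. h (f i)"]
    by (simp add: hom_def)
qed

locale fixed_point_free_action = group G for G (structure) +
  fixes Q :: "'a set" and c :: 'a and p :: nat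
  assumes Q: "Q \<lhd> G" and fin: "finite (carrier G)" and Qcomm: "\<And>x y. x \<in> Q \<Longrightarrow> y \<in> Q \<Longrightarrow> x \<otimes> y = y \<otimes> x"
    and c: "c \<in> carrier G" and p: "Factorial_Ring.prime p" and cop: "coprime p (card Q)"
    and cp: "\<And>x. x \<in> Q \<Longrightarrow> conjg G (c [^] p) x = x"
    and cfix: "\<And>x. x \<in> Q \<Longrightarrow> conjg G c x = x \<Longrightarrow> x = \<one>"
begin

lemma Qsub: "subgroup Q G" using Q normal_imp_subgroup by blast

sublocale QG: comm_group "G\<lparr>carrier := Q\<rparr>"
  using subgroup_imp_group[OF Qsub] Qcomm by (intro group.group_comm_groupI) auto

lemma Qc: "x \<in> Q \<Longrightarrow> x \<in> carrier G" using subgroup.mem_carrier[OF Qsub] .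

abbreviation act :: "nat \<Rightarrow> 'a \<Rightarrow> 'a" where "act k x \<equiv> conjg G (c [^] k) x"

lemma act_in [simp]: "x \<in> Q \<Longrightarrow> act k x \<in> Q"
  using Q c unfolding normal_iff by simp

lemma act_act: "x \<in> Q \<Longrightarrow> act k (act l x) = act (k + l) x"
  using c Qc by (simp add: conjg_conjg nat_pow_mult)

lemma act_mult_p [simp]: "x \<in> Q \<Longrightarrow> act (p * k) x = x"
proof (induction k)
  case (Suc k)
  have "act (p * Suc k) x = act p (act (p * k) x)" using Suc.prems by (simp add: act_act add.commute)
  then show ?case using Suc cp by simp
qed (use Qc in simp)

lemma act_p_mult [simp]: "x \<in> Q \<Longrightarrow> act (k * p) x = x"
  using act_mult_p[of x k] by (simp only: mult.commute)

lemma act_mod: "x \<in> Q \<Longrightarrow> act (k mod p) x = act k x"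
proof -
  assume x: "x \<in> Q"
  have "act k x = act (p * (k div p)) (act (k mod p) x)" using x by (simp add: act_act)
  then show ?thesis using x by simp
qed

lemma act_cong: "x \<in> Q \<Longrightarrow> k mod p = l mod p \<Longrightarrow> act k x = act l x"
  using act_mod by metis

lemma act_hom: "act k \<in> hom (G\<lparr>carrier := Q\<rparr>) (G\<lparr>carrier := Q\<rparr>)"
  using c Qc by (auto simp: hom_def conjg_mult)

lemma act_prod:
  assumes "finite A" "f \<in> A \<rightarrow> Q"
  shows "act k (finprod (G\<lparr>carrier := Q\<rparr>) f A) = finprod (G\<lparr>carrier := Q\<rparr>) (\<lambda>i. act k (f i)) A"
  by (rule finprod_hom[OF QG.comm_monoid_axioms QG.comm_monoid_axioms act_hom])
    (use assms c in auto)

lemma prod_in: "(\<And>i. i \<in> A \<Longrightarrow> f i \<in> Q) \<Longrightarrow> finprod (G\<lparr>carrier := Q\<rparr>) f A \<in> Q"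
  using QG.finprod_closed[of f A] by (simp add: Pi_iff)

lemma reindex_prod:
  assumes "inj_on h {..<p}" "h ` {..<p} \<subseteq> {..<p}" "f \<in> {..<p} \<rightarrow> Q"
  shows "finprod (G\<lparr>carrier := Q\<rparr>) (\<lambda>i. f (h i)) {..<p} = finprod (G\<lparr>carrier := Q\<rparr>) f {..<p}"
proof -
  have "h ` {..<p} = {..<p}" using endo_inj_surj[OF _ assms(2,1)] by simp
  then show ?thesis using QG.finprod_reindex[OF _ assms(1), of f] assms(3) by simp
qed

text \<open>As \<open>d\<close> is prime to \<open>p\<close>, the product is the norm of \<open>x\<close>. It is fixed by \<open>c\<close>, hence trivial. This
  replaces the vanishing of the sum of all powers of a nontrivial root of unity.\<close>

lemma norm_eq_one:
  assumes x: "x \<in> Q" and d: "\<not> p dvd d"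
  shows "finprod (G\<lparr>carrier := Q\<rparr>) (\<lambda>k. act (k * d) x) {..<p} = \<one>"
proof -
  have p0: "p > 0" using p prime_gt_0_nat by blast
  define \<nu> where "\<nu> = finprod (G\<lparr>carrier := Q\<rparr>) (\<lambda>k. act k x) {..<p}"
  have injd: "inj_on (\<lambda>k. k * d mod p) {..<p}"
  proof (rule inj_onI)
    fix k l assume kl: "k \<in> {..<p}" "l \<in> {..<p}" "k * d mod p = l * d mod p"
    have "coprime d p" using d p by (metis coprime_commute prime_imp_coprime)
    then have "[k = l] (mod p)" using kl(3) cong_mult_rcancel_nat unfolding cong_def by blast
    then show "k = l" using kl by (simp add: cong_def)
  qed
  have "finprod (G\<lparr>carrier := Q\<rparr>) (\<lambda>k. act (k * d) x) {..<p}
      = finprod (G\<lparr>carrier := Q\<rparr>) (\<lambda>k. act (k * d mod p) x) {..<p}"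
    using x by (intro QG.finprod_cong') (auto simp: act_mod)
  also have "\<dots> = \<nu>" unfolding \<nu>_def
    by (rule reindex_prod[OF injd, of "\<lambda>k. act k x"]) (use p0 x in auto)
  finally have e: "finprod (G\<lparr>carrier := Q\<rparr>) (\<lambda>k. act (k * d) x) {..<p} = \<nu>" .
  have \<nu>: "\<nu> \<in> Q" unfolding \<nu>_def using x by (intro prod_in) simp
  have inj1: "inj_on (\<lambda>k. (k + 1) mod p) {..<p}"
  proof (rule inj_onI)
    fix k l assume kl: "k \<in> {..<p}" "l \<in> {..<p}" "(k + 1) mod p = (l + 1) mod p"
    then have "[k = l] (mod p)" using cong_add_rcancel_nat unfolding cong_def by blast
    then show "k = l" using kl by (simp add: cong_def)
  qed
  have "act 1 \<nu> = finprod (G\<lparr>carrier := Q\<rparr>) (\<lambda>k. act 1 (act k x)) {..<p}"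
    unfolding \<nu>_def using x by (intro act_prod) auto
  also have "\<dots> = finprod (G\<lparr>carrier := Q\<rparr>) (\<lambda>k. act ((k + 1) mod p) x) {..<p}"
  proof (rule QG.finprod_cong')
    show "act 1 (act k x) = act ((k + 1) mod p) x" for k
      using act_act[OF x, of 1 k] act_mod[OF x, of "k + 1"] by (simp only: add.commute)
    show "(\<lambda>k. act ((k + 1) mod p) x) \<in> {..<p} \<rightarrow> carrier (G\<lparr>carrier := Q\<rparr>)"
      using act_in[OF x] by simp
  qed simp
  also have "\<dots> = \<nu>" unfolding \<nu>_def
    by (rule reindex_prod[OF inj1, of "\<lambda>k. act k x"]) (use p0 x in auto)
  finally have "\<nu> = \<one>" using cfix[OF \<nu>] c by simp
  then show ?thesis using e by simp
qed

text \<open>The discrete Fourier transform of \<open>f\<close>, written multiplicatively.\<close>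

definition twisted_prod :: "nat \<Rightarrow> (nat \<Rightarrow> 'a) \<Rightarrow> 'a" where
  "twisted_prod k f = finprod (G\<lparr>carrier := Q\<rparr>) (\<lambda>i. act (k * i) (f i)) {..<p}"

lemma twisted_prod_in: "f \<in> {..<p} \<rightarrow> Q \<Longrightarrow> twisted_prod k f \<in> Q"
  unfolding twisted_prod_def by (intro prod_in) (auto simp: Pi_iff)

text \<open>A cyclic shift of the coordinates is compensated by the action of a power of \<open>c\<close>. Hence the twisted
  products extend to homomorphisms on the wreath product.\<close>

lemma twisted_prod_mult:
  assumes "f \<in> {..<p} \<rightarrow> Q" "g \<in> {..<p} \<rightarrow> Q"
  shows "act (k * a) (twisted_prod k (\<lambda>i\<in>{..<p}. f i \<otimes> g ((i + a) mod p)))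
       = act (k * a) (twisted_prod k f) \<otimes> twisted_prod k g"
proof -
  have p0: "p > 0" using p prime_gt_0_nat by blast
  have inj: "inj_on (\<lambda>i. (i + a) mod p) {..<p}"
  proof (rule inj_onI)
    fix i l assume kl: "i \<in> {..<p}" "l \<in> {..<p}" "(i + a) mod p = (l + a) mod p"
    then have "[i = l] (mod p)" using cong_add_rcancel_nat unfolding cong_def by blast
    then show "i = l" using kl by (simp add: cong_def)
  qed
  have fQ: "f i \<in> Q" "g (i mod p) \<in> Q" if "i < p" for i using assms that p0 by auto
  have gQ: "g (i mod p) \<in> Q" for i using assms p0 by auto
  have "twisted_prod k (\<lambda>i\<in>{..<p}. f i \<otimes> g ((i + a) mod p))
      = finprod (G\<lparr>carrier := Q\<rparr>) (\<lambda>i. act (k * i) (f i) \<otimes>\<^bsub>G\<lparr>carrier := Q\<rparr>\<^esub> act (k * i) (g ((i + a) mod p))) {..<p}"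
    unfolding twisted_prod_def using fQ gQ subgroup.m_closed[OF Qsub] c Qc
    by (intro QG.finprod_cong') (auto simp: conjg_mult)
  also have "\<dots> = twisted_prod k f \<otimes>\<^bsub>G\<lparr>carrier := Q\<rparr>\<^esub> finprod (G\<lparr>carrier := Q\<rparr>) (\<lambda>i. act (k * i) (g ((i + a) mod p))) {..<p}"
    unfolding twisted_prod_def using fQ gQ by (intro QG.finprod_multf) auto
  finally have e: "twisted_prod k (\<lambda>i\<in>{..<p}. f i \<otimes> g ((i + a) mod p))
      = twisted_prod k f \<otimes> finprod (G\<lparr>carrier := Q\<rparr>) (\<lambda>i. act (k * i) (g ((i + a) mod p))) {..<p}" by simp
  have m: "finprod (G\<lparr>carrier := Q\<rparr>) (\<lambda>i. act (k * i) (g ((i + a) mod p))) {..<p} \<in> Q"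
    using gQ by (intro prod_in) simp
  have "act (k * a) (finprod (G\<lparr>carrier := Q\<rparr>) (\<lambda>i. act (k * i) (g ((i + a) mod p))) {..<p})
      = finprod (G\<lparr>carrier := Q\<rparr>) (\<lambda>i. act (k * a) (act (k * i) (g ((i + a) mod p)))) {..<p}"
    using gQ by (intro act_prod) auto
  also have "\<dots> = finprod (G\<lparr>carrier := Q\<rparr>) (\<lambda>i. act (k * ((i + a) mod p)) (g ((i + a) mod p))) {..<p}"
  proof (rule QG.finprod_cong')
    fix i assume "i \<in> {..<p}"
    have "act (k * a) (act (k * i) (g ((i + a) mod p))) = act (k * (i + a)) (g ((i + a) mod p))"
      using gQ by (simp add: act_act distrib_left add.commute)
    also have "\<dots> = act (k * ((i + a) mod p)) (g ((i + a) mod p))"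
      using gQ by (intro act_cong) (simp_all add: mod_mult_right_eq)
    finally show "act (k * a) (act (k * i) (g ((i + a) mod p))) = act (k * ((i + a) mod p)) (g ((i + a) mod p))" .
  qed (use gQ in auto)
  also have "\<dots> = twisted_prod k g"
    unfolding twisted_prod_def
    by (rule reindex_prod[OF inj, of "\<lambda>i. act (k * i) (g i)"]) (use p0 assms(2) in \<open>auto simp: Pi_iff\<close>)
  finally show ?thesis unfolding e using m twisted_prod_in[OF assms(1)] c Qc by (simp add: conjg_mult)
qed

text \<open>Fourier inversion: in the product of the twisted products shifted by \<open>c\<^sup>-\<^sup>k\<^sup>j\<close> all coordinates but the
  \<open>j\<close>-th contribute a norm, and what remains is \<open>(f j)\<^sup>p\<close>; here \<open>p\<close> is prime to the order of \<open>Q\<close>.\<close>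

lemma twisted_prod_separates:
  assumes f: "f \<in> {..<p} \<rightarrow> Q" and one: "\<And>k. k < p \<Longrightarrow> twisted_prod k f = \<one>" and j: "j < p"
  shows "f j = \<one>"
proof -
  have p0: "p > 0" using p prime_gt_0_nat by blast
  have fQ: "f i \<in> Q" if "i < p" for i using f that by auto
  have "\<one> = finprod (G\<lparr>carrier := Q\<rparr>) (\<lambda>k. act (k * (p - j)) (twisted_prod k f)) {..<p}"
    using one c QG.finprod_one_eqI[of "{..<p}" "\<lambda>k. act (k * (p - j)) (twisted_prod k f)"] by simp
  also have "\<dots> = finprod (G\<lparr>carrier := Q\<rparr>) (\<lambda>k. finprod (G\<lparr>carrier := Q\<rparr>) (\<lambda>i. act (k * (i + (p - j))) (f i)) {..<p}) {..<p}"
  proof (rule QG.finprod_cong')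
    fix k assume "k \<in> {..<p}"
    have "act (k * (p - j)) (twisted_prod k f)
        = finprod (G\<lparr>carrier := Q\<rparr>) (\<lambda>i. act (k * (p - j)) (act (k * i) (f i))) {..<p}"
      unfolding twisted_prod_def using fQ by (intro act_prod) auto
    also have "\<dots> = finprod (G\<lparr>carrier := Q\<rparr>) (\<lambda>i. act (k * (i + (p - j))) (f i)) {..<p}"
      using fQ by (intro QG.finprod_cong') (auto simp: act_act distrib_left add.commute)
    finally show "act (k * (p - j)) (twisted_prod k f) = finprod (G\<lparr>carrier := Q\<rparr>) (\<lambda>i. act (k * (i + (p - j))) (f i)) {..<p}" .
  qed (use fQ in \<open>auto intro!: prod_in\<close>)
  also have "\<dots> = finprod (G\<lparr>carrier := Q\<rparr>) (\<lambda>i. finprod (G\<lparr>carrier := Q\<rparr>) (\<lambda>k. act (k * (i + (p - j))) (f i)) {..<p}) {..<p}"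
    using fQ by (intro QG.finprod_swap) auto
  also have "\<dots> = finprod (G\<lparr>carrier := Q\<rparr>) (\<lambda>i. if j = i then f i [^] p else \<one>\<^bsub>G\<lparr>carrier := Q\<rparr>\<^esub>) {..<p}"
  proof (rule QG.finprod_cong')
    fix i assume i: "i \<in> {..<p}"
    show "finprod (G\<lparr>carrier := Q\<rparr>) (\<lambda>k. act (k * (i + (p - j))) (f i)) {..<p}
        = (if j = i then f i [^] p else \<one>\<^bsub>G\<lparr>carrier := Q\<rparr>\<^esub>)"
    proof (cases "j = i")
      case True
      have "finprod (G\<lparr>carrier := Q\<rparr>) (\<lambda>k. act (k * (i + (p - j))) (f i)) {..<p}
          = finprod (G\<lparr>carrier := Q\<rparr>) (\<lambda>k. f i) {..<p}"
        using fQ i True j by (intro QG.finprod_cong') auto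
      also have "\<dots> = f i [^]\<^bsub>G\<lparr>carrier := Q\<rparr>\<^esub> p" using fQ i QG.finprod_const[of "f i" "{..<p}"] by simp
      finally show ?thesis using True by (simp add: nat_pow_consistent[symmetric])
    next
      case False
      have "\<not> p dvd i + (p - j)"
      proof
        assume "p dvd i + (p - j)"
        then have "[i + (p - j) + j = 0 + j] (mod p)" by (intro cong_add) (auto simp: cong_0_iff)
        then have "[i + p = j] (mod p)" using j by simp
        then show False using False i j by (simp add: cong_def)
      qed
      then show ?thesis using norm_eq_one[OF fQ] i False by simp
    qed
  qed (use fQ pow_in_subgroup[OF Qsub] subgroup.one_closed[OF Qsub] in auto)
  also have "\<dots> = f j [^] p"
    using QG.finprod_singleton[of j "{..<p}" "\<lambda>i. f i [^] p"] j fQ pow_in_subgroup[OF Qsub] by simp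
  finally have "f j [^] p = \<one>" by simp
  then show ?thesis
    using coprime_pow_eq_one[OF is_group Qc[OF fQ[OF j]] _ pow_card_eq_one[OF Qsub fin fQ[OF j]] cop] by blast
qed

end

lemma (in group) finite_subgroupI:
  assumes "finite (carrier G)" "H \<subseteq> carrier G" "H \<noteq> {}" "\<And>x y. x \<in> H \<Longrightarrow> y \<in> H \<Longrightarrow> x \<otimes> y \<in> H"
  shows "subgroup H G"
proof (rule subgroupI)
  show "inv x \<in> H" if x: "x \<in> H" for x
  proof -
    have xc: "x \<in> carrier G" using x assms(2) by blast
    have "x [^] (Suc k) \<in> H" for k :: nat by (induction k) (use x xc assms(4) in auto)
    moreover have "inv x = x [^] (order G - 1 + order G)"
    proof (rule inv_equality)
      have o: "order G > 0" using assms(1) order_gt_0_iff_finite by blast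
      have "x [^] (order G - 1 + order G) \<otimes> x = x [^] (Suc (order G - 1 + order G))" by simp
      also have "Suc (order G - 1 + order G) = order G + order G" using o by simp
      also have "x [^] (order G + order G) = \<one>" using xc pow_order_eq_1 by (simp add: nat_pow_mult[symmetric])
      finally show "x [^] (order G - 1 + order G) \<otimes> x = \<one>" .
    qed (use xc in auto)
    moreover have "order G - 1 + order G = Suc (order G - 1 + (order G - 1))"
      using assms(1) order_gt_0_iff_finite by (metis Suc_diff_1 add_Suc_right)
    ultimately show ?thesis by metis
  qed
qed (use assms in auto)

section \<open>The lattice property in a wreath product\<close>

context lattice_formation
begin

text \<open>Let \<open>T\<close> consist of the elements of the wreath product whose coordinates lie in \<open>\<langle>m\<^sup>p\<rangle>\<close>. The group \<open>G\<close>
  maps to the wreath product as it does for an induced representation from \<open>Q\<langle>m\<^sup>p\<rangle>\<close>, and the preimage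
  of \<open>T\<close> is \<open>\<langle>m\<rangle>\<close>; so it is enough that \<open>T\<close> is \<open>K\<close>-subnormal. Now \<open>T\<close> is generated by its part in the base
  group, which is an intersection of pullbacks of \<open>\<langle>m\<^sup>p\<rangle>\<close> along the coordinates, and by the cyclic top group. The
  latter is an intersection of pullbacks of \<open>\<langle>m\<^sup>p\<rangle>\<close> as well, along homomorphisms that send the coordinates
  to a twisted product and the top group to \<open>\<langle>c\<rangle>\<close>. This is where \<open>c\<close> has to be a power of \<open>m\<^sup>p\<close>.\<close>

theorem cyclic_complement_K_subnormal:
  fixes G (structure)
  assumes G: "group G" and fin: "finite (carrier G)"
    and Q: "Q \<lhd> G" "\<And>x y. x \<in> Q \<Longrightarrow> y \<in> Q \<Longrightarrow> x \<otimes> y = y \<otimes> x"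
    and m: "m \<in> carrier G" "m [^] (p ^ n) = \<one>" "n > 0"
    and split: "\<And>g. g \<in> carrier G \<Longrightarrow> \<exists>q\<in>Q. \<exists>a::nat. g = q \<otimes> m [^] a"
    and meet: "\<And>a::nat. m [^] a \<in> Q \<Longrightarrow> m [^] a = \<one>"
    and ordm: "\<And>a b::nat. m [^] a = m [^] b \<Longrightarrow> a mod p ^ n = b mod p ^ n"
    and p: "Factorial_Ring.prime p" and cop: "coprime p (card Q)"
    and c: "c = m [^] (p * e)"
    and cp: "\<And>x. x \<in> Q \<Longrightarrow> conjg G (c [^] p) x = x"
    and cfix: "\<And>x. x \<in> Q \<Longrightarrow> conjg G c x = x \<Longrightarrow> x = \<one>"
    and Mp: "K_subnormal F (range (\<lambda>k::nat. m [^] (p * k))) G"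
  shows "K_subnormal F (range (\<lambda>k::nat. m [^] k)) G"
proof -
  interpret group G by fact
  have cc: "c \<in> carrier G" using m(1) c by simp
  interpret A: fixed_point_free_action G Q c p
    unfolding fixed_point_free_action_def fixed_point_free_action_axioms_def using assms cc by blast
  define N where "N = p ^ n"
  have p0: "p > 0" using p prime_gt_0_nat by blast
  have N: "p dvd N" "N > 0" using p0 m(3) by (auto simp: N_def)
  define W where "W = cyclic_wreath G p N"
  have Wg: "group W" unfolding W_def using cyclic_wreath_group[OF p0 N] .
  interpret W: group W by fact
  have Wfin: "finite (carrier W)" unfolding W_def using cyclic_wreath_finite[OF fin] .
  define M0 where "M0 = range (\<lambda>k::nat. m [^] (p * k))"
  have M0: "K_subnormal F M0 G" using Mp by (simp add: M0_def)
  have M0sub: "subgroup M0 G" using K_subnormal_subgroup[OF G M0] .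
  have Qc: "x \<in> carrier G" if "x \<in> Q" for x using A.Qc that .
  have M0Q: "x = \<one>" if "x \<in> M0" "x \<in> Q" for x using that meet by (auto simp: M0_def)
  have coord: "f i \<in> carrier G" if "(f, a) \<in> carrier W" "i < p" for f a i
    using that by (auto simp: W_def dest: PiE_mem)
  have snd_lt: "a < N" if "(f, a) \<in> carrier W" for f a using that by (simp add: W_def)
  have Wmult: "(f, a) \<otimes>\<^bsub>W\<^esub> (g, b) = (\<lambda>i\<in>{..<p}. f i \<otimes> g ((i + a) mod p), (a + b) mod N)" for f a g b
    by (simp add: W_def)

  \<comment> \<open>on the normal base group each coordinate is a homomorphism to \<open>G\<close>\<close>
  define B where "B = {w \<in> carrier W. snd w = 0}"
  have B: "B \<lhd> W"
  proof -
    have "(\<lambda>w. int (snd w)) \<in> hom W (integer_mod_group N)"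
    proof (rule homI)
      fix x y assume "x \<in> carrier W" "y \<in> carrier W"
      obtain f a g b where e: "x = (f, a)" "y = (g, b)" by (meson surj_pair)
      show "int (snd x) \<in> carrier (integer_mod_group N)"
        using snd_lt[of f a] \<open>x \<in> carrier W\<close> N by (simp add: e carrier_integer_mod_group)
      show "int (snd (x \<otimes>\<^bsub>W\<^esub> y)) = int (snd x) \<otimes>\<^bsub>integer_mod_group N\<^esub> int (snd y)"
        unfolding e Wmult by (simp add: zmod_int)
    qed
    then interpret h: group_hom W "integer_mod_group N" "\<lambda>w. int (snd w)"
      using Wg group_integer_mod_group by (intro group_homI)
    have "kernel W (integer_mod_group N) (\<lambda>w. int (snd w)) = B" by (auto simp: kernel_def B_def)
    then show ?thesis using h.normal_kernel by simp
  qed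
  have Bsub: "subgroup B W" using normal_imp_subgroup[OF B] .
  have KB: "K_subnormal F B W" using K_subnormal_link[OF Wg Bsub] B by blast
  have gB: "group (W\<lparr>carrier := B\<rparr>)" using W.subgroup_imp_group[OF Bsub] .
  define E where "E = {w \<in> B. \<forall>i<p. fst w i \<in> M0}"
  have KE: "K_subnormal F E W"
  proof -
    have "K_subnormal F {w \<in> carrier (W\<lparr>carrier := B\<rparr>). fst w i \<in> M0} (W\<lparr>carrier := B\<rparr>)" if i: "i < p" for i
    proof (rule K_subnormal_preimage[OF gB G _ M0])
      show "(\<lambda>w. fst w i) \<in> hom (W\<lparr>carrier := B\<rparr>) G"
        using i coord by (auto simp: hom_def B_def Wmult)
    qed
    then have "K_subnormal F (carrier (W\<lparr>carrier := B\<rparr>) \<inter> (\<Inter>i\<in>{..<p}. {w \<in> carrier (W\<lparr>carrier := B\<rparr>). fst w i \<in> M0})) (W\<lparr>carrier := B\<rparr>)"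
      by (intro K_subnormal_INT[OF gB]) auto
    moreover have "carrier (W\<lparr>carrier := B\<rparr>) \<inter> (\<Inter>i\<in>{..<p}. {w \<in> carrier (W\<lparr>carrier := B\<rparr>). fst w i \<in> M0}) = E"
      unfolding E_def by auto
    ultimately show ?thesis using K_subnormal_trans[OF Wg KB] by simp
  qed

  \<comment> \<open>the twisted products are homomorphisms for coordinates in \<open>Q\<close> only; the subgroup \<open>Y\<close> of such elements is
    the preimage of the top group under the map to the wreath product of \<open>G/Q\<close>, which is a \<open>p\<close>-group and
    so belongs to \<open>F\<close>\<close>
  define Y where "Y = {w \<in> carrier W. \<forall>i<p. fst w i \<in> Q}"
  have Ysub: "subgroup Y W"
  proof (rule W.finite_subgroupI[OF Wfin])
    have "\<one>\<^bsub>W\<^esub> \<in> Y" unfolding Y_def using W.one_closed subgroup.one_closed[OF A.Qsub] by (auto simp: W_def)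
    then show "Y \<noteq> {}" by blast
    show "x \<otimes>\<^bsub>W\<^esub> y \<in> Y" if "x \<in> Y" "y \<in> Y" for x y
    proof -
      obtain f a g b where e: "x = (f, a)" "y = (g, b)" by (meson surj_pair)
      have "x \<otimes>\<^bsub>W\<^esub> y \<in> carrier W" using that W.m_closed by (auto simp: Y_def)
      moreover have "f i \<in> Q" "g i \<in> Q" if "i < p" for i using \<open>x \<in> Y\<close> \<open>y \<in> Y\<close> that by (auto simp: Y_def e)
      then have "\<forall>i<p. fst (x \<otimes>\<^bsub>W\<^esub> y) i \<in> Q"
        unfolding e Wmult using p0 subgroup.m_closed[OF A.Qsub] by simp
      ultimately show ?thesis by (simp add: Y_def)
    qed
  qed (auto simp: Y_def)
  have gY: "group (W\<lparr>carrier := Y\<rparr>)" using W.subgroup_imp_group[OF Ysub] .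
  have KY: "K_subnormal F Y W"
  proof -
    define R where "R = G Mod Q"
    note can = canonical_hom[OF Q(1), folded R_def]
    interpret can: group_hom G R "\<lambda>x. Q #> x" using G can(4,1) by (rule group_homI)
    have finR: "finite (carrier R)" using can(2) fin by (metis finite_imageI)
    have "\<exists>j. order R = p ^ j"
    proof -
      define z where "z = Q #> m"
      have z: "z \<in> carrier R" "z [^]\<^bsub>R\<^esub> (p ^ n) = \<one>\<^bsub>R\<^esub>"
        using can.hom_closed[OF m(1)] can.hom_nat_pow[OF m(1), of "p ^ n"] m(2) by (simp_all add: z_def)
      have "carrier R \<subseteq> generate R {z}"
      proof
        fix y assume "y \<in> carrier R"
        then obtain g where g: "g \<in> carrier G" "y = Q #> g" using can(2) by (metis imageE)
        obtain q a where q: "q \<in> Q" "g = q \<otimes> m [^] (a::nat)" using split[OF g(1)] by blast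
        have "q \<in> kernel G R (\<lambda>x. Q #> x)" using q can(3) by simp
        then have "Q #> q = \<one>\<^bsub>R\<^esub>" unfolding kernel_def by blast
        then have "y = z [^]\<^bsub>R\<^esub> a"
          using g q Qc[OF q(1)] m(1) can.hom_mult[of q "m [^] a"] can.hom_nat_pow[OF m(1), of a]
            can.hom_closed[of "m [^] a"] by (simp add: z_def)
        then show "y \<in> generate R {z}" using can.H.generate_pow_on_finite_carrier[OF finR z(1)] by blast
      qed
      then have "carrier R = generate R {z}" using can.H.generate_incl z(1) by blast
      then have "order R = can.H.ord z" using can.H.generate_pow_card[OF z(1)] by (simp add: order_def)
      then have "order R dvd p ^ n" using z can.H.pow_eq_id by simp
      then show ?thesis using p by (meson divides_primepow_nat)
    qed
    then obtain j where j: "order R = p ^ j" by blast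
    define L where "L = cyclic_wreath R p N"
    have "group L" unfolding L_def using can.H.cyclic_wreath_group[OF p0 N] .
    moreover have "order L = p ^ (j * p + n)"
      unfolding L_def using can.H.cyclic_wreath_order j by (simp add: N_def power_add power_mult)
    moreover have "finite (carrier L)" unfolding L_def using can.H.cyclic_wreath_finite[OF finR] .
    ultimately have "in_class L F" using p_group_in_class p by blast
    moreover define \<theta> where "\<theta> w = (\<lambda>i\<in>{..<p}. Q #> fst w i, snd w)" for w :: "(nat \<Rightarrow> 'a) \<times> nat"
    have "\<theta> \<in> hom W L"
    proof (rule homI)
      fix x y assume xy: "x \<in> carrier W" "y \<in> carrier W"
      obtain f a g b where e: "x = (f, a)" "y = (g, b)" by (meson surj_pair)
      show "\<theta> x \<in> carrier L"
        unfolding e \<theta>_def L_def using xy(1) coord can.hom_closed snd_lt by (auto simp: e)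
      have "Q #> (f i \<otimes> g ((i + a) mod p)) = (Q #> f i) \<otimes>\<^bsub>R\<^esub> (Q #> g ((i + a) mod p))" if "i < p" for i
        using xy that p0 by (intro can.hom_mult) (auto simp: e intro: coord)
      then show "\<theta> (x \<otimes>\<^bsub>W\<^esub> y) = \<theta> x \<otimes>\<^bsub>L\<^esub> \<theta> y"
        unfolding e Wmult \<theta>_def L_def using p0 by (auto simp: fun_eq_iff)
    qed
    moreover have "kernel W L \<theta> \<subseteq> Y"
    proof
      fix w assume w: "w \<in> kernel W L \<theta>"
      obtain f a where e: "w = (f, a)" by (meson surj_pair)
      have wW: "(f, a) \<in> carrier W" and "\<theta> (f, a) = \<one>\<^bsub>L\<^esub>" using w by (auto simp: kernel_def e)
      then have eq: "(\<lambda>i\<in>{..<p}. Q #> f i) = (\<lambda>i\<in>{..<p}. \<one>\<^bsub>R\<^esub>)" by (simp add: \<theta>_def L_def)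
      have "f i \<in> Q" if i: "i < p" for i
      proof -
        have "Q #> f i = \<one>\<^bsub>R\<^esub>" using fun_cong[OF eq, of i] i by simp
        then have "f i \<in> kernel G R (\<lambda>x. Q #> x)" using coord[OF wW i] by (simp add: kernel_def)
        then show ?thesis using can(3) by simp
      qed
      then show "w \<in> Y" using wW by (simp add: Y_def e)
    qed
    ultimately have "embeds_above W Y" using embeds_aboveI by blast
    then show ?thesis using K_subnormal_link[OF Wg Ysub] by blast
  qed

  \<comment> \<open>by Fourier inversion the homomorphisms \<open>\<phi> k\<close> cut the top group \<open>S\<close> out of \<open>Y\<close>\<close>
  have cpow: "c [^] (k * (x mod N)) = c [^] (k * x)" for k x :: nat
  proof -
    have "c [^] N = \<one>" unfolding c N_def using m(1,2) by (simp add: nat_pow_pow mult.commute[of "p * e"]) (simp add: nat_pow_pow[symmetric])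
    then have "c [^] (N * y) = \<one>" for y using cc by (simp add: nat_pow_pow[symmetric])
    moreover have "k * x = k * (x mod N) + N * (k * (x div N))"
      by (metis add_mult_distrib2 mod_mult_div_eq mult.assoc mult.commute)
    ultimately show ?thesis using cc by (simp add: nat_pow_mult[symmetric])
  qed
  define \<phi> where "\<phi> k w = A.twisted_prod k (fst w) \<otimes> inv (c [^] (k * snd w))" for k :: nat and w
  have \<phi>: "\<phi> k \<in> hom (W\<lparr>carrier := Y\<rparr>) G" for k
  proof (rule homI)
    fix x y assume xy: "x \<in> carrier (W\<lparr>carrier := Y\<rparr>)" "y \<in> carrier (W\<lparr>carrier := Y\<rparr>)"
    obtain f a g b where e: "x = (f, a)" "y = (g, b)" by (meson surj_pair)
    have fg: "f \<in> {..<p} \<rightarrow> Q" "g \<in> {..<p} \<rightarrow> Q" using xy by (auto simp: Y_def e)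
    have t: "A.twisted_prod k f \<in> carrier G" "A.twisted_prod k g \<in> carrier G"
      using A.twisted_prod_in[OF fg(1)] A.twisted_prod_in[OF fg(2)] Qc by auto
    then show "\<phi> k x \<in> carrier G" using cc by (simp add: \<phi>_def e)
    define h where "h = (\<lambda>i\<in>{..<p}. f i \<otimes> g ((i + a) mod p))"
    have hQ: "h \<in> {..<p} \<rightarrow> Q" using fg p0 subgroup.m_closed[OF A.Qsub] by (auto simp: h_def Pi_iff)
    define u where "u = c [^] (k * a)"
    define v where "v = c [^] (k * b)"
    have uv: "u \<in> carrier G" "v \<in> carrier G" using cc by (auto simp: u_def v_def)
    have "conjg G u (A.twisted_prod k h) = conjg G u (A.twisted_prod k f) \<otimes> A.twisted_prod k g"
      unfolding u_def h_def by (rule A.twisted_prod_mult[OF fg])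
    then have "conjg G (inv u) (conjg G u (A.twisted_prod k h)) = conjg G (inv u) (conjg G u (A.twisted_prod k f) \<otimes> A.twisted_prod k g)"
      by simp
    then have th: "A.twisted_prod k h = A.twisted_prod k f \<otimes> conjg G (inv u) (A.twisted_prod k g)"
      using uv t Qc[OF A.twisted_prod_in[OF hQ]] by (simp add: conjg_mult)
    have "c [^] (k * ((a + b) mod N)) = v \<otimes> u"
      unfolding u_def v_def cpow using cc by (simp add: nat_pow_mult add_mult_distrib2 add.commute)
    then have "\<phi> k (x \<otimes>\<^bsub>W\<^esub> y) = A.twisted_prod k h \<otimes> inv (v \<otimes> u)"
      unfolding e Wmult \<phi>_def h_def by simp
    also have "\<dots> = A.twisted_prod k f \<otimes> inv u \<otimes> (A.twisted_prod k g \<otimes> inv v)"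
      unfolding th using uv t by (simp add: conjg_def word_simps)
    finally show "\<phi> k (x \<otimes>\<^bsub>W\<lparr>carrier := Y\<rparr>\<^esub> y) = \<phi> k x \<otimes> \<phi> k y"
      by (simp add: \<phi>_def e u_def v_def)
  qed
  define S where "S = {w \<in> Y. \<forall>i<p. fst w i = \<one>}"
  have KS: "K_subnormal F S W"
  proof -
    have "K_subnormal F {w \<in> carrier (W\<lparr>carrier := Y\<rparr>). \<phi> k w \<in> M0} (W\<lparr>carrier := Y\<rparr>)" for k
      by (rule K_subnormal_preimage[OF gY G \<phi> M0])
    then have "K_subnormal F (carrier (W\<lparr>carrier := Y\<rparr>) \<inter> (\<Inter>k\<in>{..<p}. {w \<in> carrier (W\<lparr>carrier := Y\<rparr>). \<phi> k w \<in> M0})) (W\<lparr>carrier := Y\<rparr>)"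
      by (intro K_subnormal_INT[OF gY]) auto
    moreover have "carrier (W\<lparr>carrier := Y\<rparr>) \<inter> (\<Inter>k\<in>{..<p}. {w \<in> carrier (W\<lparr>carrier := Y\<rparr>). \<phi> k w \<in> M0}) = S"
    proof -
      have cM0: "c [^] (k::nat) \<in> M0" for k
      proof -
        have "c [^] k = m [^] (p * (e * k))" unfolding c using m(1) by (simp add: nat_pow_pow mult.assoc)
        then show ?thesis unfolding M0_def by blast
      qed
      have "(\<forall>k<p. \<phi> k w \<in> M0) \<longleftrightarrow> (\<forall>i<p. fst w i = \<one>)" if w: "w \<in> Y" for w
      proof -
        have f: "fst w \<in> {..<p} \<rightarrow> Q" using w by (auto simp: Y_def)
        have iff: "\<phi> k w \<in> M0 \<longleftrightarrow> A.twisted_prod k (fst w) = \<one>" for k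
        proof
          assume "\<phi> k w \<in> M0"
          then have "\<phi> k w \<otimes> c [^] (k * snd w) \<in> M0" using cM0 subgroup.m_closed[OF M0sub] by blast
          moreover have "\<phi> k w \<otimes> c [^] (k * snd w) = A.twisted_prod k (fst w)"
            using Qc[OF A.twisted_prod_in[OF f]] cc by (simp add: \<phi>_def m_assoc)
          ultimately show "A.twisted_prod k (fst w) = \<one>" using M0Q A.twisted_prod_in[OF f] by simp
        next
          assume "A.twisted_prod k (fst w) = \<one>"
          then show "\<phi> k w \<in> M0" using cM0 subgroup.m_inv_closed[OF M0sub] cc by (simp add: \<phi>_def)
        qed
        have "A.twisted_prod k (fst w) = \<one>" if "\<forall>i<p. fst w i = \<one>" for k
          unfolding A.twisted_prod_def using that cc A.QG.finprod_one_eqI[of "{..<p}" "\<lambda>i. conjg G (c [^] (k * i)) (fst w i)"] by simp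
        then show ?thesis unfolding iff using A.twisted_prod_separates[OF f] by blast
      qed
      then show ?thesis unfolding S_def by auto
    qed
    ultimately show ?thesis using K_subnormal_trans[OF Wg KY] by simp
  qed

  \<comment> \<open>an element of \<open>T\<close> is the product of its coordinate vector and its top component\<close>
  define T where "T = {w \<in> carrier W. \<forall>i<p. fst w i \<in> M0}"
  have Tsub: "subgroup T W"
  proof (rule W.finite_subgroupI[OF Wfin])
    have "\<one>\<^bsub>W\<^esub> \<in> T" unfolding T_def using W.one_closed subgroup.one_closed[OF M0sub] by (auto simp: W_def)
    then show "T \<noteq> {}" by blast
    show "x \<otimes>\<^bsub>W\<^esub> y \<in> T" if "x \<in> T" "y \<in> T" for x y
    proof -
      obtain f a g b where e: "x = (f, a)" "y = (g, b)" by (meson surj_pair)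
      have "x \<otimes>\<^bsub>W\<^esub> y \<in> carrier W" using that W.m_closed by (auto simp: T_def)
      moreover have "f i \<in> M0" "g i \<in> M0" if "i < p" for i using \<open>x \<in> T\<close> \<open>y \<in> T\<close> that by (auto simp: T_def e)
      then have "\<forall>i<p. fst (x \<otimes>\<^bsub>W\<^esub> y) i \<in> M0"
        unfolding e Wmult using p0 subgroup.m_closed[OF M0sub] by simp
      ultimately show ?thesis by (simp add: T_def)
    qed
  qed (auto simp: T_def)
  have "generate W (E \<union> S) = T"
  proof
    have "E \<subseteq> T" by (auto simp: E_def B_def T_def)
    moreover have "S \<subseteq> T" using subgroup.one_closed[OF M0sub] by (auto simp: S_def Y_def T_def)
    ultimately show "generate W (E \<union> S) \<subseteq> T" using W.generate_subgroup_incl[OF _ Tsub] by blast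
    show "T \<subseteq> generate W (E \<union> S)"
    proof
      fix w assume w: "w \<in> T"
      obtain f a where e: "w = (f, a)" by (meson surj_pair)
      have f: "f \<in> {..<p} \<rightarrow>\<^sub>E carrier G" "a < N" "\<And>i. i < p \<Longrightarrow> f i \<in> M0"
        using w by (auto simp: T_def W_def e)
      have "(f, 0) \<in> E" using f N by (auto simp: E_def B_def W_def)
      moreover have "(\<lambda>i\<in>{..<p}. \<one>, a) \<in> S"
        using f(2) subgroup.one_closed[OF A.Qsub] by (auto simp: S_def Y_def W_def)
      moreover have "w = (f, 0) \<otimes>\<^bsub>W\<^esub> (\<lambda>i\<in>{..<p}. \<one>, a)"
      proof -
        have "(\<lambda>i\<in>{..<p}. f i \<otimes> (\<lambda>i\<in>{..<p}. \<one>) ((i + 0) mod p)) = f"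
        proof (rule ext)
          fix i show "(\<lambda>i\<in>{..<p}. f i \<otimes> (\<lambda>i\<in>{..<p}. \<one>) ((i + 0) mod p)) i = f i"
            using PiE_mem[OF f(1), of i] PiE_arb[OF f(1), of i] by (cases "i < p") auto
        qed
        then show ?thesis unfolding e Wmult using f(2) by simp
      qed
      ultimately show "w \<in> generate W (E \<union> S)" by (metis UnCI generate.eng generate.incl)
    qed
  qed
  then have KT: "K_subnormal F T W" using K_subnormal_join[OF Wg Wfin KE KS] by simp

  \<comment> \<open>\<open>s g\<close> is the exponent of \<open>m\<close> in the decomposition of \<open>g\<close>, and \<open>j\<close> is the induced
    homomorphism for the transversal \<open>m\<^sup>0, ..., m\<^sup>p\<^sup>-\<^sup>1\<close> of \<open>Q\<langle>m\<^sup>p\<rangle>\<close>\<close>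
  have mN: "m [^] (x mod N) = m [^] x" for x
  proof -
    have "m [^] x = m [^] (N * (x div N)) \<otimes> m [^] (x mod N)" using m(1) by (simp add: nat_pow_mult)
    also have "m [^] (N * (x div N)) = \<one>" using m(1,2) by (simp add: nat_pow_pow[symmetric] N_def)
    finally show ?thesis using m(1) by simp
  qed
  define P where "P g a \<longleftrightarrow> a < N \<and> g \<otimes> inv (m [^] a) \<in> Q" for g and a :: nat
  have Pex: "\<exists>a. P g a" if g: "g \<in> carrier G" for g
  proof -
    obtain q a where q: "q \<in> Q" "g = q \<otimes> m [^] (a::nat)" using split[OF g] by blast
    then have "g \<otimes> inv (m [^] (a mod N)) = q" using Qc m(1) by (simp add: mN m_assoc)
    then show ?thesis using q N unfolding P_def by (intro exI[of _ "a mod N"]) simp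
  qed
  have Puniq: "a = b" if ab: "P g a" "P g b" "g \<in> carrier G" for g a b
  proof -
    have "inv (g \<otimes> inv (m [^] a)) \<otimes> (g \<otimes> inv (m [^] b)) \<in> Q"
      using ab A.Qsub by (simp add: P_def subgroup.m_closed subgroup.m_inv_closed)
    moreover have "inv (g \<otimes> inv (m [^] a)) \<otimes> (g \<otimes> inv (m [^] b)) = m [^] a \<otimes> inv (m [^] b)"
      using ab m(1) by (simp add: word_simps)
    ultimately have 1: "m [^] a \<otimes> inv (m [^] b) \<in> Q" by simp
    have "inv (m [^] b) = m [^] (N - b)"
    proof (rule inv_equality)
      show "m [^] (N - b) \<otimes> m [^] b = \<one>" using ab m(1,2) by (simp add: nat_pow_mult P_def N_def)
    qed (use m in auto)
    then have "m [^] (a + (N - b)) \<in> Q" using 1 m(1) by (simp add: nat_pow_mult)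
    then have "m [^] (a + (N - b)) = m [^] (0::nat)" using meet by simp
    then have "(a + (N - b)) mod N = 0" using ordm by (fastforce simp: N_def)
    then have "[a + (N - b) + b = 0 + b] (mod N)" by (intro cong_add) (auto simp: cong_def)
    then show ?thesis using ab by (simp add: P_def cong_def)
  qed
  define s where "s g = (SOME a. P g a)" for g
  have Ps: "P g (s g)" if "g \<in> carrier G" for g unfolding s_def using someI_ex[OF Pex[OF that]] .
  have s_mult: "s (g \<otimes> h) = (s g + s h) mod N" if gh: "g \<in> carrier G" "h \<in> carrier G" for g h
  proof (rule Puniq[OF Ps])
    define q where "q = g \<otimes> inv (m [^] s g)"
    define r where "r = h \<otimes> inv (m [^] s h)"
    have qr: "q \<in> Q" "r \<in> Q" using Ps[OF gh(1)] Ps[OF gh(2)] by (auto simp: P_def q_def r_def)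
    have "q \<otimes> conjg G (m [^] s g) r \<in> Q"
      using qr Q(1) m(1) subgroup.m_closed[OF A.Qsub] by (simp add: normal_iff)
    moreover have "g \<otimes> h \<otimes> inv (m [^] (s g + s h)) = q \<otimes> conjg G (m [^] s g) r"
    proof -
      have "m [^] (s g + s h) = m [^] s g \<otimes> m [^] s h" using m(1) by (simp add: nat_pow_mult)
      also have "\<dots> = m [^] s h \<otimes> m [^] s g" using m(1) by (simp add: nat_pow_mult add.commute)
      finally have "inv (m [^] (s g + s h)) = inv (m [^] s g) \<otimes> inv (m [^] s h)" using m(1) by (simp add: inv_mult_group)
      moreover have "inv (m [^] s g) \<otimes> inv (m [^] s h) = inv (m [^] s h) \<otimes> inv (m [^] s g)"
      proof -
        have "m [^] s g \<otimes> m [^] s h = m [^] s h \<otimes> m [^] s g" using m(1) by (simp add: nat_pow_mult add.commute)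
        then show ?thesis using m(1) by (metis inv_mult_group nat_pow_closed)
      qed
      ultimately show ?thesis using gh m(1) by (simp add: q_def r_def conjg_def word_simps)
    qed
    ultimately show "P (g \<otimes> h) ((s g + s h) mod N)" using N by (simp add: P_def mN)
  qed (use gh in auto)
  define j where "j g = (\<lambda>i\<in>{..<p}. m [^] i \<otimes> g \<otimes> inv (m [^] ((i + s g) mod p)), s g)" for g
  have j: "j \<in> hom G W"
  proof (rule homI)
    fix g h assume gh: "g \<in> carrier G" "h \<in> carrier G"
    show "j g \<in> carrier W" using gh(1) m(1) Ps[OF gh(1)] by (auto simp: j_def W_def P_def)
    have "m [^] i \<otimes> (g \<otimes> h) \<otimes> inv (m [^] ((i + (s g + s h) mod N) mod p))
        = m [^] i \<otimes> g \<otimes> inv (m [^] ((i + s g) mod p))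
          \<otimes> (m [^] ((i + s g) mod p) \<otimes> h \<otimes> inv (m [^] (((i + s g) mod p + s h) mod p)))" for i
    proof -
      have "(i + (s g + s h) mod N) mod p = ((i + s g) mod p + s h) mod p"
        using mod_add_mod_dvd[OF N(1)] by (simp add: mod_add_left_eq add.assoc)
      then show ?thesis using gh m(1) by (simp add: word_simps)
    qed
    then show "j (g \<otimes> h) = j g \<otimes>\<^bsub>W\<^esub> j h" unfolding j_def Wmult s_mult[OF gh] using p0 by (auto simp: fun_eq_iff)
  qed
  have "K_subnormal F {g \<in> carrier G. j g \<in> T} G" by (rule K_subnormal_preimage[OF G Wg j KT])
  moreover have "{g \<in> carrier G. j g \<in> T} = range (\<lambda>k::nat. m [^] k)"
  proof
    show "{g \<in> carrier G. j g \<in> T} \<subseteq> range (\<lambda>k::nat. m [^] k)"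
    proof
      fix g assume "g \<in> {g \<in> carrier G. j g \<in> T}"
      then have g: "g \<in> carrier G" "j g \<in> T" by auto
      then have "fst (j g) 0 \<in> M0" using p0 by (auto simp: T_def)
      then have "g \<otimes> inv (m [^] (s g mod p)) \<in> M0" using p0 g(1) by (simp add: j_def)
      then obtain k where k: "g \<otimes> inv (m [^] (s g mod p)) = m [^] (p * k)" by (auto simp: M0_def)
      have "g = g \<otimes> inv (m [^] (s g mod p)) \<otimes> m [^] (s g mod p)" using g(1) m(1) by (simp add: m_assoc)
      also have "\<dots> = m [^] (p * k + s g mod p)" unfolding k using m(1) by (simp add: nat_pow_mult)
      finally show "g \<in> range (\<lambda>k::nat. m [^] k)" by blast
    qed
    show "range (\<lambda>k::nat. m [^] k) \<subseteq> {g \<in> carrier G. j g \<in> T}"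
    proof
      fix g assume "g \<in> range (\<lambda>k::nat. m [^] k)"
      then obtain k where k: "g = m [^] (k::nat)" by blast
      have gc: "g \<in> carrier G" using k m(1) by simp
      have "P g (k mod N)" using N m(1) subgroup.one_closed[OF A.Qsub] by (simp add: P_def k mN)
      then have s: "s g = k mod N" using Puniq[OF Ps[OF gc]] gc by blast
      have "m [^] i \<otimes> g \<otimes> inv (m [^] ((i + s g) mod p)) \<in> M0" if "i < p" for i
      proof -
        define d where "d = i + s g"
        have "m [^] s g = g" unfolding s mN using k by simp
        then have "m [^] i \<otimes> g = m [^] d" using m(1) nat_pow_mult[of m i "s g"] by (simp add: d_def)
        also have "\<dots> = m [^] (p * (d div p)) \<otimes> m [^] (d mod p)" using m(1) by (simp add: nat_pow_mult)
        finally have "m [^] i \<otimes> g \<otimes> inv (m [^] (d mod p)) = m [^] (p * (d div p))"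
          using m(1) by (simp add: m_assoc)
        then show ?thesis unfolding d_def M0_def by blast
      qed
      then have "j g \<in> T" using hom_in_carrier[OF j gc] by (auto simp: T_def j_def)
      then show "g \<in> {g \<in> carrier G. j g \<in> T}" using gc by simp
    qed
  qed
  ultimately show ?thesis by simp
qed

end

section \<open>Maximal chains of length two\<close>

lemma (in group) range_pow:
  assumes "finite (carrier G)" "m \<in> carrier G"
  shows "generate G {m} = range (\<lambda>k::nat. m [^] k)"
  using generate_pow_on_finite_carrier[OF assms] by auto

lemma (in group) range_pow_subgroup:
  assumes "finite (carrier G)" "m \<in> carrier G"
  shows "subgroup (range (\<lambda>k::nat. m [^] k)) G"
  unfolding range_pow[OF assms, symmetric] using assms generate_is_subgroup by blast

lemma range_pow_mult:
  assumes "group G" "m \<in> carrier G"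
  shows "range (\<lambda>k::nat. m [^]\<^bsub>G\<^esub> (p * k)) = range (\<lambda>k::nat. (m [^]\<^bsub>G\<^esub> p) [^]\<^bsub>G\<^esub> k)"
  using monoid.nat_pow_pow[OF group.is_monoid[OF assms(1)] assms(2)] by simp

lemma (in group) commuting_mult:
  assumes "a \<in> carrier G" "b \<in> carrier G" "c \<in> carrier G" "d \<in> carrier G"
    and "a \<otimes> c = c \<otimes> a" "a \<otimes> d = d \<otimes> a" "b \<otimes> c = c \<otimes> b" "b \<otimes> d = d \<otimes> b"
  shows "(a \<otimes> b) \<otimes> (c \<otimes> d) = (c \<otimes> d) \<otimes> (a \<otimes> b)"
proof -
  have "(a \<otimes> b) \<otimes> (c \<otimes> d) = a \<otimes> (b \<otimes> c) \<otimes> d" using assms(1-4) by (simp add: m_assoc)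
  also have "\<dots> = (a \<otimes> c) \<otimes> (b \<otimes> d)" unfolding assms(7) using assms(1-4) by (simp add: m_assoc)
  also have "\<dots> = c \<otimes> (a \<otimes> d) \<otimes> b" unfolding assms(5,8) using assms(1-4) by (simp add: m_assoc)
  also have "\<dots> = (c \<otimes> d) \<otimes> (a \<otimes> b)" unfolding assms(6) using assms(1-4) by (simp add: m_assoc)
  finally show ?thesis .
qed

lemma (in group) coprime_powers_in_subgroup:
  assumes H: "subgroup H G" and x: "x \<in> carrier G"
    and "x [^] (a::nat) \<in> H" "x [^] (b::nat) \<in> H" "coprime a b"
  shows "x \<in> H"
proof (cases "a = 0")
  case True
  then show ?thesis using assms by simp
next
  case False
  obtain u v where "a * u = b * v + gcd a b" using bezout_nat[OF False] by blast
  then have "a * u = b * v + 1" using assms(5) by simp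
  then have e: "x [^] (a * u) = x [^] (b * v) \<otimes> x" using x by simp
  have "x [^] (a * u) \<in> H" "x [^] (b * v) \<in> H"
    using pow_in_subgroup[OF H assms(3), of u] pow_in_subgroup[OF H assms(4), of v] x by (simp_all add: nat_pow_pow)
  then have "inv (x [^] (b * v)) \<otimes> (x [^] (b * v) \<otimes> x) \<in> H"
    unfolding e[symmetric] using H by (simp add: subgroup.m_closed subgroup.m_inv_closed)
  then show ?thesis using x by (simp add: mult_inv_cancel)
qed

context lattice_formation
begin

text \<open>The group \<open>M\<close> has only one maximal subgroup \<open>X\<close>, as the join of two of them would be \<open>M\<close>. So an element
  outside of \<open>X\<close> generates \<open>M\<close>, and two different primes dividing its order would give two maximal
  subgroups.\<close>

lemma non_K_subnormal_cyclic:
  fixes G (structure)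
  assumes G: "group G" and fin: "finite (carrier G)" and M: "subgroup M G" "\<not> K_subnormal F M G"
    and max: "\<And>X. maximal_subgroup X (G\<lparr>carrier := M\<rparr>) \<Longrightarrow> K_subnormal F X G"
  shows "\<exists>m p n. m \<in> carrier G \<and> M = range (\<lambda>k::nat. m [^] k) \<and> Factorial_Ring.prime p \<and> n > 0
           \<and> group.ord G m = p ^ n \<and> maximal_subgroup (range (\<lambda>k::nat. m [^] (p * k))) (G\<lparr>carrier := M\<rparr>)"
proof -
  interpret group G by fact
  interpret M: subgroup M G by fact
  have gM: "group (G\<lparr>carrier := M\<rparr>)" using M(1) by (rule subgroup_imp_group)
  have finM: "finite (carrier (G\<lparr>carrier := M\<rparr>))" using fin_sub[OF M(1) fin] by simp
  have "M \<noteq> {\<one>}"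
  proof
    assume "M = {\<one>}"
    then have "M \<lhd> G" using one_is_normal by simp
    then show False using M K_subnormal_link[OF G] by blast
  qed
  note above = group.ex_maximal_above[OF gM finM, unfolded subgroup_in[OF M(1)], simplified]
  obtain X where X: "maximal_subgroup X (G\<lparr>carrier := M\<rparr>)"
    using above[of "{\<one>}"] triv_subgroup \<open>M \<noteq> {\<one>}\<close> by auto
  have XM: "subgroup X G" "X \<subseteq> M" "X \<noteq> M"
    using X unfolding maximal_subgroup_def subgroup_in[OF M(1)] by auto
  have uniq: "Y = X" if Y: "maximal_subgroup Y (G\<lparr>carrier := M\<rparr>)" for Y
  proof (rule ccontr)
    assume ne: "Y \<noteq> X"
    have YM: "subgroup Y G" "Y \<subseteq> M" "Y \<noteq> M"
      using Y unfolding maximal_subgroup_def subgroup_in[OF M(1)] by auto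
    define J where "J = generate G (X \<union> Y)"
    have "X \<union> Y \<subseteq> carrier G" using XM(2) YM(2) M.subset by blast
    then have J: "subgroup J G" "X \<subseteq> J" "Y \<subseteq> J" "J \<subseteq> M"
      unfolding J_def using generate_is_subgroup[of "X \<union> Y"] XM(2) YM(2)
        generate_subgroup_incl[of "X \<union> Y" M] M(1) by (auto intro: generate.incl)
    have "J = X \<or> J = M" using X J unfolding maximal_subgroup_def subgroup_in[OF M(1)] by auto
    moreover have "J = Y \<or> J = M" using Y J unfolding maximal_subgroup_def subgroup_in[OF M(1)] by auto
    ultimately have "J = M" using ne by blast
    then show False using K_subnormal_join[OF G fin max[OF X] max[OF Y]] M(2) by (simp add: J_def)
  qed
  have inX: "H \<subseteq> X" if "subgroup H G" "H \<subseteq> M" "H \<noteq> M" for H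
    using above[of H] that uniq by blast
  obtain m where m: "m \<in> M" "m \<notin> X" using XM by blast
  have mc: "m \<in> carrier G" using m by simp
  have Mm: "M = range (\<lambda>k::nat. m [^] k)"
  proof (rule ccontr)
    assume "M \<noteq> range (\<lambda>k::nat. m [^] k)"
    moreover have "range (\<lambda>k::nat. m [^] k) \<subseteq> M" using pow_in_subgroup[OF M(1) m(1)] by blast
    ultimately have "range (\<lambda>k::nat. m [^] k) \<subseteq> X" using inX range_pow_subgroup[OF fin mc] by blast
    moreover have "m [^] (1::nat) = m" using mc by simp
    ultimately show False using m(2) by (metis rangeI subsetD)
  qed
  define N where "N = ord m"
  have N0: "N > 0" unfolding N_def using ord_ge_1[OF fin mc] by simp
  have N1: "N \<noteq> 1"
  proof
    assume "N = 1"
    then have "m = \<one>" using ord_eq_1[OF mc] by (simp add: N_def)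
    then show False using m(2) subgroup.one_closed[OF XM(1)] by simp
  qed
  have pX: "m [^] r \<in> X" "range (\<lambda>k::nat. m [^] (r * k)) \<subseteq> X" if r: "Factorial_Ring.prime r" "r dvd N" for r
  proof -
    have s: "subgroup (range (\<lambda>k::nat. m [^] (r * k))) G"
      unfolding range_pow_mult[OF G mc] using range_pow_subgroup[OF fin] mc by simp
    have "m \<notin> range (\<lambda>k::nat. m [^] (r * k))"
    proof
      assume "m \<in> range (\<lambda>k::nat. m [^] (r * k))"
      then obtain k where "m = m [^] (r * k)" by blast
      then have "m [^] (1::nat) = m [^] (r * k)" using mc by simp
      then have "[1 = r * k] (mod N)" using pow_eq_pow_iff_cong[OF mc] unfolding N_def by blast
      then have "[1 = r * k] (mod r)" using r(2) cong_dvd_modulus_nat by blast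
      then have "r dvd 1" by (metis cong_dvd_iff dvd_triv_left)
      then show False using r(1) by simp
    qed
    then have "range (\<lambda>k::nat. m [^] (r * k)) \<noteq> M" using m(1) by blast
    moreover have "range (\<lambda>k::nat. m [^] (r * k)) \<subseteq> M" using Mm by blast
    ultimately show sub: "range (\<lambda>k::nat. m [^] (r * k)) \<subseteq> X" using inX s by blast
    have "m [^] (r * 1) \<in> X" using sub by blast
    then show "m [^] r \<in> X" by simp
  qed
  have gen: "m \<in> X" if "m [^] a \<in> X" "m [^] b \<in> X" "coprime a b" for a b :: nat
    by (rule coprime_powers_in_subgroup[OF XM(1) mc that])
  obtain p where p: "Factorial_Ring.prime p" "p dvd N" using prime_factor_nat[OF N1] by blast
  define n where "n = multiplicity p N"
  obtain N' where N': "N = p ^ n * N'" "\<not> p dvd N'"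
    using multiplicity_decompose'[of N p] N0 prime_gt_1_nat[OF p(1)] by (auto simp: n_def)
  have "N' = 1"
  proof (rule ccontr)
    assume "N' \<noteq> 1"
    then obtain q where q: "Factorial_Ring.prime q" "q dvd N'" using prime_factor_nat by blast
    have "q \<noteq> p" using q N' by blast
    then have "coprime p q" using p(1) q(1) by (simp add: primes_coprime)
    moreover have "q dvd N" using q(2) N'(1) by simp
    ultimately show False using gen[OF pX(1)[OF p] pX(1)[OF q(1)]] m(2) by blast
  qed
  then have Np: "N = p ^ n" using N' by simp
  then have n: "n > 0" using N1 by (cases n) auto
  have "X \<subseteq> range (\<lambda>k::nat. m [^] (p * k))"
  proof
    fix x assume x: "x \<in> X"
    then obtain a where a: "x = m [^] (a::nat)" using XM(2) Mm by blast
    have "p dvd a"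
    proof (rule ccontr)
      assume "\<not> p dvd a"
      then have "coprime p a" using prime_imp_coprime p(1) by blast
      then show False using gen[OF pX(1)[OF p]] x a m(2) by blast
    qed
    then show "x \<in> range (\<lambda>k::nat. m [^] (p * k))" using a by (auto elim!: dvdE)
  qed
  then have "X = range (\<lambda>k::nat. m [^] (p * k))" using pX(2)[OF p] by blast
  then show ?thesis using mc Mm p(1) n Np X unfolding N_def by blast
qed

lemma maximal_chain_2:
  assumes "every_maximal_chain_includes_K_subnormal F 2 G" "maximal_subgroup M G"
    "maximal_subgroup X (G\<lparr>carrier := M\<rparr>)"
  shows "K_subnormal F M G \<or> K_subnormal F X G"
proof -
  define C where "C i = (if i = 0 then carrier G else if i = 1 then M else X)" for i :: nat
  have "maximal_chain G 2 C"
    unfolding maximal_chain_def using assms(2,3) by (auto simp: C_def less_Suc_eq numeral_2_eq_2)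
  then obtain i where "1 \<le> i" "i \<le> 2" "K_subnormal F (C i) G"
    using assms(1) unfolding every_maximal_chain_includes_K_subnormal_def by blast
  moreover have "i = 1 \<or> i = 2" using calculation by auto
  ultimately show ?thesis by (auto simp: C_def)
qed

text \<open>Here \<open>G = QM\<close> with \<open>Q\<close> an abelian minimal normal subgroup and \<open>M = \<langle>m\<rangle>\<close> a cyclic \<open>p\<close>-group, and
  \<open>m\<^sup>p\<close> is central. A proper subgroup \<open>H\<close> that contains an element outside of \<open>Q\<langle>m\<^sup>p\<rangle>\<close> satisfies
  \<open>QH = G\<close>, hence \<open>H \<inter> Q = 1\<close> and \<open>H\<close> embeds in the abelian group \<open>G/Q\<close>; otherwise \<open>H\<close> lies in the
  abelian group \<open>Q\<langle>m\<^sup>p\<rangle>\<close>. The last conclusion gives the solubility of \<open>G\<close>.\<close>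

theorem maximal_chains_2_structure:
  fixes G (structure)
  assumes G: "group G" and fin: "finite (carrier G)" and notF: "\<not> in_class G F"
    and chains: "every_maximal_chain_includes_K_subnormal F 2 G"
  shows "\<not> nilpotent_group G"
    and "\<And>H x y. subgroup H G \<Longrightarrow> H \<noteq> carrier G \<Longrightarrow> x \<in> H \<Longrightarrow> y \<in> H \<Longrightarrow> x \<otimes> y = y \<otimes> x"
    and "\<exists>Q. Q \<lhd> G \<and> (\<forall>x\<in>Q. \<forall>y\<in>Q. x \<otimes> y = y \<otimes> x) \<and>
           (\<forall>x\<in>carrier G. \<forall>y\<in>carrier G. x \<otimes> y \<otimes> inv x \<otimes> inv y \<in> Q)"
proof -
  interpret group G by fact
  obtain M where M: "maximal_subgroup M G" "\<not> K_subnormal F M G"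
    using in_class_if_maximal_K_subnormal[OF G fin] notF by blast
  have MG: "subgroup M G" "M \<noteq> carrier G" using M(1) by (auto simp: maximal_subgroup_def)
  obtain m p n where m: "m \<in> carrier G" "M = range (\<lambda>k::nat. m [^] k)" "Factorial_Ring.prime p" "n > 0"
      "ord m = p ^ n" "maximal_subgroup (range (\<lambda>k::nat. m [^] (p * k))) (G\<lparr>carrier := M\<rparr>)"
    using non_K_subnormal_cyclic[OF G fin MG(1) M(2)] maximal_chain_2[OF chains M(1)] M(2) by blast
  have KM0: "K_subnormal F (range (\<lambda>k::nat. m [^] (p * k))) G"
    using maximal_chain_2[OF chains M(1) m(6)] M(2) by blast
  have nM: "\<not> M \<lhd> G" using K_subnormal_link[OF G MG(1)] M(2) by blast
  then show nonnil: "\<not> nilpotent_group G" using nilpotent_maximal_normal M(1) by blast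
  have Mcomm: "x \<otimes> y = y \<otimes> x" if xy: "x \<in> M" "y \<in> M" for x y
  proof -
    obtain a b where ab: "x = m [^] (a::nat)" "y = m [^] (b::nat)" using xy m(2) by blast
    show ?thesis unfolding ab using m(1) by (simp add: nat_pow_mult add.commute)
  qed
  have cardM: "card M = p ^ n" using generate_pow_card[OF m(1)] range_pow[OF fin m(1)] m(2,5) by simp
  obtain q b Q where q: "Factorial_Ring.prime q" "q \<noteq> p" and Q: "Q \<lhd> G" "card Q = q ^ b" "Q \<noteq> {\<one>}"
      "Q \<inter> M = {\<one>}" "Q <#> M = carrier G"
    using abelian_maximal_p_subgroup[OF fin M(1) nM Mcomm cardM m(3)] by blast
  have Qs: "subgroup Q G" using normal_imp_subgroup[OF Q(1)] .
  interpret Q: subgroup Q G by fact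
  have split: "\<exists>q\<in>Q. \<exists>a::nat. g = q \<otimes> m [^] a" if "g \<in> carrier G" for g
  proof -
    have "g \<in> Q <#> M" using Q(5) that by simp
    then show ?thesis unfolding set_mult_def m(2) by blast
  qed
  have meet: "m [^] a = \<one>" if "m [^] a \<in> Q" for a :: nat
    using that Q(4) m(2) by blast

  \<comment> \<open>for \<open>L\<close> normal, the subgroup \<open>LM\<close> is \<open>M\<close> or \<open>G\<close>, and \<open>L\<close> is determined by it as \<open>L = Q \<inter> LM\<close>\<close>
  have Qmin: "L = {\<one>} \<or> L = Q" if L: "L \<lhd> G" "L \<subseteq> Q" for L
  proof -
    note LM = subgroup_normal_mult[OF L(1) MG(1)]
    have one: "\<one> \<in> L" using normal_imp_subgroup[OF L(1)] subgroup.one_closed by blast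
    have "L <#> M = M \<or> L <#> M = carrier G" using M(1) LM unfolding maximal_subgroup_def by blast
    then show ?thesis
    proof
      assume "L <#> M = M"
      then have "L \<subseteq> Q \<inter> M" using LM(2) L(2) by blast
      then show ?thesis using Q(4) one by blast
    next
      assume e: "L <#> M = carrier G"
      have "x \<in> L" if x: "x \<in> Q" for x
      proof -
        have "x \<in> L <#> M" using e x by simp
        then obtain l k where lk: "l \<in> L" "k \<in> M" "x = l \<otimes> k" unfolding set_mult_def by blast
        have c: "l \<in> carrier G" "k \<in> carrier G" using lk L(2) Q.mem_carrier subgroup.mem_carrier[OF MG(1)] by auto
        have "inv l \<otimes> x \<in> Q" using lk(1) L(2) x by auto
        then have "k \<in> Q" using lk c by (simp add: mult_inv_cancel)
        then have "k = \<one>" using lk(2) Q(4) by blast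
        then show ?thesis using lk c by simp
      qed
      then show ?thesis using L(2) by blast
    qed
  qed
  have Qcomm: "x \<otimes> y = y \<otimes> x" if xy: "x \<in> Q" "y \<in> Q" for x y
  proof -
    have gQ: "group (G\<lparr>carrier := Q\<rparr>)" using Qs by (rule subgroup_imp_group)
    define Z where "Z = centre (G\<lparr>carrier := Q\<rparr>)"
    have Zin: "z \<in> Z \<longleftrightarrow> z \<in> Q \<and> (\<forall>g\<in>Q. g \<otimes> z = z \<otimes> g)" for z
      unfolding Z_def using group.centre_iff[OF gQ, of z] by simp
    have Zs: "subgroup Z G"
      using group.centre_normal[OF gQ] normal_imp_subgroup subgroup_in[OF Qs] unfolding Z_def by blast
    have "conjg G g z \<in> Z" if g: "g \<in> carrier G" and z: "z \<in> Z" for g z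
    proof -
      have zQ: "z \<in> Q" "z \<in> carrier G" using z Zin by auto
      have "h \<otimes> conjg G g z = conjg G g z \<otimes> h" if h: "h \<in> Q" for h
      proof -
        define h' where "h' = conjg G (inv g) h"
        have h': "h' \<in> Q" "h = conjg G g h'" "h' \<in> carrier G"
          using Q(1) g h by (auto simp: h'_def normal_iff)
        have "h' \<otimes> z = z \<otimes> h'" using z Zin h'(1) by blast
        then show ?thesis unfolding h'(2) using g h'(3) zQ by (simp add: conjg_mult[symmetric])
      qed
      moreover have "conjg G g z \<in> Q" using Q(1) g zQ by (simp add: normal_iff)
      ultimately show ?thesis using Zin by blast
    qed
    then have "Z \<lhd> G" using Zs by (simp add: normal_iff)
    moreover have "Z \<subseteq> Q" using Zin by blast
    moreover have "Z \<noteq> {\<one>}"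
      unfolding Z_def using group.p_group_centre_nontrivial[OF gQ _ _ q(1), of b] Q(2,3) fin_sub[OF Qs fin]
      by (simp add: order_sub)
    ultimately have "Z = Q" using Qmin by blast
    then show ?thesis using xy Zin by metis
  qed

  \<comment> \<open>otherwise the last noncentral term \<open>c\<close> of the sequence \<open>m\<^sup>p\<close>, \<open>(m\<^sup>p)\<^sup>p\<close>, ... acts on \<open>Q\<close> with
    order \<open>p\<close>, and its fixed points form a normal subgroup, trivial by minimality of \<open>Q\<close>\<close>
  have central: "m [^] (p * k) \<in> centre G" for k :: nat
  proof -
    have cs: "subgroup (centre G) G" using centre_normal normal_imp_subgroup by blast
    have "m [^] p \<in> centre G"
    proof (rule ccontr)
      assume np: "m [^] p \<notin> centre G"
      have ex: "\<exists>i. m [^] (p ^ i) \<in> centre G"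
        using m(1,5) pow_ord_eq_1[OF m(1)] subgroup.one_closed[OF cs] by (intro exI[of _ n]) simp
      define i where "i = (LEAST i. m [^] (p ^ i) \<in> centre G)"
      have i: "m [^] (p ^ i) \<in> centre G" unfolding i_def by (rule LeastI_ex[OF ex])
      have ilt: "m [^] (p ^ j) \<notin> centre G" if "j < i" for j
        using not_less_Least[of j "\<lambda>i. m [^] (p ^ i) \<in> centre G"] that unfolding i_def by simp
      have i0: "i \<noteq> 0"
      proof
        assume "i = 0"
        then have "m \<in> centre G" using i m(1) by simp
        then show False using np pow_in_subgroup[OF cs] by blast
      qed
      have i1: "i \<noteq> 1" using i np by (metis power_one_right)
      obtain l where l: "i = Suc (Suc l)" using i0 i1 by (metis One_nat_def old.nat.exhaust)
      define c where "c = m [^] (p * p ^ l)"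
      have cc: "c \<in> carrier G" using m(1) by (simp add: c_def)
      have c1: "c \<notin> centre G" using ilt[of "Suc l"] l by (simp add: c_def)
      have c2: "c [^] p \<in> centre G"
        using i m(1) by (simp add: c_def l nat_pow_pow mult.commute mult.left_commute)
      define C where "C = {x \<in> Q. conjg G c x = x}"
      have "C \<lhd> G"
      proof -
        have "subgroup C G"
        proof (rule subgroupI)
          have "\<one> \<in> C" using cc by (simp add: C_def)
          then show "C \<noteq> {}" by blast
        qed (use cc in \<open>auto simp: C_def conjg_mult conjg_inv\<close>)
        moreover have "conjg G g x \<in> C" if g: "g \<in> carrier G" and x: "x \<in> C" for g x
        proof -
          obtain u a where ua: "u \<in> Q" "g = u \<otimes> m [^] (a::nat)" using split[OF g] by blast
          have xQ: "x \<in> Q" "conjg G c x = x" using x by (auto simp: C_def)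
          define y where "y = conjg G (m [^] a) x"
          have y: "y \<in> Q" using Q(1) m(1) xQ by (simp add: y_def normal_iff)
          have cm: "c \<otimes> m [^] a = m [^] a \<otimes> c" unfolding c_def using m(1) by (simp add: nat_pow_mult add.commute)
          have "conjg G c y = conjg G (m [^] a) (conjg G c x)"
            unfolding y_def using cc m(1) Q.mem_carrier[OF xQ(1)] by (simp only: conjg_conjg[OF cc] conjg_conjg cm nat_pow_closed)
          then have cy: "conjg G c y = y" using xQ by (simp add: y_def)
          have "conjg G g x = conjg G u y" unfolding y_def ua(2) using ua(1) m(1) xQ by (simp add: conjg_conjg)
          also have "\<dots> = y" using Qcomm[OF ua(1) y] conjg_fixed_iff ua(1) y by simp
          finally show ?thesis using y cy by (simp add: C_def)
        qed
        ultimately show ?thesis by (simp add: normal_iff)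
      qed
      moreover have "C \<subseteq> Q" by (auto simp: C_def)
      moreover have "C \<noteq> Q"
      proof
        assume CQ: "C = Q"
        have "g \<otimes> c = c \<otimes> g" if g: "g \<in> carrier G" for g
        proof -
          obtain u a where ua: "u \<in> Q" "g = u \<otimes> m [^] (a::nat)" using split[OF g] by blast
          have uc: "u \<otimes> c = c \<otimes> u"
          proof -
            have "conjg G c u = u" using ua(1) CQ by (auto simp: C_def)
            then show ?thesis using conjg_fixed_iff[OF cc] ua(1) by simp
          qed
          have mcc: "m [^] a \<otimes> c = c \<otimes> m [^] a" unfolding c_def using m(1) by (simp add: nat_pow_mult add.commute)
          show ?thesis unfolding ua(2)
            using commuting_mult[of u "m [^] a" c \<one>] uc mcc ua(1) m(1) cc by simp
        qed
        then show False using c1 cc by (simp add: centre_iff)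
      qed
      ultimately have "C = {\<one>}" using Qmin by blast
      then have cfix: "x = \<one>" if "x \<in> Q" "conjg G c x = x" for x using that by (auto simp: C_def)
      have "K_subnormal F (range (\<lambda>k::nat. m [^] k)) G"
      proof (rule cyclic_complement_K_subnormal[OF G fin Q(1) Qcomm m(1) _ m(4) split meet _ m(3) _ c_def _ cfix KM0])
        show "m [^] (p ^ n) = \<one>" using pow_ord_eq_1[OF m(1)] m(5) by simp
        show "a mod p ^ n = b mod p ^ n" if "m [^] a = m [^] b" for a b :: nat
          using that pow_eq_pow_iff_cong[OF m(1)] m(5) by (simp add: cong_def)
        show "coprime p (card Q)" using q m(3) Q(2) by (simp add: primes_coprime)
        show "conjg G (c [^] p) x = x" if "x \<in> Q" for x
          using centre_commute[OF c2, of x] that cc conjg_fixed_iff[of "c [^] p" x] by simp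
      qed
      then show False using M(2) m(2) by simp
    qed
    then show ?thesis using pow_in_subgroup[OF cs, of "m [^] p" k] m(1) by (simp add: nat_pow_pow)
  qed

  have derived: "x \<otimes> y \<otimes> inv x \<otimes> inv y \<in> Q" if xy: "x \<in> carrier G" "y \<in> carrier G" for x y
  proof -
    obtain u a where ua: "u \<in> Q" "x = u \<otimes> m [^] (a::nat)" using split[OF xy(1)] by blast
    obtain v b where vb: "v \<in> Q" "y = v \<otimes> m [^] (b::nat)" using split[OF xy(2)] by blast
    have e: "m [^] a \<otimes> m [^] b = m [^] b \<otimes> m [^] a" using m(1) by (simp add: nat_pow_mult add.commute)
    define w where "w = u \<otimes> conjg G (m [^] a) v"
    define w' where "w' = v \<otimes> conjg G (m [^] b) u"
    have w: "w \<in> Q" "w' \<in> Q" using ua vb Q(1) m(1) by (auto simp: w_def w'_def normal_iff)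
    have 1: "x \<otimes> y = w \<otimes> (m [^] a \<otimes> m [^] b)"
      unfolding ua(2) vb(2) w_def using ua(1) vb(1) m(1) by (simp add: conjg_def word_simps)
    have 2: "y \<otimes> x = w' \<otimes> (m [^] b \<otimes> m [^] a)"
      unfolding ua(2) vb(2) w'_def using ua(1) vb(1) m(1) by (simp add: conjg_def word_simps)
    have "x \<otimes> y \<otimes> inv x \<otimes> inv y = (x \<otimes> y) \<otimes> inv (y \<otimes> x)" using xy by (simp add: inv_mult_group m_assoc)
    also have "\<dots> = w \<otimes> (m [^] a \<otimes> m [^] b) \<otimes> inv (w' \<otimes> (m [^] a \<otimes> m [^] b))" unfolding 1 2 e ..
    also have "\<dots> = w \<otimes> inv w'" using w m(1) by (simp add: word_simps)
    finally show ?thesis using w by simp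
  qed
  show "\<exists>Q. Q \<lhd> G \<and> (\<forall>x\<in>Q. \<forall>y\<in>Q. x \<otimes> y = y \<otimes> x) \<and>
           (\<forall>x\<in>carrier G. \<forall>y\<in>carrier G. x \<otimes> y \<otimes> inv x \<otimes> inv y \<in> Q)"
    using Q(1) Qcomm derived by blast

  show "x \<otimes> y = y \<otimes> x" if H: "subgroup H G" "H \<noteq> carrier G" and xy: "x \<in> H" "y \<in> H" for H x y
  proof -
    have c: "x \<in> carrier G" "y \<in> carrier G" using xy subgroup.mem_carrier[OF H(1)] by auto
    show ?thesis
    proof (cases "\<exists>u\<in>Q. \<exists>a::nat. u \<otimes> m [^] a \<in> H \<and> \<not> p dvd a")
      case True
      then obtain u a where u: "u \<in> Q" "u \<otimes> m [^] a \<in> H" "\<not> p dvd (a::nat)" by blast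
      note QH = subgroup_normal_mult[OF Q(1) H(1)]
      have QHG: "Q <#> H = carrier G"
      proof -
        have "inv u \<otimes> (u \<otimes> m [^] a) \<in> Q <#> H" using u unfolding set_mult_def by blast
        then have ma: "m [^] a \<in> Q <#> H" using u(1) m(1) by (simp add: mult_inv_cancel)
        have "coprime a (p ^ n)" using u(3) m(3) by (metis coprime_commute coprime_power_right_iff prime_imp_coprime)
        then obtain d where "[a * d = 1] (mod p ^ n)" using cong_solve_coprime_nat[of a "p ^ n"] by auto
        then have "m [^] (a * d) = m [^] (1::nat)" using pow_eq_pow_iff_cong[OF m(1)] unfolding m(5) by blast
        then have "m \<in> Q <#> H" using pow_in_subgroup[OF QH(1) ma, of d] m(1) by (simp add: nat_pow_pow)
        then have "m [^] k \<in> Q <#> H" for k :: nat using pow_in_subgroup[OF QH(1)] by blast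
        then have "g \<in> Q <#> H" if "g \<in> carrier G" for g
          using split[OF that] QH(2) subgroup.m_closed[OF QH(1)] by blast
        then show ?thesis using subgroup.subset[OF QH(1)] by blast
      qed
      have "H \<inter> Q \<lhd> G"
      proof -
        have "conjg G g z \<in> H \<inter> Q" if g: "g \<in> carrier G" and z: "z \<in> H \<inter> Q" for g z
        proof -
          have "g \<in> Q <#> H" using g QHG by simp
          then obtain v h where v: "v \<in> Q" "h \<in> H" "g = v \<otimes> h" unfolding set_mult_def by blast
          have hc: "h \<in> carrier G" using v(2) subgroup.mem_carrier[OF H(1)] by blast
          define z' where "z' = conjg G h z"
          have z': "z' \<in> H" "z' \<in> Q"
            using z v(2) hc Q(1) H(1) by (auto simp: z'_def conjg_def subgroup.m_closed subgroup.m_inv_closed)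
              (auto simp: normal_iff conjg_def)
          have "conjg G g z = conjg G v z'" unfolding z'_def v(3) using v(1) hc z by (simp add: conjg_conjg)
          also have "\<dots> = z'" using Qcomm[OF v(1) z'(2)] conjg_fixed_iff v(1) z'(2) by simp
          finally show ?thesis using z' by simp
        qed
        then show ?thesis using subgroup_Int[OF H(1) Qs] by (simp add: normal_iff)
      qed
      then have "H \<inter> Q = {\<one>} \<or> H \<inter> Q = Q" using Qmin by blast
      moreover have "H \<inter> Q \<noteq> Q"
      proof
        assume "H \<inter> Q = Q"
        then have "Q \<subseteq> H" by blast
        then have "g \<in> H" if "g \<in> Q <#> H" for g
          using that subgroup.m_closed[OF H(1)] unfolding set_mult_def by blast
        then show False using QHG H subgroup.subset[OF H(1)] by blast
      qed
      ultimately have HQ: "H \<inter> Q = {\<one>}" by blast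
      have "x \<otimes> y \<otimes> inv x \<otimes> inv y \<in> H"
        using xy H(1) by (simp add: subgroup.m_closed subgroup.m_inv_closed)
      then have "x \<otimes> y \<otimes> inv x \<otimes> inv y = \<one>" using derived[OF c] HQ by blast
      then have "x \<otimes> y \<otimes> inv (y \<otimes> x) = \<one>" using c by (simp add: inv_mult_group m_assoc)
      then have "x \<otimes> y = \<one> \<otimes> (y \<otimes> x)" using inv_solve_right'[of \<one> "x \<otimes> y" "y \<otimes> x"] c by simp
      then show ?thesis using c by simp
    next
      case False
      have form: "\<exists>u\<in>Q. \<exists>z\<in>centre G. h = u \<otimes> z" if h: "h \<in> H" for h
      proof -
        obtain u a where ua: "u \<in> Q" "h = u \<otimes> m [^] (a::nat)"
          using split subgroup.mem_carrier[OF H(1) h] by blast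
        then have "p dvd a" using False h by blast
        then obtain k where "a = p * k" by (elim dvdE)
        then show ?thesis using ua central by blast
      qed
      obtain u z where uz: "u \<in> Q" "z \<in> centre G" "x = u \<otimes> z" using form[OF xy(1)] by blast
      obtain v w where vw: "v \<in> Q" "w \<in> centre G" "y = v \<otimes> w" using form[OF xy(2)] by blast
      have cc: "z \<in> carrier G" "w \<in> carrier G" using uz vw by (auto simp: centre_def)
      show ?thesis unfolding uz(3) vw(3)
        using uz(1) vw(1) cc Qcomm[OF uz(1) vw(1)] centre_commute[OF vw(2), of u] centre_commute[OF uz(2), of v]
          centre_commute[OF vw(2), of z]
        by (intro commuting_mult) auto
    qed
  qed
qed

theorem maximal_chains_2_schmidt:
  assumes G: "group G" and fin: "finite (carrier G)" and notF: "\<not> in_class G F"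
    and chains: "every_maximal_chain_includes_K_subnormal F 2 G"
  shows "schmidt_group G" "abelian_sylow_subgroups G"
proof -
  interpret group G by fact
  note S = maximal_chains_2_structure[OF assms]
  have "nilpotent_group (G\<lparr>carrier := H\<rparr>)" if H: "subgroup H G" "H \<noteq> carrier G" for H
    using group.comm_group_nilpotent[OF subgroup_imp_group[OF H(1)]] S(2)[OF H] by simp
  then show "schmidt_group G" unfolding schmidt_group_def using G fin S(1) by blast
  show "abelian_sylow_subgroups G"
    unfolding abelian_sylow_subgroups_def sylow_subgroup_def
  proof (intro allI impI, elim conjE)
    fix p P assume P: "Factorial_Ring.prime p" "subgroup P G" "card P = p ^ multiplicity p (order G)"
    have "P \<noteq> carrier G"
    proof
      assume "P = carrier G"
      then have "order G = p ^ multiplicity p (order G)" using P(3) by (simp add: order_def)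
      then show False using p_group_nilpotent[OF fin _ P(1)] S(1) by blast
    qed
    then show "comm_group (G\<lparr>carrier := P\<rparr>)"
      using S(2)[OF P(2)] subgroup_imp_group[OF P(2)] by (intro group.group_comm_groupI) auto
  qed
qed

end

section \<open>Schmidt groups with abelian Sylow subgroups\<close>

lemma prime_power_decompose:
  assumes "(n::nat) \<noteq> 0" "Factorial_Ring.prime p"
  shows "\<exists>m. n = p ^ multiplicity p n * m \<and> \<not> p dvd m"
  using multiplicity_decompose'[of n p] assms by (metis not_prime_unit)

lemma not_Suc_multiplicity_dvd:
  assumes "(n::nat) \<noteq> 0" "Factorial_Ring.prime p"
  shows "\<not> p ^ Suc (multiplicity p n) dvd n"
  using power_dvd_iff_le_multiplicity[of n p "Suc (multiplicity p n)"] assms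
  by (metis Suc_n_not_le_n not_prime_unit)

lemma (in group) ex_sylow:
  assumes "finite (carrier G)" "subgroup H G" "Factorial_Ring.prime p"
  shows "\<exists>P m. subgroup P G \<and> P \<subseteq> H \<and> card P = p ^ multiplicity p (card H) \<and> card H = card P * m \<and> \<not> p dvd m"
proof -
  have H: "group (G\<lparr>carrier := H\<rparr>)" using subgroup_imp_group[OF assms(2)] .
  have fH: "finite H" "card H > 0" using fin_sub[OF assms(2,1)] card_pos[OF assms(2,1)] by auto
  have "card H \<noteq> 0" using fH(2) by linarith
  then obtain m where m: "card H = p ^ multiplicity p (card H) * m" "\<not> p dvd m"
    using prime_power_decompose[OF _ assms(3)] by blast
  obtain P where "subgroup P (G\<lparr>carrier := H\<rparr>)" "card P = p ^ multiplicity p (card H)"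
    using Sylow.sylow_thm[OF assms(3) H, of "multiplicity p (card H)" m] m(1) fH by (auto simp: order_sub)
  then show ?thesis using m subgroup_in[OF assms(2)] by metis
qed

lemma (in group) ex_sylow_group:
  assumes fin: "finite (carrier G)" and p: "Factorial_Ring.prime p"
  shows "\<exists>S. subgroup S G \<and> card S = p ^ multiplicity p (order G) \<and> \<not> p dvd card (rcosets S)"
proof -
  obtain S m where S: "subgroup S G" "card S = p ^ multiplicity p (card (carrier G))"
      "card (carrier G) = card S * m" "\<not> p dvd m"
    using ex_sylow[OF fin subgroup_self p] by blast
  have "card (rcosets S) * card S = m * card S" using lagrange[OF S(1)] S(3) by (simp add: order_def mult.commute)
  then have "card (rcosets S) = m" using card_pos[OF S(1) fin] by simp
  then show ?thesis using S(1,2,4) by (auto simp: order_def)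
qed

lemma (in group) contains_sylows_eq:
  assumes fin: "finite (carrier G)" and C: "subgroup C G"
    and syl: "\<And>r::nat. Factorial_Ring.prime r \<Longrightarrow> \<exists>R. subgroup R G \<and> R \<subseteq> C \<and> card R = r ^ multiplicity r (order G)"
  shows "C = carrier G"
proof -
  have "order G dvd card C"
  proof (rule multiplicity_le_imp_dvd)
    show "order G \<noteq> 0" using fin order_gt_0_iff_finite by simp
    fix r :: nat assume r: "Factorial_Ring.prime r"
    obtain R where R: "subgroup R G" "R \<subseteq> C" "card R = r ^ multiplicity r (order G)" using syl[OF r] by blast
    have "r ^ multiplicity r (order G) dvd card C" using card_sub_dvd[OF R(1) C R(2) fin] R(3) by simp
    then show "multiplicity r (order G) \<le> multiplicity r (card C)"
      using power_dvd_iff_le_multiplicity[of "card C" r] card_pos[OF C fin] r by (metis less_irrefl not_prime_unit)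
  qed
  then have "card (carrier G) \<le> card C" using card_pos[OF C fin] by (simp add: dvd_imp_le order_def)
  then show ?thesis using fin subgroup.subset[OF C] by (simp add: card_seteq)
qed

text \<open>If a Sylow subgroup were not normal, its normaliser would lie in a maximal subgroup, which is
  normal, contradicting the Frattini argument.\<close>

lemma (in group) nilpotent_sylow_normal:
  assumes nil: "nilpotent_group G" and fin: "finite (carrier G)" and p: "Factorial_Ring.prime p"
    and P: "subgroup P G" "card P = p ^ multiplicity p (order G)"
  shows "P \<lhd> G"
proof (rule ccontr)
  assume "\<not> P \<lhd> G"
  then have "normz G P \<noteq> carrier G" using normal_iff_normz[OF P(1)] by simp
  then obtain M where M: "maximal_subgroup M G" "normz G P \<subseteq> M"
    using ex_maximal_above[OF fin normz_subgroup(1)[OF P(1)]] by blast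
  have MG: "subgroup M G" "M \<noteq> carrier G" using M(1) by (auto simp: maximal_subgroup_def)
  have Mn: "M \<lhd> G" using nilpotent_maximal_normal[OF nil M(1)] .
  have PM: "P \<subseteq> M" using normz_subgroup(2)[OF P(1)] M(2) by blast
  obtain m where m: "card M = card P * m" using card_sub_dvd[OF P(1) MG(1) PM fin] by (elim dvdE)
  have "\<not> p dvd m"
  proof
    assume "p dvd m"
    then have "p ^ Suc (multiplicity p (order G)) dvd card M" unfolding m P(2) by (simp add: mult_dvd_mono)
    moreover have "card M dvd order G" using card_sub_dvd[OF MG(1) subgroup_self _ fin] subgroup.subset[OF MG(1)]
      by (simp add: order_def)
    ultimately have "p ^ Suc (multiplicity p (order G)) dvd order G" by (rule dvd_trans)
    then show False
      using not_Suc_multiplicity_dvd[OF _ p] fin order_gt_0_iff_finite by (metis less_irrefl)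
  qed
  then have "g \<in> M" if "g \<in> carrier G" for g
    using frattini_argument[OF fin Mn P(1) PM P(2) p m _ that] M(2) subgroup.m_closed[OF MG(1)] by blast
  then show False using MG subgroup.subset[OF MG(1)] by blast
qed

text \<open>Sylow subgroups for different primes commute, being normal with trivial intersection; so the centraliser of
  an element of a Sylow subgroup contains Sylow subgroups for all primes.\<close>

lemma (in group) nilpotent_abelian_sylows_commute:
  assumes nil: "nilpotent_group G" and fin: "finite (carrier G)"
    and ab: "\<And>p P x y. Factorial_Ring.prime p \<Longrightarrow> subgroup P G \<Longrightarrow> card P = p ^ multiplicity p (order G) \<Longrightarrow>
      x \<in> P \<Longrightarrow> y \<in> P \<Longrightarrow> x \<otimes> y = y \<otimes> x"
    and xy: "x \<in> carrier G" "y \<in> carrier G"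
  shows "x \<otimes> y = y \<otimes> x"
proof -
  have ex: "\<exists>R. subgroup R G \<and> card R = r ^ multiplicity r (order G)" if "Factorial_Ring.prime r" for r :: nat
    using ex_sylow_group[OF fin that] by blast
  have cent: "P \<subseteq> centre G" if P: "Factorial_Ring.prime p" "subgroup P G" "card P = p ^ multiplicity p (order G)" for p P
  proof
    fix x assume x: "x \<in> P"
    have xc: "x \<in> carrier G" using x subgroup.mem_carrier[OF P(2)] by blast
    define C where "C = {g \<in> carrier G. \<forall>z\<in>{x}. g \<otimes> z = z \<otimes> g}"
    have C: "subgroup C G" unfolding C_def by (rule centralizer_subgroup) (use xc in auto)
    have "C = carrier G"
    proof (rule contains_sylows_eq[OF fin C])
      fix r :: nat assume r: "Factorial_Ring.prime r"
      obtain R where R: "subgroup R G" "card R = r ^ multiplicity r (order G)" using ex[OF r] by blast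
      show "\<exists>R. subgroup R G \<and> R \<subseteq> C \<and> card R = r ^ multiplicity r (order G)"
      proof (cases "r = p")
        case True
        have "P \<subseteq> C" using ab[OF P _ x] subgroup.mem_carrier[OF P(2)] by (auto simp: C_def)
        then show ?thesis using P True by blast
      next
        case False
        have n: "P \<lhd> G" "R \<lhd> G"
          using nilpotent_sylow_normal[OF nil fin] P r R by blast+
        have int: "P \<inter> R = {\<one>}"
          using coprime_subgroups_Int[OF fin P(2) R(1)] P(1,3) R(2) r False by (simp add: primes_coprime)
        have "y \<otimes> x = x \<otimes> y" if y: "y \<in> R" for y
        proof -
          have yc: "y \<in> carrier G" using y subgroup.mem_carrier[OF R(1)] by blast
          have "conjg G y x \<otimes> inv x \<in> P" using n(1) x yc P(2)
            by (simp add: normal_iff subgroup.m_closed subgroup.m_inv_closed)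
          moreover have "y \<otimes> conjg G x (inv y) \<in> R" using n(2) y xc R(1)
            by (simp add: normal_iff subgroup.m_closed subgroup.m_inv_closed)
          moreover have "y \<otimes> conjg G x (inv y) = conjg G y x \<otimes> inv x"
            using xc yc by (simp add: conjg_def word_simps)
          ultimately have "conjg G y x \<otimes> inv x = \<one>" using int by auto
          then have "conjg G y x = \<one> \<otimes> x" using inv_solve_right'[of \<one> "conjg G y x" x] xc yc by simp
          then show ?thesis using conjg_fixed_iff[OF yc xc] xc by simp
        qed
        then have "R \<subseteq> C" using subgroup.mem_carrier[OF R(1)] by (auto simp: C_def)
        then show ?thesis using R by blast
      qed
    qed
    then show "x \<in> centre G" using xc unfolding centre_iff C_def by auto
  qed
  have "centre G = carrier G"
  proof (rule contains_sylows_eq[OF fin normal_imp_subgroup[OF centre_normal]])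
    fix r :: nat assume r: "Factorial_Ring.prime r"
    then obtain R where "subgroup R G" "card R = r ^ multiplicity r (order G)" using ex by metis
    then show "\<exists>R. subgroup R G \<and> R \<subseteq> centre G \<and> card R = r ^ multiplicity r (order G)"
      using cent[OF r] by metis
  qed
  then have "y \<in> centre G" using xy by simp
  then show ?thesis using centre_commute xy(1) by blast
qed

lemma (in group) abelian_sylow_p_subgroup_commute:
  assumes fin: "finite (carrier G)" and ab: "abelian_sylow_subgroups G"
    and P: "subgroup P G" "card P = p ^ n" "Factorial_Ring.prime p" and xy: "x \<in> P" "y \<in> P"
  shows "x \<otimes> y = y \<otimes> x"
proof -
  obtain S where S: "subgroup S G" "card S = p ^ multiplicity p (order G)" "\<not> p dvd card (rcosets S)"
    using ex_sylow_group[OF fin P(3)] by blast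
  obtain g where g: "g \<in> carrier G" "conjg G g ` P \<subseteq> S"
    using sylow_contains_conjugate[OF fin P S(1,3)] by blast
  have c: "x \<in> carrier G" "y \<in> carrier G" using xy subgroup.mem_carrier[OF P(1)] by auto
  have "comm_group (G\<lparr>carrier := S\<rparr>)"
    using ab S P(3) unfolding abelian_sylow_subgroups_def sylow_subgroup_def by blast
  then have "conjg G g x \<otimes> conjg G g y = conjg G g y \<otimes> conjg G g x"
    using comm_groupE(4)[of "G\<lparr>carrier := S\<rparr>" "conjg G g x" "conjg G g y"] g(2) xy by auto
  then have "conjg G g (x \<otimes> y) = conjg G g (y \<otimes> x)" using g(1) c by (simp add: conjg_mult)
  then show ?thesis using inj_onD[OF inj_conjg[OF g(1)]] c by simp
qed

lemma (in group) schmidt_abelian_sylow_proper_commute: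
  assumes "schmidt_group G" "abelian_sylow_subgroups G" and H: "subgroup H G" "H \<noteq> carrier G"
    and xy: "x \<in> H" "y \<in> H"
  shows "x \<otimes> y = y \<otimes> x"
proof -
  have fin: "finite (carrier G)" using assms(1) by (simp add: schmidt_group_def)
  interpret H: group "G\<lparr>carrier := H\<rparr>" using subgroup_imp_group[OF H(1)] .
  have nil: "nilpotent_group (G\<lparr>carrier := H\<rparr>)" using assms(1) H by (simp add: schmidt_group_def)
  have finH: "finite (carrier (G\<lparr>carrier := H\<rparr>))" using fin_sub[OF H(1) fin] by simp
  have comm: "a \<otimes>\<^bsub>G\<lparr>carrier := H\<rparr>\<^esub> b = b \<otimes>\<^bsub>G\<lparr>carrier := H\<rparr>\<^esub> a"
    if "Factorial_Ring.prime p" "subgroup P (G\<lparr>carrier := H\<rparr>)" "card P = p ^ multiplicity p (order (G\<lparr>carrier := H\<rparr>))"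
      "a \<in> P" "b \<in> P" for p P a b
    using abelian_sylow_p_subgroup_commute[OF fin assms(2) _ that(3,1,4,5)] that(2) subgroup_in[OF H(1)] by simp
  have "x \<otimes>\<^bsub>G\<lparr>carrier := H\<rparr>\<^esub> y = y \<otimes>\<^bsub>G\<lparr>carrier := H\<rparr>\<^esub> x"
    by (rule H.nilpotent_abelian_sylows_commute[OF nil finH comm]) (use xy in simp_all)
  then show ?thesis by simp
qed

text \<open>If \<open>t\<close> is the order of \<open>x\<close> modulo \<open>Z\<close>, the power \<open>x\<^sup>t\<^sup>/\<^sup>r\<close> has prime order \<open>r\<close> modulo \<open>Z\<close>. A further power
  with an exponent prime to \<open>r\<close> makes its order a power of \<open>r\<close> and keeps it outside of \<open>Z\<close>.\<close>

lemma (in group) ex_power_prime_order_modulo: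
  assumes fin: "finite (carrier G)" and Z: "subgroup Z G" and x: "x \<in> carrier G" "x \<notin> Z"
  shows "\<exists>r a b e. Factorial_Ring.prime r \<and> order G = r ^ a * b \<and> \<not> r dvd b \<and> x [^] (e::nat) \<notin> Z
    \<and> (x [^] e) [^] r \<in> Z \<and> (x [^] e) [^] (r ^ a) = \<one>"
proof -
  have o: "order G > 0" "x [^] order G = \<one>" using fin order_gt_0_iff_finite pow_order_eq_1[OF x(1)] by auto
  have ex: "\<exists>t. t > 0 \<and> x [^] (t::nat) \<in> Z" using o subgroup.one_closed[OF Z] by (intro exI[of _ "order G"]) simp
  define t where "t = (LEAST t. t > 0 \<and> x [^] (t::nat) \<in> Z)"
  have t: "t > 0" "x [^] t \<in> Z" unfolding t_def using LeastI_ex[OF ex] by auto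
  have tmin: "\<not> (k > 0 \<and> x [^] k \<in> Z)" if "k < t" for k using not_less_Least that unfolding t_def by blast
  have "t \<noteq> 1" using t x by auto
  then obtain r where r: "Factorial_Ring.prime r" "r dvd t" using prime_factor_nat by blast
  obtain d where d: "t = r * d" using r(2) by (elim dvdE)
  have d0: "d > 0" "d < t" using d t(1) prime_gt_1_nat[OF r(1)] by auto
  define a where "a = multiplicity r (order G)"
  obtain b where b: "order G = r ^ a * b" "\<not> r dvd b"
    using prime_power_decompose[OF _ r(1), of "order G"] o(1) by (auto simp: a_def)
  have y: "x [^] d \<notin> Z" "(x [^] d) [^] r \<in> Z"
    using tmin[OF d0(2)] d0(1) t(2) x(1) d by (simp_all add: nat_pow_pow mult.commute)
  have c: "coprime b r" using b(2) r(1) by (metis coprime_commute prime_imp_coprime)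
  have "x [^] (d * b) \<notin> Z"
  proof
    assume "x [^] (d * b) \<in> Z"
    then have "(x [^] d) [^] b \<in> Z" using x(1) by (simp add: nat_pow_pow)
    then show False using coprime_powers_in_subgroup[OF Z _ _ y(2) c] y(1) x(1) by blast
  qed
  moreover have "(x [^] (d * b)) [^] r \<in> Z"
  proof -
    have "(x [^] (d * b)) [^] r = ((x [^] d) [^] r) [^] b" using x(1) by (simp add: nat_pow_pow ac_simps)
    then show ?thesis using pow_in_subgroup[OF Z y(2)] by simp
  qed
  moreover have "(x [^] (d * b)) [^] (r ^ a) = \<one>"
  proof -
    have "(x [^] (d * b)) [^] (r ^ a) = (x [^] order G) [^] d" using x(1) by (simp add: nat_pow_pow b(1) ac_simps)
    then show ?thesis using o(2) by simp
  qed
  ultimately show ?thesis using r(1) b by blast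
qed

text \<open>Let \<open>V\<close> be the transfer into \<open>M\<close>, which is a power map on \<open>M\<close>, and \<open>K\<close> the preimage of the centre \<open>Z\<close>. The
  index of \<open>M\<close> is prime to the order of \<open>M/Z\<close>, so \<open>K \<inter> M = Z\<close>; moreover \<open>G = KM\<close>, and \<open>K\<close> is abelian.
  A subgroup \<open>Y\<close> with \<open>Z \<le> Y < M\<close> commutes with \<open>M\<close> and, as \<open>KY\<close> is a proper subgroup, with \<open>K\<close>; so
  \<open>Y = Z\<close>, and \<open>Z\<close> is maximal in \<open>M\<close>. It remains to exclude maximal subgroups \<open>X\<close> of \<open>M\<close> that do not
  contain \<open>Z\<close>. For an \<open>r\<close>-element \<open>y\<close> in \<open>X\<close> but not in \<open>Z\<close>, the set \<open>D\<close> of commutators of \<open>y\<close> with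
  elements of \<open>K\<close> is a normal subgroup that meets \<open>Z\<close> trivially and satisfies \<open>D\<langle>y\<rangle> = G\<close>. Then
  \<open>M = \<langle>y\<rangle>\<close> is contained in \<open>X\<close>.\<close>

theorem (in group) minimal_nonabelian_second_maximal_central:
  assumes fin: "finite (carrier G)" and ab: "abelian_sylow_subgroups G"
    and proper: "\<And>H x y. subgroup H G \<Longrightarrow> H \<noteq> carrier G \<Longrightarrow> x \<in> H \<Longrightarrow> y \<in> H \<Longrightarrow> x \<otimes> y = y \<otimes> x"
    and M: "maximal_subgroup M G" "\<not> M \<lhd> G" and X: "maximal_subgroup X (G\<lparr>carrier := M\<rparr>)"
  shows "X = centre G"
proof -
  have MG: "subgroup M G" "M \<noteq> carrier G" using M(1) by (auto simp: maximal_subgroup_def)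
  interpret M: subgroup M G by fact
  define Z where "Z = centre G"
  have Zn: "Z \<lhd> G" unfolding Z_def by (rule centre_normal)
  have Zs: "subgroup Z G" using normal_imp_subgroup[OF Zn] .
  have Mcomm: "x \<otimes> y = y \<otimes> x" if "x \<in> M" "y \<in> M" for x y using proper[OF MG that] .
  have ZM: "Z \<subseteq> M"
  proof
    fix z assume z: "z \<in> Z"
    have zc: "z \<in> carrier G" using z subgroup.mem_carrier[OF Zs] by blast
    have "conjg G z x = x" if "x \<in> M" for x
      using centre_commute[of z x] z that conjg_fixed_iff[OF zc] by (simp add: Z_def)
    then have "conjg G z ` M \<subseteq> M" by auto
    then have "z \<in> normz G M" using fin_sub[OF MG(1) fin] zc by (intro normzI) auto
    then show "z \<in> M" using maximal_not_normal_normz[OF M] by simp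
  qed
  have MZ: "M \<noteq> Z" using Zn M(2) by blast
  interpret T: abelian_subgroup_transfer G M
    using fin MG(1) Mcomm unfolding abelian_subgroup_transfer_def abelian_subgroup_transfer_axioms_def by auto
  define V where "V = transfer G M"
  define n where "n = card (rcosets M)"
  interpret V: group_hom G "G\<lparr>carrier := M\<rparr>" V
    using is_group T.PG.group_axioms T.transfer_hom unfolding V_def by (rule group_homI)
  have Vx: "V x = x [^] n" if "x \<in> M" for x
    unfolding V_def n_def
    using T.transfer_eq_power[OF that] abelian_maximal_no_fusion[OF fin M Mcomm] by blast
  define K where "K = {g \<in> carrier G. V g \<in> Z}"
  have "subgroup Z (G\<lparr>carrier := M\<rparr>)" using Zs ZM subgroup_in[OF MG(1)] by blast
  then have "Z \<lhd> G\<lparr>carrier := M\<rparr>" by (rule T.PG.subgroup_imp_normal)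
  then have Kn: "K \<lhd> G" unfolding K_def by (rule V.preimage_normal)
  have Ks: "subgroup K G" using normal_imp_subgroup[OF Kn] .
  have ndvd: "\<not> r dvd n" if x: "x \<in> M" "x \<notin> Z" and r: "Factorial_Ring.prime r" "x [^] (r ^ a) = \<one>" for x r and a :: nat
  proof -
    have xc: "x \<in> carrier G" using x by simp
    have "ord x dvd r ^ a" using pow_eq_id[OF xc] r(2) by simp
    then obtain i where i: "ord x = r ^ i" using r(1) by (meson divides_primepow_nat)
    have s: "subgroup (generate G {x}) G" using xc by (intro generate_is_subgroup) simp
    have "generate G {x} \<subseteq> M" using x MG(1) by (intro generate_subgroup_incl) auto
    moreover have "\<not> generate G {x} \<subseteq> centre G" using x(2) generate.incl[of x "{x}" G] by (auto simp: Z_def)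
    moreover have "card (generate G {x}) = r ^ i" using generate_pow_card[OF xc] i by simp
    ultimately show ?thesis
      unfolding n_def using abelian_maximal_index[OF fin M Mcomm s] r(1) by blast
  qed
  have KM: "K \<inter> M = Z"
  proof
    show "Z \<subseteq> K \<inter> M"
      using ZM Vx pow_in_subgroup[OF Zs] M.mem_carrier by (auto simp: K_def)
    show "K \<inter> M \<subseteq> Z"
    proof
      fix x assume x: "x \<in> K \<inter> M"
      then have xn: "x [^] n \<in> Z" and xc: "x \<in> carrier G" using Vx[of x] by (auto simp: K_def)
      show "x \<in> Z"
      proof (rule ccontr)
        assume xZ: "x \<notin> Z"
        obtain r a b e where r: "Factorial_Ring.prime r" "order G = r ^ a * b" "\<not> r dvd b" "x [^] (e::nat) \<notin> Z"
          "(x [^] e) [^] r \<in> Z" "(x [^] e) [^] (r ^ a) = \<one>"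
          using ex_power_prime_order_modulo[OF fin Zs xc xZ] by blast
        have eM: "x [^] e \<in> M" using x pow_in_subgroup[OF MG(1)] by blast
        have "coprime r n" using ndvd[OF eM r(4,1,6)] r(1) prime_imp_coprime by blast
        moreover have "(x [^] e) [^] n \<in> Z"
        proof -
          have "(x [^] e) [^] n = (x [^] n) [^] e" using xc by (simp add: nat_pow_pow mult.commute)
          then show ?thesis using pow_in_subgroup[OF Zs xn] by simp
        qed
        ultimately show False using coprime_powers_in_subgroup[OF Zs _ r(5)] r(4) xc by blast
      qed
    qed
  qed
  have derived: "g \<otimes> h \<otimes> inv g \<otimes> inv h \<in> K" if gh: "g \<in> carrier G" "h \<in> carrier G" for g h
  proof -
    have Vc: "V g \<in> carrier G" "V h \<in> carrier G" "V g \<otimes> V h = V h \<otimes> V g"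
      using V.hom_closed[OF gh(1)] V.hom_closed[OF gh(2)] Mcomm by auto
    have "V (g \<otimes> h) = V (h \<otimes> g)" using V.hom_mult[OF gh] V.hom_mult[OF gh(2,1)] Vc by simp
    moreover have "g \<otimes> h \<otimes> inv g \<otimes> inv h = (g \<otimes> h) \<otimes> inv (h \<otimes> g)" using gh by (simp add: inv_mult_group m_assoc)
    ultimately have "V (g \<otimes> h \<otimes> inv g \<otimes> inv h) = V (h \<otimes> g) \<otimes>\<^bsub>G\<lparr>carrier := M\<rparr>\<^esub> inv\<^bsub>G\<lparr>carrier := M\<rparr>\<^esub> V (h \<otimes> g)"
      using V.hom_mult[of "g \<otimes> h" "inv (h \<otimes> g)"] V.hom_inv[of "h \<otimes> g"] gh by simp
    also have "\<dots> = \<one>\<^bsub>G\<lparr>carrier := M\<rparr>\<^esub>" by (rule T.PG.r_inv) (use V.hom_closed gh in blast)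
    finally show ?thesis using gh subgroup.one_closed[OF Zs] by (simp add: K_def)
  qed
  have "\<not> K \<subseteq> M"
  proof
    assume KsM: "K \<subseteq> M"
    have "conjg G g h \<in> M" if gh: "g \<in> carrier G" "h \<in> M" for g h
    proof -
      have "g \<otimes> h \<otimes> inv g \<otimes> inv h \<in> M" using derived[of g h] gh KsM by auto
      then have "g \<otimes> h \<otimes> inv g \<otimes> inv h \<otimes> h \<in> M" using gh by auto
      then show ?thesis using gh by (simp add: conjg_def m_assoc)
    qed
    then show False using M(2) MG(1) by (simp add: normal_iff)
  qed
  then have KMG: "K <#> M = carrier G"
    using M(1) subgroup_normal_mult[OF Kn MG(1)] unfolding maximal_subgroup_def by blast
  have "K \<noteq> carrier G" using KM MZ M.subset by blast
  then have Kcomm: "x \<otimes> y = y \<otimes> x" if "x \<in> K" "y \<in> K" for x y using proper[OF Ks _ that] by blast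
  have Kc: "k \<in> carrier G" if "k \<in> K" for k using subgroup.mem_carrier[OF Ks that] .
  have central: "y \<in> Z" if y: "y \<in> M" "\<And>k. k \<in> K \<Longrightarrow> k \<otimes> y = y \<otimes> k" for y
  proof -
    have "g \<otimes> y = y \<otimes> g" if g: "g \<in> carrier G" for g
    proof -
      have "g \<in> K <#> M" using g KMG by simp
      then obtain k m where km: "k \<in> K" "m \<in> M" "g = k \<otimes> m" unfolding set_mult_def by blast
      then show ?thesis using commuting_mult[of k m y \<one>] y(2)[OF km(1)] Mcomm[OF km(2) y(1)] y(1) Kc by simp
    qed
    then show ?thesis using y(1) by (simp add: Z_def centre_iff)
  qed
  have between: "Y \<subseteq> Z" if Y: "subgroup Y G" "Z \<subseteq> Y" "Y \<subseteq> M" "Y \<noteq> M" for Y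
  proof
    fix y assume y: "y \<in> Y"
    note KY = subgroup_normal_mult[OF Kn Y(1)]
    have "K <#> Y \<noteq> carrier G"
    proof
      assume e: "K <#> Y = carrier G"
      have "m \<in> Y" if m: "m \<in> M" for m
      proof -
        have "m \<in> K <#> Y" using e m by simp
        then obtain k y where ky: "k \<in> K" "y \<in> Y" "m = k \<otimes> y" unfolding set_mult_def by blast
        have yM: "y \<in> M" using ky Y(3) by blast
        have "k = m \<otimes> inv y" using ky Kc yM by (simp add: m_assoc)
        then have "k \<in> M" using m yM by simp
        then have "k \<in> Y" using ky KM Y(2) by blast
        then show ?thesis using ky subgroup.m_closed[OF Y(1)] by simp
      qed
      then show False using Y by blast
    qed
    then have "k \<otimes> y = y \<otimes> k" if "k \<in> K" for k
      using proper[OF KY(1), of k y] KY(2,3) that y by blast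
    then show "y \<in> Z" using central y Y(3) by blast
  qed
  have XM: "subgroup X G" "X \<subseteq> M" "X \<noteq> M"
    using X unfolding maximal_subgroup_def subgroup_in[OF MG(1)] by auto
  have "Z \<subseteq> X"
  proof (rule ccontr)
    assume ZX: "\<not> Z \<subseteq> X"
    have "\<not> X \<subseteq> Z"
    proof
      assume "X \<subseteq> Z"
      then have "Z = X \<or> Z = M" using X Zs ZM unfolding maximal_subgroup_def subgroup_in[OF MG(1)] by auto
      then show False using ZX MZ by blast
    qed
    then obtain y0 where y0: "y0 \<in> X" "y0 \<notin> Z" by blast
    have y0c: "y0 \<in> carrier G" using y0 XM(2) by auto
    obtain r a b e where r: "Factorial_Ring.prime r" "order G = r ^ a * b" "\<not> r dvd b" "y0 [^] (e::nat) \<notin> Z"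
      "(y0 [^] e) [^] r \<in> Z" "(y0 [^] e) [^] (r ^ a) = \<one>"
      using ex_power_prime_order_modulo[OF fin Zs y0c y0(2)] by blast
    define y where "y = y0 [^] e"
    have y: "y \<in> X" "y \<in> M" "y \<in> carrier G" "y \<notin> Z" "y [^] r \<in> Z" "y [^] (r ^ a) = \<one>"
      using pow_in_subgroup[OF XM(1) y0(1), of e] XM(2) r(4-6) by (auto simp: y_def)
    define U where "U = range (\<lambda>k::nat. y [^] k)"
    have U: "subgroup U G" "U \<subseteq> X" "y \<in> U"
    proof -
      show "subgroup U G" unfolding U_def by (rule range_pow_subgroup[OF fin y(3)])
      show "U \<subseteq> X" unfolding U_def using pow_in_subgroup[OF XM(1) y(1)] by blast
      have "y = y [^] (1::nat)" using y(3) by simp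
      then show "y \<in> U" unfolding U_def by blast
    qed

    \<comment> \<open>\<open>M = Z\<langle>y\<rangle>\<close>, since no subgroup lies strictly between \<open>Z\<close> and \<open>M\<close>; so \<open>K\<langle>y\<rangle>\<close> contains \<open>M\<close>\<close>
    have KU: "K <#> U = carrier G"
    proof -
      note ZU = subgroup_normal_mult[OF Zn U(1)] and KU = subgroup_normal_mult[OF Kn U(1)]
      have "Z <#> U \<subseteq> M" using ZM U(2) XM(2) unfolding set_mult_def by auto
      moreover have "\<not> Z <#> U \<subseteq> Z" using ZU(3) U(3) y(4) by blast
      ultimately have ZUM: "Z <#> U = M" using between[OF ZU(1,2)] by blast
      have "M \<subseteq> K <#> U" unfolding ZUM[symmetric] using KM by (intro mono_set_mult) auto
      then have "K <#> U = M \<or> K <#> U = carrier G" using M(1) KU(1) unfolding maximal_subgroup_def by blast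
      then show ?thesis using KU(2) \<open>\<not> K \<subseteq> M\<close> by blast
    qed
    have form: "\<exists>k\<in>K. \<exists>i::nat. g = k \<otimes> y [^] i" if "g \<in> carrier G" for g
    proof -
      have "g \<in> K <#> U" using KU that by simp
      then show ?thesis unfolding set_mult_def U_def by blast
    qed
    have conjK: "conjg G g k \<in> K" if "g \<in> carrier G" "k \<in> K" for g k using Kn that by (simp add: normal_iff)
    have fixK: "conjg G k k' = k'" if "k \<in> K" "k' \<in> K" for k k'
      using Kcomm[OF that] conjg_fixed_iff Kc that by blast

    \<comment> \<open>a Sylow \<open>r\<close>-subgroup \<open>S\<close> containing \<open>y\<close> contains the \<open>r\<close>-elements of \<open>K\<close>, as \<open>K\<close> and \<open>y\<close>
      generate \<open>G\<close>, and it is abelian\<close>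
    have rpart: "conjg G y k = k" if k: "k \<in> K" "k [^] (r ^ a) = \<one>" for k
    proof -
      obtain S0 where S0: "subgroup S0 G" "card S0 = r ^ multiplicity r (order G)" "\<not> r dvd card (rcosets S0)"
        using ex_sylow_group[OF fin r(1)] by blast
      have into: "\<exists>g\<in>carrier G. conjg G g x \<in> S0" if x: "x \<in> carrier G" "x [^] (r ^ a) = \<one>" for x
      proof -
        have "ord x dvd r ^ a" using pow_eq_id[OF x(1)] x(2) by simp
        then obtain i where i: "ord x = r ^ i" using r(1) by (meson divides_primepow_nat)
        have "subgroup (generate G {x}) G" using x(1) by (intro generate_is_subgroup) simp
        moreover have "card (generate G {x}) = r ^ i" using generate_pow_card[OF x(1)] i by simp
        ultimately obtain g where "g \<in> carrier G" "conjg G g ` generate G {x} \<subseteq> S0"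
          using sylow_contains_conjugate[OF fin _ _ r(1) S0(1,3)] by blast
        then show ?thesis using generate.incl[of x "{x}" G] by blast
      qed
      obtain g where g: "g \<in> carrier G" "conjg G g y \<in> S0" using into[OF y(3,6)] by blast
      define S where "S = conjg G (inv g) ` S0"
      have S: "subgroup S G" "card S = r ^ multiplicity r (order G)"
        unfolding S_def using subgroup_conjg[OF S0(1)] card_conjg[OF subgroup.subset[OF S0(1)]] S0(2) g(1) by auto
      have yS: "y \<in> S" unfolding S_def using g y(3) by (intro image_eqI[of _ _ "conjg G g y"]) auto
      obtain h where h: "h \<in> carrier G" "conjg G h k \<in> S0" using into[OF Kc[OF k(1)] k(2)] by blast
      obtain k' i where ki: "k' \<in> K" "inv g \<otimes> h = k' \<otimes> y [^] (i::nat)" using form[of "inv g \<otimes> h"] g h by auto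
      have "conjg G (inv g) (conjg G h k) = conjg G k' (conjg G (y [^] i) k)"
        using ki g h k(1) Kc y(3) by (simp add: conjg_conjg)
      also have "\<dots> = conjg G (y [^] i) k" using fixK[OF ki(1) conjK[OF _ k(1)]] y(3) by simp
      finally have cS: "conjg G (y [^] i) k \<in> S" unfolding S_def using h(2) by (metis imageI)
      have yiS: "y [^] i \<in> S" using pow_in_subgroup[OF S(1) yS] .
      have "inv (y [^] i) \<otimes> conjg G (y [^] i) k \<otimes> y [^] i \<in> S"
        using cS yiS S(1) by (simp add: subgroup.m_closed subgroup.m_inv_closed)
      then have "k \<in> S" using y(3) Kc[OF k(1)] by (simp add: conjg_def word_simps)
      then have "y \<otimes> k = k \<otimes> y"
        using abelian_sylow_p_subgroup_commute[OF fin ab S r(1) yS] by blast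
      then show ?thesis using conjg_fixed_iff[OF y(3) Kc[OF k(1)]] by simp
    qed

    \<comment> \<open>\<open>\<delta>\<close> is an endomorphism of \<open>K\<close> that kills the \<open>r\<close>-elements, so its values have order prime to \<open>r\<close>;
      a central value has order dividing \<open>r\<close> because \<open>y\<^sup>r\<close> is central\<close>
    define \<delta> where "\<delta> k = conjg G y k \<otimes> inv k" for k
    have dK: "\<delta> k \<in> K" if "k \<in> K" for k
      using that conjK[OF y(3) that] Ks by (simp add: \<delta>_def subgroup.m_closed subgroup.m_inv_closed)
    have dmult: "\<delta> (k \<otimes> l) = \<delta> k \<otimes> \<delta> l" if kl: "k \<in> K" "l \<in> K" for k l
    proof -
      have il: "inv l \<in> K" "inv k \<in> K" using kl Ks by (simp_all add: subgroup.m_inv_closed)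
      have c: "conjg G y l \<in> carrier G" "conjg G y k \<in> carrier G" "k \<in> carrier G" "l \<in> carrier G"
        using kl Kc conjK[OF y(3)] by auto
      have "\<delta> (k \<otimes> l) = conjg G y k \<otimes> (conjg G y l \<otimes> inv l) \<otimes> inv k"
        using kl Kc y(3) by (simp add: \<delta>_def conjg_mult word_simps)
      also have "\<dots> = conjg G y k \<otimes> (inv k \<otimes> (conjg G y l \<otimes> inv l))"
        using Kcomm[OF dK[OF kl(2)] il(2)] c by (simp add: \<delta>_def m_assoc)
      finally show ?thesis using c by (simp add: \<delta>_def m_assoc)
    qed
    have dpow: "\<delta> (k [^] i) = \<delta> k [^] i" if "k \<in> K" for k and i :: nat
    proof (induction i)
      case 0
      show ?case using y(3) by (simp add: \<delta>_def)
    next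
      case (Suc i)
      then show ?case using dmult[OF pow_in_subgroup[OF Ks that] that] by simp
    qed
    have db: "\<delta> k [^] b = \<one>" if k: "k \<in> K" for k
    proof -
      have "(k [^] b) [^] (r ^ a) = k [^] order G" using Kc[OF k] r(2) by (simp add: nat_pow_pow mult.commute)
      then have "(k [^] b) [^] (r ^ a) = \<one>" using pow_order_eq_1[OF Kc[OF k]] by simp
      then have "\<delta> (k [^] b) = \<one>"
        using rpart[OF pow_in_subgroup[OF Ks k]] Kc[OF k] by (simp add: \<delta>_def)
      then show ?thesis using dpow[OF k] by simp
    qed
    have dZ: "\<delta> k = \<one>" if k: "k \<in> K" "\<delta> k \<in> Z" for k
    proof -
      define d where "d = \<delta> k"
      have d: "d \<in> carrier G" "d \<in> Z" using k dK Kc by (auto simp: d_def)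
      have kc: "k \<in> carrier G" using Kc k by simp
      have yk: "conjg G y k = d \<otimes> k" using kc y(3) by (simp add: d_def \<delta>_def m_assoc)
      have it: "conjg G (y [^] i) k = d [^] i \<otimes> k" for i :: nat
      proof (induction i)
        case (Suc i)
        have "conjg G (y [^] Suc i) k = conjg G y (conjg G (y [^] i) k)"
          using y(3) kc nat_pow_Suc2[of y i] by (simp add: conjg_conjg)
        also have "\<dots> = conjg G y (d [^] i) \<otimes> conjg G y k" using Suc y(3) d kc by (simp add: conjg_mult)
        also have "conjg G y (d [^] i) = d [^] i"
          using pow_in_subgroup[OF Zs d(2), of i] y(3) by (simp add: Z_def centre_def)
        finally show ?case using yk d kc by (simp add: m_assoc)
      qed (use kc in simp)
      have "conjg G (y [^] r) k = k"
        using centre_commute[of "y [^] r" k] y(3,5) kc conjg_fixed_iff[of "y [^] r" k] by (simp add: Z_def)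
      then have "d [^] r = \<one>" using it[of r] d kc by (metis nat_pow_closed r_cancel_one)
      moreover have "d [^] b = \<one>" using db[OF k(1)] by (simp add: d_def)
      moreover have "coprime r b" using r(1,3) prime_imp_coprime by blast
      ultimately show ?thesis using coprime_pow_eq_one[OF is_group d(1)] by (simp add: d_def)
    qed
    define D where "D = \<delta> ` K"
    have Ds: "subgroup D G"
    proof (rule finite_subgroupI[OF fin])
      show "D \<subseteq> carrier G" using dK Kc by (auto simp: D_def)
      show "D \<noteq> {}" using subgroup.one_closed[OF Ks] by (auto simp: D_def)
      show "x \<otimes> z \<in> D" if "x \<in> D" "z \<in> D" for x z
        using that subgroup.m_closed[OF Ks] by (auto simp: D_def dmult[symmetric])
    qed
    have Dn: "D \<lhd> G"
    proof -
      have "conjg G g d \<in> D" if g: "g \<in> carrier G" and d: "d \<in> D" for g d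
      proof -
        obtain k where k: "k \<in> K" "d = \<delta> k" using d by (auto simp: D_def)
        obtain k' i where ki: "k' \<in> K" "g = k' \<otimes> y [^] (i::nat)" using form[OF g] by blast
        define u where "u = y [^] i"
        have uc: "u \<in> carrier G" "u \<otimes> y = y \<otimes> u" unfolding u_def using y(3) nat_pow_Suc2[of y i] by auto
        have "conjg G g d = conjg G k' (conjg G u d)" using ki k dK Kc uc by (simp add: conjg_conjg u_def)
        also have "\<dots> = conjg G u d" using fixK[OF ki(1) conjK[OF uc(1) dK[OF k(1)]]] k(2) by simp
        also have "\<dots> = conjg G u (conjg G y k) \<otimes> conjg G u (inv k)"
          unfolding k(2) \<delta>_def using uc(1) y(3) Kc[OF k(1)] by (simp add: conjg_mult)
        also have "conjg G u (conjg G y k) = conjg G y (conjg G u k)"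
          using uc y(3) Kc[OF k(1)] by (simp add: conjg_conjg)
        also have "conjg G u (inv k) = inv (conjg G u k)" using uc(1) Kc[OF k(1)] by (simp add: conjg_inv)
        finally have "conjg G g d = \<delta> (conjg G u k)" by (simp add: \<delta>_def)
        then show ?thesis using conjK[OF uc(1) k(1)] by (simp add: D_def)
      qed
      then show ?thesis using Ds by (simp add: normal_iff)
    qed
    note DU = subgroup_normal_mult[OF Dn U(1)]
    have DUG: "D <#> U = carrier G"
    proof (rule ccontr)
      assume ne: "D <#> U \<noteq> carrier G"
      have "k \<otimes> y = y \<otimes> k" if k: "k \<in> K" for k
      proof -
        have dD: "\<delta> k \<in> D" using k by (simp add: D_def)
        have dc: "\<delta> k \<in> carrier G" using dK[OF k] Kc by blast
        have dy: "\<delta> k \<otimes> y = y \<otimes> \<delta> k" using proper[OF DU(1) ne] DU(2,3) dD U(3) by blast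
        have dyi: "\<delta> k \<otimes> y [^] i = y [^] i \<otimes> \<delta> k" for i :: nat
        proof (induction i)
          case (Suc i)
          then show ?case using commuting_mult[of "y [^] i" y "\<delta> k" \<one>] dy dc y(3) by simp
        qed (use dc in simp)
        have "g \<otimes> \<delta> k = \<delta> k \<otimes> g" if g: "g \<in> carrier G" for g
        proof -
          obtain k' i where ki: "k' \<in> K" "g = k' \<otimes> y [^] (i::nat)" using form[OF g] by blast
          show ?thesis unfolding ki(2)
            using commuting_mult[of k' "y [^] i" "\<delta> k" \<one>] dyi Kcomm[OF ki(1) dK[OF k]] dc y(3) Kc[OF ki(1)] by simp
        qed
        then have "\<delta> k \<in> Z" using dc by (simp add: Z_def centre_iff)
        then have "conjg G y k \<otimes> inv k = \<one>" using dZ[OF k] by (simp add: \<delta>_def)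
        then have "conjg G y k = \<one> \<otimes> k" using inv_solve_right'[of \<one> "conjg G y k" k] Kc[OF k] y(3) by simp
        then show ?thesis using conjg_fixed_iff[OF y(3) Kc[OF k]] Kc[OF k] by simp
      qed
      then show False using central[OF y(2)] y(4) by blast
    qed
    have "x \<in> X" if x: "x \<in> M" for x
    proof -
      have "x \<in> D <#> U" using DUG x by simp
      then obtain d u where du: "d \<in> D" "u \<in> U" "x = d \<otimes> u" unfolding set_mult_def by blast
      have uM: "u \<in> M" using du(2) U(2) XM(2) by blast
      obtain k where k: "k \<in> K" "d = \<delta> k" using du(1) by (auto simp: D_def)
      have dc: "d \<in> carrier G" using k dK Kc by blast
      have "d = x \<otimes> inv u" using du(3) dc uM by (simp add: m_assoc)
      then have "d \<in> M" using x uM by simp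
      then have "\<delta> k \<in> Z" using KM dK[OF k(1)] k(2) by blast
      then have "d = \<one>" using dZ[OF k(1)] k(2) by simp
      then show ?thesis using du U(2) uM by auto
    qed
    then show False using XM by blast
  qed
  then have "X = Z" using between[OF XM(1) _ XM(2,3)] by blast
  then show ?thesis by (simp add: Z_def)
qed

context lattice_formation
begin

lemma in_class_all_K_subnormal:
  assumes "in_class G F" "subgroup H G"
  shows "K_subnormal F H G"
proof -
  have G: "group G" using assms(1) by (simp add: in_class_def)
  have "kernel G G id \<subseteq> H" using subgroup.one_closed[OF assms(2)] by (auto simp: kernel_def)
  then have "embeds_above G H" using embeds_aboveI[OF assms(1), of id] id_iso by (auto simp: iso_def)
  then show ?thesis using K_subnormal_link[OF G assms(2)] by blast
qed

lemma maximal_chain_first: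
  assumes "maximal_chain G n C" "n > 0"
  shows "maximal_subgroup (C 1) G"
  using assms unfolding maximal_chain_def by (metis One_nat_def monoid.surjective partial_object.update_convs(1))

lemma in_class_chains:
  assumes "in_class G F" "n > 0"
  shows "every_maximal_chain_includes_K_subnormal F n G"
  unfolding every_maximal_chain_includes_K_subnormal_def
proof (intro allI impI)
  fix C assume "maximal_chain G n C"
  then have "subgroup (C 1) G" using maximal_chain_first assms(2) by (auto simp: maximal_subgroup_def)
  then show "\<exists>i. 1 \<le> i \<and> i \<le> n \<and> K_subnormal F (C i) G"
    using in_class_all_K_subnormal[OF assms(1)] assms(2) by (intro exI[of _ 1]) auto
qed

lemma schmidt_chains_2:
  assumes G: "group G" and S: "schmidt_group G" "abelian_sylow_subgroups G"
  shows "every_maximal_chain_includes_K_subnormal F 2 G"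
  unfolding every_maximal_chain_includes_K_subnormal_def
proof (intro allI impI)
  interpret group G by fact
  have fin: "finite (carrier G)" using S(1) by (simp add: schmidt_group_def)
  fix C assume C: "maximal_chain G 2 C"
  have M: "maximal_subgroup (C 1) G" using maximal_chain_first[OF C] by simp
  then have MG: "subgroup (C 1) G" by (simp add: maximal_subgroup_def)
  have X: "maximal_subgroup (C 2) (G\<lparr>carrier := C 1\<rparr>)"
    using C unfolding maximal_chain_def by (metis one_less_numeral_iff semiring_norm(76) Suc_1)
  show "\<exists>i. 1 \<le> i \<and> i \<le> 2 \<and> K_subnormal F (C i) G"
  proof (cases "C 1 \<lhd> G")
    case True
    then show ?thesis using K_subnormal_link[OF G MG] by (intro exI[of _ 1]) auto
  next
    case False
    have "C 2 = centre G"
      by (rule minimal_nonabelian_second_maximal_central[OF fin S(2) schmidt_abelian_sylow_proper_commute[OF S] M False X])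
    then have "C 2 \<lhd> G" using centre_normal by simp
    then show ?thesis using K_subnormal_link[OF G normal_imp_subgroup] by (intro exI[of _ 2]) auto
  qed
qed

end

section \<open>Hereditary solubility with respect to a partition\<close>

text \<open>For finite groups this is \<open>\<sigma>\<close>-solubility, whose definition by chief factors is not visibly inherited by
  subgroups. Requiring for every nontrivial subgroup a proper normal subgroup with \<open>\<sigma>\<close>-primary quotient makes
  heredity immediate and avoids chief series; extensions and images are treated by moving one such normal
  subgroup along a homomorphism.\<close>

definition ssol :: "nat set set \<Rightarrow> ('a, 'b) monoid_scheme \<Rightarrow> bool" where
  "ssol \<sigma> G \<longleftrightarrow> (\<forall>H. subgroup H G \<and> H \<noteq> {\<one>\<^bsub>G\<^esub>} \<longrightarrow>
     (\<exists>N. N \<lhd> G\<lparr>carrier := H\<rparr> \<and> N \<noteq> H \<and> (\<exists>S\<in>\<sigma>. prime_factors (card H div card N) \<subseteq> S)))"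

lemma ssolD:
  assumes "ssol \<sigma> G" "subgroup H G" "H \<noteq> {\<one>\<^bsub>G\<^esub>}"
  shows "\<exists>N. N \<lhd> G\<lparr>carrier := H\<rparr> \<and> N \<noteq> H \<and> (\<exists>S\<in>\<sigma>. prime_factors (card H div card N) \<subseteq> S)"
  using assms unfolding ssol_def by blast

lemma (in group) ssol_subgroup:
  assumes "ssol \<sigma> G" "subgroup K G"
  shows "ssol \<sigma> (G\<lparr>carrier := K\<rparr>)"
  unfolding ssol_def
proof (intro allI impI)
  fix H assume "subgroup H (G\<lparr>carrier := K\<rparr>) \<and> H \<noteq> {\<one>\<^bsub>G\<lparr>carrier := K\<rparr>\<^esub>}"
  then have "subgroup H G" "H \<noteq> {\<one>}" using subgroup_in[OF assms(2)] by auto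
  then show "\<exists>N. N \<lhd> G\<lparr>carrier := K, carrier := H\<rparr> \<and> N \<noteq> H \<and> (\<exists>S\<in>\<sigma>. prime_factors (card H div card N) \<subseteq> S)"
    using ssolD[OF assms(1)] by simp
qed

lemma (in group) subgroup_hom:
  assumes "group L" "\<phi> \<in> hom G L" "subgroup H G"
  shows "group_hom (G\<lparr>carrier := H\<rparr>) (L\<lparr>carrier := \<phi> ` H\<rparr>) \<phi>"
proof -
  interpret p: group_hom G L \<phi> using is_group assms(1,2) by (rule group_homI)
  have "\<phi> \<in> hom (G\<lparr>carrier := H\<rparr>) (L\<lparr>carrier := \<phi> ` H\<rparr>)"
    using hom_corestrict[OF hom_restrict_sub[OF assms(2) subgroup.subset[OF assms(3)]]] by simp
  then show ?thesis
    using subgroup_imp_group[OF assms(3)] p.H.subgroup_imp_group[OF p.subgroup_img_is_subgroup[OF assms(3)]]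
    by (intro group_homI)
qed

text \<open>Restricted to a subgroup, the kernel becomes an intersection; this form is used to compare indices.\<close>

lemma (in group) card_eq_kernel_mult_image:
  assumes "group L" "\<phi> \<in> hom G L" "subgroup H G"
  shows "card H = card (kernel G L \<phi> \<inter> H) * card (\<phi> ` H)"
proof -
  interpret q: group_hom "G\<lparr>carrier := H\<rparr>" "L\<lparr>carrier := \<phi> ` H\<rparr>" \<phi> by (rule subgroup_hom[OF assms])
  have "kernel (G\<lparr>carrier := H\<rparr>) (L\<lparr>carrier := \<phi> ` H\<rparr>) \<phi> = kernel G L \<phi> \<inter> H"
    using subgroup.mem_carrier[OF assms(3)] by (auto simp: kernel_def)
  then show ?thesis using q.order_eq_card_kernel_mult_card_image by (simp add: order_sub)
qed

lemma (in group) card_quotient: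
  assumes "N \<lhd> G" "finite (carrier G)"
  shows "order (G Mod N) = order G div card N"
proof -
  note can = canonical_hom[OF assms(1)]
  interpret can: group_hom G "G Mod N" "\<lambda>x. N #> x" using is_group can(4,1) by (rule group_homI)
  have "order G = card N * order (G Mod N)"
    using can.order_eq_card_kernel_mult_card_image can(2,3) by (simp add: order_def)
  then show ?thesis using card_pos[OF normal_imp_subgroup[OF assms(1)] assms(2)] by simp
qed

text \<open>A subgroup of the kernel is covered by the hypothesis on the kernel. For any other subgroup \<open>H\<close> the
  normal subgroup of its image is pulled back, which keeps the index.\<close>

lemma (in group) ssol_extension:
  assumes fin: "finite (carrier G)" and L: "group L" "\<phi> \<in> hom G L"
    and sol: "ssol \<sigma> (L\<lparr>carrier := \<phi> ` carrier G\<rparr>)" "ssol \<sigma> (G\<lparr>carrier := kernel G L \<phi>\<rparr>)"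
  shows "ssol \<sigma> G"
  unfolding ssol_def
proof (intro allI impI, elim conjE)
  interpret p: group_hom G L \<phi> using is_group L by (rule group_homI)
  fix H assume H: "subgroup H G" "H \<noteq> {\<one>}"
  show "\<exists>N. N \<lhd> G\<lparr>carrier := H\<rparr> \<and> N \<noteq> H \<and> (\<exists>S\<in>\<sigma>. prime_factors (card H div card N) \<subseteq> S)"
  proof (cases "H \<subseteq> kernel G L \<phi>")
    case True
    then have "subgroup H (G\<lparr>carrier := kernel G L \<phi>\<rparr>)" using H(1) subgroup_in[OF p.subgroup_kernel] by blast
    then show ?thesis using ssolD[OF sol(2)] H(2) by simp
  next
    case False
    interpret q: group_hom "G\<lparr>carrier := H\<rparr>" "L\<lparr>carrier := \<phi> ` H\<rparr>" \<phi> by (rule subgroup_hom[OF L H(1)])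
    have IG: "subgroup (\<phi> ` carrier G) L" by (rule p.img_is_subgroup)
    have IH: "subgroup (\<phi> ` H) L" by (rule p.subgroup_img_is_subgroup[OF H(1)])
    have "subgroup (\<phi> ` H) (L\<lparr>carrier := \<phi> ` carrier G\<rparr>)"
      unfolding p.H.subgroup_in[OF IG] using IH image_mono[OF subgroup.subset[OF H(1)]] by (rule conjI)
    moreover have "\<phi> ` H \<noteq> {\<one>\<^bsub>L\<^esub>}"
    proof
      assume "\<phi> ` H = {\<one>\<^bsub>L\<^esub>}"
      then have "H \<subseteq> kernel G L \<phi>" using subgroup.mem_carrier[OF H(1)] by (auto simp: kernel_def)
      then show False using False by simp
    qed
    ultimately obtain N S where N: "N \<lhd> L\<lparr>carrier := \<phi> ` H\<rparr>" "N \<noteq> \<phi> ` H" "S \<in> \<sigma>"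
        "prime_factors (card (\<phi> ` H) div card N) \<subseteq> S"
      using ssolD[OF sol(1), of "\<phi> ` H"] by auto
    define N' where "N' = {x \<in> H. \<phi> x \<in> N}"
    have N'n: "N' \<lhd> G\<lparr>carrier := H\<rparr>" using q.preimage_normal[OF N(1)] by (simp add: N'_def)
    have NI: "subgroup N L" "N \<subseteq> \<phi> ` H" using N(1) p.H.normal_in[OF IH] by auto
    have N's: "subgroup N' G" using N'n normal_in[OF H(1)] by blast
    have im: "\<phi> ` N' = N" using NI(2) by (auto simp: N'_def)
    have ker: "kernel G L \<phi> \<inter> N' = kernel G L \<phi> \<inter> H"
      using subgroup.one_closed[OF NI(1)] by (auto simp: N'_def kernel_def)
    have "card H div card N' = card (\<phi> ` H) div card N"
    proof -
      have "subgroup (kernel G L \<phi> \<inter> H) G" using subgroup_Int p.subgroup_kernel H(1) by blast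
      then have "card (kernel G L \<phi> \<inter> H) > 0" using card_pos fin by blast
      then show ?thesis
        using card_eq_kernel_mult_image[OF L H(1)] card_eq_kernel_mult_image[OF L N's] im ker by simp
    qed
    moreover have "N' \<noteq> H" using im N(2) by blast
    ultimately show ?thesis using N'n N(3,4) by metis
  qed
qed

text \<open>A subgroup \<open>H\<close> of smallest order with image \<open>I\<close> has the property that the images of its proper subgroups
  are proper in \<open>I\<close>; the full preimage of \<open>I\<close> need not have it.\<close>

lemma (in group) ssol_image:
  assumes fin: "finite (carrier G)" and L: "group L" "\<phi> \<in> hom G L" "\<phi> ` carrier G = carrier L"
    and sol: "ssol \<sigma> G"
  shows "ssol \<sigma> L"
  unfolding ssol_def
proof (intro allI impI, elim conjE)
  interpret p: group_hom G L \<phi> using is_group L(1,2) by (rule group_homI)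
  fix I assume I: "subgroup I L" "I \<noteq> {\<one>\<^bsub>L\<^esub>}"
  have "subgroup {x \<in> carrier G. \<phi> x \<in> I} G \<and> \<phi> ` {x \<in> carrier G. \<phi> x \<in> I} = I"
  proof
    show "\<phi> ` {x \<in> carrier G. \<phi> x \<in> I} = I"
    proof
      show "I \<subseteq> \<phi> ` {x \<in> carrier G. \<phi> x \<in> I}"
      proof
        fix y assume y: "y \<in> I"
        then obtain x where "x \<in> carrier G" "y = \<phi> x" using L(3) subgroup.mem_carrier[OF I(1)] by (metis imageE)
        then show "y \<in> \<phi> ` {x \<in> carrier G. \<phi> x \<in> I}" using y by blast
      qed
    qed blast
  qed (rule p.preimage_subgroup[OF I(1)])
  then have ex: "\<exists>H. subgroup H G \<and> \<phi> ` H = I" by blast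
  define H where "H = arg_min card (\<lambda>H. subgroup H G \<and> \<phi> ` H = I)"
  obtain H0 where H0: "subgroup H0 G \<and> \<phi> ` H0 = I" using ex by (elim exE)
  note am = arg_min_nat_lemma[of "\<lambda>H. subgroup H G \<and> \<phi> ` H = I", OF H0, of card, folded H_def]
  have H: "subgroup H G" "\<phi> ` H = I" using am by simp_all
  have Hmin: "card H \<le> card H'" if "subgroup H' G" "\<phi> ` H' = I" for H' using am that by metis
  have "H \<noteq> {\<one>}" using H(2) I(2) by auto
  then obtain N S where N: "N \<lhd> G\<lparr>carrier := H\<rparr>" "N \<noteq> H" "S \<in> \<sigma>" "prime_factors (card H div card N) \<subseteq> S"
    using ssolD[OF sol H(1)] by blast
  have Ns: "subgroup N G" "N \<subseteq> H" "\<And>h x. h \<in> H \<Longrightarrow> x \<in> N \<Longrightarrow> conjg G h x \<in> N" using N(1) normal_in[OF H(1)] by auto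
  have lt: "card N < card H" using Ns(2) N(2) fin_sub[OF H(1) fin] by (simp add: psubset_card_mono psubsetI)
  have "\<phi> ` N \<noteq> I" using Hmin[OF Ns(1)] lt by auto
  moreover have "\<phi> ` N \<lhd> L\<lparr>carrier := I\<rparr>"
  proof -
    have "conjg L (\<phi> h) (\<phi> x) \<in> \<phi> ` N" if "h \<in> H" "x \<in> N" for h x
      using Ns(3)[OF that] p.hom_conjg[of h x] that subgroup.mem_carrier[OF H(1)] subgroup.mem_carrier[OF Ns(1)]
      by (metis imageI)
    then show ?thesis unfolding p.H.normal_in[OF I(1)]
      using p.subgroup_img_is_subgroup[OF Ns(1)] Ns(2) H(2) by auto
  qed
  moreover have "prime_factors (card I div card (\<phi> ` N)) \<subseteq> S"
  proof -
    have k: "subgroup (kernel G L \<phi> \<inter> H) G" "subgroup (kernel G L \<phi> \<inter> N) G"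
      using subgroup_Int p.subgroup_kernel H(1) Ns(1) by blast+
    obtain c where c: "card (kernel G L \<phi> \<inter> H) = card (kernel G L \<phi> \<inter> N) * c"
      using card_sub_dvd[OF k(2,1) _ fin] Ns(2) by (metis Int_mono dvdE order_refl)
    have finL: "finite (carrier L)" using L(3) fin by (metis finite_imageI)
    have sub: "subgroup (\<phi> ` N) L" using p.subgroup_img_is_subgroup[OF Ns(1)] .
    obtain d where d: "card I = card (\<phi> ` N) * d"
      using p.H.card_sub_dvd[OF sub I(1) _ finL] Ns(2) H(2) by (metis dvdE image_mono)
    have pos: "card (\<phi> ` N) > 0" "card (kernel G L \<phi> \<inter> N) > 0" "card H > 0"
      using p.H.card_pos[OF sub finL] card_pos[OF k(2) fin] card_pos[OF H(1) fin] by auto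
    have "card H = card N * (c * d)"
      using card_eq_kernel_mult_image[OF L(1,2) H(1)] card_eq_kernel_mult_image[OF L(1,2) Ns(1)] c d H(2)
      by (simp add: ac_simps)
    moreover from this have "c * d \<noteq> 0" using pos(3) by (metis less_irrefl mult_0_right)
    moreover have "card N > 0" using card_pos[OF Ns(1) fin] .
    ultimately have "prime_factors d \<subseteq> prime_factors (card H div card N)"
      using dvd_prime_factors[of "c * d" d] by simp
    then show ?thesis using N(4) d pos(1) by simp
  qed
  ultimately show "\<exists>N. N \<lhd> L\<lparr>carrier := I\<rparr> \<and> N \<noteq> I \<and> (\<exists>S\<in>\<sigma>. prime_factors (card I div card N) \<subseteq> S)"
    using N(3) by blast
qed

text \<open>For a chief factor \<open>H/K\<close> consider the normal subgroups of \<open>H\<close> that contain \<open>K\<close> and have index divisible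
  by primes of \<open>S\<close> only. They are closed under intersection and conjugation, so the smallest of them is
  normal in \<open>G\<close>. It is not \<open>H\<close>, hence equal to \<open>K\<close>.\<close>

lemma (in group) ssol_imp_sigma_soluble:
  assumes fin: "finite (carrier G)" and sol: "ssol \<sigma> G"
  shows "sigma_soluble \<sigma> G"
  unfolding sigma_soluble_def
proof (intro allI impI)
  fix H K assume "chief_factor G H K"
  then have HK: "H \<lhd> G" "K \<lhd> G" "K \<subset> H" and chief: "\<And>N. N \<lhd> G \<Longrightarrow> K \<subseteq> N \<Longrightarrow> N \<subseteq> H \<Longrightarrow> N = K \<or> N = H"
    unfolding chief_factor_def by auto
  have Hs: "subgroup H G" and Ks: "subgroup K G" using HK normal_imp_subgroup by auto
  define GH where "GH = G\<lparr>carrier := H\<rparr>"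
  interpret GH: group GH unfolding GH_def by (rule subgroup_imp_group[OF Hs])
  have finH: "finite (carrier GH)" using fin_sub[OF Hs fin] by (simp add: GH_def)
  have KGH: "K \<lhd> GH" unfolding GH_def using normal_in_subgroup[OF HK(2) Hs] HK(3) by blast
  note can = GH.canonical_hom[OF KGH]
  define L where "L = GH Mod K"
  define \<kappa> where "\<kappa> = (\<lambda>x. K #>\<^bsub>GH\<^esub> x)"
  interpret k: group_hom GH L \<kappa> unfolding L_def \<kappa>_def using GH.is_group can(4,1) by (rule group_homI)
  have ker: "kernel GH L \<kappa> = K" and surj: "\<kappa> ` carrier GH = carrier L" using can(2,3) by (auto simp: L_def \<kappa>_def)
  have Lne: "carrier L \<noteq> {\<one>\<^bsub>L\<^esub>}"
  proof
    assume "carrier L = {\<one>\<^bsub>L\<^esub>}"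
    then have "carrier GH \<subseteq> kernel GH L \<kappa>" using k.hom_closed by (auto simp: kernel_def)
    then show False using ker HK(3) by (auto simp: GH_def)
  qed
  have "ssol \<sigma> L" using GH.ssol_image[OF finH k.H.is_group k.homh surj] ssol_subgroup[OF sol Hs] by (simp add: GH_def)
  then obtain N S where N: "N \<lhd> L\<lparr>carrier := carrier L\<rparr>" "N \<noteq> carrier L" "S \<in> \<sigma>" "prime_factors (card (carrier L) div card N) \<subseteq> S"
    using ssolD[OF _ k.H.subgroup_self Lne] by blast
  have NL: "N \<lhd> L" using N(1) by simp
  have NLs: "subgroup N L" using normal_imp_subgroup[OF NL] .
  define Fam where "Fam M \<longleftrightarrow> M \<lhd> GH \<and> K \<subseteq> M \<and> prime_factors (card H div card M) \<subseteq> S" for M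
  have sub: "subgroup M G" "M \<subseteq> H" if "Fam M" for M
    using that normal_in[OF Hs] by (auto simp: Fam_def GH_def)
  define N' where "N' = {x \<in> carrier GH. \<kappa> x \<in> N}"
  have N'n: "N' \<lhd> GH" unfolding N'_def by (rule k.preimage_normal[OF NL])
  have N's: "subgroup N' GH" using normal_imp_subgroup[OF N'n] .
  have im: "\<kappa> ` N' = N"
  proof
    show "N \<subseteq> \<kappa> ` N'"
    proof
      fix y assume y: "y \<in> N"
      then obtain x where "x \<in> carrier GH" "y = \<kappa> x" using surj subgroup.mem_carrier[OF NLs y] by (metis imageE)
      then show "y \<in> \<kappa> ` N'" using y by (auto simp: N'_def)
    qed
  qed (auto simp: N'_def)
  have KN': "K \<subseteq> N'" using ker subgroup.one_closed[OF NLs] by (auto simp: N'_def kernel_def)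
  have "card N' = card K * card N"
    using GH.card_eq_kernel_mult_image[OF k.H.is_group k.homh N's] ker im KN' by (simp add: Int_absorb2)
  moreover have "card H = card K * card (carrier L)"
    using k.order_eq_card_kernel_mult_card_image ker surj by (simp add: order_def GH_def)
  ultimately have FN': "Fam N'"
    unfolding Fam_def using N'n KN' N(4) card_pos[OF Ks fin] by simp
  have N'H: "N' \<noteq> H" using im N(2) surj by (auto simp: GH_def)
  define M where "M = arg_min card Fam"
  note am = arg_min_nat_lemma[of Fam, OF FN', of card, folded M_def]
  have M: "Fam M" using am by (rule conjunct1)
  have Mmin: "card M \<le> card X" if "Fam X" for X using am that by metis
  have meet: "Fam (X \<inter> Y)" if X: "Fam X" and Y: "Fam Y" for X Y
  proof -
    have n: "X \<inter> Y \<lhd> GH" using GH.normal_subgroup_intersect X Y unfolding Fam_def by blast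
    have Yn: "Y \<lhd> GH" "X \<lhd> GH" using X Y by (auto simp: Fam_def)
    note cy = GH.canonical_hom[OF Yn(1)]
    have Xs: "subgroup X GH" using normal_imp_subgroup[OF Yn(2)] .
    interpret cy: group_hom GH "GH Mod Y" "\<lambda>x. Y #>\<^bsub>GH\<^esub> x" using GH.is_group cy(4,1) by (rule group_homI)
    have 1: "card X = card (Y \<inter> X) * card ((\<lambda>x. Y #>\<^bsub>GH\<^esub> x) ` X)"
      using GH.card_eq_kernel_mult_image[OF cy(4,1) Xs] cy(3) by simp
    have 2: "card ((\<lambda>x. Y #>\<^bsub>GH\<^esub> x) ` X) dvd order (GH Mod Y)"
      using cy.H.card_sub_dvd[OF cy.subgroup_img_is_subgroup[OF Xs] cy.H.subgroup_self]
        cy(2) finH subgroup.subset[OF cy.subgroup_img_is_subgroup[OF Xs]]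
      by (simp add: order_def) (metis finite_imageI)
    obtain u where u: "card H = card X * u" using card_sub_dvd[OF sub(1)[OF X] Hs sub(2)[OF X] fin] by (elim dvdE)
    obtain v where v: "card H = card Y * v" using card_sub_dvd[OF sub(1)[OF Y] Hs sub(2)[OF Y] fin] by (elim dvdE)
    have pos: "card X > 0" "card Y > 0" "card (X \<inter> Y) > 0" "card H > 0"
      using card_pos[OF sub(1)[OF X] fin] card_pos[OF sub(1)[OF Y] fin] card_pos[OF Hs fin]
        card_pos[OF subgroup_Int[OF sub(1)[OF X] sub(1)[OF Y]] fin] by auto
    have uv: "u \<noteq> 0" "v \<noteq> 0" using u v pos(4) by (metis less_irrefl mult_0_right)+
    have "order (GH Mod Y) = v" using GH.card_quotient[OF Yn(1) finH] v pos(2) by (simp add: order_def GH_def)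
    then obtain w where w: "v = card ((\<lambda>x. Y #>\<^bsub>GH\<^esub> x) ` X) * w" using 2 by (metis dvdE)
    have "card H div card (X \<inter> Y) = u * card ((\<lambda>x. Y #>\<^bsub>GH\<^esub> x) ` X)"
      using u 1 pos(3) by (simp add: Int_commute ac_simps)
    then have "card H div card (X \<inter> Y) dvd u * v" using w by simp
    then have "prime_factors (card H div card (X \<inter> Y)) \<subseteq> prime_factors (u * v)"
      using uv by (intro dvd_prime_factors) auto
    also have "\<dots> = prime_factors u \<union> prime_factors v" using uv by (rule prime_factors_product)
    also have "\<dots> \<subseteq> S"
    proof -
      have "card H div card X = u" "card H div card Y = v"
        using u v pos(1,2) by (metis less_irrefl nonzero_mult_div_cancel_left)+
      then show ?thesis using X Y by (simp add: Fam_def)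
    qed
    finally show ?thesis using n X Y by (auto simp: Fam_def)
  qed
  have conj: "Fam (conjg G g ` M)" if g: "g \<in> carrier G" for g
  proof -
    have s: "subgroup (conjg G g ` M) G" using subgroup_conjg[OF sub(1)[OF M] g] .
    have cH: "conjg G x h \<in> H" if "x \<in> carrier G" "h \<in> H" for x h using HK(1) that by (simp add: normal_iff)
    have "conjg G h (conjg G g x) \<in> conjg G g ` M" if h: "h \<in> H" and x: "x \<in> M" for h x
    proof -
      have xc: "x \<in> carrier G" using x subgroup.mem_carrier[OF sub(1)[OF M]] by blast
      have hc: "h \<in> carrier G" using h subgroup.mem_carrier[OF Hs] by blast
      define h' where "h' = conjg G (inv g) h"
      have h': "h' \<in> H" "h' \<in> carrier G" using cH[of "inv g" h] g h hc by (auto simp: h'_def)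
      have "conjg G h' x \<in> M" using M h'(1) x normal_in[OF Hs] by (simp add: Fam_def GH_def)
      moreover have "conjg G h (conjg G g x) = conjg G g (conjg G h' x)"
        using g hc xc by (simp add: h'_def conjg_def word_simps)
      ultimately show ?thesis by blast
    qed
    then have "conjg G g ` M \<lhd> GH"
      unfolding GH_def normal_in[OF Hs] using s cH[OF g] sub(2)[OF M] by auto
    moreover have "K \<subseteq> conjg G g ` M"
    proof
      fix x assume x: "x \<in> K"
      have "conjg G (inv g) x \<in> K" using HK(2) g x by (simp add: normal_iff)
      then have "conjg G (inv g) x \<in> M" using M by (auto simp: Fam_def)
      moreover have "x = conjg G g (conjg G (inv g) x)" using g subgroup.mem_carrier[OF Ks x] by simp
      ultimately show "x \<in> conjg G g ` M" by blast
    qed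
    moreover have "card (conjg G g ` M) = card M" using card_conjg[OF subgroup.subset[OF sub(1)[OF M]] g] .
    ultimately show ?thesis using M by (simp add: Fam_def)
  qed
  have "M \<lhd> G"
  proof -
    have "conjg G g ` M = M" if g: "g \<in> carrier G" for g
    proof -
      have finM: "finite M" using fin_sub[OF sub(1)[OF M] fin] .
      have "card M \<le> card (M \<inter> conjg G g ` M)" using Mmin[OF meet[OF M conj[OF g]]] .
      then have "M \<inter> conjg G g ` M = M" using finM by (intro card_seteq) auto
      then show ?thesis using finM card_conjg[OF subgroup.subset[OF sub(1)[OF M]] g]
        by (metis card_subset_eq finite_imageI inf.cobounded2)
    qed
    then show ?thesis using sub(1)[OF M] unfolding normal_iff by blast
  qed
  moreover have "M \<noteq> H"
  proof
    assume "M = H"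
    then have "card H \<le> card N'" using Mmin[OF FN'] by simp
    then have "N' = H" using fin_sub[OF Hs fin] sub(2)[OF FN'] by (intro card_seteq)
    then show False using N'H by simp
  qed
  ultimately have "M = K" using chief[of M] M sub(2)[OF M] by (auto simp: Fam_def)
  then have "prime_factors (card H div card K) \<subseteq> S" using M by (simp add: Fam_def)
  moreover have "order (G\<lparr>carrier := H\<rparr> Mod K) = card H div card K"
    using GH.card_quotient[OF KGH finH] by (simp add: GH_def order_def)
  ultimately show "sigma_primary \<sigma> (G\<lparr>carrier := H\<rparr> Mod K)" unfolding sigma_primary_def using N(3) by auto
qed

section \<open>The soluble radical\<close>

lemma (in group) ssol_normal_mult:
  assumes fin: "finite (carrier G)" and A: "A \<lhd> G" "ssol \<sigma> (G\<lparr>carrier := A\<rparr>)"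
    and B: "B \<lhd> G" "ssol \<sigma> (G\<lparr>carrier := B\<rparr>)"
  shows "A <#> B \<lhd> G" "ssol \<sigma> (G\<lparr>carrier := A <#> B\<rparr>)"
proof -
  have As: "subgroup A G" and Bs: "subgroup B G" using A(1) B(1) normal_imp_subgroup by auto
  note AB = subgroup_normal_mult[OF A(1) Bs]
  define J where "J = A <#> B"
  have J: "subgroup J G" using AB(1) by (simp add: J_def)
  have "conjg G g x \<in> J" if g: "g \<in> carrier G" and x: "x \<in> J" for g x
  proof -
    obtain a b where ab: "a \<in> A" "b \<in> B" "x = a \<otimes> b" using x unfolding J_def set_mult_def by blast
    have "conjg G g x = conjg G g a \<otimes> conjg G g b"
      using ab g subgroup.mem_carrier[OF As] subgroup.mem_carrier[OF Bs] by (simp add: conjg_mult)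
    moreover have "conjg G g a \<in> A" "conjg G g b \<in> B" using A(1) B(1) g ab by (auto simp: normal_iff)
    ultimately show ?thesis unfolding J_def set_mult_def by blast
  qed
  then show "A <#> B \<lhd> G" using J by (simp add: normal_iff J_def)
  interpret GJ: group "G\<lparr>carrier := J\<rparr>" by (rule subgroup_imp_group[OF J])
  have finJ: "finite (carrier (G\<lparr>carrier := J\<rparr>))" using fin_sub[OF J fin] by simp
  note can = canonical_hom[OF A(1)]
  interpret can: group_hom G "G Mod A" "\<lambda>x. A #> x" using is_group can(4,1) by (rule group_homI)
  have im: "(\<lambda>x. A #> x) ` J = (\<lambda>x. A #> x) ` B"
  proof
    show "(\<lambda>x. A #> x) ` J \<subseteq> (\<lambda>x. A #> x) ` B"
    proof
      fix y assume "y \<in> (\<lambda>x. A #> x) ` J"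
      then obtain a b where ab: "a \<in> A" "b \<in> B" "y = A #> (a \<otimes> b)" unfolding J_def set_mult_def by blast
      have c: "a \<in> carrier G" "b \<in> carrier G" using ab subgroup.mem_carrier[OF As] subgroup.mem_carrier[OF Bs] by auto
      have "a \<in> kernel G (G Mod A) (\<lambda>x. A #> x)" using ab(1) can(3) by simp
      then have "A #> a = \<one>\<^bsub>G Mod A\<^esub>" unfolding kernel_def by blast
      then have "y = A #> b" using ab(3) can.hom_mult[OF c] can.hom_closed[OF c(2)] can.H.l_one by metis
      then show "y \<in> (\<lambda>x. A #> x) ` B" using ab(2) by blast
    qed
    show "(\<lambda>x. A #> x) ` B \<subseteq> (\<lambda>x. A #> x) ` J" using AB(3) by (auto simp: J_def)
  qed
  have gB: "group (G\<lparr>carrier := B\<rparr>)" and finB: "finite (carrier (G\<lparr>carrier := B\<rparr>))"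
    using subgroup_imp_group[OF Bs] fin_sub[OF Bs fin] by auto
  interpret qB: group_hom "G\<lparr>carrier := B\<rparr>" "(G Mod A)\<lparr>carrier := (\<lambda>x. A #> x) ` B\<rparr>" "\<lambda>x. A #> x"
    by (rule subgroup_hom[OF can(4,1) Bs])
  have sol: "ssol \<sigma> ((G Mod A)\<lparr>carrier := (\<lambda>x. A #> x) ` B\<rparr>)"
    using group.ssol_image[OF gB finB qB.H.is_group qB.homh _ B(2)] by simp
  have "ssol \<sigma> (G\<lparr>carrier := J\<rparr>)"
  proof (rule GJ.ssol_extension[OF finJ can(4)])
    show "(\<lambda>x. A #> x) \<in> hom (G\<lparr>carrier := J\<rparr>) (G Mod A)"
      by (rule hom_restrict_sub[OF can(1) subgroup.subset[OF J]])
    show "ssol \<sigma> ((G Mod A)\<lparr>carrier := (\<lambda>x. A #> x) ` carrier (G\<lparr>carrier := J\<rparr>)\<rparr>)" using sol im by simp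
    have "kernel (G\<lparr>carrier := J\<rparr>) (G Mod A) (\<lambda>x. A #> x) = kernel G (G Mod A) (\<lambda>x. A #> x) \<inter> J"
      using subgroup.mem_carrier[OF J] by (auto simp: kernel_def)
    also have "\<dots> = A" using can(3) AB(2) by (auto simp: J_def)
    finally show "ssol \<sigma> (G\<lparr>carrier := J, carrier := kernel (G\<lparr>carrier := J\<rparr>) (G Mod A) (\<lambda>x. A #> x)\<rparr>)" using A(2) by simp
  qed
  then show "ssol \<sigma> (G\<lparr>carrier := A <#> B\<rparr>)" by (simp add: J_def)
qed

lemma ssol_trivial:
  fixes G (structure) assumes "group G" shows "ssol \<sigma> (G\<lparr>carrier := {\<one>}\<rparr>)"
proof -
  interpret group G by fact
  have "H = {\<one>}" if "subgroup H (G\<lparr>carrier := {\<one>}\<rparr>)" for H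
    using subgroup.subset[OF that] subgroup.one_closed[OF that] by auto
  then show ?thesis unfolding ssol_def by auto
qed

lemma (in group) ex_ssol_radical:
  assumes fin: "finite (carrier G)"
  shows "\<exists>R. R \<lhd> G \<and> ssol \<sigma> (G\<lparr>carrier := R\<rparr>) \<and> (\<forall>A. A \<lhd> G \<and> ssol \<sigma> (G\<lparr>carrier := A\<rparr>) \<longrightarrow> A \<subseteq> R)"
proof -
  define X where "X R \<longleftrightarrow> R \<lhd> G \<and> ssol \<sigma> (G\<lparr>carrier := R\<rparr>)" for R
  have X1: "X {\<one>}" unfolding X_def using one_is_normal ssol_trivial[OF is_group] by blast
  have bound: "card R < Suc (card (carrier G))" if "X R" for R
    using that normal_imp_subgroup subgroup.subset fin unfolding X_def by (metis card_mono le_imp_less_Suc)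
  obtain R where R: "X R" "\<And>A. X A \<Longrightarrow> card A \<le> card R"
    using arg_max_nat_lemma[of X "{\<one>}" card "Suc (card (carrier G))"] X1 bound by blast
  have "A \<subseteq> R" if A: "A \<lhd> G" "ssol \<sigma> (G\<lparr>carrier := A\<rparr>)" for A
  proof -
    have Rn: "R \<lhd> G" "ssol \<sigma> (G\<lparr>carrier := R\<rparr>)" using R(1) by (auto simp: X_def)
    have "X (A <#> R)" unfolding X_def using ssol_normal_mult[OF fin A Rn] by blast
    note AR = subgroup_normal_mult[OF A(1) normal_imp_subgroup[OF Rn(1)]]
    have "card (A <#> R) \<le> card R" using R(2)[OF \<open>X (A <#> R)\<close>] .
    then have "R = A <#> R" using AR(3) fin_sub[OF AR(1) fin] by (intro card_seteq) auto
    then show ?thesis using AR(2) by simp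
  qed
  then show ?thesis using R(1) unfolding X_def by blast
qed

text \<open>Being the largest, the radical of a normal subgroup is invariant under all automorphisms of that subgroup.\<close>

lemma (in group) ssol_radical_normal:
  assumes fin: "finite (carrier G)" and B: "B \<lhd> G"
    and R: "R \<lhd> G\<lparr>carrier := B\<rparr>" "ssol \<sigma> (G\<lparr>carrier := R\<rparr>)"
    and max: "\<And>A. A \<lhd> G\<lparr>carrier := B\<rparr> \<Longrightarrow> ssol \<sigma> (G\<lparr>carrier := A\<rparr>) \<Longrightarrow> A \<subseteq> R"
  shows "R \<lhd> G"
proof -
  have Bs: "subgroup B G" using normal_imp_subgroup[OF B] .
  have Rs: "subgroup R G" "R \<subseteq> B" and Rc: "\<And>b x. b \<in> B \<Longrightarrow> x \<in> R \<Longrightarrow> conjg G b x \<in> R"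
    using R(1) normal_in[OF Bs] by auto
  have "conjg G g x \<in> R" if g: "g \<in> carrier G" and x: "x \<in> R" for g x
  proof -
    define A where "A = conjg G g ` R"
    have As: "subgroup A G" unfolding A_def using subgroup_conjg[OF Rs(1) g] .
    have cB: "conjg G h b \<in> B" if "h \<in> carrier G" "b \<in> B" for h b using B that by (simp add: normal_iff)
    have "conjg G b (conjg G g y) \<in> A" if b: "b \<in> B" and y: "y \<in> R" for b y
    proof -
      have c: "b \<in> carrier G" "y \<in> carrier G" using b y subgroup.mem_carrier[OF Bs] subgroup.mem_carrier[OF Rs(1)] by auto
      have "conjg G (conjg G (inv g) b) y \<in> R" using Rc[OF cB[of "inv g" b] y] g b by simp
      moreover have "conjg G b (conjg G g y) = conjg G g (conjg G (conjg G (inv g) b) y)"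
        using g c by (simp add: conjg_def word_simps)
      ultimately show ?thesis unfolding A_def by blast
    qed
    then have "A \<lhd> G\<lparr>carrier := B\<rparr>" unfolding normal_in[OF Bs] using As cB[OF g] Rs(2) by (auto simp: A_def)
    moreover have "ssol \<sigma> (G\<lparr>carrier := A\<rparr>)"
    proof (rule group.ssol_image[OF subgroup_imp_group[OF Rs(1)] _ subgroup_imp_group[OF As] _ _ R(2)])
      show "finite (carrier (G\<lparr>carrier := R\<rparr>))" using fin_sub[OF Rs(1) fin] by simp
      show "conjg G g \<in> hom (G\<lparr>carrier := R\<rparr>) (G\<lparr>carrier := A\<rparr>)"
        using g subgroup.mem_carrier[OF Rs(1)] by (auto simp: hom_def A_def conjg_mult)
      show "conjg G g ` carrier (G\<lparr>carrier := R\<rparr>) = carrier (G\<lparr>carrier := A\<rparr>)" by (simp add: A_def)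
    qed
    ultimately have "A \<subseteq> R" by (rule max)
    then show ?thesis using x by (auto simp: A_def)
  qed
  then show ?thesis using Rs(1) by (simp add: normal_iff)
qed

context lattice_formation
begin

text \<open>\<open>Sigma_s F\<close> is itself one of the partitions over which it is formed: two primes dividing the order of a
  chief factor lie in the same part of every \<open>\<tau>\<close> for which \<open>F\<close> is \<open>\<tau>\<close>-soluble.\<close>

lemma mem_sigma_soluble:
  assumes "E \<in> F"
  shows "sigma_soluble (Sigma_s F) E"
  unfolding sigma_soluble_def
proof (intro allI impI)
  fix H K assume chief: "chief_factor E H K"
  define n where "n = order (E\<lparr>carrier := H\<rparr> Mod K)"
  define Rel where "Rel = \<Inter>{{(p, q). \<exists>S\<in>\<tau>. p \<in> S \<and> q \<in> S} | \<tau>. partition_on primes \<tau> \<and> sigma_soluble_class \<tau> F}"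
  have rel: "(p, q) \<in> Rel" if pq: "p \<in> prime_factors n" "q \<in> prime_factors n" for p q
    unfolding Rel_def
  proof (rule InterI)
    fix R assume "R \<in> {{(p, q). \<exists>S\<in>\<tau>. p \<in> S \<and> q \<in> S} | \<tau>. partition_on primes \<tau> \<and> sigma_soluble_class \<tau> F}"
    then obtain \<tau> where \<tau>: "R = {(p, q). \<exists>S\<in>\<tau>. p \<in> S \<and> q \<in> S}" "sigma_soluble_class \<tau> F" by blast
    have "sigma_primary \<tau> (E\<lparr>carrier := H\<rparr> Mod K)"
      using \<tau>(2) assms chief unfolding sigma_soluble_class_def sigma_soluble_def by blast
    then show "(p, q) \<in> R" unfolding \<tau>(1) sigma_primary_def n_def[symmetric] using pq by blast
  qed
  obtain p where p: "Factorial_Ring.prime p" "\<And>q. q \<in> prime_factors n \<Longrightarrow> p \<in> prime_factors n"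
    using two_is_prime_nat in_prime_factors_imp_prime by blast
  have "Rel `` {p} \<in> Sigma_s F" unfolding Sigma_s_def Rel_def[symmetric] using p(1) by (intro quotientI) simp
  moreover have "prime_factors n \<subseteq> Rel `` {p}" using rel p(2) by blast
  ultimately show "sigma_primary (Sigma_s F) (E\<lparr>carrier := H\<rparr> Mod K)" unfolding sigma_primary_def n_def by blast
qed

text \<open>Every subgroup \<open>H\<close> belongs to \<open>F\<close> too, and a maximal normal subgroup of \<open>H\<close> gives a chief factor at the
  top of \<open>H\<close>.\<close>

lemma in_class_ssol:
  assumes "in_class G F"
  shows "ssol (Sigma_s F) G"
  unfolding ssol_def
proof (intro allI impI, elim conjE)
  have G: "group G" using assms by (simp add: in_class_def)
  interpret group G by fact
  fix H assume H: "subgroup H G" "H \<noteq> {\<one>\<^bsub>G\<^esub>}"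
  have gH: "group (G\<lparr>carrier := H\<rparr>)" by (rule subgroup_imp_group[OF H(1)])
  obtain E h where E: "E \<in> F" "h \<in> iso (G\<lparr>carrier := H\<rparr>) E"
    using in_class_subgroup[OF assms H(1)] unfolding in_class_def is_iso_def by blast
  have gE: "group E" "finite (carrier E)" using mem_group mem_finite E(1) by auto
  interpret h: group_hom "G\<lparr>carrier := H\<rparr>" E h using gH gE(1) iso_imp_homomorphism[OF E(2)] by (rule group_homI)
  have surj: "h ` H = carrier E" and inj: "inj_on h H" using E(2) by (auto simp: iso_def bij_betw_def)
  define X where "X N \<longleftrightarrow> N \<lhd> E \<and> N \<noteq> carrier E" for N
  have "carrier E \<noteq> {\<one>\<^bsub>E\<^esub>}"
  proof
    assume e: "carrier E = {\<one>\<^bsub>E\<^esub>}"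
    have "x = \<one>\<^bsub>G\<^esub>" if x: "x \<in> H" for x
    proof -
      have "h x = \<one>\<^bsub>E\<^esub>" "h \<one>\<^bsub>G\<^esub> = \<one>\<^bsub>E\<^esub>" using e h.hom_closed[of x] x h.hom_one by auto
      then show ?thesis using inj_onD[OF inj] x subgroup.one_closed[OF H(1)] by metis
    qed
    then show False using H subgroup.one_closed[OF H(1)] by blast
  qed
  then have X1: "X {\<one>\<^bsub>E\<^esub>}" unfolding X_def using h.H.one_is_normal by auto
  have bound: "card N < Suc (card (carrier E))" if "X N" for N
    using that normal_imp_subgroup subgroup.subset gE(2) unfolding X_def by (metis card_mono le_imp_less_Suc)
  obtain N where N: "X N" "\<And>L. X L \<Longrightarrow> card L \<le> card N"
    using arg_max_nat_lemma[of X "{\<one>\<^bsub>E\<^esub>}" card "Suc (card (carrier E))"] X1 bound by blast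
  have NE: "N \<lhd> E" "N \<noteq> carrier E" using N(1) by (auto simp: X_def)
  have NEs: "subgroup N E" using normal_imp_subgroup[OF NE(1)] .
  have "chief_factor E (carrier E) N"
    unfolding chief_factor_def
  proof (intro conjI allI impI)
    show "N \<subset> carrier E" using NE subgroup.subset[OF NEs] by blast
    fix L assume L: "L \<lhd> E \<and> N \<subseteq> L \<and> L \<subseteq> carrier E"
    show "L = N \<or> L = carrier E"
    proof (rule ccontr)
      assume ne: "\<not> (L = N \<or> L = carrier E)"
      then have "card L \<le> card N" using N(2)[of L] L by (simp add: X_def)
      then have "N = L" using L gE(2) by (intro card_seteq) (auto intro: finite_subset)
      then show False using ne by simp
    qed
  qed (use NE h.H.normal_self in auto)
  then have "sigma_primary (Sigma_s F) (E Mod N)"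
    using mem_sigma_soluble[OF E(1)] unfolding sigma_soluble_def by fastforce
  then obtain S where S: "S \<in> Sigma_s F" "prime_factors (order (E Mod N)) \<subseteq> S" unfolding sigma_primary_def by blast
  define N' where "N' = {x \<in> H. h x \<in> N}"
  have "N' \<lhd> G\<lparr>carrier := H\<rparr>" using h.preimage_normal[OF NE(1)] by (simp add: N'_def)
  moreover have im: "h ` N' = N" using surj subgroup.subset[OF NEs] by (auto simp: N'_def)
  then have "N' \<noteq> H" using NE(2) surj by blast
  moreover have "card N' = card N" using im inj card_image[of h N'] by (metis (no_types, lifting) N'_def inj_on_subset mem_Collect_eq subsetI)
  moreover have "card H = card (carrier E)" using surj inj card_image by metis
  then have "order (E Mod N) = card H div card N" using h.H.card_quotient[OF NE(1) gE(2)] by (simp add: order_def)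
  ultimately show "\<exists>N. N \<lhd> G\<lparr>carrier := H\<rparr> \<and> N \<noteq> H \<and> (\<exists>S\<in>Sigma_s F. prime_factors (card H div card N) \<subseteq> S)"
    using S by metis
qed

lemma p_group_ssol:
  assumes "group G" "finite (carrier G)" "subgroup P G" "card P = p ^ n" "Factorial_Ring.prime p"
  shows "ssol (Sigma_s F) (G\<lparr>carrier := P\<rparr>)"
  using assms group.fin_sub[OF assms(1,3,2)] group.subgroup_imp_group[OF assms(1,3)]
  by (intro in_class_ssol p_group_in_class) (auto simp: order_def)

lemma ssol_abelian_extension:
  fixes G (structure)
  assumes G: "group G" "finite (carrier G)" and R: "R \<lhd> G" "ssol (Sigma_s F) (G\<lparr>carrier := R\<rparr>)"
    and H: "subgroup H G" and comm: "\<And>x y. x \<in> H \<Longrightarrow> y \<in> H \<Longrightarrow> x \<otimes> y \<otimes> inv x \<otimes> inv y \<in> R"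
  shows "ssol (Sigma_s F) (G\<lparr>carrier := H\<rparr>)"
proof -
  interpret group G by fact
  have Rs: "subgroup R G" using normal_imp_subgroup[OF R(1)] .
  note can = canonical_hom[OF R(1)]
  interpret can: group_hom G "G Mod R" "\<lambda>x. R #> x" using G(1) can(4,1) by (rule group_homI)
  interpret GH: group "G\<lparr>carrier := H\<rparr>" by (rule subgroup_imp_group[OF H])
  have finH: "finite (carrier (G\<lparr>carrier := H\<rparr>))" using fin_sub[OF H G(2)] by simp
  show ?thesis
  proof (rule GH.ssol_extension[OF finH can(4)])
    show "(\<lambda>x. R #> x) \<in> hom (G\<lparr>carrier := H\<rparr>) (G Mod R)"
      by (rule hom_restrict_sub[OF can(1) subgroup.subset[OF H]])
    have "in_class ((G Mod R)\<lparr>carrier := (\<lambda>x. R #> x) ` H\<rparr>) F"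
    proof (rule abelian_in_class)
      show "group ((G Mod R)\<lparr>carrier := (\<lambda>x. R #> x) ` H\<rparr>)"
        by (rule can.H.subgroup_imp_group[OF can.subgroup_img_is_subgroup[OF H]])
      show "finite (carrier ((G Mod R)\<lparr>carrier := (\<lambda>x. R #> x) ` H\<rparr>))" using finH by simp
      fix a b assume "a \<in> carrier ((G Mod R)\<lparr>carrier := (\<lambda>x. R #> x) ` H\<rparr>)" "b \<in> carrier ((G Mod R)\<lparr>carrier := (\<lambda>x. R #> x) ` H\<rparr>)"
      then obtain x y where xy: "x \<in> H" "y \<in> H" "a = R #> x" "b = R #> y" by auto
      have c: "x \<in> carrier G" "y \<in> carrier G" using xy subgroup.mem_carrier[OF H] by auto
      define z where "z = x \<otimes> y \<otimes> inv x \<otimes> inv y"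
      have zc: "z \<in> carrier G" using c by (simp add: z_def)
      have "z \<in> kernel G (G Mod R) (\<lambda>x. R #> x)" unfolding can(3) z_def by (rule comm[OF xy(1,2)])
      then have z1: "R #> z = \<one>\<^bsub>G Mod R\<^esub>" unfolding kernel_def by blast
      have "x \<otimes> y = z \<otimes> (y \<otimes> x)" using c by (simp add: z_def word_simps)
      then have "R #> (x \<otimes> y) = (R #> z) \<otimes>\<^bsub>G Mod R\<^esub> (R #> (y \<otimes> x))"
        using can.hom_mult[OF zc, of "y \<otimes> x"] c by (simp only: m_closed)
      also have "\<dots> = R #> (y \<otimes> x)" unfolding z1 using can.hom_closed[of "y \<otimes> x"] c can.H.l_one m_closed by blast
      finally have "a \<otimes>\<^bsub>G Mod R\<^esub> b = b \<otimes>\<^bsub>G Mod R\<^esub> a"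
        unfolding xy(3,4) using can.hom_mult[OF c] can.hom_mult[OF c(2,1)] by metis
      then show "a \<otimes>\<^bsub>(G Mod R)\<lparr>carrier := (\<lambda>x. R #> x) ` H\<rparr>\<^esub> b = b \<otimes>\<^bsub>(G Mod R)\<lparr>carrier := (\<lambda>x. R #> x) ` H\<rparr>\<^esub> a" by simp
    qed
    then show "ssol (Sigma_s F) ((G Mod R)\<lparr>carrier := (\<lambda>x. R #> x) ` carrier (G\<lparr>carrier := H\<rparr>)\<rparr>)"
      using in_class_ssol by simp
    have ker: "kernel (G\<lparr>carrier := H\<rparr>) (G Mod R) (\<lambda>x. R #> x) = R \<inter> H"
    proof -
      have "kernel (G\<lparr>carrier := H\<rparr>) (G Mod R) (\<lambda>x. R #> x) = kernel G (G Mod R) (\<lambda>x. R #> x) \<inter> H"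
        using subgroup.mem_carrier[OF H] by (auto simp: kernel_def)
      then show ?thesis using can(3) by simp
    qed
    have "subgroup (R \<inter> H) (G\<lparr>carrier := R\<rparr>)" unfolding subgroup_in[OF Rs] using subgroup_Int[OF Rs H] by blast
    then have "ssol (Sigma_s F) (G\<lparr>carrier := R \<inter> H\<rparr>)"
      using group.ssol_subgroup[OF subgroup_imp_group[OF Rs] R(2)] by simp
    then show "ssol (Sigma_s F) (G\<lparr>carrier := H, carrier := kernel (G\<lparr>carrier := H\<rparr>) (G Mod R) (\<lambda>x. R #> x)\<rparr>)"
      unfolding ker by simp
  qed
qed

text \<open>If \<open>A\<close> is normal, the radical of \<open>A\<close> will do. In the other case let \<open>C\<close> be the kernel of a homomorphism
  of \<open>G\<close> into a member of \<open>F\<close>, with \<open>C\<close> contained in \<open>A\<close>, and \<open>R\<close> the radical of \<open>C\<close>. Then \<open>X \<inter> C\<close>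
  lies in \<open>R\<close>, hence \<open>X\<close> lies in the centraliser \<open>D\<close> of \<open>C/R\<close>, which is normal in \<open>G\<close>. Modulo \<open>R\<close>
  the intersection \<open>C \<inter> D\<close> is abelian, and \<open>D/(C \<inter> D)\<close> embeds in a member of \<open>F\<close>; so \<open>D\<close> is soluble.\<close>

lemma link_preserves_radical:
  fixes G (structure)
  assumes G: "group G" and fin: "finite (carrier G)" and A: "subgroup A G" "A \<lhd> G \<or> embeds_above G A"
    and X: "X \<lhd> G\<lparr>carrier := A\<rparr>" "ssol (Sigma_s F) (G\<lparr>carrier := X\<rparr>)"
  shows "\<exists>Y. Y \<lhd> G \<and> X \<subseteq> Y \<and> ssol (Sigma_s F) (G\<lparr>carrier := Y\<rparr>)"
proof -
  interpret group G by fact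
  have Xs: "subgroup X G" "X \<subseteq> A" and Xc: "\<And>a x. a \<in> A \<Longrightarrow> x \<in> X \<Longrightarrow> conjg G a x \<in> X"
    using X(1) normal_in[OF A(1)] by auto
  have rad: "\<exists>R. R \<lhd> G \<and> ssol (Sigma_s F) (G\<lparr>carrier := R\<rparr>) \<and> R \<subseteq> B \<and>
      (\<forall>Y. Y \<lhd> G\<lparr>carrier := B\<rparr> \<and> ssol (Sigma_s F) (G\<lparr>carrier := Y\<rparr>) \<longrightarrow> Y \<subseteq> R)" if B: "B \<lhd> G" for B
  proof -
    have Bs: "subgroup B G" using normal_imp_subgroup[OF B] .
    interpret GB: group "G\<lparr>carrier := B\<rparr>" by (rule subgroup_imp_group[OF Bs])
    have "finite (carrier (G\<lparr>carrier := B\<rparr>))" using fin_sub[OF Bs fin] by simp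
    then obtain R where R: "R \<lhd> G\<lparr>carrier := B\<rparr>" "ssol (Sigma_s F) (G\<lparr>carrier := R\<rparr>)"
        "\<And>Y. Y \<lhd> G\<lparr>carrier := B\<rparr> \<Longrightarrow> ssol (Sigma_s F) (G\<lparr>carrier := Y\<rparr>) \<Longrightarrow> Y \<subseteq> R"
      using GB.ex_ssol_radical[of "Sigma_s F"] by auto
    then show ?thesis using ssol_radical_normal[OF fin B R] normal_in[OF Bs] by blast
  qed
  from A(2) show ?thesis
  proof
    assume "A \<lhd> G"
    then show ?thesis using rad[of A] X by blast
  next
    assume "embeds_above G A"
    then obtain L \<psi> where L: "L \<in> F" "\<psi> \<in> hom G L" "kernel G L \<psi> \<subseteq> A" unfolding embeds_above_def by blast
    interpret psi: group_hom G L \<psi> using G mem_group[OF L(1)] L(2) by (rule group_homI)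
    define C where "C = kernel G L \<psi>"
    have C: "C \<lhd> G" "C \<subseteq> A" unfolding C_def using psi.normal_kernel L(3) by auto
    have Cs: "subgroup C G" using normal_imp_subgroup[OF C(1)] .
    obtain R where R: "R \<lhd> G" "ssol (Sigma_s F) (G\<lparr>carrier := R\<rparr>)" "R \<subseteq> C"
        "\<And>Y. Y \<lhd> G\<lparr>carrier := C\<rparr> \<Longrightarrow> ssol (Sigma_s F) (G\<lparr>carrier := Y\<rparr>) \<Longrightarrow> Y \<subseteq> R"
      using rad[OF C(1)] by blast
    have Rs: "subgroup R G" using normal_imp_subgroup[OF R(1)] .
    have Cc: "conjg G g c \<in> C" if "g \<in> carrier G" "c \<in> C" for g c using C(1) that by (simp add: normal_iff)
    have Rc: "conjg G g c \<in> R" if "g \<in> carrier G" "c \<in> R" for g c using R(1) that by (simp add: normal_iff)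
    have cc: "c \<in> carrier G" if "c \<in> C" for c using subgroup.mem_carrier[OF Cs that] .
    have XC: "X \<inter> C \<subseteq> R"
    proof (rule R(4))
      show "X \<inter> C \<lhd> G\<lparr>carrier := C\<rparr>"
        unfolding normal_in[OF Cs] using subgroup_Int[OF Xs(1) Cs] Xc Cc cc C(2) by blast
      have "subgroup (X \<inter> C) (G\<lparr>carrier := X\<rparr>)" unfolding subgroup_in[OF Xs(1)] using subgroup_Int[OF Xs(1) Cs] by blast
      then show "ssol (Sigma_s F) (G\<lparr>carrier := X \<inter> C\<rparr>)"
        using group.ssol_subgroup[OF subgroup_imp_group[OF Xs(1)] X(2)] by simp
    qed
    define D where "D = {g \<in> carrier G. \<forall>c\<in>C. g \<otimes> c \<otimes> inv g \<otimes> inv c \<in> R}"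
    have Ds: "subgroup D G"
    proof (rule finite_subgroupI[OF fin])
      have "\<one> \<in> D" using cc subgroup.one_closed[OF Rs] by (simp add: D_def)
      then show "D \<noteq> {}" by blast
      show "d \<otimes> e \<in> D" if de: "d \<in> D" "e \<in> D" for d e
      proof -
        have c: "d \<in> carrier G" "e \<in> carrier G" using de by (auto simp: D_def)
        have "(d \<otimes> e) \<otimes> c \<otimes> inv (d \<otimes> e) \<otimes> inv c \<in> R" if cC: "c \<in> C" for c
        proof -
          have "conjg G d (e \<otimes> c \<otimes> inv e \<otimes> inv c) \<otimes> (d \<otimes> c \<otimes> inv d \<otimes> inv c) \<in> R"
            using de cC Rc[OF c(1)] Rs by (simp add: D_def subgroup.m_closed)
          moreover have "conjg G d (e \<otimes> c \<otimes> inv e \<otimes> inv c) \<otimes> (d \<otimes> c \<otimes> inv d \<otimes> inv c) = (d \<otimes> e) \<otimes> c \<otimes> inv (d \<otimes> e) \<otimes> inv c"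
            using c cc[OF cC] by (simp add: conjg_def word_simps)
          ultimately show ?thesis by simp
        qed
        then show ?thesis using c by (simp add: D_def)
      qed
    qed (auto simp: D_def)
    have "conjg G g d \<in> D" if g: "g \<in> carrier G" and d: "d \<in> D" for g d
    proof -
      have dc: "d \<in> carrier G" using d by (simp add: D_def)
      have "conjg G g d \<otimes> c \<otimes> inv (conjg G g d) \<otimes> inv c \<in> R" if cC: "c \<in> C" for c
      proof -
        define c' where "c' = conjg G (inv g) c"
        have c': "c' \<in> C" "c' \<in> carrier G" using Cc[of "inv g" c] g cC cc by (auto simp: c'_def)
        have "conjg G g (d \<otimes> c' \<otimes> inv d \<otimes> inv c') \<in> R" using Rc[OF g] d c'(1) by (simp add: D_def)
        moreover have "conjg G g (d \<otimes> c' \<otimes> inv d \<otimes> inv c') = conjg G g d \<otimes> c \<otimes> inv (conjg G g d) \<otimes> inv c"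
          unfolding c'_def using g dc cc[OF cC] by (simp add: conjg_def word_simps)
        ultimately show ?thesis by simp
      qed
      then show ?thesis using g dc by (simp add: D_def)
    qed
    then have Dn: "D \<lhd> G" using Ds by (simp add: normal_iff)
    have XD: "X \<subseteq> D"
    proof
      fix x assume x: "x \<in> X"
      have xc: "x \<in> carrier G" using x subgroup.mem_carrier[OF Xs(1)] by blast
      have "x \<otimes> c \<otimes> inv x \<otimes> inv c \<in> X \<inter> C" if cC: "c \<in> C" for c
      proof
        have "conjg G x c \<otimes> inv c \<in> C" using Cc[OF xc cC] cC Cs by (simp add: subgroup.m_closed subgroup.m_inv_closed)
        then show "x \<otimes> c \<otimes> inv x \<otimes> inv c \<in> C" by (simp add: conjg_def)
        have "conjg G c (inv x) \<in> X" using Xc[of c "inv x"] C(2) cC x Xs(1) by (auto simp: subgroup.m_inv_closed)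
        then have "x \<otimes> conjg G c (inv x) \<in> X" using x Xs(1) by (simp add: subgroup.m_closed)
        then show "x \<otimes> c \<otimes> inv x \<otimes> inv c \<in> X" using xc cc[OF cC] by (simp add: conjg_def m_assoc)
      qed
      then show "x \<in> D" using XC xc by (auto simp: D_def)
    qed
    have CDs: "subgroup (C \<inter> D) G" using subgroup_Int[OF Cs Ds] .
    have CD: "ssol (Sigma_s F) (G\<lparr>carrier := C \<inter> D\<rparr>)"
      by (rule ssol_abelian_extension[OF G fin R(1,2) CDs]) (auto simp: D_def)
    interpret GD: group "G\<lparr>carrier := D\<rparr>" by (rule subgroup_imp_group[OF Ds])
    have "ssol (Sigma_s F) (G\<lparr>carrier := D\<rparr>)"
    proof (rule GD.ssol_extension[OF _ psi.H.is_group])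
      show "finite (carrier (G\<lparr>carrier := D\<rparr>))" using fin_sub[OF Ds fin] by simp
      show "\<psi> \<in> hom (G\<lparr>carrier := D\<rparr>) L" by (rule hom_restrict_sub[OF L(2) subgroup.subset[OF Ds]])
      show "ssol (Sigma_s F) (L\<lparr>carrier := \<psi> ` carrier (G\<lparr>carrier := D\<rparr>)\<rparr>)"
        using in_class_ssol[OF in_class_subgroup[OF in_class_mem[OF L(1)] psi.subgroup_img_is_subgroup[OF Ds]]] by simp
      have "kernel (G\<lparr>carrier := D\<rparr>) L \<psi> = C \<inter> D"
        unfolding C_def using subgroup.mem_carrier[OF Ds] by (auto simp: kernel_def)
      then show "ssol (Sigma_s F) (G\<lparr>carrier := D, carrier := kernel (G\<lparr>carrier := D\<rparr>) L \<psi>\<rparr>)" using CD by simp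
    qed
    then show ?thesis using Dn XD by blast
  qed
qed

text \<open>For the induction along the chain the claim is extended from \<open>A\<close> to all soluble normal subgroups
  of \<open>A\<close>.\<close>

theorem K_subnormal_ssol_in_radical:
  fixes G (structure)
  assumes G: "group G" and fin: "finite (carrier G)" and A: "K_subnormal F A G"
    and sol: "ssol (Sigma_s F) (G\<lparr>carrier := A\<rparr>)"
  shows "\<exists>Y. Y \<lhd> G \<and> A \<subseteq> Y \<and> ssol (Sigma_s F) (G\<lparr>carrier := Y\<rparr>)"
proof -
  interpret group G by fact
  have "(Kstep G)\<^sup>*\<^sup>* A (carrier G)" using A K_subnormal_iff[OF G] by simp
  then have "\<forall>X. X \<lhd> G\<lparr>carrier := A\<rparr> \<and> ssol (Sigma_s F) (G\<lparr>carrier := X\<rparr>) \<longrightarrow>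
      (\<exists>Y. Y \<lhd> G \<and> X \<subseteq> Y \<and> ssol (Sigma_s F) (G\<lparr>carrier := Y\<rparr>))"
  proof (induction rule: converse_rtranclp_induct)
    case base
    then show ?case by auto
  next
    case (step A B)
    have B: "subgroup B G" using Kstep_rtranclp_subgroup[OF G step.hyps(2)] .
    have gB: "group (G\<lparr>carrier := B\<rparr>)" "finite (carrier (G\<lparr>carrier := B\<rparr>))"
      using subgroup_imp_group[OF B] fin_sub[OF B fin] by auto
    show ?case
    proof (intro allI impI, elim conjE)
      fix X assume X: "X \<lhd> G\<lparr>carrier := A\<rparr>" "ssol (Sigma_s F) (G\<lparr>carrier := X\<rparr>)"
      obtain Y where "Y \<lhd> G\<lparr>carrier := B\<rparr>" "X \<subseteq> Y" "ssol (Sigma_s F) (G\<lparr>carrier := Y\<rparr>)"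
        using link_preserves_radical[OF gB, of A X] step.hyps(1) X unfolding Kstep_def by auto
      then show "\<exists>Y. Y \<lhd> G \<and> X \<subseteq> Y \<and> ssol (Sigma_s F) (G\<lparr>carrier := Y\<rparr>)" using step.IH by blast
    qed
  qed
  moreover have "subgroup A G" using K_subnormal_subgroup[OF G A] .
  then have "A \<lhd> G\<lparr>carrier := A\<rparr>"
    using group.normal_self[OF subgroup_imp_group, of A] by simp
  ultimately show ?thesis using sol by blast
qed

section \<open>Maximal chains of length three\<close>

lemma maximal_chains_2_ssol:
  fixes G (structure)
  assumes G: "group G" "finite (carrier G)" and ch: "every_maximal_chain_includes_K_subnormal F 2 G"
  shows "ssol (Sigma_s F) G"
proof (cases "in_class G F")
  case True
  then show ?thesis by (rule in_class_ssol)
next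
  case False
  interpret group G by fact
  obtain Q where Q: "Q \<lhd> G" "\<And>x y. x \<in> Q \<Longrightarrow> y \<in> Q \<Longrightarrow> x \<otimes> y = y \<otimes> x"
      "\<And>x y. x \<in> carrier G \<Longrightarrow> y \<in> carrier G \<Longrightarrow> x \<otimes> y \<otimes> inv x \<otimes> inv y \<in> Q"
    using maximal_chains_2_structure(3)[OF G False ch] by blast
  have Qs: "subgroup Q G" using normal_imp_subgroup[OF Q(1)] .
  have "in_class (G\<lparr>carrier := Q\<rparr>) F"
    using subgroup_imp_group[OF Qs] fin_sub[OF Qs G(2)] Q(2) by (intro abelian_in_class) auto
  then have "ssol (Sigma_s F) (G\<lparr>carrier := Q\<rparr>)" by (rule in_class_ssol)
  then have "ssol (Sigma_s F) (G\<lparr>carrier := carrier G\<rparr>)"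
    by (rule ssol_abelian_extension[OF G Q(1) _ subgroup_self Q(3)])
  then show ?thesis by simp
qed

text \<open>In a chain of length three through \<open>M\<close> one of the two members below \<open>M\<close> is \<open>K\<close>-subnormal in \<open>G\<close>, and then in
  \<open>M\<close> as well.\<close>

lemma maximal_chains_3_maximal:
  assumes G: "group G" and ch: "every_maximal_chain_includes_K_subnormal F 3 G"
    and M: "maximal_subgroup M G" "\<not> K_subnormal F M G"
  shows "every_maximal_chain_includes_K_subnormal F 2 (G\<lparr>carrier := M\<rparr>)"
    and "maximal_subgroup X (G\<lparr>carrier := M\<rparr>) \<Longrightarrow> maximal_subgroup Y (G\<lparr>carrier := X\<rparr>) \<Longrightarrow>
      K_subnormal F X G \<or> K_subnormal F Y G"
proof -
  interpret group G by fact
  have MG: "subgroup M G" using M(1) by (simp add: maximal_subgroup_def)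
  have two: "K_subnormal F X G \<or> K_subnormal F Y G"
    if XY: "maximal_subgroup X (G\<lparr>carrier := M\<rparr>)" "maximal_subgroup Y (G\<lparr>carrier := X\<rparr>)" for X Y
  proof -
    define C where "C i = (if i = 0 then carrier G else if i = 1 then M else if i = 2 then X else Y)" for i :: nat
    have "maximal_chain G 3 C"
      unfolding maximal_chain_def using XY M(1) by (auto simp: C_def less_Suc_eq numeral_3_eq_3)
    then obtain i where i: "1 \<le> i" "i \<le> 3" "K_subnormal F (C i) G"
      using ch unfolding every_maximal_chain_includes_K_subnormal_def by blast
    then have "i = 1 \<or> i = 2 \<or> i = 3" by auto
    then show ?thesis using i(3) M(2) by (auto simp: C_def)
  qed
  then show "maximal_subgroup X (G\<lparr>carrier := M\<rparr>) \<Longrightarrow> maximal_subgroup Y (G\<lparr>carrier := X\<rparr>) \<Longrightarrow>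
      K_subnormal F X G \<or> K_subnormal F Y G" by blast
  have in_M: "K_subnormal F X (G\<lparr>carrier := M\<rparr>)" if "K_subnormal F X G" "X \<subseteq> M" for X
    using K_subnormal_in_subgroup[OF G that(1) MG] that(2) by (simp add: Int_absorb2)
  show "every_maximal_chain_includes_K_subnormal F 2 (G\<lparr>carrier := M\<rparr>)"
    unfolding every_maximal_chain_includes_K_subnormal_def
  proof (intro allI impI)
    fix C assume C: "maximal_chain (G\<lparr>carrier := M\<rparr>) 2 C"
    have 0: "C 0 = M" and 1: "maximal_subgroup (C 1) (G\<lparr>carrier := C 0\<rparr>)" and 2: "maximal_subgroup (C 2) (G\<lparr>carrier := C 1\<rparr>)"
      using C unfolding maximal_chain_def by (auto simp: numeral_2_eq_2)
    have s1: "subgroup (C 1) G" "C 1 \<subseteq> M" using 0 1 by (auto simp: maximal_subgroup_def subgroup_in[OF MG])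
    have s2: "C 2 \<subseteq> C 1" using 2 unfolding maximal_subgroup_def subgroup_in[OF s1(1)] by blast
    have "K_subnormal F (C 1) G \<or> K_subnormal F (C 2) G" using two 0 1 2 by simp
    then show "\<exists>i\<ge>1. i \<le> 2 \<and> K_subnormal F (C i) (G\<lparr>carrier := M\<rparr>)"
    proof
      assume "K_subnormal F (C 1) G"
      then show ?thesis using in_M s1 by (intro exI[of _ 1]) auto
    next
      assume "K_subnormal F (C 2) G"
      then show ?thesis using in_M s1 s2 by (intro exI[of _ 2]) auto
    qed
  qed
qed

text \<open>A maximal subgroup \<open>M\<close> that is not \<open>K\<close>-subnormal is soluble by the result on chains of length two. As the
  radical of \<open>G\<close> is trivial, the \<open>K\<close>-subnormal subgroups of \<open>G\<close> contained in \<open>M\<close> are trivial, and the chains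
  below \<open>M\<close> are very short.\<close>

theorem maximal_chains_3_trivial:
  fixes G (structure)
  assumes G: "group G" and fin: "finite (carrier G)" and ch: "every_maximal_chain_includes_K_subnormal F 3 G"
    and rad: "\<And>A. A \<lhd> G \<Longrightarrow> ssol (Sigma_s F) (G\<lparr>carrier := A\<rparr>) \<Longrightarrow> A = {\<one>}"
  shows "carrier G = {\<one>}"
proof (rule ccontr)
  assume nontriv: "carrier G \<noteq> {\<one>}"
  interpret group G by fact
  define X where "X N \<longleftrightarrow> N \<lhd> G \<and> N \<noteq> {\<one>}" for N
  have "X (carrier G)" using nontriv normal_self by (simp add: X_def)
  note am = arg_min_nat_lemma[of X, OF this, of card]
  define N where "N = arg_min card X"
  have N: "N \<lhd> G" "N \<noteq> {\<one>}" using am by (auto simp: N_def X_def)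
  have Ns: "subgroup N G" using normal_imp_subgroup[OF N(1)] .
  have Nmin: "L = {\<one>} \<or> L = N" if L: "L \<lhd> G" "L \<subseteq> N" for L
  proof (rule ccontr)
    assume ne: "\<not> (L = {\<one>} \<or> L = N)"
    then have "card N \<le> card L" using am L(1) by (simp add: N_def X_def)
    then have "L = N" using fin_sub[OF Ns fin] L(2) by (intro card_seteq) auto
    then show False using ne by simp
  qed
  have notsol: "\<not> ssol (Sigma_s F) (G\<lparr>carrier := N\<rparr>)" using rad[OF N(1)] N(2) by blast
  have pgrp: "A = {\<one>}" if "A \<lhd> G" "card A = p ^ k" "Factorial_Ring.prime p" for A p k
    using rad[OF that(1) p_group_ssol[OF G fin normal_imp_subgroup[OF that(1)] that(2,3)]] .

  \<comment> \<open>the smallest prime is chosen so that \<open>p - 1\<close> is prime to the order of \<open>N\<close>\<close>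
  have "card N \<noteq> 1"
  proof
    assume "card N = 1"
    then show False using N(2) subgroup.one_closed[OF Ns] by (auto simp: card_1_singleton_iff)
  qed
  then have exp: "\<exists>p. Factorial_Ring.prime p \<and> p dvd card N" using prime_factor_nat by blast
  define p where "p = (LEAST p. Factorial_Ring.prime p \<and> p dvd card N)"
  have p: "Factorial_Ring.prime p" "p dvd card N" using LeastI_ex[OF exp] by (auto simp: p_def)
  have pmin: "p \<le> q" if "Factorial_Ring.prime q" "q dvd card N" for q
    unfolding p_def by (rule Least_le) (use that in blast)
  obtain P m where P: "subgroup P G" "P \<subseteq> N" "card P = p ^ multiplicity p (card N)" "card N = card P * m" "\<not> p dvd m"
    using ex_sylow[OF fin Ns p(1)] by blast
  define k where "k = multiplicity p (card N)"
  have cP: "card P = p ^ k" using P(3) by (simp add: k_def)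
  have k0: "k \<noteq> 0"
  proof
    assume "k = 0"
    then have "card N = m" using P(4) cP by simp
    then show False using p(2) P(5) by simp
  qed
  have "P \<noteq> {\<one>}"
  proof
    assume "P = {\<one>}"
    then have "p ^ k = 1" using cP by simp
    then show False using k0 prime_gt_1_nat[OF p(1)] by simp
  qed
  then have Pn: "\<not> P \<lhd> G" using pgrp[OF _ cP p(1)] by blast
  then have "normz G P \<noteq> carrier G" using normal_iff_normz[OF P(1)] by simp
  then obtain M where M: "maximal_subgroup M G" "normz G P \<subseteq> M"
    using ex_maximal_above[OF fin normz_subgroup(1)[OF P(1)]] by blast
  have MG: "subgroup M G" "M \<noteq> carrier G" using M(1) by (auto simp: maximal_subgroup_def)
  have PM: "P \<subseteq> M" using normz_subgroup(2)[OF P(1)] M(2) by blast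
  have NM: "\<not> N \<subseteq> M"
  proof
    assume "N \<subseteq> M"
    have "g \<in> M" if "g \<in> carrier G" for g
      using frattini_argument[OF fin N(1) P(1,2) cP p(1) P(4,5) that] \<open>N \<subseteq> M\<close> M(2) subgroup.m_closed[OF MG(1)] by blast
    then show False using MG subgroup.subset[OF MG(1)] by blast
  qed
  \<comment> \<open>otherwise \<open>N\<close>, not being contained in \<open>M\<close>, would embed in a member of \<open>F\<close> and be soluble\<close>
  have nK: "\<not> K_subnormal F M G"
  proof
    assume "K_subnormal F M G"
    then obtain L \<psi> where L: "L \<in> F" "\<psi> \<in> hom G L" "kernel G L \<psi> \<subseteq> M"
      using K_subnormal_maximal_embeds_above[OF G fin M(1)] unfolding embeds_above_def by blast
    interpret psi: group_hom G L \<psi> using G mem_group[OF L(1)] L(2) by (rule group_homI)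
    have "kernel G L \<psi> \<inter> N \<lhd> G" using normal_subgroup_intersect psi.normal_kernel N(1) by blast
    then have "kernel G L \<psi> \<inter> N = {\<one>} \<or> kernel G L \<psi> \<inter> N = N" using Nmin by blast
    then have ker: "kernel G L \<psi> \<inter> N = {\<one>}" using NM L(3) by blast
    have gN: "group (G\<lparr>carrier := N\<rparr>)" using subgroup_imp_group[OF Ns] .
    have hN: "\<psi> \<in> hom (G\<lparr>carrier := N\<rparr>) L" by (rule hom_restrict_sub[OF L(2) subgroup.subset[OF Ns]])
    interpret r: group_hom "G\<lparr>carrier := N\<rparr>" L \<psi> using gN mem_group[OF L(1)] hN by (rule group_homI)
    have "kernel (G\<lparr>carrier := N\<rparr>) L \<psi> = {\<one>}"
      using ker subgroup.mem_carrier[OF Ns] by (auto simp: kernel_def)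
    then have "inj_on \<psi> (carrier (G\<lparr>carrier := N\<rparr>))" using r.trivial_ker_imp_inj by simp
    then have "in_class (G\<lparr>carrier := N\<rparr>) F" using in_class_embed[OF gN in_class_mem[OF L(1)] hN] by blast
    then show False using notsol in_class_ssol by blast
  qed
  note chM = maximal_chains_3_maximal[OF G ch M(1) nK]
  have gM: "group (G\<lparr>carrier := M\<rparr>)" and finM: "finite (carrier (G\<lparr>carrier := M\<rparr>))"
    using subgroup_imp_group[OF MG(1)] fin_sub[OF MG(1) fin] by auto
  have Msol: "ssol (Sigma_s F) (G\<lparr>carrier := M\<rparr>)" by (rule maximal_chains_2_ssol[OF gM finM chM(1)])
  have Ktriv: "A = {\<one>}" if A: "K_subnormal F A G" "A \<subseteq> M" for A
  proof -
    have As: "subgroup A G" using K_subnormal_subgroup[OF G A(1)] .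
    have "subgroup A (G\<lparr>carrier := M\<rparr>)" using As A(2) subgroup_in[OF MG(1)] by blast
    then have "ssol (Sigma_s F) (G\<lparr>carrier := A\<rparr>)" using group.ssol_subgroup[OF gM Msol] by simp
    then obtain Y where "Y \<lhd> G" "A \<subseteq> Y" "ssol (Sigma_s F) (G\<lparr>carrier := Y\<rparr>)"
      using K_subnormal_ssol_in_radical[OF G fin A(1)] by blast
    then have "A \<subseteq> {\<one>}" using rad by blast
    then show ?thesis using subgroup.one_closed[OF As] by blast
  qed

  \<comment> \<open>in a chain \<open>U < H < M\<close> a maximal subgroup \<open>X\<close> of \<open>M\<close> above \<open>H\<close> is not trivial and so not
    \<open>K\<close>-subnormal, hence every maximal subgroup \<open>Y\<close> of \<open>X\<close> above \<open>U\<close> is \<open>K\<close>-subnormal and trivial\<close>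
  have short: "U = {\<one>}" if H: "subgroup H G" "H \<subseteq> M" "H \<noteq> M" and U: "subgroup U G" "U \<subseteq> H" "U \<noteq> H" for H U
  proof -
    obtain X where X: "maximal_subgroup X (G\<lparr>carrier := M\<rparr>)" "H \<subseteq> X"
      using group.ex_maximal_above[OF gM finM, of H] H subgroup_in[OF MG(1)] by auto
    have Xs: "subgroup X G" "X \<subseteq> M" using X(1) by (auto simp: maximal_subgroup_def subgroup_in[OF MG(1)])
    have gX: "group (G\<lparr>carrier := X\<rparr>)" "finite (carrier (G\<lparr>carrier := X\<rparr>))"
      using subgroup_imp_group[OF Xs(1)] fin_sub[OF Xs(1) fin] by auto
    have UX: "U \<subseteq> X" "U \<noteq> X" using U X(2) by auto
    then obtain Y where Y: "maximal_subgroup Y (G\<lparr>carrier := X\<rparr>)" "U \<subseteq> Y"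
      using group.ex_maximal_above[OF gX, of U] U(1) subgroup_in[OF Xs(1)] by auto
    have Ys: "subgroup Y G" "Y \<subseteq> X" "Y \<noteq> X" using Y(1) by (auto simp: maximal_subgroup_def subgroup_in[OF Xs(1)])
    have "X \<noteq> {\<one>}" using Ys subgroup.one_closed[OF Ys(1)] by blast
    then have "\<not> K_subnormal F X G" using Ktriv Xs(2) by blast
    then have "K_subnormal F Y G" using chM(2)[OF X(1) Y(1)] by blast
    then have "Y = {\<one>}" using Ktriv Ys(2) Xs(2) by blast
    then show ?thesis using Y(2) subgroup.one_closed[OF U(1)] by blast
  qed
  show False
  proof (cases "P = M")
    case True
    \<comment> \<open>a noncentral element of the \<open>p\<close>-group \<open>M\<close> would have a centraliser strictly between the centre and
      \<open>M\<close>\<close>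
    define Z where "Z = centre (G\<lparr>carrier := M\<rparr>)"
    have Zin: "z \<in> Z \<longleftrightarrow> z \<in> M \<and> (\<forall>g\<in>M. g \<otimes> z = z \<otimes> g)" for z
      unfolding Z_def using group.centre_iff[OF gM, of z] by simp
    have Zs: "subgroup Z G"
      using group.centre_normal[OF gM] normal_imp_subgroup subgroup_in[OF MG(1)] unfolding Z_def by blast
    have Z1: "Z \<noteq> {\<one>}"
      unfolding Z_def using group.p_group_centre_nontrivial[OF gM finM _ p(1), of k] cP True \<open>P \<noteq> {\<one>}\<close>
      by (simp add: order_sub)
    have "x \<in> Z" if x: "x \<in> M" for x
    proof (rule ccontr)
      assume xZ: "x \<notin> Z"
      have xc: "x \<in> carrier G" using x subgroup.mem_carrier[OF MG(1)] by blast
      define C where "C = M \<inter> {g \<in> carrier G. \<forall>z\<in>{x}. g \<otimes> z = z \<otimes> g}"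
      have Cs: "subgroup C G" unfolding C_def
        by (rule subgroup_Int[OF MG(1) centralizer_subgroup]) (use xc in auto)
      have xC: "x \<in> C" using x xc by (simp add: C_def)
      have ZC: "Z \<subseteq> C" using Zin x subgroup.mem_carrier[OF MG(1)] by (auto simp: C_def)
      have "C \<noteq> M"
      proof
        assume "C = M"
        then have "g \<otimes> x = x \<otimes> g" if "g \<in> M" for g using that by (auto simp: C_def)
        then show False using xZ Zin x by blast
      qed
      then have "Z = {\<one>}" using short[OF Cs _ _ Zs ZC] xC xZ by (auto simp: C_def)
      then show False using Z1 by simp
    qed
    then have Mcomm: "x \<otimes> y = y \<otimes> x" if "x \<in> M" "y \<in> M" for x y using Zin that by blast
    obtain q b Q where "Factorial_Ring.prime q" "Q \<lhd> G" "card Q = q ^ b" "Q \<noteq> {\<one>}"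
      using abelian_maximal_p_subgroup[OF fin M(1) _ Mcomm _ p(1), of k] Pn cP True by blast
    then show False using pgrp by blast
  next
    case False
    have gP: "group (G\<lparr>carrier := P\<rparr>)" "finite (carrier (G\<lparr>carrier := P\<rparr>))"
      using subgroup_imp_group[OF P(1)] fin_sub[OF P(1) fin] by auto
    have "order (G\<lparr>carrier := P\<rparr>) = p ^ 1 * p ^ (k - 1)" using cP k0 by (simp add: order_sub power_eq_if)
    then obtain U where U: "subgroup U (G\<lparr>carrier := P\<rparr>)" "card U = p ^ 1"
      using Sylow.sylow_thm[OF p(1) gP(1) _ gP(2)] by blast
    have "U = P"
    proof (rule ccontr)
      assume "U \<noteq> P"
      then have "U = {\<one>}" using short[OF P(1) PM False, of U] U(1) subgroup_in[OF P(1)] by blast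
      then show False using U(2) prime_gt_1_nat[OF p(1)] by simp
    qed
    then have cP': "card P = p" using U(2) by simp
    interpret GN: group "G\<lparr>carrier := N\<rparr>" by (rule subgroup_imp_group[OF Ns])
    have finN: "finite (carrier (G\<lparr>carrier := N\<rparr>))" using fin_sub[OF Ns fin] by simp
    have PN: "subgroup P (G\<lparr>carrier := N\<rparr>)" using P(1,2) subgroup_in[OF Ns] by blast
    have "card (rcosets\<^bsub>G\<lparr>carrier := N\<rparr>\<^esub> P) * p = m * p"
      using GN.lagrange[OF PN] P(4) cP' by (simp add: order_sub mult.commute)
    then have idx: "\<not> p dvd card (rcosets\<^bsub>G\<lparr>carrier := N\<rparr>\<^esub> P)" using P(5) prime_gt_0_nat[OF p(1)] by simp
    have "coprime (order (G\<lparr>carrier := N\<rparr>)) (p - 1)"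
    proof (rule ccontr)
      assume "\<not> coprime (order (G\<lparr>carrier := N\<rparr>)) (p - 1)"
      then have "gcd (card N) (p - 1) \<noteq> 1" by (simp add: order_sub coprime_iff_gcd_eq_1)
      then obtain q where q: "Factorial_Ring.prime q" "q dvd gcd (card N) (p - 1)" using prime_factor_nat by blast
      then have "p \<le> q" "q dvd p - 1" using pmin by auto
      moreover have "q \<le> p - 1" using \<open>q dvd p - 1\<close> prime_gt_1_nat[OF p(1)] by (intro dvd_imp_le) auto
      ultimately show False using prime_gt_1_nat[OF p(1)] by simp
    qed
    then obtain K where K: "K \<lhd> G\<lparr>carrier := N\<rparr>" "card K * p = card N" "coprime (card K) p"
      using GN.smallest_prime_complement[OF finN PN cP' p(1) idx] by (auto simp: order_sub)
    have Ks: "subgroup K G" "K \<subseteq> N" using K(1) normal_in[OF Ns] by auto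
    \<comment> \<open>\<open>K\<close> is characteristic in \<open>N\<close> because its order is prime to its index\<close>
    have Kchar: "x \<in> K" if x: "x \<in> N" "x [^] card K = \<one>" for x
    proof -
      note can = GN.canonical_hom[OF K(1)]
      let ?Q = "G\<lparr>carrier := N\<rparr> Mod K" and ?k = "\<lambda>x. K #>\<^bsub>G\<lparr>carrier := N\<rparr>\<^esub> x"
      interpret can: group_hom "G\<lparr>carrier := N\<rparr>" ?Q ?k using GN.is_group can(4,1) by (rule group_homI)
      have oQ: "order ?Q = p"
        using GN.card_quotient[OF K(1) finN] K(2) card_pos[OF Ks(1) fin] by (simp add: order_sub) (metis nonzero_mult_div_cancel_left less_irrefl)
      have xQ: "?k x \<in> carrier ?Q" using can.hom_closed[of x] x(1) by simp
      have "?k x [^]\<^bsub>?Q\<^esub> card K = ?k (x [^]\<^bsub>G\<lparr>carrier := N\<rparr>\<^esub> card K)"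
        using can.hom_nat_pow[of x "card K"] x(1) by simp
      also have "x [^]\<^bsub>G\<lparr>carrier := N\<rparr>\<^esub> card K = \<one>\<^bsub>G\<lparr>carrier := N\<rparr>\<^esub>" using x(2) by (simp add: nat_pow_consistent[symmetric])
      also have "?k \<one>\<^bsub>G\<lparr>carrier := N\<rparr>\<^esub> = \<one>\<^bsub>?Q\<^esub>" by (rule can.hom_one)
      finally have 1: "?k x [^]\<^bsub>?Q\<^esub> card K = \<one>\<^bsub>?Q\<^esub>" .
      have 2: "?k x [^]\<^bsub>?Q\<^esub> p = \<one>\<^bsub>?Q\<^esub>" using can.H.pow_order_eq_1[OF xQ] oQ by simp
      have "?k x = \<one>\<^bsub>?Q\<^esub>" by (rule coprime_pow_eq_one[OF can(4) xQ 1 2 K(3)])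
      then have "x \<in> kernel (G\<lparr>carrier := N\<rparr>) ?Q ?k" using x(1) by (simp add: kernel_def)
      then show ?thesis using can(3) by simp
    qed
    have "conjg G g x \<in> K" if g: "g \<in> carrier G" and x: "x \<in> K" for g x
    proof (rule Kchar)
      have xc: "x \<in> carrier G" using x subgroup.mem_carrier[OF Ks(1)] by blast
      show "conjg G g x \<in> N" using N(1) g x Ks(2) by (auto simp: normal_iff)
      show "conjg G g x [^] card K = \<one>"
        using conjg_pow[OF g xc, of "card K"] pow_card_eq_one[OF Ks(1) fin x] g by simp
    qed
    then have "K \<lhd> G" using Ks(1) by (simp add: normal_iff)
    then have "K = {\<one>} \<or> K = N" using Nmin Ks(2) by blast
    then show False
    proof
      assume "K = {\<one>}"
      then have "card N = p ^ 1" using K(2) by simp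
      then show False using pgrp[OF N(1) _ p(1)] N(2) by blast
    next
      assume "K = N"
      then have "card N * p = card N * 1" using K(2) by simp
      then have "p = 1" using card_pos[OF Ns fin] by simp
      then show False using prime_gt_1_nat[OF p(1)] by simp
    qed
  qed
qed

lemma maximal_chains_image:
  assumes G: "group G" and L: "group L" and h: "h \<in> hom G L" "h ` carrier G = carrier L"
    and ch: "every_maximal_chain_includes_K_subnormal F n G"
  shows "every_maximal_chain_includes_K_subnormal F n L"
  unfolding every_maximal_chain_includes_K_subnormal_def
proof (intro allI impI)
  interpret h: group_hom G L h using G L h(1) by (rule group_homI)
  fix C assume C: "maximal_chain L n C"
  define D where "D i = {x \<in> carrier G. h x \<in> C i}" for i
  have C0: "C 0 = carrier L" and Cs: "\<And>i. i < n \<Longrightarrow> maximal_subgroup (C (Suc i)) (L\<lparr>carrier := C i\<rparr>)"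
    using C by (auto simp: maximal_chain_def)
  have sub: "i \<le> n \<Longrightarrow> subgroup (C i) L" for i
  proof (induction i)
    case 0
    then show ?case using C0 h.H.subgroup_self by simp
  next
    case (Suc i)
    then have "subgroup (C i) L" "subgroup (C (Suc i)) (L\<lparr>carrier := C i\<rparr>)"
      using Cs[of i] by (auto simp: maximal_subgroup_def)
    then show ?case using h.H.subgroup_in by blast
  qed
  have im: "h ` D i = C i" if le: "i \<le> n" for i
  proof
    show "C i \<subseteq> h ` D i"
    proof
      fix y assume y: "y \<in> C i"
      then obtain x where "x \<in> carrier G" "y = h x" using h(2) subgroup.mem_carrier[OF sub[OF le]] by (metis imageE)
      then show "y \<in> h ` D i" using y by (auto simp: D_def)
    qed
  qed (auto simp: D_def)
  have "maximal_chain G n D"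
    unfolding maximal_chain_def
  proof (intro conjI allI impI)
    show "D 0 = carrier G" unfolding D_def C0 using h.hom_closed by blast
    fix i assume i: "i < n"
    have Di: "subgroup (D i) G" unfolding D_def by (rule h.preimage_subgroup[OF sub]) (use i in simp)
    have imi: "h ` D i = C i" using im i by simp
    interpret r: group_hom "G\<lparr>carrier := D i\<rparr>" "L\<lparr>carrier := C i\<rparr>" h
      using h.G.subgroup_hom[OF L h(1) Di] unfolding imi .
    have "maximal_subgroup {x \<in> carrier (G\<lparr>carrier := D i\<rparr>). h x \<in> C (Suc i)} (G\<lparr>carrier := D i\<rparr>)"
      by (rule r.preimage_maximal[OF _ Cs[OF i]]) (simp add: imi)
    moreover have "C (Suc i) \<subseteq> C i"
      using Cs[OF i] sub[of i] i by (auto simp: maximal_subgroup_def h.H.subgroup_in)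
    then have "{x \<in> carrier (G\<lparr>carrier := D i\<rparr>). h x \<in> C (Suc i)} = D (Suc i)" by (auto simp: D_def)
    ultimately show "maximal_subgroup (D (Suc i)) (G\<lparr>carrier := D i\<rparr>)" by simp
  qed
  then obtain i where i: "1 \<le> i" "i \<le> n" "K_subnormal F (D i) G"
    using ch unfolding every_maximal_chain_includes_K_subnormal_def by blast
  then show "\<exists>i\<ge>1. i \<le> n \<and> K_subnormal F (C i) L"
    using K_subnormal_image[OF G L h i(3)] im[OF i(2)] by (intro exI[of _ i]) simp
qed

theorem maximal_chains_3_sigma_soluble:
  fixes G (structure)
  assumes G: "group G" and fin: "finite (carrier G)" and ch: "every_maximal_chain_includes_K_subnormal F 3 G"
  shows "sigma_soluble (Sigma_s F) G"
proof -
  interpret group G by fact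
  obtain R where R: "R \<lhd> G" "ssol (Sigma_s F) (G\<lparr>carrier := R\<rparr>)"
      "\<And>A. A \<lhd> G \<Longrightarrow> ssol (Sigma_s F) (G\<lparr>carrier := A\<rparr>) \<Longrightarrow> A \<subseteq> R"
    using ex_ssol_radical[OF fin, of "Sigma_s F"] by blast
  have Rs: "subgroup R G" using normal_imp_subgroup[OF R(1)] .
  define L where "L = G Mod R"
  define \<kappa> where "\<kappa> = (\<lambda>x. R #> x)"
  have can: "\<kappa> \<in> hom G L" "\<kappa> ` carrier G = carrier L" "kernel G L \<kappa> = R" "group L"
    unfolding \<kappa>_def L_def by (rule canonical_hom[OF R(1)])+
  interpret k: group_hom G L \<kappa> using G can(4,1) by (rule group_homI)
  have finL: "finite (carrier L)" using can(2) fin by (metis finite_imageI)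
  have "A = {\<one>\<^bsub>L\<^esub>}" if A: "A \<lhd> L" "ssol (Sigma_s F) (L\<lparr>carrier := A\<rparr>)" for A
  proof -
    have As: "subgroup A L" using normal_imp_subgroup[OF A(1)] .
    define B where "B = {x \<in> carrier G. \<kappa> x \<in> A}"
    have B: "B \<lhd> G" unfolding B_def by (rule k.preimage_normal[OF A(1)])
    have Bs: "subgroup B G" using normal_imp_subgroup[OF B] .
    have im: "\<kappa> ` B = A"
    proof
      show "A \<subseteq> \<kappa> ` B"
      proof
        fix y assume y: "y \<in> A"
        then obtain x where "x \<in> carrier G" "y = \<kappa> x" using can(2) subgroup.mem_carrier[OF As] by (metis imageE)
        then show "y \<in> \<kappa> ` B" using y by (auto simp: B_def)
      qed
    qed (auto simp: B_def)
    have RB: "R \<subseteq> B" using can(3) subgroup.one_closed[OF As] by (auto simp: B_def kernel_def)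
    have "ssol (Sigma_s F) (G\<lparr>carrier := B\<rparr>)"
    proof (rule group.ssol_extension[OF subgroup_imp_group[OF Bs] _ can(4)])
      show "finite (carrier (G\<lparr>carrier := B\<rparr>))" using fin_sub[OF Bs fin] by simp
      show "\<kappa> \<in> hom (G\<lparr>carrier := B\<rparr>) L" by (rule hom_restrict_sub[OF can(1) subgroup.subset[OF Bs]])
      show "ssol (Sigma_s F) (L\<lparr>carrier := \<kappa> ` carrier (G\<lparr>carrier := B\<rparr>)\<rparr>)" using A(2) im by simp
      have "kernel (G\<lparr>carrier := B\<rparr>) L \<kappa> = kernel G L \<kappa> \<inter> B"
        using subgroup.mem_carrier[OF Bs] by (auto simp: kernel_def)
      also have "\<dots> = R" using can(3) RB by auto
      finally show "ssol (Sigma_s F) (G\<lparr>carrier := B, carrier := kernel (G\<lparr>carrier := B\<rparr>) L \<kappa>\<rparr>)" using R(2) by simp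
    qed
    then have "B \<subseteq> R" using R(3) B by blast
    then have "A \<subseteq> \<kappa> ` kernel G L \<kappa>" using im can(3) by blast
    then have "A \<subseteq> {\<one>\<^bsub>L\<^esub>}" by (auto simp: kernel_def)
    then show ?thesis using subgroup.one_closed[OF As] by blast
  qed
  then have "carrier L = {\<one>\<^bsub>L\<^esub>}"
    using maximal_chains_3_trivial[OF can(4) finL maximal_chains_image[OF G can(4,1,2) ch]] by blast
  then have "carrier G \<subseteq> kernel G L \<kappa>" using k.hom_closed by (auto simp: kernel_def)
  then have "R = carrier G" using can(3) subgroup.subset[OF Rs] by blast
  then have "ssol (Sigma_s F) G" using R(2) by simp
  then show ?thesis by (rule ssol_imp_sigma_soluble[OF fin])
qed

end

theorem theoremB:
  fixes F :: "nat monoid set"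
    and \<sigma> :: "nat set set"
    and G :: "('a, 'b) monoid_scheme"
  assumes "formation F" and "saturated F" and "hereditary F" and "K_lattice F"
    and "contains_all_nilpotent F"
    and "\<sigma> = Sigma_s F"
    and "group G" and "finite (carrier G)"
  shows "(every_maximal_chain_includes_K_subnormal F 2 G \<longleftrightarrow>
            in_class G F \<or>
            (\<not> in_class G F \<and> schmidt_group G \<and> abelian_sylow_subgroups G)) \<and>
         (every_maximal_chain_includes_K_subnormal F 3 G \<longrightarrow> sigma_soluble \<sigma> G)"
proof -
  interpret lattice_formation F using assms(1-5) by unfold_locales
  show ?thesis
    unfolding assms(6)
    using maximal_chains_2_schmidt[OF assms(7,8)] in_class_chains[OF _ pos2] schmidt_chains_2[OF assms(7)]
      maximal_chains_3_sigma_soluble[OF assms(7,8)] by blast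
qed

end
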